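(* Let $T>0$, let $P,Q,R,R_1$ be continuous paths of real $n\times n$ matrices on $[0,T]$ with $P(t),R(t),R_1(t)$ symmetric and $P(t)$ invertible for all $t\in[0,T]$, and let $\Lambda_0,\Lambda_1$ be Lagrangian subspaces of $(\mathbb R^{2n},\omega_0)$. Assume that the operator $A$ (defined in the context) is nondegenerate, i.e. $0$ is not an eigenvalue of the Sturm-Liouville system $$-(P\dot y+Qy)^{\cdot}+Q^T\dot y+(R+\lambda R_1)y=0,\qquad z(0)\in\Lambda_0,\quad z(T)\in\Lambda_1,$$ where $z=(P\dot y+Qy,\,y)^T$, and let $\lambda_j$ be the eigenvalues of this system counted with multiplicity. Then for every positive integer $m$, $$\sum_j\frac1{\lambda_j^m}=m\sum_{k=1}^m\frac{(-1)^k}{k}\left[\sum_{j_1+\cdots+j_k=m}\mathrm{Tr}\,(G_{j_1}\cdots G_{j_k})\right],$$ where the inner sum is over $k$-tuples of positive integers $(j_1,\dots,j_k)$ with sum $m$ and $G_k$, $k\in\mathbb N$, are the $n\times n$ matrices defined in the context.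
   Context: $\omega_0$ is the standard symplectic form on $\mathbb R^{2n}$, $J=\begin{pmatrix}0_n&-I_n\\ I_n&0_n\end{pmatrix}$, and $e_1,\dots,e_{2n}$ is the standard basis of $\mathbb R^{2n}$, so $e_{n+k}=Je_k$ for $1\le k\le n$. **Operator and eigenvalues.** $A=-\frac{d}{dt}\left(P\frac{d}{dt}+Q\right)+Q^T\frac{d}{dt}+R$ is the self-adjoint operator on $L^2([0,T])$ ($n$-vector valued functions) whose domain consists of those $y\in W^{1,2}$ with $x:=P\dot y+Qy\in W^{1,2}$ such that $z=(x,y)^T$ satisfies $z(0)\in\Lambda_0$, $z(T)\in\Lambda_1$. $A$ is nondegenerate if $0$ is not an eigenvalue of $A$; then $A^{-1}$ is compact (trace class). Eigenvalues of the system are the $\lambda\in\mathbb C$ for which the boundary value problem has a nontrivial ($\mathbb C^n$-valued) solution, with the operators and $\Lambda_0,\Lambda_1$ complexified. $\lambda\ne0$ is an eigenvalue of the system if and only if $-1/\lambda$ is an eigenvalue of $R_1A^{-1}$ ($A^{-1}$ followed by multiplication by $R_1$), and the multiplicity of $\lambda_j$ means the algebraic multiplicity of $-1/\lambda_j$ as an eigenvalue of $R_1A^{-1}$. **Fundamental solution.** Let $$B_0(t)=\begin{pmatrix}P^{-1}&-P^{-1}Q\\ -Q^TP^{-1}&Q^TP^{-1}Q-R\end{pmatrix}(t),$$ and let $\gamma_0$ solve $\dot\gamma_0=JB_0\gamma_0$, $\gamma_0(0)=I_{2n}$. Set $D(t)=\begin{pmatrix}0_n&0_n\\0_n&-R_1(t)\end{pmatrix}$,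 $\hat D(t)=\gamma_0(t)^TD(t)\gamma_0(t)$, and for $k\in\mathbb N$ $$F_k=\int_0^TJ\hat D(t_1)\int_0^{t_1}J\hat D(t_2)\cdots\int_0^{t_{k-1}}J\hat D(t_k)\,dt_k\cdots dt_2\,dt_1 .$$ **The matrix $M_3$.** Let $V_0=\Lambda_0\cap\Lambda_1$ and $k_0=\dim V_0$. Choose an orthonormal basis $d_1,\dots,d_{k_0}$ of $V_0$, extend it to an orthonormal basis $d_1,\dots,d_n$ of $\Lambda_0$, put $d_{n+j}=Jd_j$, and let $M_1=(d_1,\dots,d_{2n})$, a symplectic orthogonal matrix. Let $V_1$ be the orthogonal complement of $V_0$ in $\Lambda_1$, with orthonormal basis $f_{k_0+1},\dots,f_n$. The vectors $M_1^Tf_l$ ($k_0+1\le l\le n$) lie in the span of $e_{k_0+1},\dots,e_n,e_{n+k_0+1},\dots,e_{2n}$; in these coordinates write the matrix with columns $M_1^Tf_{k_0+1},\dots,M_1^Tf_n$ as $\begin{pmatrix}\tilde X_1\\ \tilde Y_1\end{pmatrix}$ with $\tilde X_1,\tilde Y_1$ of size $(n-k_0)\times(n-k_0)$; $\tilde Y_1$ is nonsingular. Set $$M_3=\begin{pmatrix}I_{k_0}&0&0&0\\0&I_{n-k_0}&0&-\tilde X_1\tilde Y_1^{-1}\\0&0&I_{k_0}&0\\0&0&0&I_{n-k_0}\end{pmatrix}M_1^T .$$ **The matrices $G_k$.** For a $2n\times2n$ matrix $M$ let $\mathcal P(M)$ be the $n\times n$ matrix with entries $\mathcal P(M)_{i,j}=(M_3MM_3^{-1}e_j,\,e_{i+k_0})$,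 $1\le i,j\le n$, where $(\cdot,\cdot)$ is the Euclidean inner product. Under the nondegeneracy assumption $\mathcal P(\gamma_0(T))$ is nonsingular, and $$G_k=\mathcal P(\gamma_0(T)F_k)\cdot\mathcal P(\gamma_0(T))^{-1},\qquad k\in\mathbb N .$$ *)

theory Defs
  imports
    "HOL-Analysis.Analysis"
    "Jordan_Normal_Form.Gauss_Jordan_Elimination"
    "Jordan_Normal_Form.VS_Connect"
begin

no_notation Finite_Cartesian_Product.vec_nth (infixl \<open>$\<close> 90)
no_notation inner (infix \<open>\<bullet>\<close> 70)

section \<open>Linear algebra\<close>

text \<open>Indices run from 0, so the standard basis vector \<open>e\<^sub>i\<close> of the mathematical text has index
  \<open>i - 1\<close> below.\<close>

text \<open>The value is meaningful for nonsingular square matrices only.\<close>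
definition inv_mat :: "'a :: field mat \<Rightarrow> 'a mat" where
  "inv_mat A = the (mat_inverse A)"

definition trace_mat :: "'a :: comm_monoid_add mat \<Rightarrow> 'a" where
  "trace_mat A = (\<Sum>i<dim_row A. A $$ (i, i))"

definition cmat :: "real mat \<Rightarrow> complex mat" where
  "cmat A = map_mat complex_of_real A"

definition symp_J :: "nat \<Rightarrow> real mat" where
  "symp_J n = four_block_mat (0\<^sub>m n n) (- 1\<^sub>m n) (1\<^sub>m n) (0\<^sub>m n n)"

definition symp_form :: "nat \<Rightarrow> real vec \<Rightarrow> real vec \<Rightarrow> real" where
  "symp_form n u v = scalar_prod (symp_J n *\<^sub>v u) v"

abbreviation real_space :: "nat \<Rightarrow> (real, real vec) module" where
  "real_space N \<equiv> module_vec TYPE(real) N"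

definition subspace_dim :: "nat \<Rightarrow> real vec set \<Rightarrow> nat" where
  "subspace_dim N W = vectorspace.dim class_ring ((real_space N)\<lparr>carrier := W\<rparr>)"

definition lagrangian :: "nat \<Rightarrow> real vec set \<Rightarrow> bool" where
  "lagrangian n L \<longleftrightarrow>
     VectorSpace.subspace class_ring L (real_space (2 * n)) \<and>
     (\<forall>u\<in>L. \<forall>v\<in>L. symp_form n u v = 0) \<and>
     subspace_dim (2 * n) L = n"

definition orthonormal_basis :: "nat \<Rightarrow> real vec list \<Rightarrow> real vec set \<Rightarrow> bool" where
  "orthonormal_basis N vs W \<longleftrightarrow>
     set vs \<subseteq> carrier_vec N \<and>
     (\<forall>i<length vs. \<forall>j<length vs. scalar_prod (vs ! i) (vs ! j) = (if i = j then 1 else 0)) \<and>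
     LinearCombinations.module.span class_ring (real_space N) (set vs) = W"

definition orth_complement_in :: "real vec set \<Rightarrow> real vec set \<Rightarrow> real vec set" where
  "orth_complement_in V W = {w \<in> W. \<forall>v\<in>V. scalar_prod w v = 0}"

definition complexify :: "real vec set \<Rightarrow> complex vec set" where
  "complexify L = {map_vec complex_of_real a + \<i> \<cdot>\<^sub>v map_vec complex_of_real b | a b. a \<in> L \<and> b \<in> L}"

definition continuous_mat_path :: "nat \<Rightarrow> real \<Rightarrow> (real \<Rightarrow> real mat) \<Rightarrow> bool" where
  "continuous_mat_path n T M \<longleftrightarrow>
     (\<forall>t\<in>{0..T}. M t \<in> carrier_mat n n) \<and>
     (\<forall>i<n. \<forall>j<n. continuous_on {0..T} (\<lambda>t. M t $$ (i, j)))"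

section \<open>The operator on \<open>L\<^sup>2\<close> and its inverse\<close>

text \<open>Elements of \<open>L\<^sup>2([0,T]; \<complex>\<^sup>n)\<close> are represented by functions; equality in \<open>L\<^sup>2\<close> is equality
  almost everywhere on \<open>[0,T]\<close>, and values outside \<open>[0,T]\<close> play no role.\<close>

definition L2 :: "real \<Rightarrow> nat \<Rightarrow> (real \<Rightarrow> complex vec) set" where
  "L2 T n = {f. (\<forall>t\<in>{0..T}. f t \<in> carrier_vec n) \<and>
     (\<forall>i<n. (\<lambda>t. f t $ i) \<in> borel_measurable (lebesgue_on {0..T}) \<and>
            integrable (lebesgue_on {0..T}) (\<lambda>t. (cmod (f t $ i))\<^sup>2))}"

text \<open>\<open>u\<close> is the continuous representative of an element of \<open>W\<^sup>1\<^sup>,\<^sup>2\<close> with weak derivative \<open>v\<close>.\<close>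
definition W12_deriv :: "real \<Rightarrow> nat \<Rightarrow> (real \<Rightarrow> complex vec) \<Rightarrow> (real \<Rightarrow> complex vec) \<Rightarrow> bool" where
  "W12_deriv T n u v \<longleftrightarrow>
     (\<forall>t\<in>{0..T}. u t \<in> carrier_vec n) \<and> v \<in> L2 T n \<and>
     (\<forall>i<n. \<forall>t\<in>{0..T}. ((\<lambda>s. v s $ i) has_integral (u t $ i - u 0 $ i)) {0..t})"

text \<open>The graph of \<open>A\<close>, as pairs \<open>(y, A y)\<close>. The function \<open>x\<close> is the continuous representative of
  \<open>P y' + Q y\<close>, which is the one entering the boundary conditions.\<close>
definition SL_graph ::
  "nat \<Rightarrow> real \<Rightarrow> (real \<Rightarrow> real mat) \<Rightarrow> (real \<Rightarrow> real mat) \<Rightarrow> (real \<Rightarrow> real mat) \<Rightarrow>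
   real vec set \<Rightarrow> real vec set \<Rightarrow> ((real \<Rightarrow> complex vec) \<times> (real \<Rightarrow> complex vec)) set" where
  "SL_graph n T P Q R \<Lambda>0 \<Lambda>1 = {(y, f). f \<in> L2 T n \<and>
     (\<exists>dy x dx. W12_deriv T n y dy \<and> W12_deriv T n x dx \<and>
        (AE t in lebesgue_on {0..T}. x t = cmat (P t) *\<^sub>v dy t + cmat (Q t) *\<^sub>v y t) \<and>
        x 0 @\<^sub>v y 0 \<in> complexify \<Lambda>0 \<and> x T @\<^sub>v y T \<in> complexify \<Lambda>1 \<and>
        (AE t in lebesgue_on {0..T}.
           f t = - dx t + cmat (transpose_mat (Q t)) *\<^sub>v dy t + cmat (R t) *\<^sub>v y t))}"

definition SL_nondegenerate ::
  "nat \<Rightarrow> real \<Rightarrow> (real \<Rightarrow> real mat) \<Rightarrow> (real \<Rightarrow> real mat) \<Rightarrow> (real \<Rightarrow> real mat) \<Rightarrow>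
   real vec set \<Rightarrow> real vec set \<Rightarrow> bool" where
  "SL_nondegenerate n T P Q R \<Lambda>0 \<Lambda>1 \<longleftrightarrow>
     \<not> (\<exists>y. (y, \<lambda>t. 0\<^sub>v n) \<in> SL_graph n T P Q R \<Lambda>0 \<Lambda>1 \<and>
            \<not> (AE t in lebesgue_on {0..T}. y t = 0\<^sub>v n))"

text \<open>For nondegenerate \<open>A\<close> the solution \<open>y\<close> of \<open>A y = f\<close> is unique on \<open>[0,T]\<close>, so the choice only
  concerns the irrelevant values outside \<open>[0,T]\<close>.\<close>
definition SL_inverse ::
  "nat \<Rightarrow> real \<Rightarrow> (real \<Rightarrow> real mat) \<Rightarrow> (real \<Rightarrow> real mat) \<Rightarrow> (real \<Rightarrow> real mat) \<Rightarrow>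
   real vec set \<Rightarrow> real vec set \<Rightarrow> (real \<Rightarrow> complex vec) \<Rightarrow> real \<Rightarrow> complex vec" where
  "SL_inverse n T P Q R \<Lambda>0 \<Lambda>1 f = (SOME y. (y, f) \<in> SL_graph n T P Q R \<Lambda>0 \<Lambda>1)"

text \<open>The operator \<open>R\<^sub>1 A\<^sup>-\<^sup>1\<close>.\<close>
definition SL_compact_op ::
  "nat \<Rightarrow> real \<Rightarrow> (real \<Rightarrow> real mat) \<Rightarrow> (real \<Rightarrow> real mat) \<Rightarrow> (real \<Rightarrow> real mat) \<Rightarrow>
   (real \<Rightarrow> real mat) \<Rightarrow> real vec set \<Rightarrow> real vec set \<Rightarrow>
   (real \<Rightarrow> complex vec) \<Rightarrow> real \<Rightarrow> complex vec" where
  "SL_compact_op n T P Q R R1 \<Lambda>0 \<Lambda>1 f = (\<lambda>t. cmat (R1 t) *\<^sub>v SL_inverse n T P Q R \<Lambda>0 \<Lambda>1 f t)"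

section \<open>Algebraic multiplicity\<close>

text \<open>Linear independence in \<open>L\<^sup>2\<close> of the classes of \<open>fs 0, \<dots>, fs (k - 1)\<close>.\<close>
definition L2_indep :: "real \<Rightarrow> nat \<Rightarrow> nat \<Rightarrow> (nat \<Rightarrow> real \<Rightarrow> complex vec) \<Rightarrow> bool" where
  "L2_indep T n k fs \<longleftrightarrow>
     (\<forall>c :: nat \<Rightarrow> complex.
        (AE t in lebesgue_on {0..T}. \<forall>i<n. (\<Sum>j<k. c j * fs j t $ i) = 0) \<longrightarrow> (\<forall>j<k. c j = 0))"

definition L2_dim :: "real \<Rightarrow> nat \<Rightarrow> (real \<Rightarrow> complex vec) set \<Rightarrow> enat" where
  "L2_dim T n E = Sup {enat k | k. \<exists>fs. (\<forall>j<k. fs j \<in> E) \<and> L2_indep T n k fs}"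

definition L2_gen_eigenspace ::
  "real \<Rightarrow> nat \<Rightarrow> ((real \<Rightarrow> complex vec) \<Rightarrow> real \<Rightarrow> complex vec) \<Rightarrow> complex \<Rightarrow>
   (real \<Rightarrow> complex vec) set" where
  "L2_gen_eigenspace T n K \<mu> = {f \<in> L2 T n. \<exists>k.
     AE t in lebesgue_on {0..T}. ((\<lambda>g s. K g s - \<mu> \<cdot>\<^sub>v g s) ^^ k) f t = 0\<^sub>v n}"

definition L2_alg_mult ::
  "real \<Rightarrow> nat \<Rightarrow> ((real \<Rightarrow> complex vec) \<Rightarrow> real \<Rightarrow> complex vec) \<Rightarrow> complex \<Rightarrow> enat" where
  "L2_alg_mult T n K \<mu> = L2_dim T n (L2_gen_eigenspace T n K \<mu>)"

section \<open>Eigenvalues of the boundary value problem\<close>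

definition vec_path_deriv ::
  "real \<Rightarrow> nat \<Rightarrow> (real \<Rightarrow> complex vec) \<Rightarrow> (real \<Rightarrow> complex vec) \<Rightarrow> bool" where
  "vec_path_deriv T n u v \<longleftrightarrow>
     (\<forall>t\<in>{0..T}. u t \<in> carrier_vec n \<and> v t \<in> carrier_vec n) \<and>
     (\<forall>t\<in>{0..T}. \<forall>i<n. ((\<lambda>s. u s $ i) has_vector_derivative v t $ i) (at t within {0..T}))"

definition SL_eigenvalue ::
  "nat \<Rightarrow> real \<Rightarrow> (real \<Rightarrow> real mat) \<Rightarrow> (real \<Rightarrow> real mat) \<Rightarrow> (real \<Rightarrow> real mat) \<Rightarrow>
   (real \<Rightarrow> real mat) \<Rightarrow> real vec set \<Rightarrow> real vec set \<Rightarrow> complex \<Rightarrow> bool" where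
  "SL_eigenvalue n T P Q R R1 \<Lambda>0 \<Lambda>1 l \<longleftrightarrow>
     (\<exists>y dy x dx. vec_path_deriv T n y dy \<and> vec_path_deriv T n x dx \<and>
        (\<forall>t\<in>{0..T}. x t = cmat (P t) *\<^sub>v dy t + cmat (Q t) *\<^sub>v y t) \<and>
        (\<forall>t\<in>{0..T}. - dx t + cmat (transpose_mat (Q t)) *\<^sub>v dy t
             + (cmat (R t) + l \<cdot>\<^sub>m cmat (R1 t)) *\<^sub>v y t = 0\<^sub>v n) \<and>
        x 0 @\<^sub>v y 0 \<in> complexify \<Lambda>0 \<and> x T @\<^sub>v y T \<in> complexify \<Lambda>1 \<and>
        (\<exists>t\<in>{0..T}. y t \<noteq> 0\<^sub>v n))"

definition SL_mult ::
  "nat \<Rightarrow> real \<Rightarrow> (real \<Rightarrow> real mat) \<Rightarrow> (real \<Rightarrow> real mat) \<Rightarrow> (real \<Rightarrow> real mat) \<Rightarrow>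
   (real \<Rightarrow> real mat) \<Rightarrow> real vec set \<Rightarrow> real vec set \<Rightarrow> complex \<Rightarrow> enat" where
  "SL_mult n T P Q R R1 \<Lambda>0 \<Lambda>1 l =
     L2_alg_mult T n (SL_compact_op n T P Q R R1 \<Lambda>0 \<Lambda>1) (- (1 / l))"

text \<open>Index set of the eigenvalues counted with multiplicity: \<open>l\<close> occurs in \<open>SL_mult \<dots> l\<close> pairs
  \<open>(l, i)\<close>.\<close>
definition SL_spectrum ::
  "nat \<Rightarrow> real \<Rightarrow> (real \<Rightarrow> real mat) \<Rightarrow> (real \<Rightarrow> real mat) \<Rightarrow> (real \<Rightarrow> real mat) \<Rightarrow>
   (real \<Rightarrow> real mat) \<Rightarrow> real vec set \<Rightarrow> real vec set \<Rightarrow> (complex \<times> nat) set" where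
  "SL_spectrum n T P Q R R1 \<Lambda>0 \<Lambda>1 =
     {(l, i). SL_eigenvalue n T P Q R R1 \<Lambda>0 \<Lambda>1 l \<and> enat i < SL_mult n T P Q R R1 \<Lambda>0 \<Lambda>1 l}"

section \<open>Fundamental solution and the matrices \<open>F\<^sub>k\<close>\<close>

definition B0_mat :: "nat \<Rightarrow> real mat \<Rightarrow> real mat \<Rightarrow> real mat \<Rightarrow> real mat" where
  "B0_mat n P Q R = four_block_mat
     (inv_mat P) (- (inv_mat P * Q))
     (- (transpose_mat Q * inv_mat P)) (transpose_mat Q * inv_mat P * Q - R)"

definition fundamental_solution ::
  "nat \<Rightarrow> real \<Rightarrow> (real \<Rightarrow> real mat) \<Rightarrow> (real \<Rightarrow> real mat) \<Rightarrow> (real \<Rightarrow> real mat) \<Rightarrow>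
   (real \<Rightarrow> real mat) \<Rightarrow> bool" where
  "fundamental_solution n T P Q R \<gamma> \<longleftrightarrow>
     (\<forall>t\<in>{0..T}. \<gamma> t \<in> carrier_mat (2 * n) (2 * n)) \<and> \<gamma> 0 = 1\<^sub>m (2 * n) \<and>
     (\<forall>t\<in>{0..T}. \<forall>i<2 * n. \<forall>j<2 * n.
        ((\<lambda>s. \<gamma> s $$ (i, j)) has_real_derivative
           (symp_J n * B0_mat n (P t) (Q t) (R t) * \<gamma> t) $$ (i, j)) (at t within {0..T}))"

definition D_mat :: "nat \<Rightarrow> real mat \<Rightarrow> real mat" where
  "D_mat n R1 = four_block_mat (0\<^sub>m n n) (0\<^sub>m n n) (0\<^sub>m n n) (- R1)"

definition D_hat :: "nat \<Rightarrow> (real \<Rightarrow> real mat) \<Rightarrow> (real \<Rightarrow> real mat) \<Rightarrow> real \<Rightarrow> real mat" where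
  "D_hat n R1 \<gamma> t = transpose_mat (\<gamma> t) * D_mat n (R1 t) * \<gamma> t"

definition mat_integral :: "nat \<Rightarrow> real \<Rightarrow> (real \<Rightarrow> real mat) \<Rightarrow> real mat" where
  "mat_integral N t E = mat N N (\<lambda>(i, j). integral {0..t} (\<lambda>s. E s $$ (i, j)))"

text \<open>\<open>iterated_integral N E k t\<close> is
  \<open>\<integral>\<^sub>0\<^sup>t E(t\<^sub>1) \<integral>\<^sub>0\<^bsup>t\<^sub>1\<^esup> E(t\<^sub>2) \<dots> \<integral>\<^sub>0\<^bsup>t\<^sub>k\<^sub>-\<^sub>1\<^esup> E(t\<^sub>k) dt\<^sub>k \<dots> dt\<^sub>1\<close>.\<close>
primrec iterated_integral :: "nat \<Rightarrow> (real \<Rightarrow> real mat) \<Rightarrow> nat \<Rightarrow> real \<Rightarrow> real mat" where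
  "iterated_integral N E 0 t = 1\<^sub>m N"
| "iterated_integral N E (Suc k) t = mat_integral N t (\<lambda>s. E s * iterated_integral N E k s)"

definition F_mat :: "nat \<Rightarrow> real \<Rightarrow> (real \<Rightarrow> real mat) \<Rightarrow> (real \<Rightarrow> real mat) \<Rightarrow> nat \<Rightarrow> real mat" where
  "F_mat n T R1 \<gamma> k = iterated_integral (2 * n) (\<lambda>t. symp_J n * D_hat n R1 \<gamma> t) k T"

section \<open>The matrices \<open>M\<^sub>3\<close> and \<open>G\<^sub>k\<close>\<close>

text \<open>Here \<open>ds = [d\<^sub>1, \<dots>, d\<^sub>n]\<close> and \<open>fs = [f\<^bsub>k\<^sub>0+1\<^esub>, \<dots>, f\<^sub>n]\<close>.\<close>

definition M1_mat :: "nat \<Rightarrow> real vec list \<Rightarrow> real mat" where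
  "M1_mat n ds = mat_of_cols (2 * n) (ds @ map (\<lambda>d. symp_J n *\<^sub>v d) ds)"

definition X_tilde :: "nat \<Rightarrow> nat \<Rightarrow> real vec list \<Rightarrow> real vec list \<Rightarrow> real mat" where
  "X_tilde n k0 ds fs = mat (n - k0) (n - k0)
     (\<lambda>(i, j). (transpose_mat (M1_mat n ds) * mat_of_cols (2 * n) fs) $$ (k0 + i, j))"

definition Y_tilde :: "nat \<Rightarrow> nat \<Rightarrow> real vec list \<Rightarrow> real vec list \<Rightarrow> real mat" where
  "Y_tilde n k0 ds fs = mat (n - k0) (n - k0)
     (\<lambda>(i, j). (transpose_mat (M1_mat n ds) * mat_of_cols (2 * n) fs) $$ (n + k0 + i, j))"

definition M3_mat :: "nat \<Rightarrow> nat \<Rightarrow> real vec list \<Rightarrow> real vec list \<Rightarrow> real mat" where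
  "M3_mat n k0 ds fs =
     four_block_mat
       (1\<^sub>m n)
       (four_block_mat
          (0\<^sub>m k0 k0) (0\<^sub>m k0 (n - k0))
          (0\<^sub>m (n - k0) k0) (- (X_tilde n k0 ds fs * inv_mat (Y_tilde n k0 ds fs))))
       (0\<^sub>m n n) (1\<^sub>m n)
     * transpose_mat (M1_mat n ds)"

text \<open>\<open>(N e\<^sub>j, e\<^bsub>i+k\<^sub>0\<^esub>)\<close> is the entry of \<open>N\<close> in row \<open>i + k\<^sub>0\<close> and column \<open>j\<close>.\<close>
definition P_block :: "nat \<Rightarrow> nat \<Rightarrow> real mat \<Rightarrow> real mat \<Rightarrow> real mat" where
  "P_block n k0 M3 M = mat n n (\<lambda>(i, j). (M3 * M * inv_mat M3) $$ (i + k0, j))"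

definition G_mat ::
  "nat \<Rightarrow> real \<Rightarrow> (real \<Rightarrow> real mat) \<Rightarrow> (real \<Rightarrow> real mat) \<Rightarrow> nat \<Rightarrow> real mat \<Rightarrow> nat \<Rightarrow> real mat" where
  "G_mat n T R1 \<gamma> k0 M3 k =
     P_block n k0 M3 (\<gamma> T * F_mat n T R1 \<gamma> k) * inv_mat (P_block n k0 M3 (\<gamma> T))"

definition prod_mats :: "nat \<Rightarrow> 'a :: semiring_1 mat list \<Rightarrow> 'a mat" where
  "prod_mats n Ms = foldr (*) Ms (1\<^sub>m n)"

definition compositions :: "nat \<Rightarrow> nat \<Rightarrow> nat list set" where
  "compositions m k = {js. length js = k \<and> (\<forall>j\<in>set js. 0 < j) \<and> sum_list js = m}"

end

theory Submission
  imports Defs "HOL-Complex_Analysis.Complex_Analysis" "HOL-Real_Asymp.Real_Asymp" "Jordan_Normal_Form.DL_Rank"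
begin

text \<open>
  Let \<open>z\<^sub>\<lambda>(t)\<close> denote the solutions of the first order system \<open>z' = (A + \<lambda> B) z\<close> for
  \<open>z = (P y' + Q y, y)\<close> that belongs to the eigenvalue equation. In the coordinates given by
  \<open>M\<^sub>3\<close> the condition at \<open>0\<close> says that the lower half of \<open>M\<^sub>3 z(0)\<close> vanishes, and the condition at \<open>T\<close>
  says that the entries \<open>k\<^sub>0, \<dots>, k\<^sub>0 + n - 1\<close> of \<open>M\<^sub>3 z(T)\<close> vanish (\<open>complexify_Lam0\<close>,
  \<open>complexify_Lam1\<close>). So the boundary value problem is governed by an \<open>n \<times> n\<close> transfer matrix
  \<open>\<Delta>(\<lambda>)\<close> that maps the free initial data to these entries. Expanding the solution operator in a Volterra
  series at \<open>\<lambda> = 0\<close> gives \<open>\<Delta>(\<lambda>) = (I + \<lambda> G\<^sub>1 + \<lambda>\<^sup>2 G\<^sub>2 + \<dots>) \<Delta>(0)\<close>, where \<open>\<Delta>(0)\<close> is nonsingular because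
  \<open>0\<close> is not an eigenvalue. The theorem compares two descriptions of the entire function
  \<open>f(\<lambda>) = det (\<Delta>(\<lambda>) \<Delta>(0)\<^sup>-\<^sup>1)\<close>, with \<open>f(0) = 1\<close>.

  The power series side is algebra: Jacobi's formula for the derivative of a determinant expresses the
  coefficients of \<open>f'/f\<close> by traces of powers of \<open>\<Sum>\<^sub>k \<lambda>\<^sup>k G\<^sub>k\<close>, and collecting the terms of a given order produces the
  sum over compositions (\<open>fps_logderiv_det_compositions\<close>).

  The side of the zeros is complex analysis. Giving \<open>y\<close> the weight \<open>1 + sqrt \<bar>\<lambda>\<bar>\<close> turns the coefficient matrix of the
  system into one of size \<open>O(1 + sqrt \<bar>\<lambda>\<bar>)\<close>, because \<open>\<lambda>\<close> enters only through the term \<open>\<lambda> R\<^sub>1 y\<close> in the equation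
  for \<open>x\<close>. Gronwall's inequality then gives \<open>\<bar>f(\<lambda>)\<bar> \<le> exp (C (1 + sqrt \<bar>\<lambda>\<bar>))\<close> (\<open>charf_growth\<close>). A function of order
  less than one is determined by its zeros; here the identity \<open>\<Sum> 1 / \<rho>\<^sup>m = - [\<lambda>\<^bsup>m-1\<^esup>] (f'/f)\<close> is derived directly, by
  dividing out the zeros in a disc by Blaschke factors, bounding the Taylor coefficients of the logarithm of
  the remaining factor by its real part, and letting the radius tend to infinity
  (\<open>has_sum_zeros_of_order_half\<close>).

  It remains to see that the order of a zero \<open>\<lambda>\<^sub>0\<close> of \<open>f\<close> is the algebraic multiplicity of \<open>- 1 / \<lambda>\<^sub>0\<close> as an
  eigenvalue of \<open>R\<^sub>1 A\<^sup>-\<^sup>1\<close>. With the local parameter \<open>\<delta> = 1 - \<lambda>\<^sub>0 / \<lambda>\<close>, let power series in \<open>\<delta>\<close> act on finite sequences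
  by letting \<open>\<delta>\<close> shift a sequence by one place, as on polynomials in \<open>\<delta>\<^sup>-\<^sup>1\<close>. The
  elements \<open>g\<close> of the generalized eigenspace, together with the chains \<open>(R\<^sub>1 A\<^sup>-\<^sup>1 + 1 / \<lambda>\<^sub>0)\<^sup>j g\<close>, correspond exactly to
  the \<open>\<complex>\<^sup>n\<close>-valued sequences annihilated by the expansion of \<open>\<Delta>(\<lambda>\<^sub>0 / (1 - \<delta>))\<close> (\<open>L2_alg_mult_eq\<close>), and the space of those
  sequences has as dimension the order in \<open>\<delta>\<close> of the determinant (\<open>act_kernel_dimension\<close>). This order is that of
  \<open>f\<close> at \<open>\<lambda>\<^sub>0\<close>, since \<open>\<delta>\<close> is a local coordinate there.
\<close>

section \<open>Zeros of entire functions of order one half\<close>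

text \<open>The zeros in a disc are finitely many, and the quotient by the product of the linear factors
  has removable singularities.\<close>

lemma entire_divide_zeros_in_ball:
  fixes f :: "complex \<Rightarrow> complex" and r :: real
  assumes f: "f holomorphic_on UNIV" and f0: "f 0 \<noteq> 0" and r: "r > 0"
  defines "Z \<equiv> {z \<in> ball 0 r. f z = 0}"
  obtains q where "finite Z" "q holomorphic_on UNIV" "\<And>z. z \<in> ball 0 r \<Longrightarrow> q z \<noteq> 0"
    "\<And>z. f z = q z * (\<Prod>w\<in>Z. (z - w) ^ nat (zorder f w))"
proof -
  let ?p = "\<lambda>z. \<Prod>w\<in>Z. (z - w) ^ nat (zorder f w)"
  have nonconst: "\<not> f constant_on UNIV" if "Z \<noteq> {}"
    using that f0 unfolding Z_def constant_on_def by force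
  have finZ: "finite Z"
  proof (cases "Z = {}")
    case False
    have "finite {z \<in> cball 0 r. f z = 0}"
      by (rule holomorphic_compact_finite_zeros[OF f]) (use nonconst[OF False] in auto)
    then show ?thesis by (rule finite_subset[rotated]) (auto simp: Z_def)
  qed auto
  have ana: "f analytic_on {z}" for z
    using f by (meson UNIV_I analytic_at_two analytic_on_open holomorphic_on_imp_analytic_at open_UNIV)
  have ev: "eventually (\<lambda>w. f w \<noteq> 0) (at z)" for z
    using non_zero_neighbour_alt[OF f open_UNIV connected_UNIV, of z 0] f0 by auto
  have fr: "frequently (\<lambda>w. f w \<noteq> 0) (at z)" for z
    using ev[of z] by (simp add: eventually_frequently)
  have pz: "?p z = 0 \<longleftrightarrow> z \<in> Z" for z
  proof -
    have "zorder f w > 0" if "w \<in> Z" for w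
      using zorder_pos_iff'[OF ana fr, of w] that by (auto simp: Z_def)
    then show ?thesis using finZ by (auto simp: prod_zero_iff)
  qed
  have evp: "eventually (\<lambda>w. ?p w \<noteq> 0) (at z)" for z
    using islimpt_finite[OF finZ, of z] unfolding pz islimpt_iff_eventually by auto
  have zo: "zorder ?p z = zorder f z" if z: "z \<in> ball 0 r" for z
  proof (cases "z \<in> Z")
    case False
    then have "f z \<noteq> 0" using z by (auto simp: Z_def)
    then have "zorder f z = 0" using ana by (intro zorder_eq_0I)
    moreover have "zorder ?p z = 0"
      by (rule zorder_eq_0I) (use pz False in \<open>auto intro!: analytic_intros\<close>)
    ultimately show ?thesis by simp
  next
    case True
    have nz: "zorder f z > 0" using zorder_pos_iff'[OF ana fr, of z] True by (auto simp: Z_def)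
    define P where "P = (\<lambda>x. \<Prod>w\<in>Z - {z}. (x - w) ^ nat (zorder f w))"
    have p_eq: "?p = (\<lambda>x. P x * (x - z) powi zorder f z)"
      unfolding P_def fun_eq_iff using True finZ nz
      by (subst prod.remove[of _ z]) (auto simp: power_int_def)
    have "P holomorphic_on UNIV" unfolding P_def by (intro holomorphic_intros)
    moreover have "P z \<noteq> 0" unfolding P_def using finZ by auto
    ultimately show ?thesis
      using p_eq by (intro zorder_eqI[of UNIV _ P]) (auto simp: fun_eq_iff)
  qed
  have hb: "f holomorphic_on ball 0 r" using f holomorphic_on_subset by blast
  obtain h where h: "h holomorphic_on ball 0 r" "\<And>z. z \<in> ball 0 r \<Longrightarrow> h z \<noteq> 0"
      "\<And>z. z \<in> ball 0 r \<Longrightarrow> f z = h z * ?p z"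
  proof (rule holomorphic_zorder_factorization[OF hb open_ball connected_ball, of ?p])
    show "?p holomorphic_on ball 0 r" by (intro holomorphic_intros)
    show "\<And>z. z \<in> ball 0 r \<Longrightarrow> (?p z = 0) = (f z = 0)" using pz by (auto simp: Z_def)
  qed (use zo in auto)
  define q where "q = (\<lambda>z. if z \<in> ball 0 r then h z else f z / ?p z)"
  have qe: "q z = f z / ?p z" if "z \<notin> Z" for z
    using that h(3)[of z] pz[of z] unfolding q_def by auto
  have "q holomorphic_on (ball 0 r \<union> - Z)"
  proof (rule holomorphic_on_Un)
    show "q holomorphic_on ball 0 r"
      using h(1) by (rule holomorphic_transform) (auto simp: q_def)
    show "q holomorphic_on - Z"
    proof (rule holomorphic_transform[of "\<lambda>z. f z / ?p z"])
      show "(\<lambda>z. f z / ?p z) holomorphic_on - Z"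
        by (intro holomorphic_intros holomorphic_on_subset[OF f]) (use pz in auto)
    qed (use qe in auto)
    show "open (- Z)" using finZ by (simp add: finite_imp_closed open_Compl)
  qed auto
  moreover have "ball 0 r \<union> - Z = UNIV" by (auto simp: Z_def)
  ultimately have hq: "q holomorphic_on UNIV" by simp
  have "f z = q z * ?p z" for z
  proof (cases "z \<in> ball 0 r")
    case True then show ?thesis using h(3) by (simp add: q_def)
  next
    case False
    then have "z \<notin> Z" by (auto simp: Z_def)
    then show ?thesis using qe pz by auto
  qed
  moreover have "q z \<noteq> 0" if "z \<in> ball 0 r" for z using h(2) that by (simp add: q_def)
  ultimately show ?thesis using that finZ hq by blast
qed

text \<open>A one-sided bound on the real part suffices: a Moebius map takes the half plane
  \<open>Re w < A - Re (h 0)\<close> to the unit disc, the Schwarz lemma bounds \<open>h\<close> on the disc of half the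
  radius, and Cauchy's estimate applies there.\<close>

lemma higher_deriv_bound_of_Re_less:
  fixes h :: "complex \<Rightarrow> complex"
  assumes h: "h holomorphic_on ball 0 r" and r: "r > 0"
    and less: "\<And>z. z \<in> ball 0 r \<Longrightarrow> Re (h z) < A" and m: "m > 0"
  shows "norm ((deriv ^^ m) h 0) \<le> fact m * (2 * (A - Re (h 0))) * (2 / r) ^ m"
proof -
  define a where "a = A - Re (h 0)"
  have a: "a > 0" using less[of 0] r by (simp add: a_def)
  define k where "k = (\<lambda>z. h z - h 0)"
  have hk: "k holomorphic_on ball 0 r" unfolding k_def by (intro holomorphic_intros h)
  have Rek: "Re (k z) < a" if "z \<in> ball 0 r" for z using less[OF that] by (simp add: k_def a_def)
  have den: "2 * of_real a - k z \<noteq> 0" if "z \<in> ball 0 r" for z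
    using Rek[OF that] a by (auto simp: complex_eq_iff)
  define \<phi> where "\<phi> = (\<lambda>z. k (of_real r * z) / (2 * of_real a - k (of_real r * z)))"
  have inb: "of_real r * z \<in> ball 0 r" if "z \<in> ball 0 1" for z :: complex
    using that r by (auto simp: norm_mult)
  have hkr: "(\<lambda>z. k (of_real r * z)) holomorphic_on ball 0 1"
  proof -
    have "(k \<circ> (\<lambda>z. of_real r * z)) holomorphic_on ball 0 1"
      by (rule holomorphic_on_compose_gen[OF _ hk]) (use inb in \<open>auto intro!: holomorphic_intros\<close>)
    then show ?thesis by (simp add: o_def)
  qed
  have phi_hol: "\<phi> holomorphic_on ball 0 1"
    unfolding \<phi>_def by (intro holomorphic_intros hkr den inb)
  have phi_less: "norm (\<phi> z) < 1" if "norm z < 1" for z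
  proof -
    have "Re (k (r*z)) < a" using that by (intro Rek inb) auto
    then have "(norm (k (r*z)))\<^sup>2 < (norm (2 * of_real a - k (r*z)))\<^sup>2"
      using a unfolding cmod_power2 by (simp add: power2_eq_square algebra_simps)
    then have "norm (k (r*z)) < norm (2 * of_real a - k (r*z))"
      by (rule power_less_imp_less_base) simp
    then show ?thesis unfolding \<phi>_def norm_divide
      by (subst divide_less_eq_1_pos) (auto intro: le_less_trans[OF norm_ge_zero])
  qed
  have phi0: "\<phi> 0 = 0" by (simp add: \<phi>_def k_def)
  have kb: "norm (k w) \<le> 2 * a" if w: "norm w = r / 2" for w
  proof -
    define z where "z = w / r"
    have nz: "norm z = 1/2" using w r by (simp add: z_def norm_divide)
    have "norm (\<phi> z) \<le> 1/2"
      using Schwarz_Lemma(1)[OF phi_hol phi0 phi_less, of z] nz by simp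
    moreover have "w \<in> ball 0 r" using w r by simp
    ultimately have "norm (k w) \<le> 1/2 * norm (2 * of_real a - k w)"
      using r den[of w] by (simp add: \<phi>_def z_def norm_divide divide_simps)
    also have "\<dots> \<le> 1/2 * (2 * a + norm (k w))"
      using norm_triangle_ineq4[of "2 * of_real a" "k w"] a by (simp add: norm_mult)
    finally show ?thesis by simp
  qed
  have "norm ((deriv ^^ m) k 0) \<le> fact m * (2 * a) / (r / 2) ^ m"
  proof (rule Cauchy_inequality)
    show "k holomorphic_on ball 0 (r/2)" using hk r by (elim holomorphic_on_subset) auto
    have "continuous_on (ball 0 r) k" using hk by (rule holomorphic_on_imp_continuous_on)
    then show "continuous_on (cball 0 (r/2)) k" using r by (elim continuous_on_subset) auto
  qed (use r kb in auto)
  moreover have "(deriv ^^ m) k 0 = (deriv ^^ m) h 0"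
  proof -
    have "(deriv ^^ m) k 0 = (deriv ^^ m) h 0 - (deriv ^^ m) (\<lambda>_. h 0) 0"
      unfolding k_def by (rule higher_deriv_diff[of _ "ball 0 r"]) (use h r in auto)
    then show ?thesis using m by (simp add: higher_deriv_const)
  qed
  ultimately show ?thesis by (simp add: a_def power_divide field_simps)
qed

definition fps_logderiv :: "complex fps \<Rightarrow> complex fps" where
  "fps_logderiv F = fps_deriv F * inverse F"

lemma fps_logderiv_mult:
  assumes "fps_nth F 0 \<noteq> 0" "fps_nth G 0 \<noteq> 0"
  shows "fps_logderiv (F * G) = fps_logderiv F + fps_logderiv G"
proof -
  have "fps_logderiv (F * G) = fps_deriv F * inverse F * (G * inverse G) + fps_deriv G * inverse G * (F * inverse F)"
    by (simp add: fps_logderiv_def fps_inverse_mult algebra_simps)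
  moreover have "F * inverse F = 1" "G * inverse G = 1"
    using assms by (simp_all add: inverse_mult_eq_1')
  ultimately show ?thesis by (simp add: fps_logderiv_def)
qed

lemma fps_logderiv_power:
  assumes "fps_nth F 0 \<noteq> 0"
  shows "fps_logderiv (F ^ k) = of_nat k * fps_logderiv F"
proof (induction k)
  case (Suc k)
  show ?case
    using assms by (simp add: fps_logderiv_mult Suc fps_nth_power_0 algebra_simps)
qed (simp add: fps_logderiv_def)

lemma fps_nth_0_prod: "fps_nth (\<Prod>x\<in>A. F x) 0 = (\<Prod>x\<in>A. fps_nth (F x :: complex fps) 0)"
  by (induction A rule: infinite_finite_induct) auto

lemma fps_logderiv_prod:
  assumes "finite A" "\<And>x. x \<in> A \<Longrightarrow> fps_nth (F x) 0 \<noteq> 0"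
  shows "fps_logderiv (\<Prod>x\<in>A. F x) = (\<Sum>x\<in>A. fps_logderiv (F x))"
  using assms
proof (induction A)
  case (insert x A)
  have "fps_nth (\<Prod>x\<in>A. F x) 0 \<noteq> 0" using insert by (simp add: fps_nth_0_prod)
  then show ?case using insert by (simp add: fps_logderiv_mult)
qed (simp add: fps_logderiv_def)

lemma fps_nth_logderiv_linear:
  assumes c: "c \<noteq> (0::complex)"
  shows "fps_nth (fps_logderiv (fps_const c - fps_const a * fps_X)) n = - ((a / c) ^ Suc n)"
proof -
  let ?L = "fps_const c - fps_const a * fps_X"
  define S where "S = Abs_fps (\<lambda>n. - ((a / c) ^ Suc n))"
  have nz: "fps_nth ?L 0 \<noteq> 0" using c by simp
  have "S * ?L = fps_deriv ?L"
  proof (rule fps_ext)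
    fix k
    have "S * ?L = fps_const c * S - fps_const a * (S * fps_X)" by (simp add: algebra_simps)
    then show "fps_nth (S * ?L) k = fps_nth (fps_deriv ?L) k"
      using c by (cases k) (auto simp: S_def)
  qed
  then have "fps_logderiv ?L = S * (?L * inverse ?L)" by (simp add: fps_logderiv_def mult.assoc)
  also have "?L * inverse ?L = 1" using nz by (rule inverse_mult_eq_1')
  finally show ?thesis by (simp add: S_def)
qed

lemma norm_prod_eq: "norm (prod f A) = (\<Prod>x\<in>A. norm (f x :: complex))"
  by (rule prod_norm[symmetric])

text \<open>Multiplying the zero-free part of \<open>f\<close> by \<open>r - cnj w z / r\<close> for each zero \<open>w\<close> gives a
  zero-free function with the same absolute value as \<open>f\<close> on the circle of radius \<open>r\<close>. Its value at
  \<open>0\<close> bounds the number of zeros (Jensen's inequality), and the Taylor coefficients of its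
  logarithm are controlled by \<open>ln M\<close>, which leaves the logarithmic derivative of \<open>f\<close> as a sum over
  the zeros up to a small error.\<close>

lemma entire_logderiv_coeff_estimate:
  fixes f :: "complex \<Rightarrow> complex" and r M :: real
  assumes f: "f holomorphic_on UNIV" and F: "f has_fps_expansion F" and f0: "f 0 = 1" and r: "r > 0"
    and M: "\<And>z. norm z = r \<Longrightarrow> norm (f z) \<le> M"
  defines "Z \<equiv> {z \<in> ball 0 r. f z = 0}" and "k \<equiv> \<lambda>w. nat (zorder f w)"
  shows "finite Z" and "(\<Prod>w\<in>Z. (r / norm w) ^ k w) \<le> M"
    and "norm (fps_nth (fps_logderiv F) n - (\<Sum>w\<in>Z. of_nat (k w) * ((cnj w / r\<^sup>2) ^ Suc n - (1 / w) ^ Suc n)))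
           \<le> real (Suc n) * (2 * (ln M + 1)) * (2 / r) ^ Suc n"
proof -
  obtain q where q: "finite Z" "q holomorphic_on UNIV" "\<And>z. z \<in> ball 0 r \<Longrightarrow> q z \<noteq> 0"
    "\<And>z. f z = q z * (\<Prod>w\<in>Z. (z - w) ^ k w)"
  proof -
    have nz: "f 0 \<noteq> 0" using f0 by simp
    show thesis
      unfolding Z_def k_def
      by (rule entire_divide_zeros_in_ball[OF f nz r], rule that[unfolded Z_def k_def])
  qed
  show "finite Z" by (rule q(1))
  have w0: "w \<noteq> 0" "norm w < r" if "w \<in> Z" for w using that f0 by (auto simp: Z_def)
  \<comment> \<open>on the circle of radius \<open>r\<close> this reflected factor has the absolute value of \<open>z - w\<close>, and inside it has no zeros\<close>
  define b where "b = (\<lambda>w z. complex_of_real r - cnj w / of_real r * z)"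
  define g where "g = (\<lambda>z. q z * (\<Prod>w\<in>Z. b w z ^ k w))"
  have hg: "g holomorphic_on UNIV" unfolding g_def b_def by (intro holomorphic_intros q)
  have b_norm: "norm (b w z) = norm (z - w)" if "norm z = r" for w z
  proof -
    have "of_real r * b w z = of_real r ^ 2 - cnj w * z"
      using r by (simp add: b_def right_diff_distrib power2_eq_square)
    also have "of_real r ^ 2 = z * cnj z" using complex_norm_square[of z] that by simp
    finally have "of_real r * b w z = cnj (z - w) * z" by (simp add: algebra_simps)
    then have "norm (of_real r * b w z) = norm (cnj (z - w) * z)" by simp
    then have "r * norm (b w z) = r * norm (z - w)"
      using that r by (simp only: norm_mult complex_mod_cnj norm_of_real abs_of_pos mult.commute)
    then show ?thesis using r by simp
  qed
  have b_nz: "b w z \<noteq> 0" if "w \<in> Z" "norm z < r" for w z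
  proof
    assume "b w z = 0"
    then have "of_real r * b w z = 0" by simp
    moreover have "of_real r * b w z = of_real (r * r) - cnj w * z"
      using r by (simp add: b_def right_diff_distrib)
    ultimately have "of_real (r * r) = cnj w * z" by simp
    then have "norm (complex_of_real (r * r)) = norm (cnj w * z)" by simp
    then have "r * r = norm w * norm z" using r by (simp only: norm_mult complex_mod_cnj norm_of_real) simp
    moreover have "norm w * norm z < r * r" using w0[OF that(1)] that(2) by (intro mult_strict_mono') auto
    ultimately show False by simp
  qed
  have g_le: "norm (g z) \<le> M" if "z \<in> ball 0 r" for z
  proof (rule maximum_modulus_frontier[of g "cball 0 r"])
    show "g holomorphic_on interior (cball 0 r)" using hg holomorphic_on_subset by blast
    show "continuous_on (closure (cball 0 r)) g"
      using hg holomorphic_on_imp_continuous_on continuous_on_subset by blast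
    fix x :: complex assume "x \<in> frontier (cball 0 r)"
    then have x: "norm x = r" using r by (simp add: frontier_cball)
    have "norm (g x) = norm (f x)"
      unfolding g_def q(4)[of x] by (simp add: norm_mult norm_prod_eq norm_power b_norm[OF x])
    then show "norm (g x) \<le> M" using M[OF x] by simp
  qed (use that in auto)
  have g_nz: "g z \<noteq> 0" if "z \<in> ball 0 r" for z
    using q(1,3) b_nz that by (auto simp: g_def)
  have prod_nz: "(\<Prod>w\<in>Z. norm w ^ k w) > 0" using w0 by (intro prod_pos) auto
  have "norm (f 0) * (\<Prod>w\<in>Z. r ^ k w) = norm (g 0) * (\<Prod>w\<in>Z. norm w ^ k w)"
    unfolding q(4)[of 0] g_def b_def using r by (simp add: norm_mult norm_prod_eq norm_power)
  then have g0: "norm (g 0) = (\<Prod>w\<in>Z. (r / norm w) ^ k w)"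
    using prod_nz f0 by (simp add: prod_dividef power_divide divide_simps)
  show "(\<Prod>w\<in>Z. (r / norm w) ^ k w) \<le> M" using g_le[of 0] r g0 by simp
  have g0_ge: "norm (g 0) \<ge> 1" unfolding g0
    by (rule prod_ge_1) (use w0 r in \<open>auto intro!: one_le_power simp: less_imp_le\<close>)
  have M1: "M \<ge> 1" using g0_ge g_le[of 0] r by simp
  obtain h where h: "h holomorphic_on ball 0 r" "\<And>z. z \<in> ball 0 r \<Longrightarrow> exp (h z) = g z"
  proof (rule holomorphic_logarithm_exists[of "ball 0 r" g 0])
    show "g holomorphic_on ball 0 r" using hg by (rule holomorphic_on_subset) auto
  qed (use r g_nz in auto)
  have Re_h: "Re (h z) = ln (norm (g z))" if "z \<in> ball 0 r" for z
    using norm_exp_eq_Re[of "h z"] h(2)[OF that] by simp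
  have Re_less: "Re (h z) < ln M + 1" if "z \<in> ball 0 r" for z
  proof -
    have "ln (norm (g z)) \<le> ln M" using g_le[OF that] g_nz[OF that] by (intro ln_mono) auto
    then show ?thesis using Re_h[OF that] by simp
  qed
  have Re_h0: "Re (h 0) \<ge> 0" using Re_h[of 0] r g0_ge by simp
  define H where "H = fps_expansion h 0"
  have H: "h has_fps_expansion H" unfolding H_def
    by (rule has_fps_expansion_fps_expansion[of "ball 0 r"]) (use h r in auto)
  define G where "G = fps_expansion g 0"
  have G: "g has_fps_expansion G" unfolding G_def
    by (rule has_fps_expansion_fps_expansion[of UNIV]) (use hg in auto)
  have G0: "fps_nth G 0 \<noteq> 0"
    using has_fps_expansion_imp_0_eq_fps_nth_0[OF G] g_nz[of 0] r by simp
  have F0: "fps_nth F 0 \<noteq> 0" using has_fps_expansion_imp_0_eq_fps_nth_0[OF F] f0 by simp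
  have G_deriv: "fps_deriv G = fps_deriv H * G"
  proof (rule fps_expansion_unique_complex)
    show "deriv g has_fps_expansion fps_deriv G" using G by (rule has_fps_expansion_deriv)
    have "(\<lambda>z. deriv h z * g z) has_fps_expansion fps_deriv H * G"
      by (intro has_fps_expansion_mult has_fps_expansion_deriv H G)
    moreover have ev: "eventually (\<lambda>z. deriv h z * g z = deriv g z) (nhds 0)"
    proof -
      have "eventually (\<lambda>z. z \<in> ball 0 r) (nhds (0::complex))"
        using r by (intro eventually_nhds_in_open) auto
      then show ?thesis
      proof eventually_elim
        case (elim z)
        have "(h has_field_derivative deriv h z) (at z)"
          using h(1) elim by (intro holomorphic_derivI[of _ "ball 0 r"]) auto
        then have "((\<lambda>z. exp (h z)) has_field_derivative deriv h z * g z) (at z)"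
          using h(2)[OF elim] by (auto intro!: derivative_eq_intros)
        then have "(g has_field_derivative deriv h z * g z) (at z)"
          by (rule has_field_derivative_transform_within_open[of _ _ _ "ball 0 r"]) (use h(2) elim in auto)
        then show ?case by (simp add: DERIV_imp_deriv)
      qed
    qed
    ultimately show "deriv g has_fps_expansion fps_deriv H * G"
      using has_fps_expansion_cong[OF ev refl, of "fps_deriv H * G"] by simp
  qed
  then have LG: "fps_logderiv G = fps_deriv H"
    using G0 by (simp add: fps_logderiv_def mult.assoc inverse_mult_eq_1')
  define Bw where "Bw = (\<lambda>w. fps_const (complex_of_real r) - fps_const (cnj w / of_real r) * fps_X)"
  define Lw where "Lw = (\<lambda>w. fps_const (- w) - fps_const (-1) * fps_X :: complex fps)"
  have eq: "F * (\<Prod>w\<in>Z. Bw w ^ k w) = G * (\<Prod>w\<in>Z. Lw w ^ k w)"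
  proof (rule fps_expansion_unique_complex)
    show "(\<lambda>z. f z * (\<Prod>w\<in>Z. b w z ^ k w)) has_fps_expansion F * (\<Prod>w\<in>Z. Bw w ^ k w)"
      unfolding b_def Bw_def by (intro fps_expansion_intros F)
    have "(\<lambda>z. g z * (\<Prod>w\<in>Z. (- w - (-1) * z) ^ k w)) has_fps_expansion G * (\<Prod>w\<in>Z. Lw w ^ k w)"
      unfolding Lw_def by (intro fps_expansion_intros G)
    also have "(\<lambda>z. g z * (\<Prod>w\<in>Z. (- w - (-1) * z) ^ k w)) = (\<lambda>z. f z * (\<Prod>w\<in>Z. b w z ^ k w))"
      by (auto simp: q(4) g_def fun_eq_iff)
    finally show "(\<lambda>z. f z * (\<Prod>w\<in>Z. b w z ^ k w)) has_fps_expansion G * (\<Prod>w\<in>Z. Lw w ^ k w)" .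
  qed
  have B0: "fps_nth (Bw w) 0 \<noteq> 0" for w using r by (simp add: Bw_def)
  have L0: "fps_nth (Lw w) 0 \<noteq> 0" if "w \<in> Z" for w using w0[OF that] by (simp add: Lw_def)
  have "fps_logderiv (F * (\<Prod>w\<in>Z. Bw w ^ k w)) = fps_logderiv F + (\<Sum>w\<in>Z. of_nat (k w) * fps_logderiv (Bw w))"
    using F0 B0 q(1) by (simp add: fps_logderiv_mult fps_logderiv_prod fps_logderiv_power fps_nth_0_prod fps_nth_power_0)
  moreover have "fps_logderiv (G * (\<Prod>w\<in>Z. Lw w ^ k w)) = fps_logderiv G + (\<Sum>w\<in>Z. of_nat (k w) * fps_logderiv (Lw w))"
    using G0 L0 q(1) by (simp add: fps_logderiv_mult fps_logderiv_prod fps_logderiv_power fps_nth_0_prod fps_nth_power_0)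
  ultimately have sum_eq: "fps_logderiv F + (\<Sum>w\<in>Z. of_nat (k w) * fps_logderiv (Bw w)) =
      fps_logderiv G + (\<Sum>w\<in>Z. of_nat (k w) * fps_logderiv (Lw w))" using eq by simp
  have Bn: "fps_nth (of_nat (k w) * fps_logderiv (Bw w)) n = - (of_nat (k w) * (cnj w / r\<^sup>2) ^ Suc n)" for w
    unfolding Bw_def fps_of_nat[symmetric] fps_mult_left_const_nth using r
    by (subst fps_nth_logderiv_linear) (auto simp: power2_eq_square)
  have Ln: "fps_nth (of_nat (k w) * fps_logderiv (Lw w)) n = - (of_nat (k w) * (1 / w) ^ Suc n)" if "w \<in> Z" for w
    unfolding Lw_def fps_of_nat[symmetric] fps_mult_left_const_nth using w0[OF that]
    by (subst fps_nth_logderiv_linear) auto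
  have "fps_nth (fps_logderiv F) n - (\<Sum>w\<in>Z. of_nat (k w) * (cnj w / r\<^sup>2) ^ Suc n) =
        fps_nth (fps_logderiv G) n - (\<Sum>w\<in>Z. of_nat (k w) * (1 / w) ^ Suc n)"
  proof -
    have "fps_nth (\<Sum>w\<in>Z. of_nat (k w) * fps_logderiv (Bw w)) n = - (\<Sum>w\<in>Z. of_nat (k w) * (cnj w / r\<^sup>2) ^ Suc n)"
      unfolding fps_sum_nth sum_negf[symmetric] by (rule sum.cong[OF refl Bn])
    moreover have "fps_nth (\<Sum>w\<in>Z. of_nat (k w) * fps_logderiv (Lw w)) n = - (\<Sum>w\<in>Z. of_nat (k w) * (1 / w) ^ Suc n)"
      unfolding fps_sum_nth sum_negf[symmetric] by (rule sum.cong[OF refl Ln])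
    ultimately show ?thesis
      using arg_cong[OF sum_eq, of "\<lambda>F. fps_nth F n"] unfolding fps_add_nth by (simp del: power_Suc)
  qed
  then have main: "fps_nth (fps_logderiv F) n - (\<Sum>w\<in>Z. of_nat (k w) * ((cnj w / r\<^sup>2) ^ Suc n - (1 / w) ^ Suc n))
      = fps_nth (fps_logderiv G) n"
    by (simp add: sum_subtractf right_diff_distrib algebra_simps del: power_Suc)
  have "norm (fps_nth (fps_logderiv G) n) = real (Suc n) * (norm ((deriv ^^ Suc n) h 0) / fact (Suc n))"
    unfolding LG H_def fps_expansion_def by (simp add: norm_mult norm_divide del: of_nat_Suc fact_Suc)
  also have "\<dots> \<le> real (Suc n) * ((2 * (ln M + 1)) * (2 / r) ^ Suc n)"
  proof (rule mult_left_mono)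
    have "norm ((deriv ^^ Suc n) h 0) \<le> fact (Suc n) * (2 * (ln M + 1 - Re (h 0))) * (2 / r) ^ Suc n"
      by (rule higher_deriv_bound_of_Re_less[OF h(1) r Re_less]) auto
    also have "\<dots> \<le> fact (Suc n) * (2 * (ln M + 1)) * (2 / r) ^ Suc n"
      using Re_h0 r by (intro mult_right_mono mult_left_mono) auto
    finally show "norm ((deriv ^^ Suc n) h 0) / fact (Suc n) \<le> (2 * (ln M + 1)) * (2 / r) ^ Suc n"
      by (simp add: field_simps del: fact_Suc)
  qed simp
  finally show "norm (fps_nth (fps_logderiv F) n - (\<Sum>w\<in>Z. of_nat (k w) * ((cnj w / r\<^sup>2) ^ Suc n - (1 / w) ^ Suc n)))
           \<le> real (Suc n) * (2 * (ln M + 1)) * (2 / r) ^ Suc n"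
    unfolding main by (simp only: mult.assoc)
qed

text \<open>Indexing the zeros by pairs keeps multiplicities while allowing an unconditional sum over a
  set.\<close>

definition zero_multiset_index :: "(complex \<Rightarrow> complex) \<Rightarrow> (complex \<times> nat) set" where
  "zero_multiset_index f = {(l, i). f l = 0 \<and> int i < zorder f l}"

lemma sum_zero_multiset_index:
  fixes g :: "complex \<Rightarrow> 'a :: comm_semiring_1"
  assumes "finite {l \<in> B. f l = 0}"
  shows "finite {p \<in> zero_multiset_index f. fst p \<in> B}"
    and "(\<Sum>p\<in>{p \<in> zero_multiset_index f. fst p \<in> B}. g (fst p))
           = (\<Sum>l\<in>{l \<in> B. f l = 0}. of_nat (nat (zorder f l)) * g l)"
proof -
  have eq: "{p \<in> zero_multiset_index f. fst p \<in> B} = Sigma {l \<in> B. f l = 0} (\<lambda>l. {..<nat (zorder f l)})"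
    by (auto simp: zero_multiset_index_def)
  show "finite {p \<in> zero_multiset_index f. fst p \<in> B}"
    unfolding eq using assms by auto
  show "(\<Sum>p\<in>{p \<in> zero_multiset_index f. fst p \<in> B}. g (fst p))
           = (\<Sum>l\<in>{l \<in> B. f l = 0}. of_nat (nat (zorder f l)) * g l)"
    unfolding eq using sum.Sigma[OF assms, of "\<lambda>l. {..<nat (zorder f l)}" "\<lambda>l _. g l"]
    by (simp add: case_prod_beta)
qed

text \<open>The growth bound leaves at most \<open>O(sqrt r)\<close> zeros in the disc of radius \<open>r\<close>. Hence the sum
  over the zeros converges absolutely even for \<open>m = 1\<close>, the reflected terms \<open>(cnj w / r\<^sup>2)\<^sup>m\<close> in
  the previous estimate sum to \<open>O(r\<^bsup>1/2 - m\<^esup>)\<close>, and its error term is of the same order.\<close>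

lemma has_sum_zeros_of_order_half:
  fixes f :: "complex \<Rightarrow> complex" and C :: real
  assumes f: "f holomorphic_on UNIV" and F: "f has_fps_expansion F" and f0: "f 0 = 1"
    and growth: "\<And>z. norm (f z) \<le> exp (C * (1 + sqrt (norm z)))" and m: "m > 0"
  shows "((\<lambda>(l, i). 1 / l ^ m) has_sum - fps_nth (fps_logderiv F) (m - 1)) (zero_multiset_index f)"
proof -
  define S where "S = zero_multiset_index f"
  define k where "k = (\<lambda>w. nat (zorder f w))"
  define Z where "Z = (\<lambda>r::real. {z \<in> ball 0 r. f z = 0})"
  define N where "N = (\<lambda>r. \<Sum>w\<in>Z r. real (k w))"
  define U where "U = (\<lambda>r::real. {p \<in> S. fst p \<in> ball 0 r})"
  have C0: "C \<ge> 0"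
  proof -
    have "1 \<le> exp C" using growth[of 0] f0 by simp
    then show ?thesis by simp
  qed
  have bnd: "norm (f z) \<le> exp (C * (1 + sqrt r))" if "norm z = r" for z r
    using growth[of z] that by simp
  have finZ: "finite (Z r)" for r
  proof (cases "r > 0")
    case True
    show ?thesis unfolding Z_def
      by (rule entire_logderiv_coeff_estimate(1)[OF f F f0 True bnd])
  next
    case False
    have "\<not> norm z < r" for z :: complex using False norm_ge_zero[of z] by linarith
    then show ?thesis by (simp add: Z_def)
  qed
  have finU: "finite (U r)" for r
    unfolding U_def S_def using sum_zero_multiset_index(1) finZ unfolding Z_def by blast
  have sumU: "(\<Sum>p\<in>U r. g (fst p)) = (\<Sum>w\<in>Z r. of_nat (k w) * g w)"
    for r and g :: "complex \<Rightarrow> 'b :: comm_semiring_1"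
    unfolding U_def S_def Z_def k_def using sum_zero_multiset_index(2)[OF finZ[unfolded Z_def]] by blast
  have Z0: "w \<noteq> 0" if "w \<in> Z r" for w r using that f0 by (auto simp: Z_def)
  have N_le: "N r \<le> 2 * C * (1 + sqrt (2 * r))" if r: "r > 0" for r
  proof -
    have r2: "2 * r > 0" using r by simp
    have "2 powr N r = (\<Prod>w\<in>Z r. 2 ^ k w)"
      unfolding N_def using finZ by (simp add: powr_sum powr_realpow)
    also have "\<dots> \<le> (\<Prod>w\<in>Z r. (2 * r / norm w) ^ k w)"
    proof (rule prod_mono)
      fix w assume w: "w \<in> Z r"
      then have "2 \<le> 2 * r / norm w" using Z0[OF w] by (simp add: Z_def pos_le_divide_eq)
      then show "0 \<le> (2 ^ k w :: real) \<and> 2 ^ k w \<le> (2 * r / norm w) ^ k w"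
        by (simp add: power_mono)
    qed
    also have "\<dots> \<le> (\<Prod>w\<in>Z (2 * r). (2 * r / norm w) ^ k w)"
    proof (rule prod_mono2[OF finZ])
      show "Z r \<subseteq> Z (2 * r)" using r by (auto simp: Z_def)
      fix w assume w: "w \<in> Z (2 * r) - Z r"
      then have "1 \<le> 2 * r / norm w" using Z0[of w "2 * r"] by (simp add: Z_def pos_le_divide_eq)
      then show "1 \<le> (2 * r / norm w) ^ k w" by (rule one_le_power)
    qed (use r in auto)
    also have "\<dots> \<le> exp (C * (1 + sqrt (2 * r)))"
      unfolding Z_def k_def by (rule entire_logderiv_coeff_estimate(2)[OF f F f0 r2 bnd])
    finally have "ln (2 powr N r) \<le> C * (1 + sqrt (2 * r))"
      by (metis ln_exp ln_mono powr_gt_zero zero_neq_numeral)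
    then have "N r * ln 2 \<le> C * (1 + sqrt (2 * r))" by (simp add: ln_powr)
    moreover have "N r * (1/2) \<le> N r * ln 2"
      using ln2_ge_two_thirds by (intro mult_left_mono) (auto simp: N_def intro!: sum_nonneg)
    ultimately show ?thesis by linarith
  qed
  have N_nonneg: "N r \<ge> 0" for r by (auto simp: N_def intro!: sum_nonneg)
  have sum_lim: "(\<lambda>n. \<Sum>p\<in>U (real n). 1 / fst p ^ m) \<longlonglongrightarrow> - fps_nth (fps_logderiv F) (m - 1)"
  proof -
    have mm: "Suc (m - 1) = m" using m by simp
    define e where "e = (\<lambda>r. real m * (2 * (C * (1 + sqrt r) + 1)) * (2 / r) ^ m + N r / r ^ m)"
    define X where "X = fps_nth (fps_logderiv F) (m - 1)"
    have est: "norm ((\<Sum>p\<in>U r. 1 / fst p ^ m) - - X) \<le> e r" if r: "r > 0" for r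
    proof -
      define Y where "Y = (\<Sum>w\<in>Z r. of_nat (k w) * (cnj w / r\<^sup>2) ^ m)"
      have "norm (X - (\<Sum>w\<in>Z r. of_nat (k w) * ((cnj w / r\<^sup>2) ^ m - (1 / w) ^ m)))
           \<le> real m * (2 * (C * (1 + sqrt r) + 1)) * (2 / r) ^ m"
      proof -
        have "norm (fps_nth (fps_logderiv F) (m - 1)
            - (\<Sum>w\<in>Z r. of_nat (k w) * ((cnj w / r\<^sup>2) ^ Suc (m - 1) - (1 / w) ^ Suc (m - 1))))
           \<le> real (Suc (m - 1)) * (2 * (ln (exp (C * (1 + sqrt r))) + 1)) * (2 / r) ^ Suc (m - 1)"
          unfolding Z_def k_def by (rule entire_logderiv_coeff_estimate(3)[OF f F f0 r bnd])
        then show ?thesis unfolding X_def mm by (simp only: ln_exp)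
      qed
      moreover have "(\<Sum>w\<in>Z r. of_nat (k w) * ((cnj w / r\<^sup>2) ^ m - (1 / w) ^ m)) = Y - (\<Sum>p\<in>U r. 1 / fst p ^ m)"
        unfolding Y_def sumU[of "\<lambda>l. 1 / l ^ m"]
        by (simp add: right_diff_distrib sum_subtractf power_divide)
      moreover have "norm Y \<le> N r / r ^ m"
      proof -
        have "norm Y \<le> (\<Sum>w\<in>Z r. real (k w) * (1 / r ^ m))"
          unfolding Y_def
        proof (rule sum_norm_le)
          fix w assume "w \<in> Z r"
          then have "norm (cnj w / r\<^sup>2) \<le> 1 / r"
            using r by (simp add: Z_def norm_divide norm_mult power2_eq_square divide_simps)
          then have "norm (cnj w / r\<^sup>2) ^ m \<le> (1 / r) ^ m" by (rule power_mono) simp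
          then show "norm (of_nat (k w) * (cnj w / r\<^sup>2) ^ m) \<le> real (k w) * (1 / r ^ m)"
            unfolding norm_mult norm_power norm_of_nat power_one_over[symmetric]
            by (intro mult_left_mono) auto
        qed
        then show ?thesis by (simp add: N_def sum_divide_distrib)
      qed
      ultimately have "norm (X - (Y - (\<Sum>p\<in>U r. 1 / fst p ^ m))) + norm Y \<le> e r"
        unfolding e_def by simp
      moreover have "(\<Sum>p\<in>U r. 1 / fst p ^ m) - - X = (X - (Y - (\<Sum>p\<in>U r. 1 / fst p ^ m))) + Y" by simp
      ultimately show ?thesis
        using norm_triangle_ineq[of "X - (Y - (\<Sum>p\<in>U r. 1 / fst p ^ m))" Y] by (simp add: add.commute)
    qed
    define E where "E = (\<lambda>r. real m * (2 * (C * (1 + sqrt r) + 1)) * (2 ^ m / r) + 2 * C * (1 + sqrt (2 * r)) / r)"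
    have eE: "e r \<le> E r" if r: "r \<ge> 1" for r
    proof -
      have "r ^ 1 \<le> r ^ m" using r m by (intro power_increasing) auto
      then have "1 / r ^ m \<le> 1 / r" using r by (intro divide_left_mono) auto
      then have a: "(2 / r) ^ m \<le> 2 ^ m / r" using mult_left_mono[of "1 / r ^ m" "1/r" "2^m"]
        by (simp add: power_divide)
      have "N r / r ^ m \<le> N r / r" using N_nonneg[of r] \<open>1 / r ^ m \<le> 1 / r\<close>
        using mult_left_mono[of "1 / r ^ m" "1 / r" "N r"] by simp
      also have "\<dots> \<le> 2 * C * (1 + sqrt (2 * r)) / r" using N_le[of r] r by (intro divide_right_mono) auto
      finally show ?thesis unfolding e_def E_def
        using a C0 r by (intro add_mono mult_left_mono) auto
    qed
    have "(\<lambda>n. E (real n)) \<longlonglongrightarrow> 0" unfolding E_def by real_asymp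
    then have "(\<lambda>n. norm ((\<Sum>p\<in>U (real n). 1 / fst p ^ m) - - X)) \<longlonglongrightarrow> 0"
    proof (rule tendsto_0_le[of _ _ _ 1])
      show "\<forall>\<^sub>F n in sequentially. norm (norm ((\<Sum>p\<in>U (real n). 1 / fst p ^ m) - - X)) \<le> norm (E (real n)) * 1"
      proof (rule eventually_sequentiallyI[of 1])
        fix n :: nat assume "1 \<le> n"
        then have "norm ((\<Sum>p\<in>U (real n). 1 / fst p ^ m) - - X) \<le> E (real n)"
          using order_trans[OF est[of "real n"] eE[of "real n"]] by simp
        then show "norm (norm ((\<Sum>p\<in>U (real n). 1 / fst p ^ m) - - X)) \<le> norm (E (real n)) * 1"
          by (simp del: minus_diff_eq diff_minus_eq_add)
      qed
    qed
    then have "(\<lambda>n. (\<Sum>p\<in>U (real n). 1 / fst p ^ m) - - X) \<longlonglongrightarrow> 0"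
      by (rule tendsto_norm_zero_cancel)
    then show ?thesis unfolding X_def by (simp only: LIM_zero_iff)
  qed
  have summ1: "(\<lambda>p. 1 / norm (fst p)) summable_on S"
  proof (rule nonneg_bdd_above_summable_on)
    define B where "B = (\<lambda>j::nat. 2 * C * (1 + 2 * sqrt 2 ^ j) / 2 ^ j)"
    have Bs: "summable B"
    proof -
      have "summable (\<lambda>j. (2 * C) * (1/2) ^ j + (4 * C) * (sqrt 2 / 2) ^ j)"
        by (intro summable_add summable_mult summable_geometric) (auto simp: real_less_lsqrt)
      moreover have "(\<lambda>j. (2 * C) * (1/2) ^ j + (4 * C) * (sqrt 2 / 2) ^ j) = B"
        by (auto simp: B_def fun_eq_iff power_divide add_divide_distrib distrib_left distrib_right)
      ultimately show ?thesis by simp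
    qed
    have B0: "B j \<ge> 0" for j using C0 by (auto simp: B_def)
    define D where "D = (\<Sum>p\<in>U 1. 1 / norm (fst p))"
    have step: "(\<Sum>p\<in>U (2 ^ K). 1 / norm (fst p)) \<le> D + (\<Sum>j<K. B j)" for K :: nat
    proof (induction K)
      case (Suc K)
      have "(2::real) ^ K \<le> 2 ^ Suc K" by simp
      then have "norm (fst p) < 2 ^ Suc K" if "p \<in> U (2 ^ K)" for p
        using that unfolding U_def mem_Collect_eq mem_ball_0 by linarith
      then have sub: "U (2 ^ K) \<subseteq> U (2 ^ Suc K)" unfolding U_def by auto
      have "(\<Sum>p\<in>U (2 ^ Suc K). 1 / norm (fst p)) = (\<Sum>p\<in>U (2 ^ K). 1 / norm (fst p)) + (\<Sum>p\<in>U (2 ^ Suc K) - U (2 ^ K). 1 / norm (fst p))"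
        using sum.subset_diff[OF sub finU, of "\<lambda>p. 1 / norm (fst p)"] by simp
      moreover have "(\<Sum>p\<in>U (2 ^ Suc K) - U (2 ^ K). 1 / norm (fst p)) \<le> (\<Sum>p\<in>U (2 ^ Suc K) - U (2 ^ K). 1 / 2 ^ K)"
      proof (rule sum_mono)
        fix p assume "p \<in> U (2 ^ Suc K) - U (2 ^ K)"
        then have "2 ^ K \<le> norm (fst p)" by (auto simp: U_def)
        moreover have "(0::real) < 2 ^ K" by simp
        ultimately show "1 / norm (fst p) \<le> 1 / 2 ^ K" by (intro frac_le) simp_all
      qed
      moreover have "\<dots> \<le> (\<Sum>p\<in>U (2 ^ Suc K). 1 / 2 ^ K)"
        by (rule sum_mono2[OF finU]) auto
      moreover have "\<dots> = N (2 ^ Suc K) / 2 ^ K"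
        using sumU[of "\<lambda>_. 1 / 2 ^ K :: real" "2 ^ Suc K"] by (simp add: N_def sum_divide_distrib)
      moreover have "\<dots> \<le> B K"
      proof -
        have "sqrt (2 * 2 ^ Suc K) = 2 * sqrt 2 ^ K" by (simp add: real_sqrt_mult real_sqrt_power)
        then show ?thesis using N_le[of "2 ^ Suc K"] unfolding B_def by (intro divide_right_mono) auto
      qed
      ultimately show ?case using Suc by simp
    qed (simp add: D_def)
    have "sum (\<lambda>p. 1 / norm (fst p)) A \<le> D + suminf B" if A: "A \<subseteq> S" "finite A" for A
    proof -
      define b where "b = (\<Sum>p\<in>A. norm (fst p))"
      have pb: "norm (fst p) \<le> b" if "p \<in> A" for p
        unfolding b_def using A(2) that by (intro member_le_sum) auto
      obtain K :: nat where "b < 2 ^ K" using real_arch_pow[of 2 b] by auto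
      then have "A \<subseteq> U (2 ^ K)" using A pb by (force simp: U_def)
      then have "sum (\<lambda>p. 1 / norm (fst p)) A \<le> (\<Sum>p\<in>U (2 ^ K). 1 / norm (fst p))"
        by (intro sum_mono2 finU) auto
      also have "\<dots> \<le> D + (\<Sum>j<K. B j)" by (rule step)
      also have "\<dots> \<le> D + suminf B" using sum_le_suminf[OF Bs, of "{..<K}"] B0 by auto
      finally show ?thesis .
    qed
    then show "bdd_above (sum (\<lambda>p. 1 / norm (fst p)) ` {A. A \<subseteq> S \<and> finite A})"
      by (intro bdd_aboveI[of _ "D + suminf B"]) auto
  qed auto
  have "continuous (at 0) f"
    using f holomorphic_on_imp_continuous_on continuous_on_eq_continuous_at open_UNIV by blast
  then obtain \<delta> where \<delta>: "\<delta> > 0" "\<And>z. norm z < \<delta> \<Longrightarrow> f z \<noteq> 0"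
    using continuous_at_avoid[of 0 f 0] f0 by (auto simp: dist_norm)
  have "(\<lambda>p. 1 / fst p ^ m) summable_on S"
  proof (rule abs_summable_summable, rule summable_on_comparison_test)
    show "(\<lambda>p. (1 / \<delta>) ^ (m - 1) * (1 / norm (fst p))) summable_on S"
      using summ1 by (rule summable_on_cmult_right)
    fix p assume "p \<in> S"
    then have "norm (fst p) \<ge> \<delta>" using \<delta>(2)[of "fst p"] by (force simp: S_def zero_multiset_index_def)
    then have "(1 / norm (fst p)) ^ (m - 1) \<le> (1 / \<delta>) ^ (m - 1)"
      using \<delta>(1) by (intro power_mono frac_le) auto
    then have "(1 / norm (fst p)) ^ (m - 1) * (1 / norm (fst p)) \<le> (1 / \<delta>) ^ (m - 1) * (1 / norm (fst p))"
      by (intro mult_right_mono) auto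
    moreover have "(1 / norm (fst p)) ^ (m - 1) * (1 / norm (fst p)) = norm (1 / fst p ^ m)"
      using m by (cases m) (auto simp: norm_divide norm_mult norm_power power_one_over)
    ultimately show "norm (1 / fst p ^ m) \<le> (1 / \<delta>) ^ (m - 1) * (1 / norm (fst p))" by simp
  qed auto
  then obtain s where s: "((\<lambda>p. 1 / fst p ^ m) has_sum s) S" by (auto simp: summable_on_def)
  have "filterlim (\<lambda>n. U (real n)) (finite_subsets_at_top S) sequentially"
    unfolding filterlim_finite_subsets_at_top
  proof (intro allI impI)
    fix A assume A: "finite A \<and> A \<subseteq> S"
    define b where "b = (\<Sum>p\<in>A. norm (fst p))"
    have pb: "norm (fst p) \<le> b" if "p \<in> A" for p
      unfolding b_def using A that by (intro member_le_sum) auto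
    have "eventually (\<lambda>n. b < real n) sequentially" by real_asymp
    then show "\<forall>\<^sub>F n in sequentially. finite (U (real n)) \<and> A \<subseteq> U (real n) \<and> U (real n) \<subseteq> S"
      by eventually_elim (use A pb finU in \<open>force simp: U_def\<close>)
  qed
  then have "(\<lambda>n. \<Sum>p\<in>U (real n). 1 / fst p ^ m) \<longlonglongrightarrow> s"
    using s unfolding has_sum_def by (rule filterlim_compose[rotated])
  then have "s = - fps_nth (fps_logderiv F) (m - 1)" using sum_lim LIMSEQ_unique by blast
  then show ?thesis using s by (simp add: S_def case_prod_unfold)
qed

section \<open>Logarithmic derivatives of determinants of power series\<close>

lemma index_mult_mat_sum:
  assumes "A \<in> carrier_mat n k" "B \<in> carrier_mat k l" "i < n" "j < l"
  shows "(A * B) $$ (i, j) = (\<Sum>q<k. A $$ (i, q) * B $$ (q, j))"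
  using assms by (auto simp: scalar_prod_def atLeast0LessThan intro!: sum.cong)

lemma index_mult_mat_vec_sum:
  assumes "A \<in> carrier_mat n k" "v \<in> carrier_vec k" "i < n"
  shows "(A *\<^sub>v v) $ i = (\<Sum>q<k. A $$ (i, q) * v $ q)"
  using assms by (auto simp: scalar_prod_def atLeast0LessThan intro!: sum.cong)

lemma trace_mat_add:
  assumes "A \<in> carrier_mat n n" "B \<in> carrier_mat n n"
  shows "trace_mat (A + B) = trace_mat A + trace_mat (B :: 'a :: comm_monoid_add mat)"
  using assms by (auto simp: trace_mat_def sum.distrib)

lemma trace_mat_comm:
  assumes "A \<in> carrier_mat n n" "B \<in> carrier_mat n n"
  shows "trace_mat (A * B) = trace_mat (B * (A :: 'a :: comm_semiring_0 mat))"
proof -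
  have "trace_mat (A * B) = (\<Sum>i<n. \<Sum>q<n. A $$ (i, q) * B $$ (q, i))"
    using assms by (auto simp: trace_mat_def index_mult_mat_sum[OF assms] simp del: index_mult_mat(1))
  also have "\<dots> = (\<Sum>q<n. \<Sum>i<n. A $$ (i, q) * B $$ (q, i))" by (rule sum.swap)
  also have "\<dots> = trace_mat (B * A)"
    using assms by (auto simp: trace_mat_def index_mult_mat_sum[OF assms(2,1)] mult.commute simp del: index_mult_mat(1))
  finally show ?thesis .
qed

abbreviation D_fps :: "complex fps mat \<Rightarrow> complex fps mat" where
  "D_fps \<equiv> map_mat fps_deriv"

lemma fps_deriv_prod:
  "finite A \<Longrightarrow> fps_deriv (\<Prod>i\<in>A. f i) = (\<Sum>k\<in>A. fps_deriv (f k) * (\<Prod>i\<in>A - {k}. f i :: complex fps))"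
proof (induction A rule: finite_induct)
  case (insert x A)
  have "(\<Sum>k\<in>A. fps_deriv (f k) * prod f (insert x A - {k})) = (\<Sum>k\<in>A. f x * (fps_deriv (f k) * prod f (A - {k})))"
  proof (rule sum.cong[OF refl])
    fix k assume k: "k \<in> A"
    then have "insert x A - {k} = insert x (A - {k})" using insert.hyps by auto
    then show "fps_deriv (f k) * prod f (insert x A - {k}) = f x * (fps_deriv (f k) * prod f (A - {k}))"
      using insert.hyps by (simp add: mult_ac)
  qed
  then show ?case using insert by (simp add: sum_distrib_left mult_ac)
qed simp

text \<open>Jacobi's formula. Differentiating the product in each permutation term row by row leaves the Laplace expansion along the row that is differentiated.\<close>
lemma fps_deriv_det:
  fixes A :: "complex fps mat"
  assumes A: "A \<in> carrier_mat n n"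
  shows "fps_deriv (det A) = trace_mat (adj_mat A * D_fps A)"
proof -
  define Ak where "Ak = (\<lambda>k. mat n n (\<lambda>(i, j). if i = k then fps_deriv (A $$ (i, j)) else A $$ (i, j)))"
  let ?P = "{p. p permutes {0..<n}}"
  have Akc: "Ak k \<in> carrier_mat n n" for k by (simp add: Ak_def)
  have sg: "fps_deriv (signof p * F) = signof p * fps_deriv F" for p :: "nat \<Rightarrow> nat" and F :: "complex fps"
    by (simp add: sign_def)
  have "fps_deriv (det A) = (\<Sum>p\<in>?P. signof p * (\<Sum>k\<in>{0..<n}. fps_deriv (A $$ (k, p k)) * (\<Prod>i\<in>{0..<n} - {k}. A $$ (i, p i))))"
    unfolding det_def'[OF A] fps_deriv_sum sg by (simp add: fps_deriv_prod)
  also have "\<dots> = (\<Sum>p\<in>?P. \<Sum>k\<in>{0..<n}. signof p * (\<Prod>i = 0..<n. Ak k $$ (i, p i)))"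
    unfolding sum_distrib_left
  proof (intro sum.cong refl)
    fix p k assume p: "p \<in> ?P" and k: "k \<in> {0..<n}"
    have pb: "p i < n" if "i < n" for i using p that permutes_in_image[of p "{0..<n}" i] by auto
    have "(\<Prod>i = 0..<n. Ak k $$ (i, p i)) = Ak k $$ (k, p k) * (\<Prod>i\<in>{0..<n} - {k}. Ak k $$ (i, p i))"
      using k by (subst prod.remove[of _ k]) auto
    also have "\<dots> = fps_deriv (A $$ (k, p k)) * (\<Prod>i\<in>{0..<n} - {k}. A $$ (i, p i))"
      using k pb by (intro arg_cong2[of _ _ _ _ "(*)"] prod.cong) (auto simp: Ak_def)
    finally show "signof p * (fps_deriv (A $$ (k, p k)) * (\<Prod>i\<in>{0..<n} - {k}. A $$ (i, p i)))
       = signof p * (\<Prod>i = 0..<n. Ak k $$ (i, p i))" by simp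
  qed
  also have "\<dots> = (\<Sum>k\<in>{0..<n}. det (Ak k))"
    unfolding det_def'[OF Akc] by (rule sum.swap)
  also have "\<dots> = (\<Sum>k<n. \<Sum>j<n. cofactor A k j * fps_deriv (A $$ (k, j)))"
    unfolding atLeast0LessThan
  proof (rule sum.cong[OF refl])
    fix k assume k: "k \<in> {..<n}"
    have "mat_delete (Ak k) k j = mat_delete A k j" for j
      using A by (intro eq_matI) (auto simp: mat_delete_def Ak_def)
    then have "cofactor (Ak k) k j = cofactor A k j" for j by (simp add: cofactor_def)
    then show "det (Ak k) = (\<Sum>j<n. cofactor A k j * fps_deriv (A $$ (k, j)))"
      using k by (subst laplace_expansion_row[OF Akc, of k]) (auto simp: Ak_def mult.commute intro!: sum.cong)
  qed
  also have "\<dots> = (\<Sum>j<n. \<Sum>k<n. cofactor A k j * fps_deriv (A $$ (k, j)))" by (rule sum.swap)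
  also have "\<dots> = trace_mat (adj_mat A * D_fps A)"
  proof -
    have "(adj_mat A * D_fps A) $$ (j, j) = (\<Sum>k<n. cofactor A k j * fps_deriv (A $$ (k, j)))" if "j < n" for j
      using that A by (subst index_mult_mat_sum[of _ n n _ n]) (auto simp: adj_mat_def intro!: sum.cong)
    moreover have "dim_row (adj_mat A * D_fps A) = n" using A by (simp add: adj_mat_def)
    ultimately show ?thesis unfolding trace_mat_def by simp
  qed
  finally show ?thesis .
qed

lemma D_fps_mult:
  assumes "A \<in> carrier_mat n n" "B \<in> carrier_mat n n"
  shows "D_fps (A * B) = D_fps A * B + A * D_fps B"
proof (rule eq_matI)
  fix i j assume "i < dim_row (D_fps A * B + A * D_fps B)" "j < dim_col (D_fps A * B + A * D_fps B)"
  then have ij: "i < n" "j < n" using assms by auto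
  have "D_fps (A * B) $$ (i, j) = (\<Sum>q<n. fps_deriv (A $$ (i, q) * B $$ (q, j)))"
    using ij assms by (simp add: index_mult_mat_sum[OF assms] fps_deriv_sum del: index_mult_mat(1))
  also have "\<dots> = (D_fps A * B) $$ (i, j) + (A * D_fps B) $$ (i, j)"
  proof -
    have "D_fps A \<in> carrier_mat n n" "D_fps B \<in> carrier_mat n n" using assms by auto
    then have e: "(D_fps A * B) $$ (i, j) = (\<Sum>q<n. D_fps A $$ (i, q) * B $$ (q, j))"
      "(A * D_fps B) $$ (i, j) = (\<Sum>q<n. A $$ (i, q) * D_fps B $$ (q, j))"
      using index_mult_mat_sum assms ij by blast+
    show ?thesis unfolding e sum.distrib[symmetric]
      using ij assms by (intro sum.cong) (auto simp: add.commute)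
  qed
  finally show "D_fps (A * B) $$ (i, j) = (D_fps A * B + A * D_fps B) $$ (i, j)"
    using ij assms by simp
qed (use assms in auto)

lemma pow_mat_Suc_left:
  assumes "A \<in> carrier_mat n n"
  shows "A ^\<^sub>m Suc k = A * A ^\<^sub>m k"
proof (induction k)
  case (Suc k)
  have "A ^\<^sub>m Suc (Suc k) = (A * A ^\<^sub>m k) * A" unfolding pow_mat.simps(2)[of A "Suc k"] Suc ..
  also have "\<dots> = A * (A ^\<^sub>m k * A)" using assms by (intro assoc_mult_mat) auto
  finally show ?case by simp
qed (use assms in auto)

lemma pow_mat_add:
  assumes "A \<in> carrier_mat n n"
  shows "A ^\<^sub>m k * A ^\<^sub>m l = A ^\<^sub>m (k + l)"
proof (induction l)
  case (Suc l)
  have "A ^\<^sub>m k * A ^\<^sub>m Suc l = (A ^\<^sub>m k * A ^\<^sub>m l) * A" using assms by (simp add: assoc_mult_mat[of _ n n _ n _ n])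
  then show ?case using Suc by simp
qed (use assms in auto)

lemma fps_deriv_trace_mat: "dim_row A = dim_col A \<Longrightarrow> fps_deriv (trace_mat A) = trace_mat (D_fps A)"
  by (simp add: trace_mat_def fps_deriv_sum)

lemma trace_D_fps_pow:
  assumes N: "N \<in> carrier_mat n n"
  shows "trace_mat (D_fps (N ^\<^sub>m Suc k) * N ^\<^sub>m l) = of_nat (Suc k) * trace_mat (N ^\<^sub>m (k + l) * D_fps N)"
proof (induction k arbitrary: l)
  case 0
  then show ?case using N trace_mat_comm[of "D_fps N" n "N ^\<^sub>m l"] by simp
next
  case (Suc k)
  have DN: "D_fps N \<in> carrier_mat n n" using N by auto
  have Np: "N ^\<^sub>m j \<in> carrier_mat n n" for j using N by simp
  have DNp: "D_fps (N ^\<^sub>m j) \<in> carrier_mat n n" for j using Np by auto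
  have "D_fps (N ^\<^sub>m Suc (Suc k)) * N ^\<^sub>m l = (D_fps (N ^\<^sub>m Suc k) * N + N ^\<^sub>m Suc k * D_fps N) * N ^\<^sub>m l"
    using D_fps_mult[OF Np N, of "Suc k"] by simp
  also have "\<dots> = D_fps (N ^\<^sub>m Suc k) * N * N ^\<^sub>m l + N ^\<^sub>m Suc k * D_fps N * N ^\<^sub>m l"
    using N DN Np DNp by (intro add_mult_distrib_mat[of _ n n _ _ n]) (auto intro!: mult_carrier_mat)
  also have "D_fps (N ^\<^sub>m Suc k) * N * N ^\<^sub>m l = D_fps (N ^\<^sub>m Suc k) * N ^\<^sub>m Suc l"
    unfolding pow_mat_Suc_left[OF N, of l] by (rule assoc_mult_mat[OF DNp N Np])
  finally have "trace_mat (D_fps (N ^\<^sub>m Suc (Suc k)) * N ^\<^sub>m l) =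
     trace_mat (D_fps (N ^\<^sub>m Suc k) * N ^\<^sub>m Suc l) + trace_mat (N ^\<^sub>m Suc k * D_fps N * N ^\<^sub>m l)"
    using trace_mat_add[of "D_fps (N ^\<^sub>m Suc k) * N ^\<^sub>m Suc l" n "N ^\<^sub>m Suc k * D_fps N * N ^\<^sub>m l"]
      mult_carrier_mat[OF DNp Np] mult_carrier_mat[OF mult_carrier_mat[OF Np DN] Np] by presburger
  also have "trace_mat (N ^\<^sub>m Suc k * D_fps N * N ^\<^sub>m l) = trace_mat (N ^\<^sub>m l * (N ^\<^sub>m Suc k * D_fps N))"
    by (rule trace_mat_comm[OF mult_carrier_mat[OF Np DN] Np])
  also have "N ^\<^sub>m l * (N ^\<^sub>m Suc k * D_fps N) = N ^\<^sub>m (Suc k + l) * D_fps N"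
    unfolding assoc_mult_mat[OF Np Np DN, symmetric] pow_mat_add[OF N] by (simp only: add.commute)
  finally have "trace_mat (D_fps (N ^\<^sub>m Suc (Suc k)) * N ^\<^sub>m l) =
     of_nat (Suc k) * trace_mat (N ^\<^sub>m (k + Suc l) * D_fps N) + trace_mat (N ^\<^sub>m (Suc k + l) * D_fps N)"
    unfolding Suc.IH .
  moreover have "k + Suc l = Suc k + l" by simp
  ultimately show ?case by (simp only: of_nat_Suc distrib_right mult_1 add.commute add.left_commute)
qed

lemma fps_nth_pow_mat_less:
  fixes N :: "complex fps mat"
  assumes N: "N \<in> carrier_mat n n" and N0: "\<And>i j. i < n \<Longrightarrow> j < n \<Longrightarrow> fps_nth (N $$ (i, j)) 0 = 0"
    and ij: "i < n" "j < n" and "a < k"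
  shows "fps_nth ((N ^\<^sub>m k) $$ (i, j)) a = 0"
  using ij \<open>a < k\<close>
proof (induction k arbitrary: a i j)
  case (Suc k)
  have "fps_nth ((N ^\<^sub>m Suc k) $$ (i, j)) a = (\<Sum>q<n. \<Sum>b=0..a. fps_nth ((N ^\<^sub>m k) $$ (i, q)) b * fps_nth (N $$ (q, j)) (a - b))"
    using Suc.prems N by (simp add: index_mult_mat_sum[of _ n n _ n] fps_sum_nth fps_mult_nth del: index_mult_mat(1))
  also have "\<dots> = 0"
  proof (intro sum.neutral ballI)
    fix q b assume qb: "q \<in> {..<n}" "b \<in> {0..a}"
    show "fps_nth ((N ^\<^sub>m k) $$ (i, q)) b * fps_nth (N $$ (q, j)) (a - b) = 0"
    proof (cases "b < k")
      case True then show ?thesis using Suc qb by auto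
    next
      case False
      then have "a - b = 0" using Suc.prems qb by auto
      then show ?thesis using N0 qb Suc.prems by auto
    qed
  qed
  finally show ?case .
qed simp

text \<open>By Jacobi's formula the logarithmic derivative is the trace of \<open>(I + N)\<^sup>-\<^sup>1 N'\<close>. Iterating
  \<open>B = I - N B\<close> for the inverse \<open>B\<close> expands it into a Neumann series, which may be cut off after
  order \<open>m\<close> because \<open>N\<close> has no constant term; cyclicity of the trace turns \<open>N\<^sup>k N'\<close> into the
  derivative of \<open>N\<^bsup>k+1\<^esup> / (k + 1)\<close>.\<close>

lemma fps_logderiv_det_eq_sum_traces:
  fixes N :: "complex fps mat"
  assumes N: "N \<in> carrier_mat n n" and N0: "\<And>i j. i < n \<Longrightarrow> j < n \<Longrightarrow> fps_nth (N $$ (i, j)) 0 = 0"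
    and m: "m > 0"
  shows "fps_nth (fps_logderiv (det (1\<^sub>m n + N))) (m - 1) =
    - (of_nat m * (\<Sum>k=1..m. (-1) ^ k / of_nat k * fps_nth (trace_mat (N ^\<^sub>m k)) m))"
proof -
  let ?A = "1\<^sub>m n + N"
  have A: "?A \<in> carrier_mat n n" using N by auto
  have Np: "N ^\<^sub>m j \<in> carrier_mat n n" for j using N by simp
  have DN: "D_fps N \<in> carrier_mat n n" using N by auto
  interpret h: comm_ring_hom "\<lambda>F :: complex fps. fps_nth F 0"
    by unfold_locales auto
  have det0: "fps_nth (det ?A) 0 = 1"
  proof -
    have "map_mat (\<lambda>F. fps_nth F 0) ?A = 1\<^sub>m n"
      using N N0 by (intro eq_matI) auto
    then have "det (map_mat (\<lambda>F. fps_nth F 0) ?A) = 1" by simp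
    then show ?thesis by (simp only: h.hom_det)
  qed
  define B where "B = inverse (det ?A) \<cdot>\<^sub>m adj_mat ?A"
  have B: "B \<in> carrier_mat n n" using adj_mat(1)[OF A] by (simp add: B_def)
  have inv: "inverse (det ?A) * det ?A = 1" using det0 by (simp add: inverse_mult_eq_1)
  have "?A * B = inverse (det ?A) \<cdot>\<^sub>m (det ?A \<cdot>\<^sub>m 1\<^sub>m n)"
    unfolding B_def mult_smult_distrib[OF A adj_mat(1)[OF A]] adj_mat(2)[OF A] ..
  also have "\<dots> = 1\<^sub>m n" by (intro eq_matI) (auto simp: inv mult.assoc[symmetric])
  finally have AB: "?A * B = 1\<^sub>m n" .
  have Beq: "B = 1\<^sub>m n - N * B"
  proof -
    have "1\<^sub>m n = 1\<^sub>m n * B + N * B"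
      using AB add_mult_distrib_mat[of "1\<^sub>m n" n n N B n] N B by simp
    then have "1\<^sub>m n = B + N * B" using B by simp
    then have "(1\<^sub>m n :: complex fps mat) $$ (i, j) = (B + N * B) $$ (i, j)" for i j by simp
    then show ?thesis using B N
      by (intro eq_matI) (simp_all del: index_mult_mat(1) index_one_mat(1))
  qed
  have DA: "D_fps ?A = D_fps N" using N by (intro eq_matI) auto
  have L: "fps_logderiv (det ?A) = trace_mat (B * D_fps N)"
  proof -
    have "B * D_fps N = inverse (det ?A) \<cdot>\<^sub>m (adj_mat ?A * D_fps N)"
      unfolding B_def using adj_mat(1)[OF A] DN by (intro mult_smult_assoc_mat)
    then have "trace_mat (B * D_fps N) = inverse (det ?A) * trace_mat (adj_mat ?A * D_fps N)"
      using adj_mat(1)[OF A] DN by (simp add: trace_mat_def sum_distrib_left)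
    then show ?thesis unfolding fps_logderiv_def fps_deriv_det[OF A] DA by (simp add: mult.commute)
  qed
  have neumann: "trace_mat (B * D_fps N) = (\<Sum>k<l. (-1) ^ k * trace_mat (N ^\<^sub>m k * D_fps N))
      + (-1) ^ l * trace_mat (N ^\<^sub>m l * B * D_fps N)" for l
  proof (induction l)
    case 0
    then show ?case using N B by simp
  next
    case (Suc l)
    have "N ^\<^sub>m l * B = N ^\<^sub>m l * 1\<^sub>m n - N ^\<^sub>m l * (N * B)"
      by (subst Beq, rule mult_minus_distrib_mat[OF Np]) (use N B in auto)
    also have "N ^\<^sub>m l * (N * B) = N ^\<^sub>m Suc l * B" using assoc_mult_mat[OF Np N B] by simp
    finally have "N ^\<^sub>m l * B * D_fps N = N ^\<^sub>m l * D_fps N - N ^\<^sub>m Suc l * B * D_fps N"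
      using minus_mult_distrib_mat[OF Np mult_carrier_mat[OF Np B] DN, of l "Suc l"] right_mult_one_mat[OF Np] by simp
    then have tr: "trace_mat (N ^\<^sub>m l * B * D_fps N) = trace_mat (N ^\<^sub>m l * D_fps N) - trace_mat (N ^\<^sub>m Suc l * B * D_fps N)"
      using mult_carrier_mat[OF Np DN] mult_carrier_mat[OF mult_carrier_mat[OF Np B] DN] N
      by (simp add: trace_mat_def sum_subtractf del: pow_mat.simps index_mult_mat(1))
    show ?case unfolding Suc.IH tr by (simp add: right_diff_distrib del: pow_mat.simps)
  qed
  have rest: "fps_nth (trace_mat (N ^\<^sub>m m * B * D_fps N)) (m - 1) = 0"
  proof -
    have "fps_nth ((N ^\<^sub>m m * (B * D_fps N)) $$ (i, i)) (m - 1) = 0" if i: "i < n" for i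
    proof -
      have "(N ^\<^sub>m m * (B * D_fps N)) $$ (i, i) = (\<Sum>q<n. (N ^\<^sub>m m) $$ (i, q) * (B * D_fps N) $$ (q, i))"
        by (rule index_mult_mat_sum[OF Np mult_carrier_mat[OF B DN] i i])
      moreover have "fps_nth ((N ^\<^sub>m m) $$ (i, q) * (B * D_fps N) $$ (q, i)) (m - 1) = 0" if "q < n" for q
        unfolding fps_mult_nth
        by (rule sum.neutral) (use fps_nth_pow_mat_less[OF N N0 i that, of _ m] m in auto)
      ultimately show ?thesis by (simp add: fps_sum_nth del: index_mult_mat(1))
    qed
    moreover have "N ^\<^sub>m m * B * D_fps N = N ^\<^sub>m m * (B * D_fps N)" using assoc_mult_mat[OF Np B DN] .
    ultimately show ?thesis using N by (simp add: trace_mat_def fps_sum_nth del: index_mult_mat(1))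
  qed
  have trm: "fps_nth (trace_mat (N ^\<^sub>m k * D_fps N)) (m - 1) = of_nat m / of_nat (Suc k) * fps_nth (trace_mat (N ^\<^sub>m Suc k)) m" for k
  proof -
    have "fps_deriv (trace_mat (N ^\<^sub>m Suc k)) = of_nat (Suc k) * trace_mat (N ^\<^sub>m k * D_fps N)"
      using trace_D_fps_pow[OF N, of k 0] fps_deriv_trace_mat[of "N ^\<^sub>m Suc k"] Np[of "Suc k"] N
        right_mult_one_mat[of "D_fps (N ^\<^sub>m Suc k)" n n] by (simp del: of_nat_Suc)
    then have "fps_nth (fps_deriv (trace_mat (N ^\<^sub>m Suc k))) (m - 1)
        = of_nat (Suc k) * fps_nth (trace_mat (N ^\<^sub>m k * D_fps N)) (m - 1)"
      unfolding fps_of_nat[symmetric] by (simp only: fps_mult_left_const_nth)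
    moreover have "Suc (m - 1) = m" using m by simp
    ultimately have "of_nat m * fps_nth (trace_mat (N ^\<^sub>m Suc k)) m
        = of_nat (Suc k) * fps_nth (trace_mat (N ^\<^sub>m k * D_fps N)) (m - 1)"
      by (simp only: fps_deriv_nth Suc_eq_plus1[symmetric])
    then show ?thesis by (simp add: field_simps del: of_nat_Suc pow_mat.simps)
  qed
  have c1: "(-1 :: complex fps) ^ k = fps_const ((-1) ^ k)" for k
    by (simp flip: fps_const_power fps_const_neg)
  have "fps_nth (fps_logderiv (det ?A)) (m - 1) = (\<Sum>k<m. (-1) ^ k * (of_nat m / of_nat (Suc k) * fps_nth (trace_mat (N ^\<^sub>m Suc k)) m))"
    unfolding L neumann[of m] fps_add_nth fps_sum_nth c1 fps_mult_left_const_nth rest trm by simp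
  also have "\<dots> = (\<Sum>k=1..m. (-1) ^ (k - 1) * (of_nat m / of_nat k * fps_nth (trace_mat (N ^\<^sub>m k)) m))"
    by (rule sum.reindex_bij_witness[of _ "\<lambda>k. k - 1" Suc]) auto
  also have "\<dots> = - (of_nat m * (\<Sum>k=1..m. (-1) ^ k / of_nat k * fps_nth (trace_mat (N ^\<^sub>m k)) m))"
    unfolding sum_distrib_left sum_negf[symmetric]
  proof (rule sum.cong[OF refl])
    fix k assume "k \<in> {1..m}"
    then obtain l where "k = Suc l" by (cases k) auto
    then show "(-1) ^ (k - 1) * (of_nat m / of_nat k * fps_nth (trace_mat (N ^\<^sub>m k)) m) =
      - (of_nat m * ((-1) ^ k / of_nat k * fps_nth (trace_mat (N ^\<^sub>m k)) m))"
      by (simp del: of_nat_Suc pow_mat.simps)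
  qed
  finally show ?thesis .
qed

lemma finite_compositions: "finite (compositions m k)"
proof (rule finite_subset)
  show "compositions m k \<subseteq> {js. set js \<subseteq> {0..m} \<and> length js = k}"
    unfolding compositions_def using member_le_sum_list by fastforce
qed (rule finite_lists_length_eq, simp)

lemma compositions_Suc: "compositions m (Suc k) = (\<Union>j\<in>{1..m}. (#) j ` compositions (m - j) k)"
proof (intro equalityI subsetI)
  fix js assume "js \<in> compositions m (Suc k)"
  then obtain j ks where "js = j # ks" "length ks = k" "\<forall>j\<in>set ks. 0 < j" "0 < j" "j + sum_list ks = m"
    by (auto simp: compositions_def length_Suc_conv)
  then show "js \<in> (\<Union>j\<in>{1..m}. (#) j ` compositions (m - j) k)"
    by (auto simp: compositions_def intro!: bexI[of _ j])
qed (auto simp: compositions_def)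

lemma prod_mats_carrier:
  assumes "\<And>j. G j \<in> carrier_mat n n"
  shows "prod_mats n (map G js) \<in> carrier_mat n n"
  by (induction js) (auto simp: prod_mats_def intro!: mult_carrier_mat assms)

text \<open>Splitting off the order of the first factor matches the recursion of compositions by their
  first part.\<close>

lemma fps_nth_pow_mat_compositions:
  fixes G :: "nat \<Rightarrow> complex mat"
  assumes G: "\<And>k. G k \<in> carrier_mat n n" and ij: "i < n" "j < n"
  defines "N \<equiv> mat n n (\<lambda>(i, j). Abs_fps (\<lambda>k. if k = 0 then 0 else G k $$ (i, j)))"
  shows "fps_nth ((N ^\<^sub>m k) $$ (i, j)) m = (\<Sum>js\<in>compositions m k. prod_mats n (map G js) $$ (i, j))"
  using ij
proof (induction k arbitrary: m i)
  case 0
  have "compositions m 0 = (if m = 0 then {[]} else {})" by (auto simp: compositions_def)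
  then show ?case using 0 by (simp add: prod_mats_def N_def)
next
  case (Suc k)
  have N: "N \<in> carrier_mat n n" by (simp add: N_def)
  have Np: "N ^\<^sub>m k \<in> carrier_mat n n" using N by simp
  have PM: "prod_mats n (map G js) \<in> carrier_mat n n" for js using prod_mats_carrier[of G n js] G by blast
  have "fps_nth ((N ^\<^sub>m Suc k) $$ (i, j)) m = (\<Sum>q<n. \<Sum>a=0..m. fps_nth (N $$ (i, q)) a * fps_nth ((N ^\<^sub>m k) $$ (q, j)) (m - a))"
    unfolding pow_mat_Suc_left[OF N] index_mult_mat_sum[OF N Np Suc.prems] fps_sum_nth fps_mult_nth ..
  also have "\<dots> = (\<Sum>q<n. \<Sum>a=1..m. G a $$ (i, q) * (\<Sum>js\<in>compositions (m - a) k. prod_mats n (map G js) $$ (q, j)))"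
  proof (rule sum.cong[OF refl])
    fix q assume q: "q \<in> {..<n}"
    have "(\<Sum>a=0..m. fps_nth (N $$ (i, q)) a * fps_nth ((N ^\<^sub>m k) $$ (q, j)) (m - a))
      = (\<Sum>a=1..m. fps_nth (N $$ (i, q)) a * fps_nth ((N ^\<^sub>m k) $$ (q, j)) (m - a))"
      using q Suc.prems by (intro sum.mono_neutral_right) (auto simp: N_def)
    also have "\<dots> = (\<Sum>a=1..m. G a $$ (i, q) * (\<Sum>js\<in>compositions (m - a) k. prod_mats n (map G js) $$ (q, j)))"
      using q Suc by (intro sum.cong refl arg_cong2[of _ _ _ _ "(*)"]) (auto simp: N_def)
    finally show "(\<Sum>a=0..m. fps_nth (N $$ (i, q)) a * fps_nth ((N ^\<^sub>m k) $$ (q, j)) (m - a)) = \<dots>" .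
  qed
  also have "\<dots> = (\<Sum>a=1..m. \<Sum>q<n. G a $$ (i, q) * (\<Sum>js\<in>compositions (m - a) k. prod_mats n (map G js) $$ (q, j)))"
    by (rule sum.swap)
  also have "\<dots> = (\<Sum>a=1..m. \<Sum>js\<in>compositions (m - a) k. prod_mats n (map G (a # js)) $$ (i, j))"
  proof (rule sum.cong[OF refl])
    fix a assume "a \<in> {1..m}"
    have "prod_mats n (map G (a # js)) $$ (i, j) = (\<Sum>q<n. G a $$ (i, q) * prod_mats n (map G js) $$ (q, j))" for js
      using index_mult_mat_sum[OF G PM Suc.prems] by (simp add: prod_mats_def)
    then show "(\<Sum>q<n. G a $$ (i, q) * (\<Sum>js\<in>compositions (m - a) k. prod_mats n (map G js) $$ (q, j)))
       = (\<Sum>js\<in>compositions (m - a) k. prod_mats n (map G (a # js)) $$ (i, j))"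
      unfolding sum_distrib_left by (simp only: sum.swap[of _ "{..<n}"])
  qed
  also have "\<dots> = (\<Sum>js\<in>compositions m (Suc k). prod_mats n (map G js) $$ (i, j))"
    unfolding compositions_Suc
    by (subst sum.UNION_disjoint) (auto simp: finite_compositions sum.reindex o_def)
  finally show ?case .
qed

lemma fps_logderiv_det_compositions:
  fixes G :: "nat \<Rightarrow> complex mat"
  assumes G: "\<And>k. G k \<in> carrier_mat n n" and m: "m > 0"
  defines "N \<equiv> mat n n (\<lambda>(i, j). Abs_fps (\<lambda>k. if k = 0 then 0 else G k $$ (i, j)))"
  shows "fps_nth (fps_logderiv (det (1\<^sub>m n + N))) (m - 1) =
    - (of_nat m * (\<Sum>k=1..m. (-1) ^ k / of_nat k * (\<Sum>js\<in>compositions m k. trace_mat (prod_mats n (map G js)))))"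
proof -
  have N: "N \<in> carrier_mat n n" by (simp add: N_def)
  have "dim_row (prod_mats n (map G js)) = n" for js using prod_mats_carrier[of G n js] G by auto
  then have "fps_nth (trace_mat (N ^\<^sub>m k)) m = (\<Sum>js\<in>compositions m k. trace_mat (prod_mats n (map G js)))" for k
    unfolding trace_mat_def fps_sum_nth N_def
    using fps_nth_pow_mat_compositions[OF G] by (simp add: sum.swap[of _ "{..<n}"])
  then show ?thesis
    by (subst fps_logderiv_det_eq_sum_traces[OF N _ m]) (auto simp: N_def)
qed

section \<open>Power series matrices acting on inverse polynomials\<close>

definition fin_supp :: "(nat \<Rightarrow> complex) \<Rightarrow> bool" where
  "fin_supp f \<longleftrightarrow> (\<exists>K. \<forall>j\<ge>K. f j = 0)"

text \<open>The sequence \<open>f\<close> stands for the polynomial \<open>\<Sum>\<^sub>j f j X\<^bsup>-j\<^esup>\<close> in \<open>X\<^sup>-\<^sup>1\<close>, on which \<open>a\<close> acts by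
  multiplication followed by dropping the positive powers of \<open>X\<close>. The index set of the sum is
  finite for finitely supported \<open>f\<close>.\<close>

definition fps_act :: "complex fps \<Rightarrow> (nat \<Rightarrow> complex) \<Rightarrow> nat \<Rightarrow> complex" where
  "fps_act a f j = (\<Sum>i | f (j + i) \<noteq> 0. fps_nth a i * f (j + i))"

lemma fps_act_eq:
  assumes "\<And>j. j \<ge> K \<Longrightarrow> f j = 0"
  shows "fps_act a f j = (\<Sum>i<K. fps_nth a i * f (j + i))"
  unfolding fps_act_def
proof (rule sum.mono_neutral_left)
  show "{i. f (j + i) \<noteq> 0} \<subseteq> {..<K}"
  proof
    fix i assume "i \<in> {i. f (j + i) \<noteq> 0}"
    then have "\<not> K \<le> j + i" using assms by auto
    then show "i \<in> {..<K}" by simp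
  qed
qed auto

lemma fin_supp_bound2:
  assumes "fin_supp f" "fin_supp g"
  obtains K where "\<And>j. j \<ge> K \<Longrightarrow> f j = 0" "\<And>j. j \<ge> K \<Longrightarrow> g j = 0"
proof -
  obtain K1 K2 where "\<forall>j\<ge>K1. f j = 0" "\<forall>j\<ge>K2. g j = 0" using assms by (auto simp: fin_supp_def)
  then show ?thesis by (intro that[of "max K1 K2"]) auto
qed

lemma fin_supp_add: "fin_supp f \<Longrightarrow> fin_supp g \<Longrightarrow> fin_supp (\<lambda>j. f j + g j)"
proof -
  assume "fin_supp f" "fin_supp g"
  then obtain K where "\<And>j. j \<ge> K \<Longrightarrow> f j = 0" "\<And>j. j \<ge> K \<Longrightarrow> g j = 0"
    using fin_supp_bound2 by blast
  then have "\<forall>j\<ge>K. f j + g j = 0" by simp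
  then show ?thesis unfolding fin_supp_def ..
qed

lemma fin_supp_cmult: "fin_supp f \<Longrightarrow> fin_supp (\<lambda>j. x * f j)"
  by (auto simp: fin_supp_def)

lemma fin_supp_0: "fin_supp (\<lambda>j. 0)"
  by (auto simp: fin_supp_def)

lemma fin_supp_sum: "(\<And>x. x \<in> A \<Longrightarrow> fin_supp (f x)) \<Longrightarrow> fin_supp (\<lambda>j. \<Sum>x\<in>A. f x j)"
  by (induction A rule: infinite_finite_induct) (auto intro: fin_supp_add fin_supp_0)

lemma fin_supp_act: assumes "fin_supp f" shows "fin_supp (fps_act a f)"
proof -
  obtain K where K: "\<And>j. j \<ge> K \<Longrightarrow> f j = 0" using assms by (auto simp: fin_supp_def)
  then show ?thesis unfolding fin_supp_def by (intro exI[of _ K]) (auto simp: fps_act_eq[OF K])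
qed

lemma fps_act_add_right:
  assumes "fin_supp f" "fin_supp g"
  shows "fps_act a (\<lambda>j. f j + g j) j = fps_act a f j + fps_act a g j"
proof -
  obtain K where K: "\<And>j. j \<ge> K \<Longrightarrow> f j = 0" "\<And>j. j \<ge> K \<Longrightarrow> g j = 0"
    using fin_supp_bound2[OF assms] by blast
  have "fps_act a (\<lambda>j. f j + g j) j = (\<Sum>i<K. fps_nth a i * (f (j + i) + g (j + i)))"
    by (rule fps_act_eq) (simp add: K)
  then show ?thesis by (simp add: fps_act_eq[OF K(1)] fps_act_eq[OF K(2)] sum.distrib distrib_left)
qed

lemma fps_act_cmult_right:
  assumes "fin_supp f"
  shows "fps_act a (\<lambda>j. x * f j) j = x * fps_act a f j"
proof -
  obtain K where K: "\<And>j. j \<ge> K \<Longrightarrow> f j = 0" using assms by (auto simp: fin_supp_def)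
  have "fps_act a (\<lambda>j. x * f j) j = (\<Sum>i<K. fps_nth a i * (x * f (j + i)))"
    by (rule fps_act_eq) (simp add: K)
  then show ?thesis by (simp add: fps_act_eq[OF K] sum_distrib_left mult_ac)
qed

lemma fps_act_0_right: "fps_act a (\<lambda>j. 0) j = 0"
  by (simp add: fps_act_def)

lemma fps_act_sum_right:
  assumes "\<And>x. x \<in> A \<Longrightarrow> fin_supp (f x)"
  shows "fps_act a (\<lambda>j. \<Sum>x\<in>A. f x j) j = (\<Sum>x\<in>A. fps_act a (f x) j)"
  using assms
  by (induction A rule: infinite_finite_induct) (auto simp: fps_act_add_right fin_supp_sum fps_act_0_right)

lemma fps_act_add_left:
  assumes "fin_supp f"
  shows "fps_act (a + b) f j = fps_act a f j + fps_act b f j"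
proof -
  obtain K where K: "\<And>j. j \<ge> K \<Longrightarrow> f j = 0" using assms by (auto simp: fin_supp_def)
  show ?thesis by (simp add: fps_act_eq[OF K] sum.distrib distrib_right)
qed

lemma fps_act_0_left [simp]: "fps_act 0 f j = 0"
  by (simp add: fps_act_def)

lemma fps_act_sum_left:
  assumes "fin_supp f"
  shows "fps_act (\<Sum>x\<in>A. a x) f j = (\<Sum>x\<in>A. fps_act (a x) f j)"
  by (induction A rule: infinite_finite_induct) (auto simp: fps_act_add_left assms)

lemma fps_act_const: assumes "fin_supp f" shows "fps_act (fps_const x) f j = x * f j"
proof -
  obtain K where K: "\<And>j. j \<ge> K \<Longrightarrow> f j = 0" using assms by (auto simp: fin_supp_def)
  then have "fps_act (fps_const x) f j = (\<Sum>i<Suc K. fps_nth (fps_const x) i * f (j + i))"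
    by (intro fps_act_eq) auto
  also have "\<dots> = x * f j" by (subst sum.lessThan_Suc_shift) simp
  finally show ?thesis .
qed

lemma fps_act_X: assumes "fin_supp f" shows "fps_act fps_X f j = f (Suc j)"
proof -
  obtain K where K: "\<And>j. j \<ge> K \<Longrightarrow> f j = 0" using assms by (auto simp: fin_supp_def)
  then have "fps_act fps_X f j = (\<Sum>i<Suc (Suc K). fps_nth fps_X i * f (j + i))"
    by (intro fps_act_eq) auto
  also have "\<dots> = f (Suc j)" by (simp only: sum.lessThan_Suc_shift) (simp add: fps_X_def)
  finally show ?thesis .
qed

lemma fps_act_mult:
  assumes "fin_supp f"
  shows "fps_act (a * b) f j = fps_act a (fps_act b f) j"
proof -
  obtain K where K: "\<And>j. j \<ge> K \<Longrightarrow> f j = 0" using assms by (auto simp: fin_supp_def)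
  have K': "fps_act b f j = 0" if "j \<ge> K" for j using that by (simp add: fps_act_eq[OF K] K)
  have "fps_act a (fps_act b f) j = (\<Sum>i<K. \<Sum>l<K. fps_nth a i * fps_nth b l * f (j + i + l))"
    by (simp add: fps_act_eq[OF K'] fps_act_eq[OF K] sum_distrib_left mult.assoc)
  also have "\<dots> = (\<Sum>(i, l)\<in>{..<K} \<times> {..<K}. fps_nth a i * fps_nth b l * f (j + i + l))"
    by (rule sum.cartesian_product)
  also have "\<dots> = (\<Sum>(i, l)\<in>(SIGMA i:{..<K}. {..<K - i}). fps_nth a i * fps_nth b l * f (j + i + l))"
  proof (rule sum.mono_neutral_right)
    have "f (j + i + l) = 0" if "\<not> l < K - i" for i l using that by (intro K) simp
    then show "\<forall>x\<in>{..<K} \<times> {..<K} - (SIGMA i:{..<K}. {..<K - i}).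
        (case x of (i, l) \<Rightarrow> fps_nth a i * fps_nth b l * f (j + i + l)) = 0" by fastforce
  qed auto
  also have "\<dots> = (\<Sum>(k, i)\<in>(SIGMA k:{..<K}. {0..k}). fps_nth a i * fps_nth b (k - i) * f (j + k))"
    by (rule sum.reindex_bij_witness[of _ "\<lambda>(k, i). (i, k - i)" "\<lambda>(i, l). (i + l, i)"]) (auto simp: add.assoc)
  also have "\<dots> = (\<Sum>k<K. \<Sum>i=0..k. fps_nth a i * fps_nth b (k - i) * f (j + k))"
    by (rule sum.Sigma[symmetric]) auto
  also have "\<dots> = fps_act (a * b) f j"
    by (simp add: fps_act_eq[OF K] fps_mult_nth sum_distrib_right)
  finally show ?thesis ..
qed

definition act_kernel :: "nat \<Rightarrow> complex fps mat \<Rightarrow> (nat \<Rightarrow> nat \<Rightarrow> complex) set" where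
  "act_kernel n A = {c. (\<forall>q<n. fin_supp (c q)) \<and> (\<forall>p<n. \<forall>j. (\<Sum>q<n. fps_act (A $$ (p, q)) (c q) j) = 0)}"

definition act_kernel_basis :: "nat \<Rightarrow> complex fps mat \<Rightarrow> nat \<Rightarrow> (nat \<Rightarrow> nat \<Rightarrow> nat \<Rightarrow> complex) \<Rightarrow> bool" where
  "act_kernel_basis n A d b \<longleftrightarrow>
     (\<forall>s<d. b s \<in> act_kernel n A) \<and>
     (\<forall>c\<in>act_kernel n A. \<exists>x. \<forall>q<n. \<forall>j. c q j = (\<Sum>s<d. x s * b s q j)) \<and>
     (\<forall>x. (\<forall>q<n. \<forall>j. (\<Sum>s<d. x s * b s q j) = 0) \<longrightarrow> (\<forall>s<d. x s = 0))"

text \<open>The adjugate matrix turns the system into \<open>det A\<close> acting on each component, and a power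
  series with nonzero constant term acts injectively because it has an inverse.\<close>

lemma act_kernel_unit_det:
  assumes A: "A \<in> carrier_mat n n" and u: "fps_nth (det A) 0 \<noteq> 0"
    and c: "c \<in> act_kernel n A" and q: "q < n"
  shows "c q j = 0"
proof -
  have fs: "fin_supp (c q)" if "q < n" for q using c that by (auto simp: act_kernel_def)
  have d: "fps_act (det A) (c q) j = 0" if q: "q < n" for q j
  proof -
    have "(\<Sum>r<n. fps_act ((adj_mat A * A) $$ (q, r)) (c r) j)
      = (\<Sum>r<n. \<Sum>p<n. fps_act (adj_mat A $$ (q, p) * A $$ (p, r)) (c r) j)"
      using q fs adj_mat(1)[OF A] A
      by (intro sum.cong refl) (simp add: index_mult_mat_sum[of _ n n _ n] fps_act_sum_left del: index_mult_mat(1))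
    also have "\<dots> = (\<Sum>p<n. \<Sum>r<n. fps_act (adj_mat A $$ (q, p)) (fps_act (A $$ (p, r)) (c r)) j)"
      using fs by (subst sum.swap) (simp add: fps_act_mult)
    also have "\<dots> = (\<Sum>p<n. fps_act (adj_mat A $$ (q, p)) (\<lambda>j. \<Sum>r<n. fps_act (A $$ (p, r)) (c r) j) j)"
    proof (rule sum.cong[OF refl])
      fix p
      show "(\<Sum>r<n. fps_act (adj_mat A $$ (q, p)) (fps_act (A $$ (p, r)) (c r)) j)
        = fps_act (adj_mat A $$ (q, p)) (\<lambda>j. \<Sum>r<n. fps_act (A $$ (p, r)) (c r) j) j"
        by (rule fps_act_sum_right[symmetric]) (use fs fin_supp_act in auto)
    qed
    also have "\<dots> = 0" using c by (simp add: act_kernel_def fps_act_0_right)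
    finally have "(\<Sum>r<n. fps_act ((adj_mat A * A) $$ (q, r)) (c r) j) = 0" .
    moreover have "(\<Sum>r<n. fps_act ((adj_mat A * A) $$ (q, r)) (c r) j) = (\<Sum>r<n. if r = q then fps_act (det A) (c q) j else 0)"
      unfolding adj_mat(3)[OF A] using q by (intro sum.cong refl) auto
    ultimately show ?thesis using q by simp
  qed
  have "c q j = fps_act (fps_const 1) (c q) j" using fps_act_const[OF fs[OF q], of 1 j] by simp
  also have "fps_const 1 = inverse (det A) * det A" using u by (simp add: inverse_mult_eq_1)
  also have "fps_act \<dots> (c q) j = fps_act (inverse (det A)) (fps_act (det A) (c q)) j"
    by (rule fps_act_mult[OF fs[OF q]])
  also have "fps_act (det A) (c q) = (\<lambda>j. 0)" using d[OF q] by auto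
  finally show ?thesis by (simp add: fps_act_0_right)
qed

lemma det_replace_col:
  assumes A: "(A :: 'a :: comm_ring_1 mat) \<in> carrier_mat n n" and k: "k < n"
  shows "det (replace_col A b k) = (\<Sum>i<n. b $ i * cofactor A i k)"
proof -
  have Ab: "replace_col A b k \<in> carrier_mat n n" using A by (auto simp: replace_col_def)
  have "cofactor (replace_col A b k) i k = cofactor A i k" for i
  proof -
    have "mat_delete (replace_col A b k) i k = mat_delete A i k"
      using A k by (intro eq_matI) (auto simp: replace_col_def mat_delete_def)
    then show ?thesis by (simp add: cofactor_def)
  qed
  then show ?thesis
    unfolding laplace_expansion_column[OF Ab k] using A k by (intro sum.cong) (auto simp: replace_col_def)
qed

text \<open>Induction on the order of the determinant, in place of the Smith normal form. If \<open>A\<close> is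
  singular at \<open>0\<close>, a constant vector \<open>v\<close> in its kernel there satisfies \<open>A v = X u\<close>. Replacing a
  column of \<open>A\<close> in the support of \<open>v\<close> by \<open>u\<close> lowers the order of the determinant by one (Cramer's
  rule), and it removes from the kernel exactly the line spanned by the sequence with the single
  entry \<open>v\<close>.\<close>

theorem act_kernel_dimension:
  fixes A :: "complex fps mat"
  assumes A: "A \<in> carrier_mat n n" and "det A \<noteq> 0" and "subdegree (det A) = d"
  shows "\<exists>b. act_kernel_basis n A d b"
  using assms
proof (induction d arbitrary: A)
  case 0
  then have "fps_nth (det A) 0 \<noteq> 0" by (metis nth_subdegree_nonzero)
  then have "c q j = 0" if "c \<in> act_kernel n A" "q < n" for c q j
    using act_kernel_unit_det[OF 0(1)] that by blast
  then show ?case by (auto simp: act_kernel_basis_def)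
next
  case (Suc d)
  note A = Suc.prems(1)
  interpret h: comm_ring_hom "\<lambda>F :: complex fps. fps_nth F 0"
    by unfold_locales auto
  define A0 where "A0 = map_mat (\<lambda>F. fps_nth F 0) A"
  have A0: "A0 \<in> carrier_mat n n" using A by (simp add: A0_def)
  have "det A0 = fps_nth (det A) 0" unfolding A0_def by (rule h.hom_det)
  also have "\<dots> = 0" using Suc.prems(3) by (intro nth_less_subdegree_zero) simp
  finally obtain v where v: "v \<in> carrier_vec n" "v \<noteq> 0\<^sub>v n" "A0 *\<^sub>v v = 0\<^sub>v n"
    using det_0_iff_vec_prod_zero[OF A0] by auto
  obtain q0 where q0: "q0 < n" "v $ q0 \<noteq> 0"
    using v(1,2) by (metis carrier_vecD eq_vecI index_zero_vec)
  define w where "w = v $ q0"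
  have w: "w \<noteq> 0" using q0 by (simp add: w_def)
  define V where "V = map_vec fps_const v"
  have V: "V \<in> carrier_vec n" using v(1) by (simp add: V_def)
  define u where "u = vec n (\<lambda>p. fps_shift 1 (\<Sum>i<n. A $$ (p, i) * fps_const (v $ i)))"
  have u: "u \<in> carrier_vec n" by (simp add: u_def)
  have Xu: "fps_X * u $ p = (\<Sum>i<n. A $$ (p, i) * fps_const (v $ i))" if p: "p < n" for p
  proof -
    have "fps_nth (\<Sum>i<n. A $$ (p, i) * fps_const (v $ i)) 0 = (A0 *\<^sub>v v) $ p"
      using p A unfolding index_mult_mat_vec_sum[OF A0 v(1) p]
      by (simp add: fps_sum_nth A0_def)
    then have z: "fps_nth (\<Sum>i<n. A $$ (p, i) * fps_const (v $ i)) 0 = 0" using v(3) p by simp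
    show ?thesis
      unfolding u_def index_vec[OF p]
    proof (rule fps_ext)
      fix m show "fps_nth (fps_X * fps_shift 1 (\<Sum>i<n. A $$ (p, i) * fps_const (v $ i))) m
         = fps_nth (\<Sum>i<n. A $$ (p, i) * fps_const (v $ i)) m"
        using z by (cases m) auto
    qed
  qed
  define A' where "A' = replace_col A u q0"
  have A': "A' \<in> carrier_mat n n" using A by (simp add: A'_def replace_col_def)
  have AV: "A *\<^sub>v V = fps_X \<cdot>\<^sub>v u"
  proof (rule eq_vecI)
    fix i assume "i < dim_vec (fps_X \<cdot>\<^sub>v u)"
    then have i: "i < n" using u by simp
    show "(A *\<^sub>v V) $ i = (fps_X \<cdot>\<^sub>v u) $ i"
      unfolding index_mult_mat_vec_sum[OF A V i] using Xu[OF i] i u v(1) by (simp add: V_def)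
  qed (use A u in auto)
  have "fps_X * det A' = det (replace_col A (fps_X \<cdot>\<^sub>v u) q0)"
    unfolding A'_def det_replace_col[OF A q0(1)] using u by (simp add: sum_distrib_left mult.assoc)
  also have "\<dots> = V $ q0 * det A" using cramer_lemma_mat[OF A V q0(1)] AV by simp
  also have "V $ q0 = fps_const w" using q0 v(1) by (simp add: V_def w_def)
  finally have det_eq: "fps_X * det A' = fps_const w * det A" .
  have nz: "det A' \<noteq> 0" using det_eq w Suc.prems(2) by auto
  have "subdegree (fps_X * det A') = Suc (subdegree (det A'))" using nz by simp
  moreover have "subdegree (fps_const w * det A) = Suc d" using w Suc.prems by simp
  ultimately have sd: "subdegree (det A') = d" using det_eq by simp
  obtain b' where b': "act_kernel_basis n A' d b'" using Suc.IH[OF A' nz sd] by blast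
  \<comment> \<open>writing \<open>c = c' + v g\<close> with \<open>c'\<close> zero at \<open>q\<^sub>0\<close>, the identity \<open>A v g = u X g\<close> turns \<open>A c\<close> into \<open>A'\<close> applied to \<open>red c\<close>;
    \<open>lift\<close> reverses this with \<open>0\<close> as the entry that \<open>X\<close> has dropped\<close>
  define red where "red = (\<lambda>(c :: nat \<Rightarrow> nat \<Rightarrow> complex) i j. if i = q0 then c q0 (Suc j) / w else c i j - v $ i * c q0 j / w)"
  define lift where "lift = (\<lambda>(c :: nat \<Rightarrow> nat \<Rightarrow> complex) i j.
     let l = (case j of 0 \<Rightarrow> 0 | Suc k \<Rightarrow> w * c q0 k) in if i = q0 then l else c i j + v $ i * l / w)"
  define e where "e = (\<lambda>i j::nat. if j = 0 then v $ i else 0)"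
  have fs_q0: "fin_supp (\<lambda>j. c q0 (Suc j) / w)" if "fin_supp (c q0)" for c :: "nat \<Rightarrow> nat \<Rightarrow> complex"
  proof -
    obtain K where "\<forall>j\<ge>K. c q0 j = 0" using \<open>fin_supp (c q0)\<close> by (auto simp: fin_supp_def)
    then show ?thesis by (auto simp: fin_supp_def intro!: exI[of _ K])
  qed
  have fs_lin: "fin_supp (\<lambda>j. f j - x * g j / w)" if "fin_supp f" "fin_supp g" for f g :: "nat \<Rightarrow> complex" and x
    using fin_supp_add[OF that(1) fin_supp_cmult[OF that(2), of "- (x / w)"]] by simp
  have red_fs: "fin_supp (red c i)" if "\<forall>q<n. fin_supp (c q)" "i < n" for c i
    using that fs_q0[of c] fs_lin q0(1) by (cases "i = q0") (auto simp: red_def)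
  have act_eq: "(\<Sum>q<n. fps_act (A' $$ (p, q)) (red c q) j) = (\<Sum>q<n. fps_act (A $$ (p, q)) (c q) j)"
    if c: "\<forall>q<n. fin_supp (c q)" and p: "p < n" for c p j
  proof -
    define g where "g = (\<lambda>j. c q0 j / w)"
    have gs: "fin_supp g" using fin_supp_cmult[of "c q0" "1 / w"] c q0 by (simp add: g_def)
    have gx: "fps_act fps_X g = red c q0" using fps_act_X[OF gs] by (auto simp: g_def red_def)
    have "fps_act (A' $$ (p, q0)) (red c q0) j = fps_act (u $ p * fps_X) g j"
      unfolding fps_act_mult[OF gs] gx using p q0 A by (simp add: A'_def replace_col_def)
    also have "u $ p * fps_X = (\<Sum>i<n. A $$ (p, i) * fps_const (v $ i))" using Xu[OF p] by (simp add: mult.commute)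
    also have "fps_act \<dots> g j = (\<Sum>i<n. fps_act (A $$ (p, i)) (\<lambda>j. v $ i * g j) j)"
    proof -
      have "fps_act (fps_const x) g = (\<lambda>j. x * g j)" for x using fps_act_const[OF gs] by auto
      then show ?thesis by (simp add: fps_act_sum_left[OF gs] fps_act_mult[OF gs])
    qed
    also have "\<dots> = fps_act (A $$ (p, q0)) (c q0) j + (\<Sum>i\<in>{..<n} - {q0}. fps_act (A $$ (p, i)) (\<lambda>j. v $ i * g j) j)"
    proof -
      have "(\<lambda>j. v $ q0 * g j) = c q0" using w by (auto simp: g_def w_def)
      then show ?thesis using q0 by (subst sum.remove[of _ q0]) auto
    qed
    finally have 1: "fps_act (A' $$ (p, q0)) (red c q0) j = \<dots>" .
    have "(\<Sum>q\<in>{..<n} - {q0}. fps_act (A' $$ (p, q)) (red c q) j)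
        = (\<Sum>q\<in>{..<n} - {q0}. fps_act (A $$ (p, q)) (c q) j - fps_act (A $$ (p, q)) (\<lambda>j. v $ q * g j) j)"
    proof (intro sum.cong refl)
      fix q assume q: "q \<in> {..<n} - {q0}"
      have fc: "fin_supp (c q)" using c q by auto
      have r: "red c q = (\<lambda>j. c q j + (- v $ q) * g j)" using q by (auto simp: red_def g_def)
      have "fps_act (A $$ (p, q)) (red c q) j = fps_act (A $$ (p, q)) (c q) j + (- v $ q) * fps_act (A $$ (p, q)) g j"
        unfolding r fps_act_add_right[OF fc fin_supp_cmult[OF gs]] fps_act_cmult_right[OF gs] ..
      then show "fps_act (A' $$ (p, q)) (red c q) j = fps_act (A $$ (p, q)) (c q) j - fps_act (A $$ (p, q)) (\<lambda>j. v $ q * g j) j"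
        using q p A by (simp add: A'_def replace_col_def fps_act_cmult_right[OF gs])
    qed
    then show ?thesis using 1 q0
      by (simp add: sum.remove[of "{..<n}" q0] sum_subtractf)
  qed
  have red_ker: "red c \<in> act_kernel n A'" if "c \<in> act_kernel n A" for c
    using that red_fs act_eq by (simp add: act_kernel_def)
  have red_lift: "red (lift c) = c" for c
    using w by (auto simp: red_def lift_def Let_def fun_eq_iff split: nat.split)
  have lift_fs: "fin_supp (lift c i)" if c: "\<forall>q<n. fin_supp (c q)" and i: "i < n" for c i
  proof -
    define l where "l = (\<lambda>j. case j of 0 \<Rightarrow> 0 | Suc k \<Rightarrow> w * c q0 k)"
    obtain K where "\<forall>j\<ge>K. c q0 j = 0" using c q0 by (auto simp: fin_supp_def)
    then have "fin_supp l" unfolding fin_supp_def l_def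
      by (intro exI[of _ "Suc K"]) (auto split: nat.split)
    then have "fin_supp (\<lambda>j. c i j + (v $ i / w) * l j)" "fin_supp l"
      using fin_supp_add fin_supp_cmult c i by blast+
    then show ?thesis by (cases "i = q0") (simp_all add: lift_def Let_def l_def[symmetric])
  qed
  have lift_ker: "lift c \<in> act_kernel n A" if c: "c \<in> act_kernel n A'" for c
  proof -
    have f: "\<forall>q<n. fin_supp (lift c q)" using lift_fs c by (auto simp: act_kernel_def)
    then show ?thesis using c act_eq[OF f] by (simp add: act_kernel_def red_lift)
  qed
  have lift_sum: "lift c i j = (\<Sum>s<d. x s * lift (b' s) i j)"
    if "\<forall>q<n. \<forall>j. c q j = (\<Sum>s<d. x s * b' s q j)" "i < n" for c x i j
  proof -
    have cq: "c q0 k = (\<Sum>s<d. x s * b' s q0 k)" for k using that q0 by auto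
    have ci: "c i k = (\<Sum>s<d. x s * b' s i k)" for k using that by auto
    show ?thesis
      using w by (cases j) (auto simp: lift_def Let_def cq ci sum_distrib_left sum.distrib distrib_left sum_divide_distrib mult_ac)
  qed
  have decomp: "c i j = lift (red c) i j + c q0 0 / w * e i j" if "i < n" for c i j
    using w by (cases j) (auto simp: lift_def red_def e_def Let_def w_def)
  have e_ker: "e \<in> act_kernel n A"
  proof -
    have fe: "\<forall>q<n. fin_supp (e q)" by (auto simp: fin_supp_def e_def intro!: exI[of _ 1])
    have "red e = (\<lambda>i j. 0)" using w by (auto simp: red_def e_def w_def fun_eq_iff)
    then have "(\<Sum>q<n. fps_act (A' $$ (p, q)) (red e q) j) = 0" for p j by (simp add: fps_act_0_right)
    then show ?thesis using act_eq[OF fe] fe by (simp add: act_kernel_def)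
  qed
  define b where "b = (\<lambda>s. if s < d then lift (b' s) else e)"
  have sum_b: "(\<Sum>s<Suc d. x s * b s i j) = (\<Sum>s<d. x s * lift (b' s) i j) + x d * e i j" for x i j
    by (simp add: b_def)
  have "act_kernel_basis n A (Suc d) b"
    unfolding act_kernel_basis_def
  proof (intro conjI allI impI ballI)
    fix s assume "s < Suc d"
    then show "b s \<in> act_kernel n A"
      using b' lift_ker e_ker by (auto simp: b_def act_kernel_basis_def)
  next
    fix c assume "c \<in> act_kernel n A"
    then obtain x where x: "\<forall>q<n. \<forall>j. red c q j = (\<Sum>s<d. x s * b' s q j)"
      using b' red_ker unfolding act_kernel_basis_def by blast
    define y where "y = x(d := c q0 0 / w)"
    have "c i j = (\<Sum>s<Suc d. y s * b s i j)" if "i < n" for i j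
      using decomp[OF that, of c j] lift_sum[OF x that, of j] unfolding sum_b by (simp add: y_def)
    then show "\<exists>x. \<forall>q<n. \<forall>j. c q j = (\<Sum>s<Suc d. x s * b s q j)" by blast
  next
    fix x s assume z: "\<forall>q<n. \<forall>j. (\<Sum>s<Suc d. x s * b s q j) = 0" and s: "s < Suc d"
    define c where "c = (\<lambda>i j. \<Sum>s<d. x s * b' s i j)"
    have lc: "lift c i j + x d * e i j = 0" if "i < n" for i j
      using lift_sum[of c x i j] z that unfolding sum_b by (simp add: c_def)
    have xd: "x d = 0" using lc[OF q0(1), of 0] q0 by (simp add: lift_def e_def)
    then have "lift c i j = 0" if "i < n" for i j using lc[OF that, of j] by simp
    then have "red (lift c) i j = 0" if "i < n" for i j using that q0 by (simp add: red_def)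
    then have "\<forall>q<n. \<forall>j. (\<Sum>s<d. x s * b' s q j) = 0" unfolding red_lift by (simp add: c_def)
    then have "\<forall>s<d. x s = 0" using b' unfolding act_kernel_basis_def by blast
    then show "x s = 0" using s xd by (auto simp: less_Suc_eq)
  qed
  then show ?case by blast
qed

section \<open>Lagrangian subspaces in adapted coordinates\<close>

lemma inv_mat_inverse:
  fixes A :: "'a :: field mat"
  assumes A: "A \<in> carrier_mat n n" and d: "det A \<noteq> 0"
  shows "inv_mat A \<in> carrier_mat n n" "A * inv_mat A = 1\<^sub>m n" "inv_mat A * A = 1\<^sub>m n"
proof -
  have "mat_inverse A \<noteq> None"
    using mat_inverse(1)[OF A, where b = "()"] det_non_zero_imp_unit[OF A d, of "()"] by auto
  then obtain B where B: "mat_inverse A = Some B" by auto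
  show "inv_mat A \<in> carrier_mat n n" "A * inv_mat A = 1\<^sub>m n" "inv_mat A * A = 1\<^sub>m n"
    using mat_inverse(2)[OF A B] B by (simp_all add: inv_mat_def)
qed

lemma inv_mat_eqI:
  fixes A :: "'a :: field mat"
  assumes A: "A \<in> carrier_mat n n" and B: "B \<in> carrier_mat n n" and AB: "A * B = 1\<^sub>m n"
  shows "inv_mat A = B" "det A \<noteq> 0"
proof -
  have "det A * det B = 1" using det_mult[OF A B] AB by simp
  then show d: "det A \<noteq> 0" by auto
  note I = inv_mat_inverse[OF A d]
  have "inv_mat A = inv_mat A * (A * B)" using I AB by simp
  also have "\<dots> = (inv_mat A * A) * B" using assoc_mult_mat[OF I(1) A B] by simp
  finally show "inv_mat A = B" using I B by simp
qed

lemma orthonormal_basis_carrier: "orthonormal_basis N vs W \<Longrightarrow> i < length vs \<Longrightarrow> vs ! i \<in> carrier_vec N"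
  by (auto simp: orthonormal_basis_def)

lemma scalar_prod_combination:
  fixes vs :: "real vec list"
  assumes "set vs \<subseteq> carrier_vec N" "c \<in> carrier_vec (length vs)" "w \<in> carrier_vec N"
  shows "scalar_prod (mat_of_cols N vs *\<^sub>v c) w = (\<Sum>l<length vs. c $ l * scalar_prod (vs ! l) w)"
proof -
  have M: "mat_of_cols N vs \<in> carrier_mat N (length vs)" by simp
  have "scalar_prod (mat_of_cols N vs *\<^sub>v c) w = (\<Sum>i<N. (\<Sum>l<length vs. vs ! l $ i * c $ l) * w $ i)"
    using assms by (auto simp: scalar_prod_def[of _ w] atLeast0LessThan mat_of_cols_index
        index_mult_mat_vec_sum[OF M assms(2)] simp del: index_mult_mat_vec intro!: sum.cong)
  also have "\<dots> = (\<Sum>l<length vs. \<Sum>i<N. vs ! l $ i * c $ l * w $ i)"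
    unfolding sum_distrib_right by (rule sum.swap)
  also have "\<dots> = (\<Sum>l<length vs. c $ l * scalar_prod (vs ! l) w)"
    using assms by (auto simp: scalar_prod_def atLeast0LessThan sum_distrib_left mult_ac intro!: sum.cong)
  finally show ?thesis .
qed

lemma orthonormal_basis_eq:
  assumes "orthonormal_basis N vs W"
  shows "W = {mat_of_cols N vs *\<^sub>v c | c. c \<in> carrier_vec (length vs)}"
proof -
  interpret V: vec_space "TYPE(real)" N .
  have s: "set vs \<subseteq> carrier_vec N" and W: "V.span (set vs) = W"
    using assms by (auto simp: orthonormal_basis_def)
  have d: "\<forall>w\<in>set vs. dim_vec w = N" using s by auto
  have "W = V.span_list vs" using V.span_list_as_span[OF s] W by simp
  also have "\<dots> = {mat_of_cols N vs *\<^sub>v vec (length vs) c | c. True}"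
    unfolding V.span_list_def V.lincomb_list_as_mat_mult[OF d] by auto
  also have "\<dots> = {mat_of_cols N vs *\<^sub>v c | c. c \<in> carrier_vec (length vs)}"
  proof (intro equalityI subsetI)
    fix x assume "x \<in> {mat_of_cols N vs *\<^sub>v c | c. c \<in> carrier_vec (length vs)}"
    then obtain c where "x = mat_of_cols N vs *\<^sub>v c" "c \<in> carrier_vec (length vs)" by auto
    moreover from this have "vec (length vs) (\<lambda>i. c $ i) = c" by auto
    ultimately have "x = mat_of_cols N vs *\<^sub>v vec (length vs) (\<lambda>i. c $ i)" by simp
    then show "x \<in> {mat_of_cols N vs *\<^sub>v vec (length vs) c | c. True}" by blast
  qed auto
  finally show ?thesis .
qed

lemma orthonormal_basis_coeff:
  assumes "orthonormal_basis N vs W" "c \<in> carrier_vec (length vs)" "l < length vs"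
  shows "scalar_prod (mat_of_cols N vs *\<^sub>v c) (vs ! l) = c $ l"
proof -
  have "scalar_prod (mat_of_cols N vs *\<^sub>v c) (vs ! l) = (\<Sum>i<length vs. c $ i * scalar_prod (vs ! i) (vs ! l))"
    using assms by (intro scalar_prod_combination) (auto simp: orthonormal_basis_def)
  also have "\<dots> = (\<Sum>i<length vs. if i = l then c $ i else 0)"
    using assms by (intro sum.cong) (auto simp: orthonormal_basis_def)
  finally show ?thesis using assms by simp
qed

lemma subspace_dim_orthonormal_basis:
  assumes "orthonormal_basis N vs W"
  shows "subspace_dim N W = length vs"
proof -
  interpret V: vec_space "TYPE(real)" N .
  have s: "set vs \<subseteq> carrier_vec N" and W: "V.span (set vs) = W"
    and on: "\<And>i j. i < length vs \<Longrightarrow> j < length vs \<Longrightarrow> scalar_prod (vs ! i) (vs ! j) = (if i = j then 1 else 0)"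
    using assms by (auto simp: orthonormal_basis_def)
  have dist: "distinct vs"
    unfolding distinct_conv_nth
  proof (intro allI impI)
    fix i j assume "i < length vs" "j < length vs" "i \<noteq> j"
    then show "vs ! i \<noteq> vs ! j" using on[of i j] on[of i i] by auto
  qed
  have d: "\<forall>w\<in>set vs. dim_vec w = N" using s by auto
  have li: "V.lin_indpt (set vs)"
  proof (rule V.finite_lin_indpt2)
    fix a assume z: "V.lincomb a (set vs) = 0\<^sub>v N"
    have "mat_of_cols N vs *\<^sub>v vec (length vs) (\<lambda>i. a (vs ! i)) = 0\<^sub>v N"
      using z unfolding V.lincomb_as_lincomb_list_distinct[OF s dist] V.lincomb_list_as_mat_mult[OF d]
      by simp
    then have "a (vs ! l) = 0" if "l < length vs" for l
      using orthonormal_basis_coeff[OF assms, of "vec (length vs) (\<lambda>i. a (vs ! i))" l] that s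
      by (auto simp: nth_mem subset_iff)
    then show "\<forall>v\<in>set vs. a v = 0" by (auto simp: in_set_conv_nth)
  qed (use s in auto)
  have "vectorspace.dim class_ring (V.vs (V.span (set vs))) = card (set vs)"
    by (rule V.dim_span) (use s li in \<open>auto simp: maximal_def\<close>)
  then show ?thesis using W dist by (simp add: subspace_dim_def distinct_card)
qed

lemma symp_J_carrier [simp]: "symp_J n \<in> carrier_mat (2 * n) (2 * n)"
  by (simp add: symp_J_def mult_2)

lemma symp_J_dim [simp]: "dim_row (symp_J n) = 2 * n" "dim_col (symp_J n) = 2 * n"
  using symp_J_carrier by blast+

lemma sum_lessThan_add:
  fixes f :: "nat \<Rightarrow> 'a :: comm_monoid_add"
  shows "(\<Sum>q<a + b. f q) = (\<Sum>q<a. f q) + (\<Sum>q<b. f (a + q))"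
  by (induction b) (auto simp: add_ac)

lemma symp_J_mult_vec:
  assumes "v \<in> carrier_vec (2 * n)" "i < n"
  shows "(symp_J n *\<^sub>v v) $ i = - v $ (n + i)" "(symp_J n *\<^sub>v v) $ (n + i) = v $ i"
proof -
  have split: "(\<Sum>q<2 * n. f q) = (\<Sum>q<n. f q) + (\<Sum>q<n. f (n + q))" for f :: "nat \<Rightarrow> real"
    unfolding mult_2 by (rule sum_lessThan_add)
  show "(symp_J n *\<^sub>v v) $ i = - v $ (n + i)"
    using assms by (subst index_mult_mat_vec_sum[OF symp_J_carrier assms(1)])
      (auto simp: split symp_J_def if_distrib[of "\<lambda>x. x * _"] if_distrib[of uminus] sum_negf cong: if_cong)
  show "(symp_J n *\<^sub>v v) $ (n + i) = v $ i"
    using assms by (subst index_mult_mat_vec_sum[OF symp_J_carrier assms(1)])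
      (auto simp: split symp_J_def if_distrib[of "\<lambda>x. x * _"] cong: if_cong)
qed


lemma scalar_prod_symp_J:
  assumes "u \<in> carrier_vec (2 * n)" "v \<in> carrier_vec (2 * n)"
  shows "scalar_prod (symp_J n *\<^sub>v u) (symp_J n *\<^sub>v v) = scalar_prod u v"
proof -
  have "scalar_prod (symp_J n *\<^sub>v u) (symp_J n *\<^sub>v v) = (\<Sum>q<n + n. (symp_J n *\<^sub>v u) $ q * (symp_J n *\<^sub>v v) $ q)"
    by (simp add: scalar_prod_def atLeast0LessThan mult_2 del: index_mult_mat_vec)
  also have "\<dots> = (\<Sum>q<n + n. u $ q * v $ q)"
  proof -
    have "(\<Sum>q<n. (symp_J n *\<^sub>v u) $ q * (symp_J n *\<^sub>v v) $ q) = (\<Sum>q<n. u $ (n + q) * v $ (n + q))"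
      by (simp add: symp_J_mult_vec[OF assms(1)] symp_J_mult_vec[OF assms(2)] del: index_mult_mat_vec)
    moreover have "(\<Sum>q<n. (symp_J n *\<^sub>v u) $ (n + q) * (symp_J n *\<^sub>v v) $ (n + q)) = (\<Sum>q<n. u $ q * v $ q)"
      by (simp add: symp_J_mult_vec[OF assms(1)] symp_J_mult_vec[OF assms(2)] del: index_mult_mat_vec)
    ultimately show ?thesis unfolding sum_lessThan_add by simp
  qed
  also have "\<dots> = scalar_prod u v"
    using assms by (simp add: scalar_prod_def atLeast0LessThan mult_2)
  finally show ?thesis .
qed

locale lagrangian_frame =
  fixes n k0 :: nat and \<Lambda>0 \<Lambda>1 :: "real vec set" and ds fs :: "real vec list"
  assumes lag0: "lagrangian n \<Lambda>0" and lag1: "lagrangian n \<Lambda>1"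
    and k0: "k0 = subspace_dim (2 * n) (\<Lambda>0 \<inter> \<Lambda>1)"
    and onb_V0: "orthonormal_basis (2 * n) (take k0 ds) (\<Lambda>0 \<inter> \<Lambda>1)"
    and onb0: "orthonormal_basis (2 * n) ds \<Lambda>0"
    and onb_V1: "orthonormal_basis (2 * n) fs (orth_complement_in (\<Lambda>0 \<inter> \<Lambda>1) \<Lambda>1)"
begin

abbreviation "N \<equiv> 2 * n"

lemma length_ds: "length ds = n"
  using subspace_dim_orthonormal_basis[OF onb0] lag0 by (simp add: lagrangian_def)

lemma k0_le: "k0 \<le> n"
  using subspace_dim_orthonormal_basis[OF onb_V0] k0 length_ds by simp

lemma ds_carrier: "i < n \<Longrightarrow> ds ! i \<in> carrier_vec N"
  using orthonormal_basis_carrier[OF onb0] length_ds by simp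

lemma fs_carrier: "i < length fs \<Longrightarrow> fs ! i \<in> carrier_vec N"
  using orthonormal_basis_carrier[OF onb_V1] by simp

lemma Lam_carrier: "v \<in> \<Lambda>0 \<Longrightarrow> v \<in> carrier_vec N" "v \<in> \<Lambda>1 \<Longrightarrow> v \<in> carrier_vec N"
  using lag0 lag1 by (auto simp: lagrangian_def subspace_def submodule_def module_vec_simps)

lemma Lam1_closed:
  "0\<^sub>v N \<in> \<Lambda>1" "u \<in> \<Lambda>1 \<Longrightarrow> v \<in> \<Lambda>1 \<Longrightarrow> u + v \<in> \<Lambda>1" "u \<in> \<Lambda>1 \<Longrightarrow> x \<cdot>\<^sub>v u \<in> \<Lambda>1"
proof -
  have s: "submodule class_ring \<Lambda>1 (real_space N)" using lag1 by (auto simp: lagrangian_def subspace_def)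
  show "0\<^sub>v N \<in> \<Lambda>1" using submodule.zero_closed[OF s] by (simp add: module_vec_simps)
  show "u \<in> \<Lambda>1 \<Longrightarrow> v \<in> \<Lambda>1 \<Longrightarrow> u + v \<in> \<Lambda>1" using submodule.m_closed[OF s] by (simp add: module_vec_simps)
  show "u \<in> \<Lambda>1 \<Longrightarrow> x \<cdot>\<^sub>v u \<in> \<Lambda>1" using submodule.smult_closed[OF s] by (simp add: module_vec_simps)
qed

lemma ds_mem: "i < n \<Longrightarrow> ds ! i \<in> \<Lambda>0"
proof -
  interpret V: vec_space "TYPE(real)" N .
  assume "i < n"
  have "set ds \<subseteq> V.span (set ds)" using onb0 by (intro V.in_own_span) (auto simp: orthonormal_basis_def)
  then show ?thesis using \<open>i < n\<close> onb0 length_ds by (auto simp: orthonormal_basis_def)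
qed

lemma ds_mem1: "i < k0 \<Longrightarrow> ds ! i \<in> \<Lambda>1"
proof -
  interpret V: vec_space "TYPE(real)" N .
  assume i: "i < k0"
  have "set (take k0 ds) \<subseteq> V.span (set (take k0 ds))"
    using onb_V0 by (intro V.in_own_span) (auto simp: orthonormal_basis_def)
  moreover have "ds ! i \<in> set (take k0 ds)" using i k0_le length_ds by (auto simp: in_set_conv_nth)
  ultimately show ?thesis using onb_V0 by (auto simp: orthonormal_basis_def)
qed

lemma fs_mem: "l < length fs \<Longrightarrow> fs ! l \<in> \<Lambda>1"
  and fs_orth: "l < length fs \<Longrightarrow> v \<in> \<Lambda>0 \<Longrightarrow> v \<in> \<Lambda>1 \<Longrightarrow> scalar_prod (fs ! l) v = 0"
proof -
  interpret V: vec_space "TYPE(real)" N .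
  assume l: "l < length fs"
  have "set fs \<subseteq> V.span (set fs)" using onb_V1 by (intro V.in_own_span) (auto simp: orthonormal_basis_def)
  then have "fs ! l \<in> orth_complement_in (\<Lambda>0 \<inter> \<Lambda>1) \<Lambda>1"
    using onb_V1 l by (auto simp: orthonormal_basis_def)
  then show "fs ! l \<in> \<Lambda>1" "v \<in> \<Lambda>0 \<Longrightarrow> v \<in> \<Lambda>1 \<Longrightarrow> scalar_prod (fs ! l) v = 0"
    by (auto simp: orth_complement_in_def)
qed

lemma isotropic0: "u \<in> \<Lambda>0 \<Longrightarrow> v \<in> \<Lambda>0 \<Longrightarrow> scalar_prod (symp_J n *\<^sub>v u) v = 0"
  using lag0 by (auto simp: lagrangian_def symp_form_def)

lemma isotropic1: "u \<in> \<Lambda>1 \<Longrightarrow> v \<in> \<Lambda>1 \<Longrightarrow> scalar_prod (symp_J n *\<^sub>v u) v = 0"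
  using lag1 by (auto simp: lagrangian_def symp_form_def)

lemma ds_orthonormal: "i < n \<Longrightarrow> j < n \<Longrightarrow> scalar_prod (ds ! i) (ds ! j) = (if i = j then 1 else 0)"
  using onb0 length_ds by (auto simp: orthonormal_basis_def)

lemma combination_in_Lam1:
  assumes "set vs \<subseteq> \<Lambda>1" "c \<in> carrier_vec (length vs)"
  shows "mat_of_cols N vs *\<^sub>v c \<in> \<Lambda>1"
proof -
  interpret V: vec_space "TYPE(real)" N .
  have s: "set vs \<subseteq> carrier_vec N" using assms Lam_carrier by auto
  have d: "\<forall>w\<in>set vs. dim_vec w = N" using s by auto
  have "mat_of_cols N vs *\<^sub>v c = V.lincomb_list (\<lambda>i. c $ i) vs"
    using assms(2) unfolding V.lincomb_list_as_mat_mult[OF d]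
    by (intro arg_cong2[of _ _ _ _ "(*\<^sub>v)"]) auto
  also have "\<dots> \<in> \<Lambda>1"
    using assms(1)
  proof (induction vs arbitrary: c)
    case Nil
    then show ?case using Lam1_closed(1) by simp
  next
    case (Cons v vs)
    have "V.lincomb_list ((\<lambda>i. c $ i) \<circ> Suc) vs = V.lincomb_list (\<lambda>i. vec (length vs) (\<lambda>i. c $ Suc i) $ i) vs"
      unfolding V.lincomb_list_def by (rule arg_cong[of _ _ V.sumlist]) simp
    then show ?case using Cons Lam1_closed by (simp add: V.lincomb_list_Cons)
  qed
  finally show ?thesis .
qed

text \<open>\<open>coord v i\<close> is the \<open>i\<close>-th coordinate of \<open>v\<close> in the orthonormal frame of the columns of \<open>M\<^sub>1\<close>.\<close>
definition coord :: "real vec \<Rightarrow> nat \<Rightarrow> real" where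
  "coord v i = (if i < n then scalar_prod (ds ! i) v else scalar_prod (symp_J n *\<^sub>v (ds ! (i - n))) v)"

lemma M1_carrier: "M1_mat n ds \<in> carrier_mat N N"
proof -
  have "length (ds @ map (\<lambda>d. symp_J n *\<^sub>v d) ds) = N" by (simp add: length_ds)
  then show ?thesis unfolding M1_mat_def using mat_of_cols_carrier(1) by metis
qed

lemma M1_col: "i < N \<Longrightarrow> col (M1_mat n ds) i = (if i < n then ds ! i else symp_J n *\<^sub>v (ds ! (i - n)))"
  unfolding M1_mat_def
  by (subst col_mat_of_cols) (auto simp: length_ds nth_append ds_carrier intro!: mult_mat_vec_carrier[of _ _ N])

lemma M1T_mult: "v \<in> carrier_vec N \<Longrightarrow> i < N \<Longrightarrow> (transpose_mat (M1_mat n ds) *\<^sub>v v) $ i = coord v i"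
  using M1_carrier by (simp add: M1_col coord_def)

lemma M1_orthogonal: "transpose_mat (M1_mat n ds) * M1_mat n ds = 1\<^sub>m N"
  and M1_orthogonal': "M1_mat n ds * transpose_mat (M1_mat n ds) = 1\<^sub>m N"
proof -
  let ?M = "M1_mat n ds"
  show 1: "transpose_mat ?M * ?M = 1\<^sub>m N"
  proof (rule eq_matI)
    fix i j assume "i < dim_row (1\<^sub>m N :: real mat)" "j < dim_col (1\<^sub>m N :: real mat)"
    then have ij: "i < N" "j < N" by auto
    have "(transpose_mat ?M * ?M) $$ (i, j) = scalar_prod (col ?M i) (col ?M j)"
      using ij M1_carrier by simp
    also have "\<dots> = (if i = j then 1 else 0)"
    proof -
      have c: "scalar_prod (ds ! a) (symp_J n *\<^sub>v (ds ! b)) = scalar_prod (symp_J n *\<^sub>v (ds ! b)) (ds ! a)" if "a < n" "b < n" for a b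
        using that ds_carrier by (intro comm_scalar_prod[of _ N]) (auto intro!: mult_mat_vec_carrier[of _ _ N])
      show ?thesis
        using ij ds_carrier ds_mem
        by (auto simp: M1_col ds_orthonormal c isotropic0 scalar_prod_symp_J)
    qed
    finally show "(transpose_mat ?M * ?M) $$ (i, j) = (1\<^sub>m N :: real mat) $$ (i, j)" using ij by simp
  qed (use M1_carrier in auto)
  show "?M * transpose_mat ?M = 1\<^sub>m N"
    by (rule mat_mult_left_right_inverse[OF _ M1_carrier 1]) (use M1_carrier in auto)
qed

lemma coord_eqI:
  assumes "u \<in> carrier_vec N" "v \<in> carrier_vec N" "\<And>i. i < N \<Longrightarrow> coord u i = coord v i"
  shows "u = v"
proof -
  let ?M = "M1_mat n ds"
  have MT: "transpose_mat ?M \<in> carrier_mat N N" using M1_carrier by simp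
  have "transpose_mat ?M *\<^sub>v u = transpose_mat ?M *\<^sub>v v"
    using assms M1T_mult M1_carrier by (intro eq_vecI) (auto simp del: index_mult_mat_vec)
  then have "?M *\<^sub>v (transpose_mat ?M *\<^sub>v u) = ?M *\<^sub>v (transpose_mat ?M *\<^sub>v v)" by simp
  then show ?thesis
    using assms unfolding assoc_mult_mat_vec[OF M1_carrier MT assms(1), symmetric]
      assoc_mult_mat_vec[OF M1_carrier MT assms(2), symmetric] M1_orthogonal' by simp
qed

lemma coord_combination:
  assumes "set vs \<subseteq> carrier_vec N" "c \<in> carrier_vec (length vs)" "i < N"
  shows "coord (mat_of_cols N vs *\<^sub>v c) i = (\<Sum>l<length vs. c $ l * coord (vs ! l) i)"
proof -
  define w where "w = (if i < n then ds ! i else symp_J n *\<^sub>v (ds ! (i - n)))"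
  have w: "w \<in> carrier_vec N"
    using assms(3) ds_carrier by (auto simp: w_def intro!: mult_mat_vec_carrier[of _ _ N])
  have c: "coord v i = scalar_prod v w" if "v \<in> carrier_vec N" for v
  proof -
    have "coord v i = scalar_prod w v" by (simp add: coord_def w_def)
    then show ?thesis using comm_scalar_prod[OF w that] by simp
  qed
  have "vs ! l \<in> carrier_vec N" if "l < length vs" for l using assms(1) that by auto
  then show ?thesis using scalar_prod_combination[OF assms(1,2) w] assms(2)
    by (subst c) (auto intro!: mult_mat_vec_carrier[of _ _ "length vs"] sum.cong simp: c)
qed

text \<open>The lower coordinates of \<open>v\<close> are the values of the symplectic form against a basis of \<open>\<Lambda>0\<close>,
  so that their vanishing leaves a combination of the \<open>ds\<close>.\<close>

lemma Lam0_iff: "v \<in> \<Lambda>0 \<longleftrightarrow> v \<in> carrier_vec N \<and> (\<forall>i<n. coord v (n + i) = 0)"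
proof
  assume "v \<in> \<Lambda>0"
  then show "v \<in> carrier_vec N \<and> (\<forall>i<n. coord v (n + i) = 0)"
    using Lam_carrier ds_mem isotropic0 by (auto simp: coord_def)
next
  assume v: "v \<in> carrier_vec N \<and> (\<forall>i<n. coord v (n + i) = 0)"
  define c where "c = vec n (coord v)"
  define w where "w = mat_of_cols N ds *\<^sub>v c"
  have c: "c \<in> carrier_vec (length ds)" by (simp add: c_def length_ds)
  have sds: "set ds \<subseteq> carrier_vec N" using onb0 by (auto simp: orthonormal_basis_def)
  have w0: "w \<in> \<Lambda>0" using orthonormal_basis_eq[OF onb0] c by (auto simp: w_def)
  have "w = v"
  proof (rule coord_eqI)
    fix i assume i: "i < N"
    show "coord w i = coord v i"
    proof (cases "i < n")
      case True
      have "coord w i = (\<Sum>l<n. if l = i then c $ l else 0)"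
        unfolding w_def coord_combination[OF sds c i] length_ds
        using True by (intro sum.cong) (auto simp: coord_def ds_orthonormal)
      then show ?thesis using True by (simp add: c_def)
    next
      case False
      then have "coord w (n + (i - n)) = 0" "coord v (n + (i - n)) = 0"
        using i v isotropic0[OF ds_mem w0, of "i - n"] by (auto simp: coord_def)
      then show ?thesis using False by simp
    qed
  qed (use v w0 Lam_carrier in auto)
  then show "v \<in> \<Lambda>0" using w0 by simp
qed

text \<open>Completeness is the one point to check: subtracting the projection to \<open>\<Lambda>0 \<inter> \<Lambda>1\<close> moves a
  vector of \<open>\<Lambda>1\<close> into the orthogonal complement, which \<open>fs\<close> spans.\<close>

lemma onb1: "orthonormal_basis N (take k0 ds @ fs) \<Lambda>1"
proof -
  let ?vs = "take k0 ds @ fs"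
  have len: "length (take k0 ds) = k0" using k0_le length_ds by simp
  have sv: "set ?vs \<subseteq> \<Lambda>1"
    using ds_mem1 fs_mem k0_le length_ds by (auto simp: in_set_conv_nth)
  have svc: "set ?vs \<subseteq> carrier_vec N" using sv Lam_carrier by auto
  show ?thesis
    unfolding orthonormal_basis_def
  proof (intro conjI allI impI)
    show "set ?vs \<subseteq> carrier_vec N" by fact
    fix i j assume ij: "i < length ?vs" "j < length ?vs"
    have o: "scalar_prod (ds ! a) (fs ! b) = 0" "scalar_prod (fs ! b) (ds ! a) = 0" if "a < k0" "b < length fs" for a b
    proof -
      have "a < n" using that k0_le by simp
      then show "scalar_prod (fs ! b) (ds ! a) = 0" using fs_orth[OF that(2) ds_mem ds_mem1] that by blast
      then show "scalar_prod (ds ! a) (fs ! b) = 0"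
        using comm_scalar_prod[OF ds_carrier fs_carrier] \<open>a < n\<close> that by simp
    qed
    have f: "scalar_prod (fs ! a) (fs ! b) = (if a = b then 1 else 0)" if "a < length fs" "b < length fs" for a b
      using onb_V1 that by (auto simp: orthonormal_basis_def)
    show "scalar_prod (?vs ! i) (?vs ! j) = (if i = j then 1 else 0)"
      using ij k0_le o f ds_orthonormal by (auto simp: nth_append len)
  next
    interpret V: vec_space "TYPE(real)" N .
    have d: "\<forall>w\<in>set ?vs. dim_vec w = N" using svc by auto
    show "V.span (set ?vs) = \<Lambda>1"
    proof (intro equalityI subsetI)
      fix v assume "v \<in> V.span (set ?vs)"
      then obtain c where "v = V.lincomb_list c ?vs" using V.span_list_as_span[OF svc] by (auto simp: V.span_list_def)
      then show "v \<in> \<Lambda>1" unfolding V.lincomb_list_as_mat_mult[OF d] using combination_in_Lam1[OF sv] by simp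
    next
      fix v assume v: "v \<in> \<Lambda>1"
      define v0 where "v0 = mat_of_cols N (take k0 ds) *\<^sub>v vec k0 (\<lambda>j. scalar_prod (ds ! j) v)"
      define v1 where "v1 = v + (-1) \<cdot>\<^sub>v v0"
      have st: "set (take k0 ds) \<subseteq> carrier_vec N" using svc by auto
      have v0': "v0 \<in> \<Lambda>0 \<inter> \<Lambda>1" using orthonormal_basis_eq[OF onb_V0] len by (auto simp: v0_def)
      have vc: "v \<in> carrier_vec N" "v0 \<in> carrier_vec N" using v v0' Lam_carrier by auto
      have "v1 \<in> orth_complement_in (\<Lambda>0 \<inter> \<Lambda>1) \<Lambda>1"
        unfolding orth_complement_in_def mem_Collect_eq
      proof (intro conjI ballI)
        show "v1 \<in> \<Lambda>1" unfolding v1_def using v v0' Lam1_closed by auto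
        fix w assume "w \<in> \<Lambda>0 \<inter> \<Lambda>1"
        then obtain c where c: "c \<in> carrier_vec k0" "w = mat_of_cols N (take k0 ds) *\<^sub>v c"
          using orthonormal_basis_eq[OF onb_V0] len by auto
        have v1c: "v1 \<in> carrier_vec N" using vc by (simp add: v1_def)
        have "scalar_prod (ds ! j) v1 = 0" if j: "j < k0" for j
        proof -
          have dj: "ds ! j \<in> carrier_vec N" using j k0_le ds_carrier by simp
          have "scalar_prod v0 (take k0 ds ! j) = scalar_prod (ds ! j) v"
            unfolding v0_def using orthonormal_basis_coeff[OF onb_V0, of "vec k0 (\<lambda>j. scalar_prod (ds ! j) v)" j] j len by simp
          then have "scalar_prod (ds ! j) v0 = scalar_prod (ds ! j) v"
            using comm_scalar_prod[OF dj vc(2)] j by simp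
          then show ?thesis unfolding v1_def using dj vc by (simp add: scalar_prod_add_distrib[of _ N])
        qed
        then have "scalar_prod w v1 = 0"
          unfolding c(2) using scalar_prod_combination[OF st, of c v1] c(1) len v1c by simp
        then show "scalar_prod v1 w = 0"
          using comm_scalar_prod[OF v1c] c(2) Lam_carrier \<open>w \<in> \<Lambda>0 \<inter> \<Lambda>1\<close> by (metis IntD1)
      qed
      then obtain b where b: "b \<in> carrier_vec (length fs)" "v1 = mat_of_cols N fs *\<^sub>v b"
        using orthonormal_basis_eq[OF onb_V1] by auto
      have sub: "V.span (set xs) \<subseteq> V.span (set ?vs)" if "set xs \<subseteq> set ?vs" for xs
        using V.span_is_monotone[OF that] .
      have "v0 \<in> V.span (set (take k0 ds))" "v1 \<in> V.span (set fs)"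
        using v0' onb_V0 \<open>v1 \<in> orth_complement_in _ _\<close> onb_V1 by (auto simp: orthonormal_basis_def)
      then have "v0 + v1 \<in> V.span (set ?vs)"
        using sub[of "take k0 ds"] sub[of fs] svc by (intro V.span_add1) auto
      moreover have "v0 + v1 = v" using vc by (intro eq_vecI) (auto simp: v1_def)
      ultimately show "v \<in> V.span (set ?vs)" by simp
    qed
  qed
qed

lemma length_fs: "length fs = n - k0"
proof -
  have "length (take k0 ds @ fs) = n" using subspace_dim_orthonormal_basis[OF onb1] lag1 by (simp add: lagrangian_def)
  then show ?thesis using k0_le length_ds by simp
qed

end

text \<open>A real linear condition holds for a complex vector if and only if it holds for its real and
  its imaginary part.\<close>

lemma complexify_linear_conditions:
  assumes L: "\<And>v. v \<in> L \<longleftrightarrow> v \<in> carrier_vec N \<and> (\<forall>i\<in>I. (M *\<^sub>v v) $ i = 0)"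
    and M: "M \<in> carrier_mat N N" and I: "I \<subseteq> {..<N}"
  shows "v \<in> complexify L \<longleftrightarrow> v \<in> carrier_vec N \<and> (\<forall>i\<in>I. (cmat M *\<^sub>v v) $ i = 0)"
proof -
  have cM: "cmat M \<in> carrier_mat N N" using M by (simp add: cmat_def)
  have ReIm: "(map_vec Re v \<in> carrier_vec N \<and> map_vec Im v \<in> carrier_vec N)" 
     "Re ((cmat M *\<^sub>v v) $ i) = (M *\<^sub>v map_vec Re v) $ i" 
     "Im ((cmat M *\<^sub>v v) $ i) = (M *\<^sub>v map_vec Im v) $ i" 
    if v: "v \<in> carrier_vec N" and i: "i < N" for v i
  proof -
    have c: "map_vec Re v \<in> carrier_vec N" "map_vec Im v \<in> carrier_vec N" using v by auto
    then show "(map_vec Re v \<in> carrier_vec N \<and> map_vec Im v \<in> carrier_vec N)" by simp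
    show "Re ((cmat M *\<^sub>v v) $ i) = (M *\<^sub>v map_vec Re v) $ i" 
     "Im ((cmat M *\<^sub>v v) $ i) = (M *\<^sub>v map_vec Im v) $ i" 
      unfolding index_mult_mat_vec_sum[OF cM v i] index_mult_mat_vec_sum[OF M c(1) i] index_mult_mat_vec_sum[OF M c(2) i]
      using v i M by (auto simp: cmat_def intro!: sum.cong)
  qed
  have bij: "v \<in> complexify L \<longleftrightarrow> v \<in> carrier_vec N \<and> map_vec Re v \<in> L \<and> map_vec Im v \<in> L"
  proof
    assume "v \<in> complexify L"
    then obtain a b where ab: "a \<in> L" "b \<in> L" "v = map_vec complex_of_real a + \<i> \<cdot>\<^sub>v map_vec complex_of_real b"
      by (auto simp: complexify_def)
    then have c: "a \<in> carrier_vec N" "b \<in> carrier_vec N" using L by auto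
    have "map_vec Re v = a" "map_vec Im v = b" unfolding ab(3) using c by (auto intro!: eq_vecI)
    then show "v \<in> carrier_vec N \<and> map_vec Re v \<in> L \<and> map_vec Im v \<in> L" using ab c by auto
  next
    assume v: "v \<in> carrier_vec N \<and> map_vec Re v \<in> L \<and> map_vec Im v \<in> L"
    have "v = map_vec complex_of_real (map_vec Re v) + \<i> \<cdot>\<^sub>v map_vec complex_of_real (map_vec Im v)"
      by (rule eq_vecI) (auto simp: complex_eq)
    then show "v \<in> complexify L" using v by (auto simp: complexify_def)
  qed
  show ?thesis
    unfolding bij L using I ReIm by (auto simp: complex_eq_iff subset_iff)
qed

context lagrangian_frame
begin

abbreviation "M3 \<equiv> M3_mat n k0 ds fs"
abbreviation "Xt \<equiv> X_tilde n k0 ds fs"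
abbreviation "Yt \<equiv> Y_tilde n k0 ds fs"

lemma sfs: "set fs \<subseteq> carrier_vec N"
  using onb_V1 by (auto simp: orthonormal_basis_def)

lemma XY_index:
  assumes "i < n - k0" "j < n - k0"
  shows "Xt $$ (i, j) = coord (fs ! j) (k0 + i)" "Yt $$ (i, j) = coord (fs ! j) (n + k0 + i)"
proof -
  have "(transpose_mat (M1_mat n ds) * mat_of_cols N fs) $$ (a, j) = coord (fs ! j) a" if a: "a < N" for a
  proof -
    have "(transpose_mat (M1_mat n ds) * mat_of_cols N fs) $$ (a, j) = (transpose_mat (M1_mat n ds) *\<^sub>v (fs ! j)) $ a"
      using a assms length_fs M1_carrier fs_carrier by (simp add: col_mat_of_cols)
    then show ?thesis using M1T_mult[OF fs_carrier a] assms length_fs by simp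
  qed
  then show "Xt $$ (i, j) = coord (fs ! j) (k0 + i)" "Yt $$ (i, j) = coord (fs ! j) (n + k0 + i)"
    using assms by (auto simp: X_tilde_def Y_tilde_def)
qed

lemma coord_fs_0: "l < n - k0 \<Longrightarrow> i < k0 \<Longrightarrow> coord (fs ! l) i = 0" "l < n - k0 \<Longrightarrow> i < k0 \<Longrightarrow> coord (fs ! l) (n + i) = 0"
proof -
  assume l: "l < n - k0" and i: "i < k0"
  have i': "i < n" using i k0_le by simp
  show "coord (fs ! l) i = 0"
    using fs_orth[of l "ds ! i"] l i i' length_fs ds_mem ds_mem1 comm_scalar_prod[OF ds_carrier[OF i'] fs_carrier[of l]]
    by (simp add: coord_def)
  show "coord (fs ! l) (n + i) = 0"
    using isotropic1[OF ds_mem1[OF i] fs_mem] l length_fs by (simp add: coord_def)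
qed

text \<open>A kernel vector yields an element of \<open>\<Lambda>1\<close> with vanishing lower coordinates, which lies in
  \<open>\<Lambda>0\<close> and is orthogonal to \<open>\<Lambda>0 \<inter> \<Lambda>1\<close>.\<close>

lemma Yt_nonsingular: "det Yt \<noteq> 0"
proof
  have Y: "Yt \<in> carrier_mat (n - k0) (n - k0)" by (simp add: Y_tilde_def)
  assume "det Yt = 0"
  then obtain c where c: "c \<in> carrier_vec (n - k0)" "c \<noteq> 0\<^sub>v (n - k0)" "Yt *\<^sub>v c = 0\<^sub>v (n - k0)"
    using det_0_iff_vec_prod_zero_field[OF Y] by auto
  have c': "c \<in> carrier_vec (length fs)" using c length_fs by simp
  define f where "f = mat_of_cols N fs *\<^sub>v c"
  have f_orth: "f \<in> orth_complement_in (\<Lambda>0 \<inter> \<Lambda>1) \<Lambda>1"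
    using orthonormal_basis_eq[OF onb_V1] c' by (auto simp: f_def)
  have f_coord: "coord f i = (\<Sum>l<n - k0. c $ l * coord (fs ! l) i)" if "i < N" for i
    unfolding f_def using coord_combination[OF sfs c' that] length_fs by simp
  have "coord f (n + i) = 0" if i: "i < n" for i
  proof (cases "i < k0")
    case True
    then show ?thesis using f_coord[of "n + i"] i coord_fs_0 by simp
  next
    case False
    then have "coord f (n + i) = (\<Sum>l<n - k0. Yt $$ (i - k0, l) * c $ l)"
      using f_coord[of "n + i"] i by (simp add: XY_index mult.commute)
    also have "\<dots> = (Yt *\<^sub>v c) $ (i - k0)"
      using i False by (intro index_mult_mat_vec_sum[OF Y c(1), symmetric]) auto
    finally show ?thesis using c(3) i False by simp
  qed
  then have "f \<in> \<Lambda>0" using Lam0_iff f_orth Lam_carrier by (auto simp: orth_complement_in_def)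
  then have "scalar_prod (fs ! l) f = 0" if "l < length fs" for l
    using fs_orth[OF that] f_orth by (auto simp: orth_complement_in_def)
  then have "c $ l = 0" if "l < length fs" for l
    using orthonormal_basis_coeff[OF onb_V1 c' that] that
      comm_scalar_prod[OF fs_carrier[OF that], of f] f_orth Lam_carrier by (auto simp: f_def orth_complement_in_def)
  then have "c = 0\<^sub>v (n - k0)" using c length_fs by (intro eq_vecI) auto
  then show False using c by simp
qed

definition Zm :: "real mat" where
  "Zm = four_block_mat (0\<^sub>m k0 k0) (0\<^sub>m k0 (n - k0)) (0\<^sub>m (n - k0) k0) (- (Xt * inv_mat Yt))"

lemma Zm_carrier: "Zm \<in> carrier_mat n n"
  using k0_le inv_mat_inverse(1)[OF _ Yt_nonsingular, of "n - k0"]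
  by (auto simp: Zm_def X_tilde_def Y_tilde_def)

lemma Zm_index:
  assumes "i < n" "j < n"
  shows "Zm $$ (i, j) = (if i < k0 \<or> j < k0 then 0 else - (Xt * inv_mat Yt) $$ (i - k0, j - k0))"
  using assms k0_le inv_mat_inverse(1)[OF _ Yt_nonsingular, of "n - k0"]
  by (auto simp: Zm_def X_tilde_def Y_tilde_def)

definition Sm :: "real mat" where
  "Sm = four_block_mat (1\<^sub>m n) Zm (0\<^sub>m n n) (1\<^sub>m n)"

lemma Sm_carrier: "Sm \<in> carrier_mat N N"
  using Zm_carrier by (simp add: Sm_def mult_2)

lemma M3_eq: "M3 = Sm * transpose_mat (M1_mat n ds)"
  by (simp add: M3_mat_def Sm_def Zm_def)

lemma M3_carrier: "M3 \<in> carrier_mat N N"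
  unfolding M3_eq using Sm_carrier M1_carrier by simp

lemma M3_det: "det M3 \<noteq> 0"
proof -
  have "det Sm = 1" unfolding Sm_def
    using Zm_carrier by (subst det_four_block_mat_lower_left_zero[of _ n _ n]) auto
  moreover have "det (transpose_mat (M1_mat n ds)) * det (M1_mat n ds) = 1"
    using det_mult[of "transpose_mat (M1_mat n ds)" N "M1_mat n ds"] M1_orthogonal M1_carrier by simp
  moreover have "det M3 = det Sm * det (transpose_mat (M1_mat n ds))"
    unfolding M3_eq using Sm_carrier M1_carrier by (intro det_mult) auto
  ultimately show ?thesis by auto
qed

lemma M3_mult_vec:
  assumes v: "v \<in> carrier_vec N" and i: "i < n"
  shows "(M3 *\<^sub>v v) $ i = coord v i + (\<Sum>j<n. Zm $$ (i, j) * coord v (n + j))"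
    and "(M3 *\<^sub>v v) $ (n + i) = coord v (n + i)"
proof -
  define w where "w = transpose_mat (M1_mat n ds) *\<^sub>v v"
  have w: "w \<in> carrier_vec N" unfolding w_def using M1_carrier v by (intro mult_mat_vec_carrier) auto
  have wi: "w $ q = coord v q" if "q < N" for q unfolding w_def using M1T_mult[OF v that] .
  have e: "M3 *\<^sub>v v = Sm *\<^sub>v w"
    unfolding M3_eq w_def using Sm_carrier M1_carrier v by (intro assoc_mult_mat_vec) auto
  have i2: "i < N" "n + i < N" using i by auto
  show "(M3 *\<^sub>v v) $ i = coord v i + (\<Sum>j<n. Zm $$ (i, j) * coord v (n + j))"
    unfolding e index_mult_mat_vec_sum[OF Sm_carrier w i2(1)] mult_2 sum_lessThan_add
    using i Zm_carrier by (simp add: Sm_def wi if_distrib[of "\<lambda>x. x * _"] cong: if_cong)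
  show "(M3 *\<^sub>v v) $ (n + i) = coord v (n + i)"
    unfolding e index_mult_mat_vec_sum[OF Sm_carrier w i2(2)] mult_2 sum_lessThan_add
    using i Zm_carrier by (simp add: Sm_def wi if_distrib[of "\<lambda>x. x * _"] cong: if_cong)
qed

lemma M3_Lam0: "v \<in> \<Lambda>0 \<longleftrightarrow> v \<in> carrier_vec N \<and> (\<forall>i\<in>{n..<N}. (M3 *\<^sub>v v) $ i = 0)"
proof -
  have "(\<forall>i\<in>{n..<N}. (M3 *\<^sub>v v) $ i = 0) \<longleftrightarrow> (\<forall>i<n. coord v (n + i) = 0)" if v: "v \<in> carrier_vec N"
  proof
    assume a: "\<forall>i\<in>{n..<N}. (M3 *\<^sub>v v) $ i = 0"
    show "\<forall>i<n. coord v (n + i) = 0"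
    proof (intro allI impI)
      fix i assume "i < n"
      then have "n + i \<in> {n..<N}" by simp
      then show "coord v (n + i) = 0" using a M3_mult_vec(2)[OF v \<open>i < n\<close>] by metis
    qed
  next
    assume a: "\<forall>i<n. coord v (n + i) = 0"
    show "\<forall>i\<in>{n..<N}. (M3 *\<^sub>v v) $ i = 0"
    proof
      fix i assume "i \<in> {n..<N}"
      then have "i - n < n" "n + (i - n) = i" by auto
      then show "(M3 *\<^sub>v v) $ i = 0" using a M3_mult_vec(2)[OF v, of "i - n"] by metis
    qed
  qed
  then show ?thesis using Lam0_iff by auto
qed

lemma M3_fs:
  assumes l: "l < n - k0" and i: "i < n"
  shows "(M3 *\<^sub>v (fs ! l)) $ (k0 + i) = (if i < n - k0 then 0 else coord (fs ! l) (k0 + i))"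
proof (cases "i < n - k0")
  case True
  have f: "fs ! l \<in> carrier_vec N" using l length_fs fs_carrier by simp
  have iY: "inv_mat Yt \<in> carrier_mat (n - k0) (n - k0)" "inv_mat Yt * Yt = 1\<^sub>m (n - k0)"
    using inv_mat_inverse[OF _ Yt_nonsingular, of "n - k0"] by (auto simp: Y_tilde_def)
  have X: "Xt \<in> carrier_mat (n - k0) (n - k0)" and Y: "Yt \<in> carrier_mat (n - k0) (n - k0)"
    by (auto simp: X_tilde_def Y_tilde_def)
  have "(\<Sum>j<n. Zm $$ (k0 + i, j) * coord (fs ! l) (n + j)) = (\<Sum>j<k0 + (n - k0). Zm $$ (k0 + i, j) * coord (fs ! l) (n + j))"
    using k0_le by simp
  also have "\<dots> = (\<Sum>j<n - k0. - (Xt * inv_mat Yt) $$ (i, j) * Yt $$ (j, l))"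
    unfolding sum_lessThan_add using True l by (simp add: Zm_index XY_index coord_fs_0(2) add.assoc)
  also have "\<dots> = - ((Xt * inv_mat Yt) * Yt) $$ (i, l)"
    using index_mult_mat_sum[OF mult_carrier_mat[OF X iY(1)] Y True l] by (simp add: sum_negf)
  also have "(Xt * inv_mat Yt) * Yt = Xt" using assoc_mult_mat[OF X iY(1) Y] iY X by simp
  finally have "(\<Sum>j<n. Zm $$ (k0 + i, j) * coord (fs ! l) (n + j)) = - Xt $$ (i, l)" .
  then show ?thesis using M3_mult_vec(1)[OF f, of "k0 + i"] True l by (simp add: XY_index del: index_mult_mat_vec)
next
  case False
  have f: "fs ! l \<in> carrier_vec N" using l length_fs fs_carrier by simp
  have "k0 + i = n + (k0 + i - n)" "k0 + i - n < n" using False i k0_le by auto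
  then show ?thesis using M3_mult_vec(2)[OF f, of "k0 + i - n"] False by simp
qed

text \<open>The shear in \<open>M\<^sub>3\<close> fixes the first \<open>k\<^sub>0\<close> coordinate directions and moves the span of the
  \<open>fs\<close> onto the span of the coordinate directions \<open>n + k\<^sub>0, \<dots>, 2 n - 1\<close>, because it annihilates
  their middle coordinates and \<open>Y\<close> is nonsingular.\<close>

lemma M3_Lam1: "v \<in> \<Lambda>1 \<longleftrightarrow> v \<in> carrier_vec N \<and> (\<forall>i\<in>{k0..<k0 + n}. (M3 *\<^sub>v v) $ i = 0)"
proof -
  have fwd_f: "(M3 *\<^sub>v (fs ! l)) $ i = 0" if "l < n - k0" "i \<in> {k0..<k0 + n}" for l i
  proof -
    have "(M3 *\<^sub>v (fs ! l)) $ (k0 + (i - k0)) = 0"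
      using M3_fs[OF that(1), of "i - k0"] coord_fs_0(2)[OF that(1), of "i - n"] that k0_le
      by (auto simp del: index_mult_mat_vec)
    then show ?thesis using that by simp
  qed
  have coord_ds: "coord (ds ! j) i = (if i = j then 1 else 0)" if "j < n" "i < N" for i j
    using that ds_orthonormal isotropic0[OF ds_mem ds_mem, of "i - n" j] by (auto simp: coord_def)
  have fwd_d: "(M3 *\<^sub>v (ds ! j)) $ i = 0" if j: "j < k0" and i: "i \<in> {k0..<k0 + n}" for j i
  proof -
    have j': "j < n" using j k0_le by simp
    note d = ds_carrier[OF j']
    show ?thesis
    proof (cases "i < n")
      case True
      then show ?thesis using M3_mult_vec(1)[OF d True] i j j' by (simp add: coord_ds del: index_mult_mat_vec)
    next
      case False
      then show ?thesis using M3_mult_vec(2)[OF d, of "i - n"] i j j' k0_le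
        by (simp add: coord_ds del: index_mult_mat_vec)
    qed
  qed
  let ?vs = "take k0 ds @ fs"
  have len: "length (take k0 ds) = k0" using k0_le length_ds by simp
  have lenv: "length ?vs = n" using len length_fs k0_le by simp
  have sv: "set ?vs \<subseteq> \<Lambda>1"
    using ds_mem1 fs_mem k0_le length_ds by (auto simp: in_set_conv_nth)
  have svc: "set ?vs \<subseteq> carrier_vec N" using sv Lam_carrier by auto
  have M3_comb: "(M3 *\<^sub>v (mat_of_cols N ?vs *\<^sub>v c)) $ i = (\<Sum>l<n. c $ l * (M3 *\<^sub>v (?vs ! l)) $ i)"
    if c: "c \<in> carrier_vec n" and i: "i < N" for c i
  proof -
    have m: "mat_of_cols N ?vs \<in> carrier_mat N n" using mat_of_cols_carrier(1)[of N ?vs] lenv by simp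
    have "M3 *\<^sub>v (mat_of_cols N ?vs *\<^sub>v c) = (M3 * mat_of_cols N ?vs) *\<^sub>v c"
      using assoc_mult_mat_vec[OF M3_carrier m c] by simp
    also have "\<dots> $ i = (\<Sum>l<n. (M3 * mat_of_cols N ?vs) $$ (i, l) * c $ l)"
      by (rule index_mult_mat_vec_sum[OF mult_carrier_mat[OF M3_carrier m] c i])
    also have "\<dots> = (\<Sum>l<n. c $ l * (M3 *\<^sub>v (?vs ! l)) $ i)"
    proof (rule sum.cong[OF refl])
      fix l assume l: "l \<in> {..<n}"
      have "?vs ! l \<in> carrier_vec N" using svc l lenv nth_mem[of l ?vs] by auto
      then have "col (mat_of_cols N ?vs) l = ?vs ! l" using l lenv by (intro col_mat_of_cols) auto
      then show "(M3 * mat_of_cols N ?vs) $$ (i, l) * c $ l = c $ l * (M3 *\<^sub>v (?vs ! l)) $ i"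
        using M3_carrier i l lenv m by simp
    qed
    finally show ?thesis .
  qed
  have vs_nth: "?vs ! l = (if l < k0 then ds ! l else fs ! (l - k0))" for l using len by (simp add: nth_append)
  have bwd: "v \<in> \<Lambda>1" if v: "v \<in> carrier_vec N" and z: "\<forall>i\<in>{k0..<k0 + n}. (M3 *\<^sub>v v) $ i = 0" for v
  proof -
    have Y: "Yt \<in> carrier_mat (n - k0) (n - k0)" by (auto simp: Y_tilde_def)
    note iY = inv_mat_inverse[OF Y Yt_nonsingular]
    define b where "b = inv_mat Yt *\<^sub>v vec (n - k0) (\<lambda>i. coord v (n + k0 + i))"
    have b: "b \<in> carrier_vec (n - k0)" unfolding b_def using iY(1) by (intro mult_mat_vec_carrier) auto
    have Yb: "Yt *\<^sub>v b = vec (n - k0) (\<lambda>i. coord v (n + k0 + i))"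
      unfolding b_def using assoc_mult_mat_vec[OF Y iY(1), of "vec (n - k0) (\<lambda>i. coord v (n + k0 + i))"] iY(2) by simp
    define c where "c = vec n (\<lambda>l. if l < k0 then (M3 *\<^sub>v v) $ l else b $ (l - k0))"
    have c: "c \<in> carrier_vec n" by (simp add: c_def)
    define v' where "v' = mat_of_cols N ?vs *\<^sub>v c"
    have v': "v' \<in> \<Lambda>1" unfolding v'_def using combination_in_Lam1[OF sv] c lenv by simp
    have v'c: "v' \<in> carrier_vec N" using v' Lam_carrier by simp
    have sp: "(M3 *\<^sub>v v') $ i = (\<Sum>l<k0. (M3 *\<^sub>v v) $ l * (M3 *\<^sub>v (ds ! l)) $ i) + (\<Sum>l<n - k0. b $ l * (M3 *\<^sub>v (fs ! l)) $ i)"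
      if "i < N" for i
    proof -
      have "(M3 *\<^sub>v v') $ i = (\<Sum>l<k0 + (n - k0). c $ l * (M3 *\<^sub>v (?vs ! l)) $ i)"
        unfolding v'_def M3_comb[OF c that] using k0_le by simp
      then show ?thesis unfolding sum_lessThan_add using k0_le
        by (simp add: vs_nth c_def del: index_mult_mat_vec)
    qed
    have "M3 *\<^sub>v v' = M3 *\<^sub>v v"
    proof (rule eq_vecI)
      fix i assume "i < dim_vec (M3 *\<^sub>v v)"
      then have i: "i < N" using M3_carrier by simp
      consider "i < k0" | "i \<in> {k0..<k0 + n}" | "k0 + n \<le> i" by force
      then show "(M3 *\<^sub>v v') $ i = (M3 *\<^sub>v v) $ i"
      proof cases
        case 1
        then have i': "i < n" using k0_le by simp
        have zz: "(\<Sum>j<n. Zm $$ (i, j) * f j) = 0" for f :: "nat \<Rightarrow> real"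
          using 1 i' by (simp add: Zm_index)
        have "(M3 *\<^sub>v (ds ! l)) $ i = (if l = i then 1 else 0)" if "l < k0" for l
          using M3_mult_vec(1)[OF ds_carrier i', of l] zz that k0_le i by (simp add: coord_ds del: index_mult_mat_vec)
        moreover have "(M3 *\<^sub>v (fs ! l)) $ i = 0" if "l < n - k0" for l
          using M3_mult_vec(1)[OF fs_carrier i', of l] zz that length_fs coord_fs_0(1)[OF that 1]
          by (simp del: index_mult_mat_vec)
        ultimately show ?thesis using 1 unfolding sp[OF i]
          by (simp add: if_distrib[of "\<lambda>x. _ * x"] del: index_mult_mat_vec cong: if_cong)
      next
        case 2
        then show ?thesis unfolding sp[OF i] using z fwd_d fwd_f by (simp del: index_mult_mat_vec)
      next
        case 3
        define p where "p = i - (n + k0)"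
        have p: "i = n + (k0 + p)" "p < n - k0" "k0 + p < n" using 3 i by (auto simp: p_def)
        have "(M3 *\<^sub>v (ds ! l)) $ i = 0" if "l < k0" for l
          using M3_mult_vec(2)[OF ds_carrier p(3), of l] that k0_le i p by (simp add: coord_ds del: index_mult_mat_vec)
        moreover have "(M3 *\<^sub>v (fs ! l)) $ i = Yt $$ (p, l)" if "l < n - k0" for l
          using M3_mult_vec(2)[OF fs_carrier p(3), of l] that length_fs p by (simp add: XY_index add.assoc del: index_mult_mat_vec)
        ultimately have "(M3 *\<^sub>v v') $ i = (\<Sum>l<n - k0. Yt $$ (p, l) * b $ l)"
          unfolding sp[OF i] by (simp add: mult.commute del: index_mult_mat_vec)
        also have "\<dots> = (Yt *\<^sub>v b) $ p" by (rule index_mult_mat_vec_sum[OF Y b p(2), symmetric])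
        also have "\<dots> = (M3 *\<^sub>v v) $ i"
          unfolding Yb using p M3_mult_vec(2)[OF v p(3)] by (simp add: add.assoc del: index_mult_mat_vec)
        finally show ?thesis .
      qed
    qed (use M3_carrier in auto)
    then have "inv_mat M3 *\<^sub>v (M3 *\<^sub>v v') = inv_mat M3 *\<^sub>v (M3 *\<^sub>v v)" by simp
    then have "v' = v"
      using inv_mat_inverse[OF M3_carrier M3_det] assoc_mult_mat_vec[of "inv_mat M3" N N M3 N v'] assoc_mult_mat_vec[of "inv_mat M3" N N M3 N v]
        M3_carrier v v'c by simp
    then show ?thesis using v' by simp
  qed
  have fwd: "(M3 *\<^sub>v v) $ i = 0" if v: "v \<in> \<Lambda>1" and i: "i \<in> {k0..<k0 + n}" for v i
  proof -
    have iN: "i < N" using i k0_le by auto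
    obtain c where c: "c \<in> carrier_vec n" "v = mat_of_cols N ?vs *\<^sub>v c"
      using orthonormal_basis_eq[OF onb1] lenv v by auto
    have "(M3 *\<^sub>v v) $ i = (\<Sum>l<n. c $ l * (M3 *\<^sub>v (?vs ! l)) $ i)" unfolding c(2) by (rule M3_comb[OF c(1) iN])
    also have "\<dots> = 0"
      using fwd_d fwd_f i by (intro sum.neutral) (auto simp: vs_nth simp del: index_mult_mat_vec)
    finally show ?thesis .
  qed
  show ?thesis using fwd bwd Lam_carrier by blast
qed

lemma cM3_carrier: "cmat M3 \<in> carrier_mat N N"
  using M3_carrier by (simp add: cmat_def)

theorem complexify_Lam0: "v \<in> complexify \<Lambda>0 \<longleftrightarrow> v \<in> carrier_vec N \<and> (\<forall>i\<in>{n..<N}. (cmat M3 *\<^sub>v v) $ i = 0)"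
  by (rule complexify_linear_conditions[OF M3_Lam0 M3_carrier]) auto

theorem complexify_Lam1: "v \<in> complexify \<Lambda>1 \<longleftrightarrow> v \<in> carrier_vec N \<and> (\<forall>i\<in>{k0..<k0 + n}. (cmat M3 *\<^sub>v v) $ i = 0)"
  by (rule complexify_linear_conditions[OF M3_Lam1 M3_carrier]) (use k0_le in auto)

end

section \<open>Linear systems of differential equations\<close>

definition mat_path :: "real \<Rightarrow> nat \<Rightarrow> nat \<Rightarrow> (real \<Rightarrow> real mat) \<Rightarrow> bool" where
  "mat_path T r c M \<longleftrightarrow> (\<forall>t\<in>{0..T}. M t \<in> carrier_mat r c) \<and>
     (\<forall>i<r. \<forall>j<c. continuous_on {0..T} (\<lambda>t. M t $$ (i, j)))"

lemma mat_path_mult: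
  assumes "mat_path T r m A" "mat_path T m c B"
  shows "mat_path T r c (\<lambda>t. A t * B t)"
  unfolding mat_path_def
proof (intro conjI allI impI ballI)
  fix i j assume ij: "i < r" "j < c"
  have "continuous_on {0..T} (\<lambda>t. \<Sum>q<m. A t $$ (i, q) * B t $$ (q, j))"
    using assms ij by (intro continuous_intros) (auto simp: mat_path_def)
  then show "continuous_on {0..T} (\<lambda>t. (A t * B t) $$ (i, j))"
    by (rule continuous_on_eq) (use assms ij in \<open>auto simp: mat_path_def index_mult_mat_sum[of _ r m _ c] simp del: index_mult_mat(1)\<close>)
qed (use assms in \<open>auto simp: mat_path_def intro!: mult_carrier_mat\<close>)

lemma mat_path_transpose: "mat_path T r c A \<Longrightarrow> mat_path T c r (\<lambda>t. transpose_mat (A t))"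
  unfolding mat_path_def
proof (intro conjI allI impI ballI)
  fix i j assume a: "(\<forall>t\<in>{0..T}. A t \<in> carrier_mat r c) \<and> (\<forall>i<r. \<forall>j<c. continuous_on {0..T} (\<lambda>t. A t $$ (i, j)))"
    and ij: "i < c" "j < r"
  then have "continuous_on {0..T} (\<lambda>t. A t $$ (j, i))" by simp
  moreover have "dim_row (A t) = r" "dim_col (A t) = c" if "t \<in> {0..T}" for t using a that by auto
  ultimately show "continuous_on {0..T} (\<lambda>t. transpose_mat (A t) $$ (i, j))"
    by (elim continuous_on_eq) (use ij in auto)
qed auto

lemma mat_path_minus: "mat_path T r c A \<Longrightarrow> mat_path T r c B \<Longrightarrow> mat_path T r c (\<lambda>t. A t - B t)"
  unfolding mat_path_def
proof (intro conjI allI impI ballI)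
  fix i j assume a: "(\<forall>t\<in>{0..T}. A t \<in> carrier_mat r c) \<and> (\<forall>i<r. \<forall>j<c. continuous_on {0..T} (\<lambda>t. A t $$ (i, j)))"
    "(\<forall>t\<in>{0..T}. B t \<in> carrier_mat r c) \<and> (\<forall>i<r. \<forall>j<c. continuous_on {0..T} (\<lambda>t. B t $$ (i, j)))"
    and ij: "i < r" "j < c"
  then have "continuous_on {0..T} (\<lambda>t. A t $$ (i, j) - B t $$ (i, j))" by (intro continuous_intros) auto
  moreover have "dim_row (B t) = r" "dim_col (B t) = c" if "t \<in> {0..T}" for t using a that by auto
  ultimately show "continuous_on {0..T} (\<lambda>t. (A t - B t) $$ (i, j))"
    by (elim continuous_on_eq) (use ij in auto)
qed (auto intro!: minus_carrier_mat)

lemma mat_path_uminus: "mat_path T r c A \<Longrightarrow> mat_path T r c (\<lambda>t. - A t)"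
  unfolding mat_path_def
proof (intro conjI allI impI ballI)
  fix i j assume a: "(\<forall>t\<in>{0..T}. A t \<in> carrier_mat r c) \<and> (\<forall>i<r. \<forall>j<c. continuous_on {0..T} (\<lambda>t. A t $$ (i, j)))"
    and ij: "i < r" "j < c"
  then have "continuous_on {0..T} (\<lambda>t. - A t $$ (i, j))" by (intro continuous_intros) auto
  moreover have "dim_row (A t) = r" "dim_col (A t) = c" if "t \<in> {0..T}" for t using a that by auto
  ultimately show "continuous_on {0..T} (\<lambda>t. (- A t) $$ (i, j))"
    by (elim continuous_on_eq) (use ij in auto)
qed (auto intro!: uminus_carrier_mat)

lemma mat_path_const: "A \<in> carrier_mat r c \<Longrightarrow> mat_path T r c (\<lambda>t. A)"
  by (auto simp: mat_path_def)

lemma mat_path_four_block: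
  assumes "mat_path T r c A" "mat_path T r c' B" "mat_path T r' c C" "mat_path T r' c' D"
  shows "mat_path T (r + r') (c + c') (\<lambda>t. four_block_mat (A t) (B t) (C t) (D t))"
  unfolding mat_path_def
proof (intro conjI allI impI ballI)
  fix t assume "t \<in> {0..T}"
  then show "four_block_mat (A t) (B t) (C t) (D t) \<in> carrier_mat (r + r') (c + c')"
    using assms by (auto simp: mat_path_def)
next
  fix i j assume ij: "i < r + r'" "j < c + c'"
  have "continuous_on {0..T} (\<lambda>t. if i < r then if j < c then A t $$ (i, j) else B t $$ (i, j - c)
       else if j < c then C t $$ (i - r, j) else D t $$ (i - r, j - c))"
    using assms ij by (cases "i < r"; cases "j < c") (auto simp: mat_path_def)
  then show "continuous_on {0..T} (\<lambda>t. four_block_mat (A t) (B t) (C t) (D t) $$ (i, j))"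
  proof (rule continuous_on_eq)
    fix t assume "t \<in> {0..T}"
    then have "dim_row (A t) = r" "dim_col (A t) = c" "dim_row (D t) = r'" "dim_col (D t) = c'" using assms by (auto simp: mat_path_def)
    then show "(if i < r then if j < c then A t $$ (i, j) else B t $$ (i, j - c)
       else if j < c then C t $$ (i - r, j) else D t $$ (i - r, j - c)) = four_block_mat (A t) (B t) (C t) (D t) $$ (i, j)"
      using ij by auto
  qed
qed

lemma continuous_det_path:
  assumes "mat_path T n n A"
  shows "continuous_on {0..T} (\<lambda>t. det (A t))"
proof -
  have "continuous_on {0..T} (\<lambda>t. \<Sum>p\<in>{p. p permutes {0..<n}}. signof p * (\<Prod>i = 0..<n. A t $$ (i, p i)))"
  proof (intro continuous_intros)
    fix p i assume "p \<in> {p. p permutes {0..<n}}" "i \<in> {0..<n}"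
    then have "i < n" "p i < n" using permutes_in_image[of p "{0..<n}" i] by auto
    then show "continuous_on {0..T} (\<lambda>t. A t $$ (i, p i))" using assms by (auto simp: mat_path_def)
  qed
  then show ?thesis
    by (rule continuous_on_eq) (use assms in \<open>auto simp: mat_path_def det_def'[of _ n]\<close>)
qed

text \<open>Continuity is read off from the adjugate formula.\<close>

lemma mat_path_inverse:
  assumes A: "mat_path T n n A" and d: "\<And>t. t \<in> {0..T} \<Longrightarrow> det (A t) \<noteq> 0"
  shows "mat_path T n n (\<lambda>t. inv_mat (A t))"
  unfolding mat_path_def
proof (intro conjI allI impI ballI)
  fix t assume "t \<in> {0..T}"
  then show "inv_mat (A t) \<in> carrier_mat n n" using A d inv_mat_inverse(1)[of "A t" n] by (auto simp: mat_path_def)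
next
  fix i j assume ij: "i < n" "j < n"
  have md: "mat_path T (n - 1) (n - 1) (\<lambda>t. mat_delete (A t) j i)"
    unfolding mat_path_def
  proof (intro conjI allI impI ballI)
    fix t assume "t \<in> {0..T}"
    then have "A t \<in> carrier_mat n n" using A by (auto simp: mat_path_def)
    then show "mat_delete (A t) j i \<in> carrier_mat (n - 1) (n - 1)" by (auto simp: mat_delete_def)
  next
    fix a b assume ab: "a < n - 1" "b < n - 1"
    have "continuous_on {0..T} (\<lambda>t. A t $$ (if a < j then a else Suc a, if b < i then b else Suc b))"
      using A ab by (auto simp: mat_path_def)
    moreover have "dim_row (A t) = n" "dim_col (A t) = n" if "t \<in> {0..T}" for t using A that by (auto simp: mat_path_def)
    ultimately show "continuous_on {0..T} (\<lambda>t. mat_delete (A t) j i $$ (a, b))"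
      by (elim continuous_on_eq) (use ab in \<open>auto simp: mat_delete_def\<close>)
  qed
  have "continuous_on {0..T} (\<lambda>t. inverse (det (A t)) * ((-1) ^ (j + i) * det (mat_delete (A t) j i)))"
    by (intro continuous_intros continuous_det_path[OF A] continuous_det_path[OF md]) (use d in auto)
  then show "continuous_on {0..T} (\<lambda>t. inv_mat (A t) $$ (i, j))"
  proof (rule continuous_on_eq)
    fix t assume t: "t \<in> {0..T}"
    have At: "A t \<in> carrier_mat n n" using A t by (auto simp: mat_path_def)
    have "A t * (inverse (det (A t)) \<cdot>\<^sub>m adj_mat (A t)) = 1\<^sub>m n"
      unfolding mult_smult_distrib[OF At adj_mat(1)[OF At]] adj_mat(2)[OF At]
      using d[OF t] by (intro eq_matI) auto
    then have "inv_mat (A t) = inverse (det (A t)) \<cdot>\<^sub>m adj_mat (A t)"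
      using adj_mat(1)[OF At] by (intro inv_mat_eqI(1)[OF At]) auto
    then show "inverse (det (A t)) * ((-1) ^ (j + i) * det (mat_delete (A t) j i)) = inv_mat (A t) $$ (i, j)"
      using ij At by (simp add: adj_mat_def cofactor_def)
  qed
qed

lemma mat_path_bounded:
  assumes "mat_path T r c A"
  obtains C where "C \<ge> 0" "\<And>t i j. t \<in> {0..T} \<Longrightarrow> i < r \<Longrightarrow> j < c \<Longrightarrow> \<bar>A t $$ (i, j)\<bar> \<le> C"
proof -
  have "\<exists>C. \<forall>t\<in>{0..T}. \<bar>A t $$ (i, j)\<bar> \<le> C" if "i < r" "j < c" for i j
  proof -
    have "compact ((\<lambda>t. A t $$ (i, j)) ` {0..T})"
      using assms that by (intro compact_continuous_image) (auto simp: mat_path_def)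
    then have "bounded ((\<lambda>t. A t $$ (i, j)) ` {0..T})" by (rule compact_imp_bounded)
    then show ?thesis by (auto simp: bounded_iff)
  qed
  then obtain f where f: "\<And>i j t. i < r \<Longrightarrow> j < c \<Longrightarrow> t \<in> {0..T} \<Longrightarrow> \<bar>A t $$ (i, j)\<bar> \<le> f i j" by metis
  define C where "C = (\<Sum>i<r. \<Sum>j<c. \<bar>f i j\<bar>)"
  have "\<bar>f i j\<bar> \<le> C" if "i < r" "j < c" for i j
  proof -
    have "\<bar>f i j\<bar> \<le> (\<Sum>j<c. \<bar>f i j\<bar>)" using that by (intro member_le_sum) auto
    also have "\<dots> \<le> C" unfolding C_def using that by (intro member_le_sum[of i _ "\<lambda>i. \<Sum>j<c. \<bar>f i j\<bar>"]) (auto intro: sum_nonneg)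
    finally show ?thesis .
  qed
  then have "\<bar>A t $$ (i, j)\<bar> \<le> C" if "t \<in> {0..T}" "i < r" "j < c" for t i j
    using f[OF that(2,3,1)] abs_ge_self[of "f i j"] that by force
  moreover have "C \<ge> 0" by (auto simp: C_def intro!: sum_nonneg)
  ultimately show ?thesis using that by blast
qed

text \<open>The sum of squares has a derivative of at most \<open>2 d c\<close> times itself, so that its product
  with \<open>exp (- 2 d c t)\<close> decreases.\<close>

lemma gronwall_linear_system:
  fixes u :: "nat \<Rightarrow> real \<Rightarrow> complex" and M :: "real \<Rightarrow> nat \<Rightarrow> nat \<Rightarrow> complex"
  assumes u: "\<And>i t. i < d \<Longrightarrow> t \<in> {0..T} \<Longrightarrow> (u i has_vector_derivative (\<Sum>j<d. M t i j * u j t)) (at t within {0..T})"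
    and M: "\<And>i j t. i < d \<Longrightarrow> j < d \<Longrightarrow> t \<in> {0..T} \<Longrightarrow> norm (M t i j) \<le> c"
    and c: "c \<ge> 0" and t: "t \<in> {0..T}"
  shows "(\<Sum>i<d. (norm (u i t))\<^sup>2) \<le> exp (2 * real d * c * t) * (\<Sum>i<d. (norm (u i 0))\<^sup>2)"
proof (cases "t = 0")
  case False
  then have t0: "t > 0" using t by simp
  define e where "e = (\<lambda>t. \<Sum>i<d. inner (u i t) (u i t))"
  define e' where "e' = (\<lambda>t. \<Sum>i<d. 2 * inner (u i t) (\<Sum>j<d. M t i j * u j t))"
  define k where "k = 2 * real d * c"
  have e_der: "(e has_real_derivative e' s) (at s within {0..t})" if s: "s \<in> {0..t}" for s
  proof -
    have sT: "s \<in> {0..T}" using s t by auto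
    have "((\<lambda>t. inner (u i t) (u i t)) has_real_derivative 2 * inner (u i s) (\<Sum>j<d. M s i j * u j s)) (at s within {0..T})"
      if "i < d" for i
    proof -
      have "((\<lambda>t. inner (u i t) (u i t)) has_vector_derivative
         inner (u i s) (\<Sum>j<d. M s i j * u j s) + inner (\<Sum>j<d. M s i j * u j s) (u i s)) (at s within {0..T})"
        by (rule bounded_bilinear.has_vector_derivative[OF bounded_bilinear_inner u[OF that sT] u[OF that sT]])
      then show ?thesis by (simp add: has_real_derivative_iff_has_vector_derivative inner_commute)
    qed
    then have "(e has_real_derivative e' s) (at s within {0..T})"
      unfolding e_def e'_def by (intro DERIV_sum) auto
    then show ?thesis using t by (elim DERIV_subset) auto
  qed
  have e'_le: "e' s \<le> k * e s" if s: "s \<in> {0..t}" for s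
  proof -
    have sT: "s \<in> {0..T}" using s t by auto
    have "e' s \<le> (\<Sum>i<d. \<Sum>j<d. c * ((norm (u i s))\<^sup>2 + (norm (u j s))\<^sup>2))"
      unfolding e'_def
    proof (rule sum_mono)
      fix i assume i: "i \<in> {..<d}"
      have "2 * inner (u i s) (\<Sum>j<d. M s i j * u j s) = (\<Sum>j<d. 2 * inner (u i s) (M s i j * u j s))"
        by (simp add: inner_sum_right sum_distrib_left)
      also have "\<dots> \<le> (\<Sum>j<d. c * ((norm (u i s))\<^sup>2 + (norm (u j s))\<^sup>2))"
      proof (rule sum_mono)
        fix j assume j: "j \<in> {..<d}"
        have "inner (u i s) (M s i j * u j s) \<le> norm (u i s) * (norm (M s i j) * norm (u j s))"
          using norm_cauchy_schwarz[of "u i s" "M s i j * u j s"] by (simp add: norm_mult)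
        also have "\<dots> \<le> norm (u i s) * (c * norm (u j s))"
          using M[of i j s] i j sT by (intro mult_left_mono mult_right_mono) auto
        finally have "2 * inner (u i s) (M s i j * u j s) \<le> c * (2 * norm (u i s) * norm (u j s))"
          by (simp add: mult_ac)
        also have "\<dots> \<le> c * ((norm (u i s))\<^sup>2 + (norm (u j s))\<^sup>2)"
          using c sum_squares_bound by (intro mult_left_mono) auto
        finally show "2 * inner (u i s) (M s i j * u j s) \<le> c * ((norm (u i s))\<^sup>2 + (norm (u j s))\<^sup>2)" .
      qed
      finally show "2 * inner (u i s) (\<Sum>j<d. M s i j * u j s) \<le> (\<Sum>j<d. c * ((norm (u i s))\<^sup>2 + (norm (u j s))\<^sup>2))" .
    qed
    also have "\<dots> = k * e s"
      by (simp add: k_def e_def sum.distrib distrib_left power2_norm_eq_inner sum_distrib_left mult_ac)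
    finally show ?thesis .
  qed
  define g where "g = (\<lambda>s. e s * exp (- (k * s)))"
  define g' where "g' = (\<lambda>s. e' s * exp (- (k * s)) - k * (e s * exp (- (k * s))))"
  have g_der: "(g has_derivative (\<lambda>h. h * g' s)) (at s within {0..t})" if "s \<in> {0..t}" for s
  proof -
    have "(g has_real_derivative g' s) (at s within {0..t})"
      unfolding g_def g'_def by (rule derivative_eq_intros e_der that refl | simp)+
    then show ?thesis by (simp add: has_field_derivative_def mult_commute_abs)
  qed
  obtain s where s: "s \<in> {0<..<t}" "g t - g 0 = (t - 0) * g' s"
    using mvt_simple[OF t0 g_der] by (auto simp: mult.commute)
  have "g' s = (e' s - k * e s) * exp (- (k * s))" by (simp add: g'_def algebra_simps)
  also have "\<dots> \<le> 0" using e'_le[of s] s by (intro mult_nonpos_nonneg) auto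
  finally have "g t \<le> g 0" using s t0 mult_nonneg_nonpos[of t "g' s"] by simp
  then have "e t * exp (- (k * t)) * exp (k * t) \<le> e 0 * exp (k * t)" by (intro mult_right_mono) (auto simp: g_def)
  then have "e t \<le> e 0 * exp (k * t)" by (simp add: mult.assoc flip: exp_add)
  then show ?thesis by (simp add: e_def k_def power2_norm_eq_inner mult.commute)
qed simp

text \<open>Iterated integrals decay like \<open>C\<^sup>k / k!\<close>, so that a geometric bound on the weights suffices
  for absolute convergence. Weights other than \<open>l\<^sup>k\<close> are needed for derivatives of solutions with
  respect to the parameter.\<close>

definition geometric_bound :: "(nat \<Rightarrow> complex) \<Rightarrow> bool" where
  "geometric_bound a \<longleftrightarrow> (\<exists>c \<rho>. c \<ge> 0 \<and> \<rho> \<ge> 0 \<and> (\<forall>k. norm (a k) \<le> c * \<rho> ^ k))"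

lemma geometric_bound_Suc:
  assumes "geometric_bound a" shows "geometric_bound (\<lambda>k. a (Suc k))"
proof -
  obtain c \<rho> where "c \<ge> 0" "\<rho> \<ge> 0" "\<And>k. norm (a k) \<le> c * \<rho> ^ k" using assms by (auto simp: geometric_bound_def)
  then have "c * \<rho> \<ge> 0 \<and> \<rho> \<ge> 0 \<and> (\<forall>k. norm (a (Suc k)) \<le> (c * \<rho>) * \<rho> ^ k)"
    by (metis mult.assoc mult_nonneg_nonneg power_Suc)
  then show ?thesis unfolding geometric_bound_def by blast
qed

lemma geometric_bound_power: "geometric_bound (\<lambda>k. l ^ k)"
  unfolding geometric_bound_def by (intro exI[of _ 1] exI[of _ "norm l"]) (auto simp: norm_power)

locale volterra_series =
  fixes T :: real and N :: nat and E :: "real \<Rightarrow> real mat"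
  assumes T: "T > 0" and E: "mat_path T N N E"
begin

definition F :: "nat \<Rightarrow> real \<Rightarrow> nat \<Rightarrow> nat \<Rightarrow> real" where
  "F k t i j = iterated_integral N E k t $$ (i, j)"

lemma E_carrier: "t \<in> {0..T} \<Longrightarrow> E t \<in> carrier_mat N N"
  and E_cont: "i < N \<Longrightarrow> j < N \<Longrightarrow> continuous_on {0..T} (\<lambda>t. E t $$ (i, j))"
  using E by (auto simp: mat_path_def)

lemma iterated_integral_carrier: "iterated_integral N E k t \<in> carrier_mat N N"
  by (cases k) (auto simp: mat_integral_def)

lemma F_0: "i < N \<Longrightarrow> j < N \<Longrightarrow> F 0 t i j = (if i = j then 1 else 0)"
  by (simp add: F_def)

lemma F_Suc:
  assumes "i < N" "j < N" "t \<in> {0..T}"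
  shows "F (Suc k) t i j = integral {0..t} (\<lambda>s. \<Sum>l<N. E s $$ (i, l) * F k s l j)"
proof -
  have "F (Suc k) t i j = integral {0..t} (\<lambda>s. (E s * iterated_integral N E k s) $$ (i, j))"
    using assms by (simp add: F_def mat_integral_def)
  also have "\<dots> = integral {0..t} (\<lambda>s. \<Sum>l<N. E s $$ (i, l) * F k s l j)"
    using assms E_carrier iterated_integral_carrier
    by (intro integral_cong) (auto simp: F_def index_mult_mat_sum[of _ N N _ N] simp del: index_mult_mat(1))
  finally show ?thesis .
qed

lemma F_cont: "i < N \<Longrightarrow> j < N \<Longrightarrow> continuous_on {0..T} (\<lambda>t. F k t i j)"
proof (induction k arbitrary: i)
  case 0 then show ?case by (simp add: F_0)
next
  case (Suc k)
  have "continuous_on {0..T} (\<lambda>s. \<Sum>l<N. E s $$ (i, l) * F k s l j)"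
    using Suc E_cont by (intro continuous_intros) auto
  then have "continuous_on {0..T} (\<lambda>t. integral {0..t} (\<lambda>s. \<Sum>l<N. E s $$ (i, l) * F k s l j))"
    by (intro indefinite_integral_continuous_1 integrable_continuous_real)
  then show ?case by (rule continuous_on_eq) (use Suc F_Suc in auto)
qed

lemma F_Suc_deriv:
  assumes "i < N" "j < N" "t \<in> {0..T}"
  shows "((\<lambda>t. F (Suc k) t i j) has_real_derivative (\<Sum>l<N. E t $$ (i, l) * F k t l j)) (at t within {0..T})"
proof -
  have "continuous_on {0..T} (\<lambda>s. \<Sum>l<N. E s $$ (i, l) * F k s l j)"
    using assms F_cont E_cont by (intro continuous_intros) auto
  then have "((\<lambda>t. integral {0..t} (\<lambda>s. \<Sum>l<N. E s $$ (i, l) * F k s l j)) has_real_derivative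
      (\<Sum>l<N. E t $$ (i, l) * F k t l j)) (at t within {0..T})"
    using assms by (intro integral_has_real_derivative) auto
  then show ?thesis
    unfolding has_field_derivative_def
    by (rule has_derivative_transform[OF assms(3), rotated]) (use assms F_Suc in auto)
qed

lemma F_at_0: "i < N \<Longrightarrow> j < N \<Longrightarrow> F k 0 i j = (if k = 0 \<and> i = j then 1 else 0)"
  using T by (cases k) (auto simp: F_0 F_Suc)

text \<open>The usual factorial decay, from the volume of the simplex of integration.\<close>

lemma F_bound:
  obtains C where "C \<ge> 0" "\<And>k t i j. i < N \<Longrightarrow> j < N \<Longrightarrow> t \<in> {0..T} \<Longrightarrow> \<bar>F k t i j\<bar> \<le> C ^ k / fact k"
proof -
  obtain c where c: "c \<ge> 0" "\<And>t i j. t \<in> {0..T} \<Longrightarrow> i < N \<Longrightarrow> j < N \<Longrightarrow> \<bar>E t $$ (i, j)\<bar> \<le> c"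
    using mat_path_bounded[OF E] by blast
  define C where "C = real N * c"
  have C0: "C \<ge> 0" using c by (simp add: C_def)
  have b: "\<bar>F k t i j\<bar> \<le> (C * t) ^ k / fact k" if "i < N" "j < N" "t \<in> {0..T}" for k t i j
    using that
  proof (induction k arbitrary: t i)
    case 0 then show ?case by (simp add: F_0)
  next
    case (Suc k)
    have int: "((\<lambda>s. C ^ Suc k / fact k * s ^ k) has_integral (C * t) ^ Suc k / fact (Suc k)) {0..t}"
    proof -
      have "((\<lambda>s. C ^ Suc k / fact k * s ^ k) has_integral
         ((C * t) ^ Suc k / fact (Suc k) - (C * 0) ^ Suc k / fact (Suc k))) {0..t}"
      proof (rule fundamental_theorem_of_calculus)
        show "0 \<le> t" using Suc.prems by simp
        fix s assume "s \<in> {0..t}"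
        have "((\<lambda>s. C ^ Suc k / fact (Suc k) * s ^ Suc k) has_real_derivative C ^ Suc k / fact k * s ^ k) (at s within {0..t})"
        proof -
          have "((\<lambda>s. C ^ Suc k / fact (Suc k) * s ^ Suc k) has_real_derivative
              C ^ Suc k / fact (Suc k) * (real (Suc k) * s ^ k)) (at s within {0..t})"
            by (rule derivative_eq_intros refl | simp)+
          moreover have "C ^ Suc k / fact (Suc k) * (real (Suc k) * s ^ k) = C ^ Suc k / fact k * s ^ k"
            by (simp add: fact_Suc del: of_nat_Suc power_Suc)
          ultimately show ?thesis by (rule DERIV_cong)
        qed
        then show "((\<lambda>s. (C * s) ^ Suc k / fact (Suc k)) has_vector_derivative C ^ Suc k / fact k * s ^ k) (at s within {0..t})"
          by (simp add: has_real_derivative_iff_has_vector_derivative power_mult_distrib mult_ac)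
      qed
      then show ?thesis by simp
    qed
    have cont: "continuous_on {0..t} (\<lambda>s. \<Sum>l<N. E s $$ (i, l) * F k s l j)"
      using Suc.prems F_cont E_cont continuous_on_subset
      by (intro continuous_intros) (auto intro: continuous_on_subset[of "{0..T}"])
    have "\<bar>F (Suc k) t i j\<bar> \<le> integral {0..t} (\<lambda>s. C ^ Suc k / fact k * s ^ k)"
      unfolding F_Suc[OF Suc.prems] real_norm_def[symmetric]
    proof (rule integral_norm_bound_integral)
      show "(\<lambda>s. \<Sum>l<N. E s $$ (i, l) * F k s l j) integrable_on {0..t}"
        using cont by (rule integrable_continuous_real)
      show "(\<lambda>s. C ^ Suc k / fact k * s ^ k) integrable_on {0..t}" using int by blast
      fix s assume s: "s \<in> {0..t}"
      then have sT: "s \<in> {0..T}" using Suc.prems by auto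
      have "norm (\<Sum>l<N. E s $$ (i, l) * F k s l j) \<le> (\<Sum>l<N. c * ((C * s) ^ k / fact k))"
      proof (rule sum_norm_le)
        fix l assume "l \<in> {..<N}"
        then show "norm (E s $$ (i, l) * F k s l j) \<le> c * ((C * s) ^ k / fact k)"
          unfolding real_norm_def abs_mult using c Suc sT by (intro mult_mono) auto
      qed
      also have "\<dots> = C ^ Suc k / fact k * s ^ k" by (simp add: C_def power_mult_distrib)
      finally show "norm (\<Sum>l<N. E s $$ (i, l) * F k s l j) \<le> C ^ Suc k / fact k * s ^ k" .
    qed
    also have "\<dots> = (C * t) ^ Suc k / fact (Suc k)" using int by (rule integral_unique)
    finally show ?case .
  qed
  show ?thesis
  proof (rule that[of "C * T"])
    show "C * T \<ge> 0" using C0 T by simp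
    fix k t i j assume a: "i < N" "j < N" "t \<in> {0..T}"
    have "(C * t) ^ k / fact k \<le> (C * T) ^ k / fact k"
      using a C0 by (intro divide_right_mono power_mono mult_left_mono mult_nonneg_nonneg) auto
    then show "\<bar>F k t i j\<bar> \<le> (C * T) ^ k / fact k" using b[OF a, of k] by simp
  qed
qed

lemma series_majorant:
  assumes a: "geometric_bound a"
  obtains M :: "nat \<Rightarrow> real" where "summable M"
    "\<And>k t i j. i < N \<Longrightarrow> j < N \<Longrightarrow> t \<in> {0..T} \<Longrightarrow> norm (a k * of_real (F k t i j)) \<le> M k"
proof -
  obtain C where C: "C \<ge> 0" "\<And>k t i j. i < N \<Longrightarrow> j < N \<Longrightarrow> t \<in> {0..T} \<Longrightarrow> \<bar>F k t i j\<bar> \<le> C ^ k / fact k"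
    using F_bound by blast
  obtain c \<rho> where c: "c \<ge> 0" "\<rho> \<ge> 0" "\<And>k. norm (a k) \<le> c * \<rho> ^ k" using a by (auto simp: geometric_bound_def)
  show ?thesis
  proof (rule that[of "\<lambda>k. c * ((\<rho> * C) ^ k / fact k)"])
    have "summable (\<lambda>k. (\<rho> * C) ^ k / fact k)" using summable_exp[of "\<rho> * C"] by (simp add: divide_inverse mult.commute)
    then show "summable (\<lambda>k. c * ((\<rho> * C) ^ k / fact k))" by (rule summable_mult)
    fix k t i j assume h: "i < N" "j < N" "t \<in> {0..T}"
    have "norm (a k * of_real (F k t i j)) \<le> (c * \<rho> ^ k) * (C ^ k / fact k)"
      unfolding norm_mult norm_of_real using C(2)[OF h] c C(1) by (intro mult_mono) auto
    then show "norm (a k * of_real (F k t i j)) \<le> c * ((\<rho> * C) ^ k / fact k)"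
      by (simp add: power_mult_distrib mult_ac)
  qed
qed

definition S :: "(nat \<Rightarrow> complex) \<Rightarrow> real \<Rightarrow> nat \<Rightarrow> nat \<Rightarrow> complex" where
  "S a t i j = (\<Sum>k. a k * of_real (F k t i j))"

lemma S_summable: "geometric_bound a \<Longrightarrow> i < N \<Longrightarrow> j < N \<Longrightarrow> t \<in> {0..T} \<Longrightarrow> summable (\<lambda>k. a k * of_real (F k t i j))"
  by (rule series_majorant[of a]) (auto intro: summable_comparison_test'[of _ 0])

lemma S_at_0: "i < N \<Longrightarrow> j < N \<Longrightarrow> S a 0 i j = (if i = j then a 0 else 0)"
proof -
  assume "i < N" "j < N"
  then have "S a 0 i j = (\<Sum>k. if k = 0 then (if i = j then a 0 else 0) else 0)"
    unfolding S_def by (intro suminf_cong) (simp add: F_at_0)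
  also have "\<dots> = (if i = j then a 0 else 0)"
    using suminf_finite[of "{0::nat}" "\<lambda>k. if k = 0 then (if i = j then a 0 else 0) else 0"] by simp
  finally show ?thesis .
qed

text \<open>Differentiation shifts the weights by one, since the derivative of the \<open>k + 1\<close>-st iterated
  integral is \<open>E\<close> times the \<open>k\<close>-th. With weights \<open>l\<^sup>k\<close> the shift is multiplication by \<open>l\<close>, and the
  series solves \<open>S' = l E S\<close>.\<close>

lemma S_deriv:
  assumes a: "geometric_bound a" and ij: "i < N" "j < N" and t: "t \<in> {0..T}"
  shows "((\<lambda>t. S a t i j) has_vector_derivative (\<Sum>l<N. of_real (E t $$ (i, l)) * S (\<lambda>k. a (Suc k)) t l j)) (at t within {0..T})"
proof -
  let ?b = "\<lambda>k. a (Suc k)"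
  have b: "geometric_bound ?b" using a by (rule geometric_bound_Suc)
  define d where "d = (\<lambda>k t. case k of 0 \<Rightarrow> 0 | Suc k \<Rightarrow> a (Suc k) * of_real (\<Sum>l<N. E t $$ (i, l) * F k t l j))"
  define D where "D = (\<lambda>t. \<Sum>l<N. of_real (E t $$ (i, l)) * S ?b t l j)"
  obtain M where M: "summable M" "\<And>k t i j. i < N \<Longrightarrow> j < N \<Longrightarrow> t \<in> {0..T} \<Longrightarrow> norm (?b k * of_real (F k t i j)) \<le> M k"
    using series_majorant[OF b] by blast
  obtain c where c: "c \<ge> 0" "\<And>t i j. t \<in> {0..T} \<Longrightarrow> i < N \<Longrightarrow> j < N \<Longrightarrow> \<bar>E t $$ (i, j)\<bar> \<le> c"
    using mat_path_bounded[OF E] by blast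
  have dk: "d (Suc k) t = (\<Sum>l<N. of_real (E t $$ (i, l)) * (?b k * of_real (F k t l j)))" for k t
    by (simp add: d_def sum_distrib_left mult_ac)
  have d_bound: "norm (d (Suc k) t) \<le> (real N * c) * M k" if t: "t \<in> {0..T}" for k t
  proof -
    have "norm (d (Suc k) t) \<le> (\<Sum>l<N. c * M k)"
      unfolding dk
    proof (rule sum_norm_le)
      fix l assume "l \<in> {..<N}"
      then show "norm (of_real (E t $$ (i, l)) * (?b k * of_real (F k t l j))) \<le> c * M k"
        unfolding norm_mult[of "of_real _"] norm_of_real using c M(2) ij t by (intro mult_mono) auto
    qed
    then show ?thesis by simp
  qed
  have d_sums: "(\<lambda>k. d k t) sums D t" if t: "t \<in> {0..T}" for t
  proof -
    have "(\<lambda>k. d (Suc k) t) sums D t"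
      unfolding dk D_def
    proof (intro sums_sum sums_mult)
      fix l assume "l \<in> {..<N}"
      then show "(\<lambda>k. ?b k * of_real (F k t l j)) sums S ?b t l j"
        unfolding S_def using S_summable[OF b _ ij(2) t] by (intro summable_sums) auto
    qed
    moreover have "d 0 t = 0" by (simp add: d_def)
    ultimately show ?thesis using sums_Suc_iff[of "\<lambda>k. d k t" "D t"] by simp
  qed
  define MM where "MM = (\<lambda>k. case k of 0 \<Rightarrow> 0 | Suc k \<Rightarrow> (real N * c) * M k)"
  have MMs: "summable MM"
    using summable_mult[OF M(1), of "real N * c"] unfolding MM_def by (subst summable_Suc_iff[symmetric]) simp
  have unif: "uniform_limit {0..T} (\<lambda>n t. \<Sum>k<n. d k t) D sequentially"
  proof -
    have "uniform_limit {0..T} (\<lambda>n t. \<Sum>k<n. d k t) (\<lambda>t. \<Sum>k. d k t) sequentially"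
    proof (rule Weierstrass_m_test[OF _ MMs])
      fix k t assume "t \<in> {0..T}"
      then show "norm (d k t) \<le> MM k"
        using d_bound by (cases k) (auto simp: MM_def d_def)
    qed
    note lim = this
    have dD: "(\<Sum>k. d k t) = D t" if "t \<in> {0..T}" for t using d_sums[OF that] by (simp add: sums_iff)
    show ?thesis unfolding uniform_limit_iff
    proof (intro allI impI)
      fix e :: real assume "e > 0"
      then have "\<forall>\<^sub>F n in sequentially. \<forall>t\<in>{0..T}. dist (\<Sum>k<n. d k t) (\<Sum>k. d k t) < e"
        using lim by (simp add: uniform_limit_iff)
      then show "\<forall>\<^sub>F n in sequentially. \<forall>t\<in>{0..T}. dist (\<Sum>k<n. d k t) (D t) < e"
        by eventually_elim (use dD in auto)
    qed
  qed
  have trm: "((\<lambda>t. a k * of_real (F k t i j)) has_vector_derivative d k t) (at t within {0..T})" if t: "t \<in> {0..T}" for k t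
  proof (cases k)
    case 0
    then show ?thesis using ij by (simp add: F_0 d_def)
  next
    case (Suc k')
    have "((\<lambda>t. a (Suc k') * of_real (F (Suc k') t i j)) has_vector_derivative a (Suc k') * of_real (\<Sum>l<N. E t $$ (i, l) * F k' t l j)) (at t within {0..T})"
      by (intro has_vector_derivative_mult_right has_vector_derivative_of_real F_Suc_deriv ij t)
    then show ?thesis by (simp add: Suc d_def)
  qed
  have s0: "(\<lambda>k. a k * of_real (F k 0 i j)) sums S a 0 i j"
    unfolding S_def using T by (intro summable_sums S_summable[OF a ij]) auto
  have "\<exists>g. \<forall>x\<in>{0..T}. (\<lambda>k. a k * of_real (F k x i j)) sums g x \<and> (g has_derivative (\<lambda>h. h *\<^sub>R D x)) (at x within {0..T})"
  proof (rule has_derivative_series[where f' = "\<lambda>k x h. h *\<^sub>R d k x"])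
    show "((\<lambda>x. a n * of_real (F n x i j)) has_derivative (\<lambda>h. h *\<^sub>R d n x)) (at x within {0..T})" if "x \<in> {0..T}" for n x
      using trm[OF that] by (simp add: has_vector_derivative_def)
    show "\<forall>\<^sub>F n in sequentially. \<forall>x\<in>{0..T}. \<forall>h. norm ((\<Sum>k<n. h *\<^sub>R d k x) - h *\<^sub>R D x) \<le> e * norm h" if e: "e > 0" for e
    proof -
      have "\<forall>\<^sub>F n in sequentially. \<forall>x\<in>{0..T}. dist (\<Sum>k<n. d k x) (D x) < e"
        using unif e by (simp add: uniform_limit_iff)
      then show ?thesis
      proof eventually_elim
        case (elim n)
        show ?case
        proof (intro ballI allI)
          fix x h assume x: "x \<in> {0..T}"
          have "norm ((\<Sum>k<n. h *\<^sub>R d k x) - h *\<^sub>R D x) = \<bar>h\<bar> * dist (\<Sum>k<n. d k x) (D x)"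
            by (simp add: dist_norm flip: scaleR_sum_right scaleR_diff_right)
          also have "\<dots> \<le> \<bar>h\<bar> * e" using elim x by (intro mult_left_mono[OF less_imp_le]) auto
          finally show "norm ((\<Sum>k<n. h *\<^sub>R d k x) - h *\<^sub>R D x) \<le> e * norm h" by (simp add: mult.commute)
        qed
      qed
    qed
    show "(\<lambda>k. a k * of_real (F k 0 i j)) sums S a 0 i j" by (rule s0)
  qed (use T in auto)
  then obtain g where g: "\<And>x. x \<in> {0..T} \<Longrightarrow> (\<lambda>k. a k * of_real (F k x i j)) sums g x"
     "\<And>x. x \<in> {0..T} \<Longrightarrow> (g has_derivative (\<lambda>h. h *\<^sub>R D x)) (at x within {0..T})" by blast
  have gS: "g x = S a x i j" if "x \<in> {0..T}" for x using g(1)[OF that] by (simp add: S_def sums_iff)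
  have "((\<lambda>t. S a t i j) has_derivative (\<lambda>h. h *\<^sub>R D t)) (at t within {0..T})"
    by (rule has_derivative_transform[OF t gS[symmetric] g(2)[OF t]])
  then show ?thesis by (simp add: has_vector_derivative_def D_def)
qed

end

section \<open>The transfer matrix\<close>

lemma invertible_mat_det:
  fixes A :: "'a :: field mat"
  assumes A: "A \<in> carrier_mat n n" and "invertible_mat A"
  shows "det A \<noteq> 0"
proof -
  obtain B where B: "A * B = 1\<^sub>m (dim_row A)" "B * A = 1\<^sub>m (dim_row B)"
    using assms(2) by (auto simp: invertible_mat_def inverts_mat_def)
  have "dim_col B = n" using arg_cong[OF B(1), of dim_col] A by simp
  moreover have "dim_row B = n" using arg_cong[OF B(2), of dim_col] A by simp
  ultimately have "B \<in> carrier_mat n n" by auto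
  then show ?thesis using inv_mat_eqI(2)[OF A] B(1) A by simp
qed

lemma symp_J_index:
  assumes "i < 2 * n" "j < 2 * n"
  shows "symp_J n $$ (i, j) = (if i < n \<and> j = n + i then - 1 else if n \<le> i \<and> i = n + j then 1 else 0)"
  using assms by (auto simp: symp_J_def)

lemma symp_J_sq: "symp_J n * symp_J n = - 1\<^sub>m (2 * n)"
proof (rule eq_matI)
  fix i j assume "i < dim_row (- 1\<^sub>m (2 * n) :: real mat)" "j < dim_col (- 1\<^sub>m (2 * n) :: real mat)"
  then have ij: "i < 2 * n" "j < 2 * n" by auto
  have "(symp_J n * symp_J n) $$ (i, j) = (\<Sum>q<2 * n. symp_J n $$ (i, q) * symp_J n $$ (q, j))"
    by (rule index_mult_mat_sum[OF symp_J_carrier symp_J_carrier ij])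
  also have "\<dots> = (\<Sum>q<2 * n. if q = (if i < n then n + i else i - n) then symp_J n $$ (i, q) * symp_J n $$ (q, j) else 0)"
    using ij by (intro sum.cong) (auto simp: symp_J_index)
  also have "\<dots> = (- 1\<^sub>m (2 * n) :: real mat) $$ (i, j)"
    using ij by (auto simp: symp_J_index)
  finally show "(symp_J n * symp_J n) $$ (i, j) = (- 1\<^sub>m (2 * n) :: real mat) $$ (i, j)" .
qed auto

lemma symp_J_transpose: "transpose_mat (symp_J n) = - symp_J n"
  by (rule eq_matI) (auto simp: symp_J_index)

locale sl_system = lagrangian_frame n k0 \<Lambda>0 \<Lambda>1 ds fs
  for n k0 :: nat and \<Lambda>0 \<Lambda>1 :: "real vec set" and ds fs :: "real vec list" +
  fixes T :: real and P Q R R1 \<gamma>0 :: "real \<Rightarrow> real mat"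
  assumes n: "n > 0" and T: "T > 0"
    and cP: "continuous_mat_path n T P" and cQ: "continuous_mat_path n T Q"
    and cR: "continuous_mat_path n T R" and cR1: "continuous_mat_path n T R1"
    and symP: "\<And>t. t \<in> {0..T} \<Longrightarrow> transpose_mat (P t) = P t"
    and symR: "\<And>t. t \<in> {0..T} \<Longrightarrow> transpose_mat (R t) = R t"
    and symR1: "\<And>t. t \<in> {0..T} \<Longrightarrow> transpose_mat (R1 t) = R1 t"
    and invP: "\<And>t. t \<in> {0..T} \<Longrightarrow> invertible_mat (P t)"
    and nondeg: "SL_nondegenerate n T P Q R \<Lambda>0 \<Lambda>1"
    and fund: "fundamental_solution n T P Q R \<gamma>0"
begin

definition A :: "real \<Rightarrow> real mat" where "A t = symp_J n * B0_mat n (P t) (Q t) (R t)"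
definition Bd :: "real \<Rightarrow> real mat" where "Bd t = symp_J n * D_mat n (R1 t)"
definition E :: "real \<Rightarrow> real mat" where "E t = symp_J n * D_hat n R1 \<gamma>0 t"

lemma paths: "mat_path T n n P" "mat_path T n n Q" "mat_path T n n R" "mat_path T n n R1"
  using cP cQ cR cR1 by (auto simp: continuous_mat_path_def mat_path_def)

lemma carriers:
  assumes "t \<in> {0..T}"
  shows "P t \<in> carrier_mat n n" "Q t \<in> carrier_mat n n" "R t \<in> carrier_mat n n" "R1 t \<in> carrier_mat n n"
  using paths assms by (auto simp: mat_path_def)

lemma detP: "t \<in> {0..T} \<Longrightarrow> det (P t) \<noteq> 0"
  using invertible_mat_det[OF carriers(1) invP] .

lemma iP: "t \<in> {0..T} \<Longrightarrow> inv_mat (P t) \<in> carrier_mat n n"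
  "t \<in> {0..T} \<Longrightarrow> P t * inv_mat (P t) = 1\<^sub>m n" "t \<in> {0..T} \<Longrightarrow> inv_mat (P t) * P t = 1\<^sub>m n"
  using inv_mat_inverse[OF carriers(1) detP] by auto

lemma iP_path: "mat_path T n n (\<lambda>t. inv_mat (P t))"
  by (rule mat_path_inverse[OF paths(1) detP])

lemma B0_path: "mat_path T N N (\<lambda>t. B0_mat n (P t) (Q t) (R t))"
  unfolding B0_mat_def mult_2
  by (intro mat_path_four_block mat_path_uminus mat_path_minus mat_path_mult[where m = n] mat_path_transpose iP_path paths)

lemma D_path: "mat_path T N N (\<lambda>t. D_mat n (R1 t))"
  unfolding D_mat_def mult_2
  by (intro mat_path_four_block mat_path_uminus mat_path_const paths) auto

lemma \<gamma>_path: "mat_path T N N \<gamma>0"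
  unfolding mat_path_def
proof (intro conjI allI impI ballI)
  fix i j assume "i < N" "j < N"
  then show "continuous_on {0..T} (\<lambda>t. \<gamma>0 t $$ (i, j))"
    using fund unfolding fundamental_solution_def
    by (intro DERIV_continuous_on) blast
qed (use fund in \<open>auto simp: fundamental_solution_def\<close>)

lemma A_path: "mat_path T N N A"
  unfolding A_def by (intro mat_path_mult[where m = N] mat_path_const B0_path symp_J_carrier)

lemma Bd_path: "mat_path T N N Bd"
  unfolding Bd_def by (intro mat_path_mult[where m = N] mat_path_const D_path symp_J_carrier)

lemma E_path: "mat_path T N N E"
  unfolding E_def D_hat_def
  by (intro mat_path_mult[where m = N] mat_path_const mat_path_transpose \<gamma>_path D_path symp_J_carrier)

sublocale vs: volterra_series T "2 * n" E
  by unfold_locales (use T E_path in auto)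

lemma \<gamma>_carrier: "t \<in> {0..T} \<Longrightarrow> \<gamma>0 t \<in> carrier_mat N N"
  and A_carrier: "t \<in> {0..T} \<Longrightarrow> A t \<in> carrier_mat N N"
  and Bd_carrier: "t \<in> {0..T} \<Longrightarrow> Bd t \<in> carrier_mat N N"
  using \<gamma>_path A_path Bd_path by (auto simp: mat_path_def)

lemma A_cont: "i < N \<Longrightarrow> j < N \<Longrightarrow> continuous_on {0..T} (\<lambda>t. A t $$ (i, j))"
  and Bd_cont: "i < N \<Longrightarrow> j < N \<Longrightarrow> continuous_on {0..T} (\<lambda>t. Bd t $$ (i, j))"
  using A_path Bd_path by (auto simp: mat_path_def)

lemma \<gamma>_deriv:
  assumes "t \<in> {0..T}" "i < N" "j < N"
  shows "((\<lambda>s. \<gamma>0 s $$ (i, j)) has_real_derivative (\<Sum>l<N. A t $$ (i, l) * \<gamma>0 t $$ (l, j))) (at t within {0..T})"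
proof -
  have "((\<lambda>s. \<gamma>0 s $$ (i, j)) has_real_derivative (A t * \<gamma>0 t) $$ (i, j)) (at t within {0..T})"
    using fund assms unfolding fundamental_solution_def A_def by blast
  then show ?thesis
    using index_mult_mat_sum[OF A_carrier[OF assms(1)] \<gamma>_carrier[OF assms(1)] assms(2,3)] by metis
qed

lemma \<gamma>_0: "\<gamma>0 0 = 1\<^sub>m N"
  using fund by (simp add: fundamental_solution_def)

lemma B0_sym: "t \<in> {0..T} \<Longrightarrow> transpose_mat (B0_mat n (P t) (Q t) (R t)) = B0_mat n (P t) (Q t) (R t)"
proof -
  assume t: "t \<in> {0..T}"
  note c = carriers[OF t] iP[OF t]
  have iPs: "transpose_mat (inv_mat (P t)) = inv_mat (P t)"
  proof -
    have "P t * transpose_mat (inv_mat (P t)) = 1\<^sub>m n"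
      using transpose_mult[OF c(5) c(1)] c symP[OF t] by simp
    then show ?thesis using inv_mat_eqI(1)[OF c(1), of "transpose_mat (inv_mat (P t))"] c by simp
  qed
  have q: "transpose_mat (Q t) \<in> carrier_mat n n" using c by simp
  have 1: "transpose_mat (inv_mat (P t) * Q t) = transpose_mat (Q t) * inv_mat (P t)"
    using transpose_mult[OF c(5) c(2)] iPs by simp
  have 2: "transpose_mat (transpose_mat (Q t) * inv_mat (P t)) = inv_mat (P t) * Q t"
    using transpose_mult[OF q c(5)] iPs by simp
  have 3: "transpose_mat (transpose_mat (Q t) * inv_mat (P t) * Q t) = transpose_mat (Q t) * inv_mat (P t) * Q t"
    using transpose_mult[OF mult_carrier_mat[OF q c(5)] c(2)] 2 assoc_mult_mat[OF q c(5) c(2)] by simp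
  have tu: "transpose_mat (- X) = - transpose_mat X" for X :: "real mat" by (intro eq_matI) auto
  have tm: "transpose_mat (X - Y) = transpose_mat X - transpose_mat Y"
    if "X \<in> carrier_mat n n" "Y \<in> carrier_mat n n" for X Y :: "real mat" using that by (intro eq_matI) auto
  show ?thesis unfolding B0_mat_def
    using c q mult_carrier_mat[OF c(5) c(2)] mult_carrier_mat[OF q c(5)] mult_carrier_mat[OF mult_carrier_mat[OF q c(5)] c(2)]
    by (subst transpose_four_block_mat[of _ n n _ n _ n]) (auto simp: tu tm iPs 1 2 3[unfolded assoc_mult_mat[OF q c(5) c(2)]] symR[OF t] simp del: transpose_mult)
qed

text \<open>The matrix \<open>\<gamma>\<^sup>T J \<gamma>\<close> is constant because \<open>A = J B\<close> with symmetric \<open>B\<close>.\<close>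

lemma \<gamma>_symplectic:
  assumes t: "t \<in> {0..T}"
  shows "transpose_mat (\<gamma>0 t) * symp_J n * \<gamma>0 t = symp_J n"
proof (rule eq_matI)
  let ?J = "symp_J n"
  define W where "W = (\<lambda>t i j. \<Sum>q<N. \<Sum>p<N. \<gamma>0 t $$ (p, i) * ?J $$ (p, q) * \<gamma>0 t $$ (q, j))"
  have W_eq: "(transpose_mat (\<gamma>0 s) * ?J * \<gamma>0 s) $$ (i, j) = W s i j" if "s \<in> {0..T}" "i < N" "j < N" for s i j
  proof -
    note g = \<gamma>_carrier[OF that(1)]
    have gt: "transpose_mat (\<gamma>0 s) \<in> carrier_mat N N" using g by simp
    have "(transpose_mat (\<gamma>0 s) * ?J * \<gamma>0 s) $$ (i, j) = (\<Sum>q<N. (\<Sum>p<N. transpose_mat (\<gamma>0 s) $$ (i, p) * ?J $$ (p, q)) * \<gamma>0 s $$ (q, j))"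
      unfolding index_mult_mat_sum[OF mult_carrier_mat[OF gt symp_J_carrier] g that(2,3)]
      by (intro sum.cong refl) (use index_mult_mat_sum[OF gt symp_J_carrier that(2)] in auto)
    also have "\<dots> = W s i j" unfolding W_def sum_distrib_right using g that by (intro sum.cong refl) auto
    finally show ?thesis .
  qed
  fix i j assume "i < dim_row (symp_J n)" "j < dim_col (symp_J n)"
  then have ij: "i < N" "j < N" by auto
  have "((\<lambda>s. W s i j) has_real_derivative 0) (at s within {0..T})" if s: "s \<in> {0..T}" for s
  proof -
    define B where "B = B0_mat n (P s) (Q s) (R s)"
    have B: "B \<in> carrier_mat N N" using B0_path s by (auto simp: mat_path_def B_def)
    note g = \<gamma>_carrier[OF s]
    note a = A_carrier[OF s]
    have Ag: "A s * \<gamma>0 s \<in> carrier_mat N N" using a g by simp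
    have d: "((\<lambda>s. \<gamma>0 s $$ (p, q)) has_real_derivative (A s * \<gamma>0 s) $$ (p, q)) (at s within {0..T})" if "p < N" "q < N" for p q
      using \<gamma>_deriv[OF s that] index_mult_mat_sum[OF a g that] by simp
    define W' where "W' = (\<Sum>q<N. \<Sum>p<N. (A s * \<gamma>0 s) $$ (p, i) * ?J $$ (p, q) * \<gamma>0 s $$ (q, j)
        + \<gamma>0 s $$ (p, i) * ?J $$ (p, q) * (A s * \<gamma>0 s) $$ (q, j))"
    have der: "((\<lambda>s. W s i j) has_real_derivative W') (at s within {0..T})"
      unfolding W_def W'_def
    proof (intro DERIV_sum)
      fix q p assume qp: "q \<in> {..<N}" "p \<in> {..<N}"
      have d1: "((\<lambda>s. \<gamma>0 s $$ (p, i)) has_real_derivative (A s * \<gamma>0 s) $$ (p, i)) (at s within {0..T})"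
        using d qp ij by simp
      have d2: "((\<lambda>s. \<gamma>0 s $$ (q, j)) has_real_derivative (A s * \<gamma>0 s) $$ (q, j)) (at s within {0..T})"
        using d qp ij by simp
      show "((\<lambda>s. \<gamma>0 s $$ (p, i) * ?J $$ (p, q) * \<gamma>0 s $$ (q, j)) has_real_derivative
         (A s * \<gamma>0 s) $$ (p, i) * ?J $$ (p, q) * \<gamma>0 s $$ (q, j) + \<gamma>0 s $$ (p, i) * ?J $$ (p, q) * (A s * \<gamma>0 s) $$ (q, j)) (at s within {0..T})"
        using DERIV_mult[OF DERIV_cmult_right[OF d1, of "?J $$ (p, q)"] d2] by (simp add: algebra_simps del: index_mult_mat(1))
    qed
    have AJ: "transpose_mat (A s) * ?J = B"
    proof -
      have JJ: "- symp_J n * symp_J n = 1\<^sub>m N"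
        using symp_J_sq[of n] by (subst uminus_mult_left_mat) auto
      have "transpose_mat (A s) = B * - ?J"
        unfolding A_def B_def[symmetric] using transpose_mult[OF symp_J_carrier B] B0_sym[OF s] symp_J_transpose by (simp add: B_def)
      then have "transpose_mat (A s) * ?J = B * (- ?J * ?J)"
        using assoc_mult_mat[OF B, of "- ?J" N ?J N] by simp
      then show ?thesis using JJ B by simp
    qed
    have JA: "?J * A s = - B"
    proof -
      have "?J * A s = (?J * ?J) * B" unfolding A_def B_def[symmetric]
        using assoc_mult_mat[OF symp_J_carrier symp_J_carrier B] by simp
      also have "\<dots> = - B" unfolding symp_J_sq using B carrier_matD[OF B] by simp
      finally show ?thesis .
    qed
    have "W' = (\<Sum>q<N. \<Sum>p<N. (A s * \<gamma>0 s) $$ (p, i) * ?J $$ (p, q) * \<gamma>0 s $$ (q, j))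
       + (\<Sum>q<N. \<Sum>p<N. \<gamma>0 s $$ (p, i) * ?J $$ (p, q) * (A s * \<gamma>0 s) $$ (q, j))"
      by (simp add: W'_def sum.distrib del: index_mult_mat(1))
    also have "(\<Sum>q<N. \<Sum>p<N. (A s * \<gamma>0 s) $$ (p, i) * ?J $$ (p, q) * \<gamma>0 s $$ (q, j))
      = (transpose_mat (A s * \<gamma>0 s) * ?J * \<gamma>0 s) $$ (i, j)"
    proof -
      have gt: "transpose_mat (A s * \<gamma>0 s) \<in> carrier_mat N N" using Ag by simp
      have "(transpose_mat (A s * \<gamma>0 s) * ?J) $$ (i, q) = (\<Sum>p<N. (A s * \<gamma>0 s) $$ (p, i) * ?J $$ (p, q))" if "q < N" for q
        unfolding index_mult_mat_sum[OF gt symp_J_carrier ij(1) that] using ij carrier_matD[OF a] carrier_matD[OF g] by (intro sum.cong refl) (simp del: index_mult_mat(1))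
      then show ?thesis
        unfolding index_mult_mat_sum[OF mult_carrier_mat[OF gt symp_J_carrier] g ij] sum_distrib_right[symmetric]
        by (simp del: index_mult_mat(1))
    qed
    also have "(\<Sum>q<N. \<Sum>p<N. \<gamma>0 s $$ (p, i) * ?J $$ (p, q) * (A s * \<gamma>0 s) $$ (q, j))
      = (transpose_mat (\<gamma>0 s) * ?J * (A s * \<gamma>0 s)) $$ (i, j)"
    proof -
      have gt: "transpose_mat (\<gamma>0 s) \<in> carrier_mat N N" using g by simp
      have "(transpose_mat (\<gamma>0 s) * ?J) $$ (i, q) = (\<Sum>p<N. \<gamma>0 s $$ (p, i) * ?J $$ (p, q))" if "q < N" for q
        unfolding index_mult_mat_sum[OF gt symp_J_carrier ij(1) that] using g ij by (intro sum.cong refl) (simp del: index_mult_mat(1))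
      then show ?thesis
        unfolding index_mult_mat_sum[OF mult_carrier_mat[OF gt symp_J_carrier] Ag ij] sum_distrib_right[symmetric]
        by (simp del: index_mult_mat(1))
    qed
    also have "transpose_mat (A s * \<gamma>0 s) * ?J * \<gamma>0 s = transpose_mat (\<gamma>0 s) * B * \<gamma>0 s"
    proof -
      have gt: "transpose_mat (\<gamma>0 s) \<in> carrier_mat N N" "transpose_mat (A s) \<in> carrier_mat N N" using g a by auto
      have "transpose_mat (A s * \<gamma>0 s) * ?J = transpose_mat (\<gamma>0 s) * (transpose_mat (A s) * ?J)"
        unfolding transpose_mult[OF a g] by (rule assoc_mult_mat[OF gt symp_J_carrier])
      then show ?thesis unfolding AJ by simp
    qed
    also have "transpose_mat (\<gamma>0 s) * ?J * (A s * \<gamma>0 s) = - (transpose_mat (\<gamma>0 s) * B * \<gamma>0 s)"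
    proof -
      have gt: "transpose_mat (\<gamma>0 s) \<in> carrier_mat N N" using g by auto
      have "transpose_mat (\<gamma>0 s) * ?J * (A s * \<gamma>0 s) = (transpose_mat (\<gamma>0 s) * ?J * A s) * \<gamma>0 s"
        using assoc_mult_mat[OF mult_carrier_mat[OF gt symp_J_carrier] a g] by simp
      also have "transpose_mat (\<gamma>0 s) * ?J * A s = transpose_mat (\<gamma>0 s) * (- B)"
        using assoc_mult_mat[OF gt symp_J_carrier a] JA by simp
      also have "\<dots> = - (transpose_mat (\<gamma>0 s) * B)" using carrier_matD[OF gt] carrier_matD[OF B] by (intro uminus_mult_right_mat) simp
      also have "\<dots> * \<gamma>0 s = - (transpose_mat (\<gamma>0 s) * B * \<gamma>0 s)" using carrier_matD[OF gt] carrier_matD[OF B] carrier_matD[OF g] by (intro uminus_mult_left_mat) simp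
      finally show ?thesis .
    qed
    finally have "W' = 0" using g ij B by (simp del: index_mult_mat(1))
    then show ?thesis using der by simp
  qed
  then obtain w where "\<forall>s\<in>{0..T}. W s i j = w"
    using has_field_derivative_zero_constant[of "{0..T}" "\<lambda>s. W s i j"] by auto
  then have "W t i j = W 0 i j" using t T by simp
  then show "(transpose_mat (\<gamma>0 t) * ?J * \<gamma>0 t) $$ (i, j) = ?J $$ (i, j)"
    using W_eq[OF t ij] W_eq[OF _ ij, of 0] T ij \<gamma>_0 by (simp del: index_mult_mat(1))
qed (use \<gamma>_carrier[OF t] in auto)


definition \<gamma>inv :: "real \<Rightarrow> real mat" where "\<gamma>inv t = - (symp_J n * transpose_mat (\<gamma>0 t) * symp_J n)"

lemma \<gamma>inv_carrier: "t \<in> {0..T} \<Longrightarrow> \<gamma>inv t \<in> carrier_mat N N"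
proof -
  assume "t \<in> {0..T}"
  then have "transpose_mat (\<gamma>0 t) \<in> carrier_mat N N" using \<gamma>_carrier by simp
  then show ?thesis unfolding \<gamma>inv_def
    using mult_carrier_mat[OF mult_carrier_mat[OF symp_J_carrier] symp_J_carrier] by simp
qed

lemma \<gamma>inv:
  assumes t: "t \<in> {0..T}"
  shows "\<gamma>0 t * \<gamma>inv t = 1\<^sub>m N" "\<gamma>0 t * symp_J n * transpose_mat (\<gamma>0 t) = symp_J n"
proof -
  let ?J = "symp_J n"
  note g = \<gamma>_carrier[OF t]
  have gt: "transpose_mat (\<gamma>0 t) \<in> carrier_mat N N" using g by simp
  note J = symp_J_carrier[of n]
  have JgJ: "?J * transpose_mat (\<gamma>0 t) * ?J \<in> carrier_mat N N" using mult_carrier_mat[OF mult_carrier_mat[OF J gt] J] .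
  have "\<gamma>inv t * \<gamma>0 t = - (?J * transpose_mat (\<gamma>0 t) * ?J * \<gamma>0 t)"
    unfolding \<gamma>inv_def using JgJ g carrier_matD[OF g] carrier_matD[OF JgJ] by (intro uminus_mult_left_mat) simp
  also have "?J * transpose_mat (\<gamma>0 t) * ?J * \<gamma>0 t = ?J * (transpose_mat (\<gamma>0 t) * ?J * \<gamma>0 t)"
    using assoc_mult_mat[OF mult_carrier_mat[OF J gt] J g] assoc_mult_mat[OF J gt mult_carrier_mat[OF J g]]
      assoc_mult_mat[OF gt J g] by metis
  also have "\<dots> = - 1\<^sub>m N" unfolding \<gamma>_symplectic[OF t] symp_J_sq ..
  finally have "\<gamma>inv t * \<gamma>0 t = 1\<^sub>m N" by simp
  then show 1: "\<gamma>0 t * \<gamma>inv t = 1\<^sub>m N"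
    by (rule mat_mult_left_right_inverse[OF \<gamma>inv_carrier[OF t] g])
  have K: "\<gamma>0 t * ?J * transpose_mat (\<gamma>0 t) \<in> carrier_mat N N" using mult_carrier_mat[OF mult_carrier_mat[OF g J] gt] .
  have "\<gamma>0 t * (?J * transpose_mat (\<gamma>0 t) * ?J) = - 1\<^sub>m N"
  proof -
    have "\<gamma>0 t * \<gamma>inv t = - (\<gamma>0 t * (?J * transpose_mat (\<gamma>0 t) * ?J))"
      unfolding \<gamma>inv_def using carrier_matD[OF g] carrier_matD[OF JgJ] by (intro uminus_mult_right_mat) simp
    then have "- (\<gamma>0 t * \<gamma>inv t) = \<gamma>0 t * (?J * transpose_mat (\<gamma>0 t) * ?J)" by simp
    then show ?thesis using 1 by simp
  qed
  moreover have "\<gamma>0 t * (?J * transpose_mat (\<gamma>0 t) * ?J) = (\<gamma>0 t * ?J * transpose_mat (\<gamma>0 t)) * ?J"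
    using assoc_mult_mat[OF g J gt] assoc_mult_mat[OF g mult_carrier_mat[OF J gt] J] by metis
  ultimately have "(\<gamma>0 t * ?J * transpose_mat (\<gamma>0 t)) * ?J * ?J = - 1\<^sub>m N * ?J" by simp
  then have "(\<gamma>0 t * ?J * transpose_mat (\<gamma>0 t)) * (- 1\<^sub>m N) = - 1\<^sub>m N * ?J"
    unfolding assoc_mult_mat[OF K J J] symp_J_sq .
  moreover have "(\<gamma>0 t * ?J * transpose_mat (\<gamma>0 t)) * (- 1\<^sub>m N) = - (\<gamma>0 t * ?J * transpose_mat (\<gamma>0 t))"
    using carrier_matD[OF K] right_mult_one_mat[OF K] by (subst uminus_mult_right_mat) auto
  moreover have "- 1\<^sub>m N * ?J = - ?J" using left_mult_one_mat[OF J] by (subst uminus_mult_left_mat) auto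
  ultimately have "- (- (\<gamma>0 t * ?J * transpose_mat (\<gamma>0 t))) = - (- ?J)" by metis
  then show "\<gamma>0 t * ?J * transpose_mat (\<gamma>0 t) = ?J" by (simp only: uminus_uminus_mat)
qed

text \<open>Symplecticity of \<open>\<gamma>\<close> gives \<open>\<gamma> J \<gamma>\<^sup>T = J\<close>. Hence the iterated integrals of \<open>E = J \<gamma>\<^sup>T D \<gamma>\<close>
  are those of the perturbation \<open>J D\<close>, transported along the unperturbed flow.\<close>

lemma \<gamma>_E: assumes t: "t \<in> {0..T}" shows "\<gamma>0 t * E t = Bd t * \<gamma>0 t"
proof -
  let ?J = "symp_J n"
  note g = \<gamma>_carrier[OF t]
  have gt: "transpose_mat (\<gamma>0 t) \<in> carrier_mat N N" using g by simp
  have D: "D_mat n (R1 t) \<in> carrier_mat N N" using D_path t by (auto simp: mat_path_def)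
  note J = symp_J_carrier[of n]
  have "\<gamma>0 t * E t = \<gamma>0 t * ?J * (transpose_mat (\<gamma>0 t) * D_mat n (R1 t) * \<gamma>0 t)"
    unfolding E_def D_hat_def by (rule assoc_mult_mat[OF g J mult_carrier_mat[OF mult_carrier_mat[OF gt D] g], symmetric])
  also have "\<dots> = \<gamma>0 t * ?J * transpose_mat (\<gamma>0 t) * (D_mat n (R1 t) * \<gamma>0 t)"
    unfolding assoc_mult_mat[OF gt D g] by (rule assoc_mult_mat[OF mult_carrier_mat[OF g J] gt mult_carrier_mat[OF D g], symmetric])
  also have "\<dots> = Bd t * \<gamma>0 t"
    unfolding \<gamma>inv(2)[OF t] Bd_def by (rule assoc_mult_mat[OF J D g, symmetric])
  finally show ?thesis .
qed

text \<open>Variation of constants: the unperturbed flow applied to the weighted Volterra series. The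
  weights \<open>l\<^sup>k\<close> give the solution with parameter \<open>l\<close> and initial value \<open>w\<close>; other weights give its
  coefficients in the expansion with respect to a parameter.\<close>

definition sol :: "(nat \<Rightarrow> complex) \<Rightarrow> (nat \<Rightarrow> complex) \<Rightarrow> nat \<Rightarrow> real \<Rightarrow> complex" where
  "sol a w i t = (\<Sum>l<N. of_real (\<gamma>0 t $$ (i, l)) * (\<Sum>j<N. vs.S a t l j * w j))"

lemma sol_deriv:
  assumes a: "geometric_bound a" and i: "i < N" and t: "t \<in> {0..T}"
  shows "((\<lambda>t. sol a w i t) has_vector_derivative
     (\<Sum>p<N. of_real (A t $$ (i, p)) * sol a w p t) + (\<Sum>p<N. of_real (Bd t $$ (i, p)) * sol (\<lambda>k. a (Suc k)) w p t)) (at t within {0..T})"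
proof -
  let ?b = "\<lambda>k. a (Suc k)"
  define s where "s = (\<lambda>a l t. \<Sum>j<N. vs.S a t l j * w j)"
  have s_eq: "(\<Sum>j<N. vs.S a t l j * w j) = s a l t" for a l t by (simp add: s_def)
  have s': "((\<lambda>t. s a l t) has_vector_derivative (\<Sum>m<N. of_real (E t $$ (l, m)) * s ?b m t)) (at t within {0..T})" if l: "l < N" for l
  proof -
    have "((\<lambda>t. s a l t) has_vector_derivative (\<Sum>j<N. (\<Sum>m<N. of_real (E t $$ (l, m)) * vs.S ?b t m j) * w j)) (at t within {0..T})"
      unfolding s_def by (intro has_vector_derivative_sum has_vector_derivative_mult_left vs.S_deriv a l t) auto
    also have "(\<Sum>j<N. (\<Sum>m<N. of_real (E t $$ (l, m)) * vs.S ?b t m j) * w j) = (\<Sum>m<N. of_real (E t $$ (l, m)) * s ?b m t)"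
      unfolding s_def sum_distrib_right sum_distrib_left by (subst sum.swap) (simp add: mult.assoc)
    finally show ?thesis .
  qed
  have "((\<lambda>t. sol a w i t) has_vector_derivative
     (\<Sum>l<N. of_real (\<gamma>0 t $$ (i, l)) * (\<Sum>m<N. of_real (E t $$ (l, m)) * s ?b m t) + of_real (\<Sum>p<N. A t $$ (i, p) * \<gamma>0 t $$ (p, l)) * s a l t)) (at t within {0..T})"
    unfolding sol_def s_eq
    by (intro has_vector_derivative_sum has_vector_derivative_mult has_vector_derivative_of_real \<gamma>_deriv s' i t) auto
  also have "(\<Sum>l<N. of_real (\<gamma>0 t $$ (i, l)) * (\<Sum>m<N. of_real (E t $$ (l, m)) * s ?b m t) + of_real (\<Sum>p<N. A t $$ (i, p) * \<gamma>0 t $$ (p, l)) * s a l t)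
    = (\<Sum>m<N. of_real (\<Sum>l<N. \<gamma>0 t $$ (i, l) * E t $$ (l, m)) * s ?b m t) + (\<Sum>l<N. of_real (\<Sum>p<N. A t $$ (i, p) * \<gamma>0 t $$ (p, l)) * s a l t)"
    unfolding sum.distrib
    by (simp add: sum_distrib_left sum_distrib_right mult.assoc sum.swap[of "\<lambda>l m. of_real (\<gamma>0 t $$ (i, l)) * (of_real (E t $$ (l, m)) * s ?b m t)"])
  also have "(\<Sum>m<N. of_real (\<Sum>l<N. \<gamma>0 t $$ (i, l) * E t $$ (l, m)) * s ?b m t) = (\<Sum>m<N. of_real (\<Sum>p<N. Bd t $$ (i, p) * \<gamma>0 t $$ (p, m)) * s ?b m t)"
  proof (rule sum.cong[OF refl])
    fix m assume "m \<in> {..<N}"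
    then have m: "m < N" by simp
    show "of_real (\<Sum>l<N. \<gamma>0 t $$ (i, l) * E t $$ (l, m)) * s ?b m t = of_real (\<Sum>p<N. Bd t $$ (i, p) * \<gamma>0 t $$ (p, m)) * s ?b m t"
      using index_mult_mat_sum[OF \<gamma>_carrier[OF t] vs.E_carrier[OF t] i m] index_mult_mat_sum[OF Bd_carrier[OF t] \<gamma>_carrier[OF t] i m] \<gamma>_E[OF t]
      by simp
  qed
  also have "\<dots> = (\<Sum>p<N. of_real (Bd t $$ (i, p)) * sol ?b w p t)"
    unfolding sol_def s_eq of_real_sum sum_distrib_left sum_distrib_right of_real_mult
    by (subst sum.swap) (simp add: mult.assoc)
  also have "(\<Sum>l<N. of_real (\<Sum>p<N. A t $$ (i, p) * \<gamma>0 t $$ (p, l)) * s a l t) = (\<Sum>p<N. of_real (A t $$ (i, p)) * sol a w p t)"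
    unfolding sol_def s_eq of_real_sum sum_distrib_left sum_distrib_right of_real_mult
    by (subst sum.swap) (simp add: mult.assoc)
  finally show ?thesis by (simp add: add.commute)
qed

lemma sol_0: "i < N \<Longrightarrow> sol a w i 0 = a 0 * w i"
proof -
  assume i: "i < N"
  have "(\<Sum>j<N. vs.S a 0 l j * w j) = a 0 * w l" if "l < N" for l
    using that by (simp add: vs.S_at_0 if_distrib[of "\<lambda>x. x * _"] cong: if_cong)
  then have "sol a w i 0 = (\<Sum>l<N. if l = i then a 0 * w l else 0)"
    unfolding sol_def \<gamma>_0 using i by (intro sum.cong) auto
  then show ?thesis using i by simp
qed

lemma sol_sum_right: "sol a (\<lambda>j. \<Sum>s\<in>X. x s * w s j) i t = (\<Sum>s\<in>X. x s * sol a (w s) i t)"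
proof (induction X rule: infinite_finite_induct)
  case (insert s X)
  have gen: "(\<Sum>l<N. g l * (y * X l + V l)) = y * (\<Sum>l<N. g l * X l) + (\<Sum>l<N. g l * V l)"
    for g X V :: "nat \<Rightarrow> complex" and y
    by (simp add: distrib_left sum.distrib sum_distrib_left mult_ac)
  have "sol a (\<lambda>j. x s * w s j + v j) i t = x s * sol a (w s) i t + sol a v i t" for v
    unfolding sol_def gen ..
  then show ?case using insert by simp
qed (auto simp: sol_def)

lemma sol_zero: "(\<And>j. j < N \<Longrightarrow> w j = 0) \<Longrightarrow> sol a w i t = 0"
  by (simp add: sol_def)

lemma sol_sum_left:
  assumes a: "\<And>s. s \<in> X \<Longrightarrow> geometric_bound (a s)" and X: "finite X" and t: "t \<in> {0..T}"
  shows "sol (\<lambda>k. x * (\<Sum>s\<in>X. a s k)) w i t = x * (\<Sum>s\<in>X. sol (a s) w i t)"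
proof -
  have "vs.S (\<lambda>k. x * (\<Sum>s\<in>X. a s k)) t l j = x * (\<Sum>s\<in>X. vs.S (a s) t l j)" if lj: "l < N" "j < N" for l j
  proof -
    have "(\<lambda>k. x * (\<Sum>s\<in>X. a s k * of_real (vs.F k t l j))) sums (x * (\<Sum>s\<in>X. vs.S (a s) t l j))"
      unfolding vs.S_def by (intro sums_mult sums_sum summable_sums vs.S_summable a lj t)
    then show ?thesis unfolding vs.S_def by (simp add: sums_iff sum_distrib_right mult.assoc)
  qed
  then have "sol (\<lambda>k. x * (\<Sum>s\<in>X. a s k)) w i t = (\<Sum>l<N. of_real (\<gamma>0 t $$ (i, l)) * (\<Sum>j<N. x * (\<Sum>s\<in>X. vs.S (a s) t l j) * w j))"
    unfolding sol_def by (intro sum.cong arg_cong2[of _ _ _ _ "(*)"] refl) auto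
  also have "\<dots> = x * (\<Sum>s\<in>X. sol (a s) w i t)"
  proof -
    have "(\<Sum>s\<in>X. sol (a s) w i t) = (\<Sum>l<N. of_real (\<gamma>0 t $$ (i, l)) * (\<Sum>j<N. (\<Sum>s\<in>X. vs.S (a s) t l j) * w j))"
      using X by (induction X) (simp_all add: sol_def sum.distrib distrib_left distrib_right)
    then show ?thesis by (simp add: sum_distrib_left mult_ac)
  qed
  finally show ?thesis .
qed

text \<open>A parametrization of the initial values in \<open>\<Lambda>0\<close>: the vector \<open>M\<^sub>3\<^sup>-\<^sup>1 (c, 0)\<close>.\<close>

definition emb :: "(nat \<Rightarrow> complex) \<Rightarrow> nat \<Rightarrow> complex" where
  "emb c i = (\<Sum>j<n. of_real (inv_mat M3 $$ (i, j)) * c j)"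

lemma iM3: "inv_mat M3 \<in> carrier_mat N N" "M3 * inv_mat M3 = 1\<^sub>m N" "inv_mat M3 * M3 = 1\<^sub>m N"
  using inv_mat_inverse[OF M3_carrier M3_det] by auto

definition M3v :: "(nat \<Rightarrow> complex) \<Rightarrow> nat \<Rightarrow> complex" where
  "M3v z i = (\<Sum>q<N. of_real (M3 $$ (i, q)) * z q)"

lemma M3v_emb: "i < N \<Longrightarrow> M3v (emb c) i = (if i < n then c i else 0)"
proof -
  assume i: "i < N"
  have "M3v (emb c) i = (\<Sum>j<n. of_real (\<Sum>q<N. M3 $$ (i, q) * inv_mat M3 $$ (q, j)) * c j)"
    unfolding M3v_def emb_def sum_distrib_left of_real_sum sum_distrib_right
    by (subst sum.swap) (simp add: mult.assoc)
  also have "\<dots> = (\<Sum>j<n. if j = i then c j else 0)"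
  proof (rule sum.cong[OF refl])
    fix j assume "j \<in> {..<n}"
    then have j: "j < N" by simp
    have e: "(\<Sum>q<N. M3 $$ (i, q) * inv_mat M3 $$ (q, j)) = (if i = j then 1 else 0)"
      unfolding index_mult_mat_sum[OF M3_carrier iM3(1) i j, symmetric] iM3(2) using i j by simp
    show "of_real (\<Sum>q<N. M3 $$ (i, q) * inv_mat M3 $$ (q, j)) * c j = (if j = i then c j else 0)"
      unfolding e by simp
  qed
  finally show ?thesis by simp
qed

lemma M3v_inverse: "i < N \<Longrightarrow> z i = (\<Sum>j<N. of_real (inv_mat M3 $$ (i, j)) * M3v z j)"
proof -
  assume i: "i < N"
  have "(\<Sum>j<N. of_real (inv_mat M3 $$ (i, j)) * M3v z j) = (\<Sum>q<N. of_real (\<Sum>j<N. inv_mat M3 $$ (i, j) * M3 $$ (j, q)) * z q)"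
    unfolding M3v_def sum_distrib_left of_real_sum sum_distrib_right
    by (subst sum.swap) (simp add: mult.assoc)
  also have "\<dots> = (\<Sum>q<N. if q = i then z q else 0)"
  proof (rule sum.cong[OF refl])
    fix q assume "q \<in> {..<N}"
    then have q: "q < N" by simp
    have e: "(\<Sum>j<N. inv_mat M3 $$ (i, j) * M3 $$ (j, q)) = (if i = q then 1 else 0)"
      unfolding index_mult_mat_sum[OF iM3(1) M3_carrier i q, symmetric] iM3(3) using i q by simp
    show "of_real (\<Sum>j<N. inv_mat M3 $$ (i, j) * M3 $$ (j, q)) * z q = (if q = i then z q else 0)"
      unfolding e by simp
  qed
  finally show ?thesis using i by simp
qed

text \<open>The boundary conditions in the coordinates of \<open>M\<^sub>3\<close>.\<close>

definition BC :: "(nat \<Rightarrow> real \<Rightarrow> complex) \<Rightarrow> bool" where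
  "BC z \<longleftrightarrow> (\<forall>i\<in>{n..<N}. M3v (\<lambda>q. z q 0) i = 0) \<and> (\<forall>i<n. M3v (\<lambda>q. z q T) (k0 + i) = 0)"

lemma M3v_vec: "i < N \<Longrightarrow> (cmat M3 *\<^sub>v vec N z) $ i = M3v z i"
  using M3_carrier by (subst index_mult_mat_vec_sum[OF cM3_carrier]) (auto simp: M3v_def cmat_def intro!: sum.cong)

lemma BC_iff: "BC z \<longleftrightarrow> vec N (\<lambda>i. z i 0) \<in> complexify \<Lambda>0 \<and> vec N (\<lambda>i. z i T) \<in> complexify \<Lambda>1"
proof -
  have "(\<forall>i<n. M3v (\<lambda>q. z q T) (k0 + i) = 0) \<longleftrightarrow> (\<forall>i\<in>{k0..<k0 + n}. M3v (\<lambda>q. z q T) i = 0)"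
  proof
    assume a: "\<forall>i<n. M3v (\<lambda>q. z q T) (k0 + i) = 0"
    show "\<forall>i\<in>{k0..<k0 + n}. M3v (\<lambda>q. z q T) i = 0"
    proof
      fix i assume "i \<in> {k0..<k0 + n}"
      then have "i - k0 < n" "k0 + (i - k0) = i" by auto
      then show "M3v (\<lambda>q. z q T) i = 0" using a by metis
    qed
  qed auto
  then show ?thesis unfolding BC_def complexify_Lam0 complexify_Lam1 using k0_le M3v_vec by auto
qed

lemma BC_initial: "BC z \<Longrightarrow> i < N \<Longrightarrow> z i 0 = emb (M3v (\<lambda>q. z q 0)) i"
proof -
  assume bc: "BC z" and i: "i < N"
  have "z i 0 = (\<Sum>j<n + n. of_real (inv_mat M3 $$ (i, j)) * M3v (\<lambda>q. z q 0) j)"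
    using M3v_inverse[OF i, of "\<lambda>q. z q 0"] by (simp add: mult_2)
  also have "\<dots> = emb (M3v (\<lambda>q. z q 0)) i"
    unfolding sum_lessThan_add emb_def using bc by (simp add: BC_def)
  finally show ?thesis .
qed

definition Pk :: "nat \<Rightarrow> real mat" where
  "Pk k = P_block n k0 M3 (\<gamma>0 T * F_mat n T R1 \<gamma>0 k)"

definition \<Delta> :: "(nat \<Rightarrow> complex) \<Rightarrow> nat \<Rightarrow> nat \<Rightarrow> complex" where
  "\<Delta> a i j = (\<Sum>k. a k * of_real (Pk k $$ (i, j)))"

lemma F_mat_eq: "F_mat n T R1 \<gamma>0 k = iterated_integral N E k T"
proof -
  have "E = (\<lambda>t. symp_J n * D_hat n R1 \<gamma>0 t)" by (simp add: fun_eq_iff E_def)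
  then show ?thesis by (simp add: F_mat_def)
qed

lemma Pk_index:
  assumes "i < n" "j < n"
  shows "Pk k $$ (i, j) = (\<Sum>q<N. M3 $$ (k0 + i, q) * (\<Sum>l<N. \<gamma>0 T $$ (q, l) * (\<Sum>p<N. vs.F k T l p * inv_mat M3 $$ (p, j))))"
proof -
  have T0: "T \<in> {0..T}" using T by simp
  note g = \<gamma>_carrier[OF T0]
  have F: "iterated_integral N E k T \<in> carrier_mat N N" by (rule vs.iterated_integral_carrier)
  have i: "i + k0 < N" "j < N" using assms k0_le by auto
  have FI: "iterated_integral N E k T * inv_mat M3 \<in> carrier_mat N N" using mult_carrier_mat[OF F iM3(1)] .
  have "Pk k $$ (i, j) = (M3 * (\<gamma>0 T * iterated_integral N E k T) * inv_mat M3) $$ (i + k0, j)"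
    using assms by (simp add: Pk_def P_block_def F_mat_eq)
  also have "M3 * (\<gamma>0 T * iterated_integral N E k T) * inv_mat M3 = M3 * (\<gamma>0 T * (iterated_integral N E k T * inv_mat M3))"
    using assoc_mult_mat[OF M3_carrier mult_carrier_mat[OF g F] iM3(1)] assoc_mult_mat[OF g F iM3(1)] by simp
  also have "\<dots> $$ (i + k0, j) = (\<Sum>q<N. M3 $$ (i + k0, q) * (\<gamma>0 T * (iterated_integral N E k T * inv_mat M3)) $$ (q, j))"
    by (rule index_mult_mat_sum[OF M3_carrier mult_carrier_mat[OF g FI] i])
  also have "\<dots> = (\<Sum>q<N. M3 $$ (k0 + i, q) * (\<Sum>l<N. \<gamma>0 T $$ (q, l) * (\<Sum>p<N. vs.F k T l p * inv_mat M3 $$ (p, j))))"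
  proof (intro sum.cong refl)
    fix q assume "q \<in> {..<N}"
    then have q: "q < N" by simp
    have "(\<gamma>0 T * (iterated_integral N E k T * inv_mat M3)) $$ (q, j) = (\<Sum>l<N. \<gamma>0 T $$ (q, l) * (iterated_integral N E k T * inv_mat M3) $$ (l, j))"
      by (rule index_mult_mat_sum[OF g FI q i(2)])
    also have "\<dots> = (\<Sum>l<N. \<gamma>0 T $$ (q, l) * (\<Sum>p<N. vs.F k T l p * inv_mat M3 $$ (p, j)))"
      using index_mult_mat_sum[OF F iM3(1) _ i(2)] by (intro sum.cong refl) (simp add: vs.F_def)
    finally show "M3 $$ (i + k0, q) * (\<gamma>0 T * (iterated_integral N E k T * inv_mat M3)) $$ (q, j)
      = M3 $$ (k0 + i, q) * (\<Sum>l<N. \<gamma>0 T $$ (q, l) * (\<Sum>p<N. vs.F k T l p * inv_mat M3 $$ (p, j)))"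
      by (simp add: add.commute)
  qed
  finally show ?thesis .
qed

lemma \<Delta>_sums:
  assumes a: "geometric_bound a" and i: "i < n" and j: "j < n"
  shows "(\<lambda>k. a k * of_real (Pk k $$ (i, j))) sums \<Delta> a i j"
proof -
  have "(\<lambda>k. \<Sum>q<N. of_real (M3 $$ (k0 + i, q)) * (\<Sum>l<N. of_real (\<gamma>0 T $$ (q, l)) * (\<Sum>p<N. (a k * of_real (vs.F k T l p)) * of_real (inv_mat M3 $$ (p, j)))))
    sums (\<Sum>q<N. of_real (M3 $$ (k0 + i, q)) * (\<Sum>l<N. of_real (\<gamma>0 T $$ (q, l)) * (\<Sum>p<N. vs.S a T l p * of_real (inv_mat M3 $$ (p, j)))))"
    unfolding vs.S_def using T
    by (intro sums_sum sums_mult sums_mult2 summable_sums vs.S_summable a) auto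
  moreover have "(\<lambda>k. \<Sum>q<N. of_real (M3 $$ (k0 + i, q)) * (\<Sum>l<N. of_real (\<gamma>0 T $$ (q, l)) * (\<Sum>p<N. (a k * of_real (vs.F k T l p)) * of_real (inv_mat M3 $$ (p, j)))))
    = (\<lambda>k. a k * of_real (Pk k $$ (i, j)))"
    unfolding Pk_index[OF i j] of_real_sum of_real_mult sum_distrib_left by (simp add: mult_ac)
  ultimately show ?thesis unfolding \<Delta>_def by (simp add: sums_iff)
qed

text \<open>This is the role of the matrices \<open>Pk\<close>: they are the coefficients of the map from free
  initial data to the boundary form at \<open>T\<close>.\<close>

lemma M3v_sol_T:
  assumes a: "geometric_bound a" and i: "i < n"
  shows "M3v (\<lambda>q. sol a (emb c) q T) (k0 + i) = (\<Sum>j<n. \<Delta> a i j * c j)"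
proof -
  have "(\<lambda>k. \<Sum>q<N. of_real (M3 $$ (k0 + i, q)) * (\<Sum>l<N. of_real (\<gamma>0 T $$ (q, l)) * (\<Sum>p<N. (a k * of_real (vs.F k T l p)) * emb c p)))
     sums M3v (\<lambda>q. sol a (emb c) q T) (k0 + i)"
    unfolding M3v_def sol_def vs.S_def using T
    by (intro sums_sum sums_mult sums_mult2 summable_sums vs.S_summable a) auto
  moreover have "(\<Sum>q<N. of_real (M3 $$ (k0 + i, q)) * (\<Sum>l<N. of_real (\<gamma>0 T $$ (q, l)) * (\<Sum>p<N. (a k * of_real (vs.F k T l p)) * emb c p)))
     = (\<Sum>j<n. (a k * of_real (Pk k $$ (i, j))) * c j)" for k
  proof -
    have swapg: "(\<Sum>l<N. g l * (\<Sum>j<n. c j * H l j)) = (\<Sum>j<n. c j * (\<Sum>l<N. g l * H l j))"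
      for g :: "nat \<Rightarrow> complex" and H
      unfolding sum_distrib_left by (subst sum.swap) (simp add: mult_ac)
    have e: "emb c p = (\<Sum>j<n. c j * of_real (inv_mat M3 $$ (p, j)))" for p
      by (simp add: emb_def mult.commute)
    have "(\<Sum>q<N. of_real (M3 $$ (k0 + i, q)) * (\<Sum>l<N. of_real (\<gamma>0 T $$ (q, l)) * (\<Sum>p<N. (a k * of_real (vs.F k T l p)) * emb c p)))
       = (\<Sum>j<n. c j * (\<Sum>q<N. of_real (M3 $$ (k0 + i, q)) * (\<Sum>l<N. of_real (\<gamma>0 T $$ (q, l)) * (\<Sum>p<N. (a k * of_real (vs.F k T l p)) * of_real (inv_mat M3 $$ (p, j))))))"
      unfolding e swapg ..
    also have "\<dots> = (\<Sum>j<n. (a k * of_real (Pk k $$ (i, j))) * c j)"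
    proof (rule sum.cong[OF refl])
      fix j assume "j \<in> {..<n}"
      then show "c j * (\<Sum>q<N. of_real (M3 $$ (k0 + i, q)) * (\<Sum>l<N. of_real (\<gamma>0 T $$ (q, l)) * (\<Sum>p<N. (a k * of_real (vs.F k T l p)) * of_real (inv_mat M3 $$ (p, j)))))
        = (a k * of_real (Pk k $$ (i, j))) * c j"
        using Pk_index[OF i, of j k] by (simp add: sum_distrib_left mult_ac)
    qed
    finally show ?thesis .
  qed
  moreover have "(\<lambda>k. \<Sum>j<n. (a k * of_real (Pk k $$ (i, j))) * c j) sums (\<Sum>j<n. \<Delta> a i j * c j)"
    by (intro sums_sum sums_mult2 \<Delta>_sums a i) auto
  ultimately show ?thesis using sums_unique2 by (simp only:) blast
qed

end

no_notation fps_nth (infixl \<open>$\<close> 75)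

section \<open>Function spaces\<close>

lemma AE_lebesgue_on_negligible:
  assumes "AE t in lebesgue_on {0..T::real}. Q t"
  obtains S where "negligible S" "\<And>t. t \<in> {0..T} \<Longrightarrow> t \<notin> S \<Longrightarrow> Q t"
proof -
  have "AE t in lebesgue. t \<in> {0..T} \<longrightarrow> Q t"
    using assms by (subst (asm) AE_restrict_space_iff) auto
  then obtain S where S: "{t \<in> space lebesgue. \<not> (t \<in> {0..T} \<longrightarrow> Q t)} \<subseteq> S" "S \<in> null_sets lebesgue"
    by (auto simp: eventually_ae_filter)
  show ?thesis
    by (rule that[of S]) (use S in \<open>auto simp: negligible_iff_null_sets\<close>)
qed

lemma finite_measure_interval: "finite_measure (lebesgue_on {0..T::real})"
  by (rule finite_measure_lebesgue_on) auto

lemma L2_cong_lin: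
  fixes f g h :: "real \<Rightarrow> complex vec"
  assumes f: "f \<in> L2 T n" and g: "g \<in> L2 T n"
    and h: "\<And>t. t \<in> {0..T} \<Longrightarrow> h t \<in> carrier_vec n"
    and hi: "\<And>t i. t \<in> {0..T} \<Longrightarrow> i < n \<Longrightarrow> h t $ i = a * f t $ i + b * g t $ i"
  shows "h \<in> L2 T n"
  unfolding L2_def mem_Collect_eq
proof (intro conjI ballI allI impI)
  fix i assume i: "i < n"
  have fm: "(\<lambda>t. f t $ i) \<in> borel_measurable (lebesgue_on {0..T})" "integrable (lebesgue_on {0..T}) (\<lambda>t. (cmod (f t $ i))\<^sup>2)"
    and gm: "(\<lambda>t. g t $ i) \<in> borel_measurable (lebesgue_on {0..T})" "integrable (lebesgue_on {0..T}) (\<lambda>t. (cmod (g t $ i))\<^sup>2)"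
    using f g i by (auto simp: L2_def)
  have "(\<lambda>t. a * f t $ i + b * g t $ i) \<in> borel_measurable (lebesgue_on {0..T})"
    using fm gm by measurable
  then show hm: "(\<lambda>t. h t $ i) \<in> borel_measurable (lebesgue_on {0..T})"
    by (subst measurable_cong[of _ _ "\<lambda>t. a * f t $ i + b * g t $ i"]) (use hi i in auto)
  show "integrable (lebesgue_on {0..T}) (\<lambda>t. (cmod (h t $ i))\<^sup>2)"
  proof (rule Bochner_Integration.integrable_bound)
    show "integrable (lebesgue_on {0..T}) (\<lambda>t. 2 * (cmod a)\<^sup>2 * (cmod (f t $ i))\<^sup>2 + 2 * (cmod b)\<^sup>2 * (cmod (g t $ i))\<^sup>2)"
      using fm gm by auto
    show "(\<lambda>t. (cmod (h t $ i))\<^sup>2) \<in> borel_measurable (lebesgue_on {0..T})" using hm by measurable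
    show "AE t in lebesgue_on {0..T}. norm ((cmod (h t $ i))\<^sup>2) \<le> norm (2 * (cmod a)\<^sup>2 * (cmod (f t $ i))\<^sup>2 + 2 * (cmod b)\<^sup>2 * (cmod (g t $ i))\<^sup>2)"
    proof (rule AE_I2)
      fix t assume "t \<in> space (lebesgue_on {0..T})"
      then have t: "t \<in> {0..T}" by simp
      define u v where "u = cmod a * cmod (f t $ i)" and "v = cmod b * cmod (g t $ i)"
      have "cmod (h t $ i) \<le> u + v" unfolding hi[OF t i] u_def v_def norm_mult[symmetric] by (rule norm_triangle_ineq)
      then have "(cmod (h t $ i))\<^sup>2 \<le> (u + v)\<^sup>2" by (intro power_mono) auto
      also have "\<dots> \<le> 2 * u\<^sup>2 + 2 * v\<^sup>2" using sum_squares_bound[of u v] by (simp add: power2_sum)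
      finally show "norm ((cmod (h t $ i))\<^sup>2) \<le> norm (2 * (cmod a)\<^sup>2 * (cmod (f t $ i))\<^sup>2 + 2 * (cmod b)\<^sup>2 * (cmod (g t $ i))\<^sup>2)"
        by (simp add: u_def v_def power_mult_distrib)
    qed
  qed
qed (use h in auto)

lemma continuous_on_interval_bounded:
  fixes f :: "real \<Rightarrow> complex"
  assumes "continuous_on {0..T} f"
  shows "\<exists>B. \<forall>t\<in>{0..T}. norm (f t) \<le> B"
proof -
  have "bounded (f ` {0..T})" by (rule compact_imp_bounded[OF compact_continuous_image[OF assms]]) simp
  then obtain B where "\<forall>x\<in>f ` {0..T}. norm x \<le> B" unfolding bounded_iff ..
  then show ?thesis by auto
qed

lemma continuous_L2:
  fixes f :: "real \<Rightarrow> complex vec"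
  assumes "\<And>t. t \<in> {0..T} \<Longrightarrow> f t \<in> carrier_vec n" "\<And>i. i < n \<Longrightarrow> continuous_on {0..T} (\<lambda>t. f t $ i)"
  shows "f \<in> L2 T n"
  unfolding L2_def mem_Collect_eq
proof (intro conjI ballI allI impI)
  fix i assume i: "i < n"
  show m: "(\<lambda>t. f t $ i) \<in> borel_measurable (lebesgue_on {0..T})"
    by (rule continuous_imp_measurable_on_sets_lebesgue[OF assms(2)[OF i]]) auto
  obtain B where B: "\<And>t. t \<in> {0..T} \<Longrightarrow> cmod (f t $ i) \<le> B"
    using continuous_on_interval_bounded[OF assms(2)[OF i]] by blast
  show "integrable (lebesgue_on {0..T}) (\<lambda>t. (cmod (f t $ i))\<^sup>2)"
  proof (rule finite_measure.integrable_const_bound[OF finite_measure_interval, of _ "B\<^sup>2"])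
    show "AE t in lebesgue_on {0..T}. norm ((cmod (f t $ i))\<^sup>2) \<le> B\<^sup>2"
      by (rule AE_I2) (auto intro!: power_mono B)
    show "(\<lambda>t. (cmod (f t $ i))\<^sup>2) \<in> borel_measurable (lebesgue_on {0..T})" using m by measurable
  qed
qed (use assms in auto)

lemma L2_integrable_on:
  fixes f :: "real \<Rightarrow> complex vec"
  assumes f: "f \<in> L2 T n" and i: "i < n" and t: "t \<in> {0..T}"
  shows "(\<lambda>s. f s $ i) integrable_on {0..t}"
proof -
  have fm: "(\<lambda>t. f t $ i) \<in> borel_measurable (lebesgue_on {0..T})" "integrable (lebesgue_on {0..T}) (\<lambda>t. (cmod (f t $ i))\<^sup>2)"
    using f i by (auto simp: L2_def)
  have "integrable (lebesgue_on {0..T}) (\<lambda>t. f t $ i)"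
  proof (rule Bochner_Integration.integrable_bound)
    show "integrable (lebesgue_on {0..T}) (\<lambda>t. 1 + (cmod (f t $ i))\<^sup>2)"
      using fm(2) finite_measure.integrable_const[OF finite_measure_interval] by (intro Bochner_Integration.integrable_add) auto
    show "AE t in lebesgue_on {0..T}. cmod (f t $ i) \<le> norm (1 + (cmod (f t $ i))\<^sup>2)"
    proof (rule AE_I2)
      fix t
      have "x \<le> 1 + x\<^sup>2" for x :: real using zero_le_power2[of "x - 1/2"] by (simp add: power2_eq_square algebra_simps)
      from this[of "cmod (f t $ i)"] show "cmod (f t $ i) \<le> norm (1 + (cmod (f t $ i))\<^sup>2)" by simp
    qed
  qed (rule fm)
  then have "(\<lambda>s. f s $ i) integrable_on {0..T}" by (rule integrable_on_lebesgue_on) auto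
  then show ?thesis by (rule integrable_on_subinterval) (use t in auto)
qed

lemma has_integral_of_vector_derivative:
  fixes z g :: "real \<Rightarrow> complex"
  assumes "\<And>t. t \<in> {0..T} \<Longrightarrow> (z has_vector_derivative g t) (at t within {0..T})" and t: "t \<in> {0..T}"
  shows "(g has_integral (z t - z 0)) {0..t}"
  by (rule fundamental_theorem_of_calculus) (use t in \<open>auto intro: has_vector_derivative_within_subset[OF assms(1)]\<close>)

lemma continuous_on_of_has_integral:
  fixes z g :: "real \<Rightarrow> complex"
  assumes T: "T \<ge> 0" and g: "\<And>t. t \<in> {0..T} \<Longrightarrow> (g has_integral (z t - z 0)) {0..t}"
  shows "continuous_on {0..T} z"
proof -
  have "g integrable_on {0..T}" using g[of T] T by auto
  then have "continuous_on {0..T} (\<lambda>t. z 0 + integral {0..t} g)"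
    by (intro continuous_intros indefinite_integral_continuous_1)
  moreover have "z 0 + integral {0..t} g = z t" if "t \<in> {0..T}" for t
    using integral_unique[OF g[OF that]] by simp
  ultimately show ?thesis by (rule continuous_on_eq)
qed

text \<open>A solution of the integral equation is differentiable with vanishing initial value, and
  Gronwall's inequality applies.\<close>

lemma volterra_unique:
  fixes d :: "nat \<Rightarrow> real \<Rightarrow> complex" and M :: "real \<Rightarrow> nat \<Rightarrow> nat \<Rightarrow> complex"
  assumes T: "T \<ge> 0"
    and M: "\<And>i j. i < m \<Longrightarrow> j < m \<Longrightarrow> continuous_on {0..T} (\<lambda>t. M t i j)"
    and d: "\<And>i t. i < m \<Longrightarrow> t \<in> {0..T} \<Longrightarrow> ((\<lambda>s. \<Sum>j<m. M s i j * d j s) has_integral d i t) {0..t}"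
    and i: "i < m" and t: "t \<in> {0..T}"
  shows "d i t = 0"
proof -
  have d0: "d i 0 = 0" if "i < m" for i 
  proof -
    have "((\<lambda>s. \<Sum>j<m. M s i j * d j s) has_integral d i 0) {0}" using d[OF that, of 0] T by simp
    then show ?thesis using has_integral_refl(2) has_integral_unique by blast
  qed
  have dc: "continuous_on {0..T} (d i)" if "i < m" for i
    by (rule continuous_on_of_has_integral[OF T, of "\<lambda>s. \<Sum>j<m. M s i j * d j s"]) (use d[OF that] d0[OF that] in auto)
  have der: "(d i has_vector_derivative (\<Sum>j<m. M t i j * d j t)) (at t within {0..T})" if i: "i < m" and t: "t \<in> {0..T}" for i t
  proof -
    have "continuous_on {0..T} (\<lambda>s. \<Sum>j<m. M s i j * d j s)"
      using M dc i by (intro continuous_intros) auto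
    then have "((\<lambda>t. integral {0..t} (\<lambda>s. \<Sum>j<m. M s i j * d j s)) has_vector_derivative (\<Sum>j<m. M t i j * d j t)) (at t within {0..T})"
      using t by (intro integral_has_vector_derivative)
    then show ?thesis unfolding has_vector_derivative_def
      by (rule has_derivative_transform[OF t, rotated]) (use integral_unique[OF d[OF i]] in auto)
  qed
  have "\<exists>B. \<forall>t\<in>{0..T}. norm (M t i j) \<le> B" if "i < m" "j < m" for i j
    using continuous_on_interval_bounded[OF M[OF that]] .
  then obtain B where B: "\<And>i j t. i < m \<Longrightarrow> j < m \<Longrightarrow> t \<in> {0..T} \<Longrightarrow> norm (M t i j) \<le> B i j" by metis
  define c where "c = (\<Sum>i<m. \<Sum>j<m. \<bar>B i j\<bar>)"
  have c: "norm (M t i j) \<le> c" if "i < m" "j < m" "t \<in> {0..T}" for i j t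
  proof -
    have "norm (M t i j) \<le> \<bar>B i j\<bar>" using B[OF that] by linarith
    also have "\<dots> \<le> (\<Sum>j<m. \<bar>B i j\<bar>)" using that by (intro member_le_sum) auto
    also have "\<dots> \<le> c" unfolding c_def using that by (intro member_le_sum[of i _ "\<lambda>i. \<Sum>j<m. \<bar>B i j\<bar>"]) (auto intro: sum_nonneg)
    finally show ?thesis .
  qed
  have "c \<ge> 0" by (auto simp: c_def intro!: sum_nonneg)
  then have "(\<Sum>i<m. (norm (d i t))\<^sup>2) \<le> exp (2 * real m * c * t) * (\<Sum>i<m. (norm (d i 0))\<^sup>2)"
    by (intro gronwall_linear_system[OF der c]) (use t in auto)
  also have "\<dots> = 0" using d0 by simp
  finally have "(\<Sum>i<m. (norm (d i t))\<^sup>2) = 0" by (intro antisym sum_nonneg) auto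
  then show ?thesis using i by (simp add: sum_nonneg_eq_0_iff)
qed

context sl_system
begin

section \<open>The boundary value problem as an integral equation\<close>

text \<open>The derivative of \<open>y\<close>, recovered from \<open>x = P y' + Q y\<close>.\<close>

definition dyf :: "(nat \<Rightarrow> complex) \<Rightarrow> real \<Rightarrow> nat \<Rightarrow> complex" where
  "dyf z t i = (\<Sum>p<n. of_real (inv_mat (P t) $$ (i, p)) * (z p - (\<Sum>q<n. of_real (Q t $$ (p, q)) * z (n + q))))"

lemma cmat_mult_vec:
  assumes "M \<in> carrier_mat n n" "v \<in> carrier_vec n" "i < n"
  shows "(cmat M *\<^sub>v v) $ i = (\<Sum>q<n. of_real (M $$ (i, q)) * v $ q)"
  using assms by (subst index_mult_mat_vec_sum[of _ n n]) (auto simp: cmat_def intro!: sum.cong)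

lemma J_mult_index:
  assumes B: "B \<in> carrier_mat N N" and i: "i < n" and p: "p < N"
  shows "(symp_J n * B) $$ (i, p) = - B $$ (n + i, p)" "(symp_J n * B) $$ (n + i, p) = B $$ (i, p)"
proof -
  have c: "col B p \<in> carrier_vec N" using carrier_matD[OF B] by (intro carrier_vecI) simp
  have "(symp_J n * B) $$ (r, p) = (symp_J n *\<^sub>v col B p) $ r" if "r < N" for r
    using that B p by simp
  then show "(symp_J n * B) $$ (i, p) = - B $$ (n + i, p)" "(symp_J n * B) $$ (n + i, p) = B $$ (i, p)"
    using symp_J_mult_vec[OF c i] i p B by auto
qed

lemma A_mult:
  assumes t: "t \<in> {0..T}" and i: "i < n"
  shows "(\<Sum>p<N. of_real (A t $$ (n + i, p)) * z p) = dyf z t i"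
    and "(\<Sum>p<N. of_real (A t $$ (i, p)) * z p) = (\<Sum>p<n. of_real (Q t $$ (p, i)) * dyf z t p) + (\<Sum>q<n. of_real (R t $$ (i, q)) * z (n + q))"
proof -
  note c = carriers[OF t] iP[OF t]
  define B where "B = B0_mat n (P t) (Q t) (R t)"
  have B: "B \<in> carrier_mat N N" using B0_path t by (auto simp: mat_path_def B_def)
  have q: "transpose_mat (Q t) \<in> carrier_mat n n" using c by simp
  note m1 = mult_carrier_mat[OF c(5) c(2)] and m2 = mult_carrier_mat[OF q c(5)]
  note m3 = mult_carrier_mat[OF m2 c(2)]
  have Bi: "B $$ (a, b) = inv_mat (P t) $$ (a, b)" "B $$ (a, n + b) = - (inv_mat (P t) * Q t) $$ (a, b)"
    "B $$ (n + a, b) = - (transpose_mat (Q t) * inv_mat (P t)) $$ (a, b)"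
    "B $$ (n + a, n + b) = (transpose_mat (Q t) * inv_mat (P t) * Q t) $$ (a, b) - R t $$ (a, b)"
    if "a < n" "b < n" for a b
    using that c q m1 m2 m3 carrier_matD[OF c(5)] carrier_matD[OF m1] carrier_matD[OF m2] carrier_matD[OF m3] carrier_matD[OF c(3)]
    by (simp_all add: B_def B0_mat_def del: index_mult_mat(1) assoc_mult_mat)
  have A_eq: "A t = symp_J n * B" by (simp add: A_def B_def)
  have dy: "dyf z t a = (\<Sum>p<n. of_real (inv_mat (P t) $$ (a, p)) * z p) - (\<Sum>p<n. of_real ((inv_mat (P t) * Q t) $$ (a, p)) * z (n + p))" if a: "a < n" for a
  proof -
    have "(\<Sum>p<n. of_real (inv_mat (P t) $$ (a, p)) * (\<Sum>r<n. of_real (Q t $$ (p, r)) * z (n + r)))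
       = (\<Sum>r<n. of_real (\<Sum>p<n. inv_mat (P t) $$ (a, p) * Q t $$ (p, r)) * z (n + r))"
      unfolding sum_distrib_left of_real_sum sum_distrib_right by (subst sum.swap) (simp add: mult.assoc)
    also have "\<dots> = (\<Sum>p<n. of_real ((inv_mat (P t) * Q t) $$ (a, p)) * z (n + p))"
      using index_mult_mat_sum[OF c(5) c(2) a] by (intro sum.cong refl) simp
    finally show ?thesis unfolding dyf_def by (simp add: right_diff_distrib sum_subtractf del: index_mult_mat(1))
  qed
  show "(\<Sum>p<N. of_real (A t $$ (n + i, p)) * z p) = dyf z t i"
    unfolding A_eq mult_2 sum_lessThan_add dy[OF i]
    using J_mult_index(2)[OF B i] i by (simp add: Bi sum_negf del: index_mult_mat(1))
  have "(\<Sum>p<n. of_real (Q t $$ (p, i)) * dyf z t p)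
     = (\<Sum>p<n. of_real ((transpose_mat (Q t) * inv_mat (P t)) $$ (i, p)) * z p) - (\<Sum>p<n. of_real ((transpose_mat (Q t) * inv_mat (P t) * Q t) $$ (i, p)) * z (n + p))"
  proof -
    have e: "(\<Sum>p<n. of_real (Q t $$ (p, i)) * (\<Sum>r<n. of_real (X $$ (p, r)) * w r)) = (\<Sum>r<n. of_real ((transpose_mat (Q t) * X) $$ (i, r)) * w r)"
      if X: "X \<in> carrier_mat n n" for X and w :: "nat \<Rightarrow> complex"
    proof -
      have "(\<Sum>p<n. of_real (Q t $$ (p, i)) * (\<Sum>r<n. of_real (X $$ (p, r)) * w r)) = (\<Sum>r<n. of_real (\<Sum>p<n. Q t $$ (p, i) * X $$ (p, r)) * w r)"
        unfolding sum_distrib_left of_real_sum sum_distrib_right by (subst sum.swap) (simp add: mult.assoc)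
      also have "\<dots> = (\<Sum>r<n. of_real ((transpose_mat (Q t) * X) $$ (i, r)) * w r)"
      proof (rule sum.cong[OF refl])
        fix r assume "r \<in> {..<n}"
        then have "(transpose_mat (Q t) * X) $$ (i, r) = (\<Sum>p<n. Q t $$ (p, i) * X $$ (p, r))"
          using index_mult_mat_sum[OF q X i, of r] i carrier_matD[OF c(2)] by simp
        then show "of_real (\<Sum>p<n. Q t $$ (p, i) * X $$ (p, r)) * w r = of_real ((transpose_mat (Q t) * X) $$ (i, r)) * w r" by simp
      qed
      finally show ?thesis .
    qed
    show ?thesis
      using e[OF c(5), of z] e[OF m1, of "\<lambda>p. z (n + p)"] assoc_mult_mat[OF q c(5) c(2)]
      by (simp add: dy right_diff_distrib sum_subtractf del: index_mult_mat(1))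
  qed
  then show "(\<Sum>p<N. of_real (A t $$ (i, p)) * z p) = (\<Sum>p<n. of_real (Q t $$ (p, i)) * dyf z t p) + (\<Sum>q<n. of_real (R t $$ (i, q)) * z (n + q))"
    unfolding A_eq mult_2 sum_lessThan_add
    using J_mult_index(1)[OF B i] i by (simp add: Bi sum_negf left_diff_distrib sum_subtractf del: index_mult_mat(1) assoc_mult_mat)
qed

lemma Bd_mult:
  assumes t: "t \<in> {0..T}" and i: "i < n"
  shows "(\<Sum>p<N. of_real (Bd t $$ (n + i, p)) * z p) = 0"
    and "(\<Sum>p<N. of_real (Bd t $$ (i, p)) * z p) = (\<Sum>q<n. of_real (R1 t $$ (i, q)) * z (n + q))"
proof -
  note c = carriers[OF t]
  define D where "D = D_mat n (R1 t)"
  have D: "D \<in> carrier_mat N N" using D_path t by (auto simp: mat_path_def D_def)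
  have Di: "D $$ (a, b) = 0" "D $$ (a, n + b) = 0" "D $$ (n + a, b) = 0" "D $$ (n + a, n + b) = - R1 t $$ (a, b)"
    if "a < n" "b < n" for a b
    using that carrier_matD[OF c(4)] by (simp_all add: D_def D_mat_def)
  have B_eq: "Bd t = symp_J n * D" by (simp add: Bd_def D_def)
  show "(\<Sum>p<N. of_real (Bd t $$ (n + i, p)) * z p) = 0"
    unfolding B_eq mult_2 sum_lessThan_add using J_mult_index(2)[OF D i] i by (simp add: Di del: index_mult_mat(1))
  show "(\<Sum>p<N. of_real (Bd t $$ (i, p)) * z p) = (\<Sum>q<n. of_real (R1 t $$ (i, q)) * z (n + q))"
    unfolding B_eq mult_2 sum_lessThan_add using J_mult_index(1)[OF D i] i by (simp add: Di del: index_mult_mat(1))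
qed

lemma P_inverse_sum:
  assumes t: "t \<in> {0..T}" and i: "i < n"
  shows "(\<Sum>p<n. of_real (inv_mat (P t) $$ (i, p)) * (\<Sum>q<n. of_real (P t $$ (p, q)) * v q)) = (v i :: complex)"
    and "(\<Sum>p<n. of_real (P t $$ (i, p)) * (\<Sum>q<n. of_real (inv_mat (P t) $$ (p, q)) * v q)) = (v i :: complex)"
proof -
  note c = carriers[OF t] iP[OF t]
  have gen: "(\<Sum>p<n. of_real (X $$ (i, p)) * (\<Sum>q<n. of_real (Y $$ (p, q)) * v q)) = v i"
    if X: "X \<in> carrier_mat n n" and Y: "Y \<in> carrier_mat n n" and XY: "X * Y = 1\<^sub>m n" for X Y :: "real mat"
  proof -
    have "(\<Sum>p<n. of_real (X $$ (i, p)) * (\<Sum>q<n. of_real (Y $$ (p, q)) * v q)) = (\<Sum>q<n. of_real (\<Sum>p<n. X $$ (i, p) * Y $$ (p, q)) * v q)"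
      unfolding sum_distrib_left of_real_sum sum_distrib_right by (subst sum.swap) (simp add: mult.assoc)
    also have "\<dots> = (\<Sum>q<n. if q = i then v q else 0)"
    proof (rule sum.cong[OF refl])
      fix q assume "q \<in> {..<n}"
      then have q: "q < n" by simp
      have e: "(\<Sum>p<n. X $$ (i, p) * Y $$ (p, q)) = (if i = q then 1 else 0)"
        unfolding index_mult_mat_sum[OF X Y i q, symmetric] XY using i q by simp
      show "of_real (\<Sum>p<n. X $$ (i, p) * Y $$ (p, q)) * v q = (if q = i then v q else 0)" unfolding e by simp
    qed
    finally show ?thesis using i by simp
  qed
  show "(\<Sum>p<n. of_real (inv_mat (P t) $$ (i, p)) * (\<Sum>q<n. of_real (P t $$ (p, q)) * v q)) = v i"
    by (rule gen) (use c in auto)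
  show "(\<Sum>p<n. of_real (P t $$ (i, p)) * (\<Sum>q<n. of_real (inv_mat (P t) $$ (p, q)) * v q)) = v i"
    by (rule gen) (use c in auto)
qed

lemma dyf_iff:
  assumes t: "t \<in> {0..T}"
  shows "(\<forall>i<n. z i = (\<Sum>q<n. of_real (P t $$ (i, q)) * d q) + (\<Sum>q<n. of_real (Q t $$ (i, q)) * z (n + q)))
     \<longleftrightarrow> (\<forall>i<n. d i = dyf z t i)"
proof
  assume a: "\<forall>i<n. z i = (\<Sum>q<n. of_real (P t $$ (i, q)) * d q) + (\<Sum>q<n. of_real (Q t $$ (i, q)) * z (n + q))"
  show "\<forall>i<n. d i = dyf z t i"
  proof (intro allI impI)
    fix i assume i: "i < n"
    have "z p - (\<Sum>q<n. of_real (Q t $$ (p, q)) * z (n + q)) = (\<Sum>q<n. of_real (P t $$ (p, q)) * d q)" if "p < n" for p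
      using a that by (simp add: algebra_simps)
    then have "dyf z t i = (\<Sum>p<n. of_real (inv_mat (P t) $$ (i, p)) * (\<Sum>q<n. of_real (P t $$ (p, q)) * d q))"
      unfolding dyf_def by (intro sum.cong refl) auto
    then show "d i = dyf z t i" using P_inverse_sum(1)[OF t i] by simp
  qed
next
  assume a: "\<forall>i<n. d i = dyf z t i"
  show "\<forall>i<n. z i = (\<Sum>q<n. of_real (P t $$ (i, q)) * d q) + (\<Sum>q<n. of_real (Q t $$ (i, q)) * z (n + q))"
  proof (intro allI impI)
    fix i assume i: "i < n"
    have "(\<Sum>q<n. of_real (P t $$ (i, q)) * d q) = z i - (\<Sum>q<n. of_real (Q t $$ (i, q)) * z (n + q))"
      using a P_inverse_sum(2)[OF t i, of "\<lambda>p. z p - (\<Sum>q<n. of_real (Q t $$ (p, q)) * z (n + q))"] by (simp add: dyf_def)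
    then show "z i = (\<Sum>q<n. of_real (P t $$ (i, q)) * d q) + (\<Sum>q<n. of_real (Q t $$ (i, q)) * z (n + q))" by simp
  qed
qed

text \<open>The system \<open>A y = f\<close> in integrated form, for \<open>z = (P y' + Q y, y)\<close> with all components
  continuous. The integral form fits a right hand side that is only square integrable.\<close>

definition SLsol :: "(real \<Rightarrow> complex vec) \<Rightarrow> (nat \<Rightarrow> real \<Rightarrow> complex) \<Rightarrow> bool" where
  "SLsol f z \<longleftrightarrow> (\<forall>i<N. continuous_on {0..T} (z i)) \<and> (\<forall>i<N. \<forall>t\<in>{0..T}.
     ((\<lambda>s. (\<Sum>p<N. of_real (A s $$ (i, p)) * z p s) - (if i < n then f s $ i else 0)) has_integral (z i t - z i 0)) {0..t})"

lemma SL_graph_imp_SLsol: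
  assumes "(y, f) \<in> SL_graph n T P Q R \<Lambda>0 \<Lambda>1"
  obtains z where "SLsol f z" "BC z" "\<And>t i. t \<in> {0..T} \<Longrightarrow> i < n \<Longrightarrow> y t $ i = z (n + i) t"
proof -
  obtain dy x dx where f: "f \<in> L2 T n" and Wy: "W12_deriv T n y dy" and Wx: "W12_deriv T n x dx"
    and AEx: "AE t in lebesgue_on {0..T}. x t = cmat (P t) *\<^sub>v dy t + cmat (Q t) *\<^sub>v y t"
    and bc: "x 0 @\<^sub>v y 0 \<in> complexify \<Lambda>0" "x T @\<^sub>v y T \<in> complexify \<Lambda>1"
    and AEf: "AE t in lebesgue_on {0..T}. f t = - dx t + cmat (transpose_mat (Q t)) *\<^sub>v dy t + cmat (R t) *\<^sub>v y t"
    using assms by (auto simp: SL_graph_def)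
  define z where "z = (\<lambda>i t. if i < n then x t $ i else y t $ (i - n))"
  obtain S1 where S1: "negligible S1" "\<And>t. t \<in> {0..T} \<Longrightarrow> t \<notin> S1 \<Longrightarrow> x t = cmat (P t) *\<^sub>v dy t + cmat (Q t) *\<^sub>v y t"
    using AE_lebesgue_on_negligible[OF AEx] by blast
  obtain S2 where S2: "negligible S2" "\<And>t. t \<in> {0..T} \<Longrightarrow> t \<notin> S2 \<Longrightarrow> f t = - dx t + cmat (transpose_mat (Q t)) *\<^sub>v dy t + cmat (R t) *\<^sub>v y t"
    using AE_lebesgue_on_negligible[OF AEf] by blast
  have neg: "negligible (S1 \<union> S2)" using S1 S2 by simp
  have car: "x t \<in> carrier_vec n" "y t \<in> carrier_vec n" "dx t \<in> carrier_vec n" "dy t \<in> carrier_vec n" "f t \<in> carrier_vec n" if "t \<in> {0..T}" for t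
    using Wx Wy f that by (auto simp: W12_deriv_def L2_def)
  have dyi: "dy t $ i = dyf (\<lambda>p. z p t) t i" if t: "t \<in> {0..T}" "t \<notin> S1" and i: "i < n" for t i
  proof -
    have "\<forall>i<n. z i t = (\<Sum>q<n. of_real (P t $$ (i, q)) * dy t $ q) + (\<Sum>q<n. of_real (Q t $$ (i, q)) * z (n + q) t)"
    proof (intro allI impI)
      fix i assume i: "i < n"
      have "z i t = (cmat (P t) *\<^sub>v dy t + cmat (Q t) *\<^sub>v y t) $ i" using i S1(2)[OF t] by (simp add: z_def)
      also have "\<dots> = (cmat (P t) *\<^sub>v dy t) $ i + (cmat (Q t) *\<^sub>v y t) $ i"
        using i carriers[OF t(1)] by (intro index_add_vec(1)) (auto simp: cmat_def)
      also have "\<dots> = (\<Sum>q<n. of_real (P t $$ (i, q)) * dy t $ q) + (\<Sum>q<n. of_real (Q t $$ (i, q)) * z (n + q) t)"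
        using cmat_mult_vec[OF carriers(1)[OF t(1)] car(4)[OF t(1)] i] cmat_mult_vec[OF carriers(2)[OF t(1)] car(2)[OF t(1)] i]
        by (simp add: z_def)
      finally show "z i t = (\<Sum>q<n. of_real (P t $$ (i, q)) * dy t $ q) + (\<Sum>q<n. of_real (Q t $$ (i, q)) * z (n + q) t)" .
    qed
    then show ?thesis using dyf_iff[OF t(1), of "\<lambda>p. z p t" "\<lambda>q. dy t $ q"] i by blast
  qed
  have dxi: "dx t $ i = (\<Sum>p<N. of_real (A t $$ (i, p)) * z p t) - f t $ i" if t: "t \<in> {0..T}" "t \<notin> S1 \<union> S2" and i: "i < n" for t i
  proof -
    have QT: "transpose_mat (Q t) \<in> carrier_mat n n" using carriers[OF t(1)] by simp
    have "f t $ i = (- dx t + cmat (transpose_mat (Q t)) *\<^sub>v dy t + cmat (R t) *\<^sub>v y t) $ i" using S2(2)[OF t(1)] t by simp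
    also have "\<dots> = - dx t $ i + (cmat (transpose_mat (Q t)) *\<^sub>v dy t) $ i + (cmat (R t) *\<^sub>v y t) $ i"
      using i carriers[OF t(1)] car[OF t(1)] by (simp add: cmat_def)
    also have "\<dots> = - dx t $ i + (\<Sum>q<n. of_real (Q t $$ (q, i)) * dy t $ q) + (\<Sum>q<n. of_real (R t $$ (i, q)) * z (n + q) t)"
      using cmat_mult_vec[OF QT car(4)[OF t(1)] i] cmat_mult_vec[OF carriers(3)[OF t(1)] car(2)[OF t(1)] i] carriers[OF t(1)] i
      by (simp add: z_def)
    also have "\<dots> = - dx t $ i + (\<Sum>p<N. of_real (A t $$ (i, p)) * z p t)"
      unfolding A_mult(2)[OF t(1) i] using dyi t by simp
    finally show ?thesis by (simp add: algebra_simps)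
  qed
  have int: "((\<lambda>s. (\<Sum>p<N. of_real (A s $$ (i, p)) * z p s) - (if i < n then f s $ i else 0)) has_integral (z i t - z i 0)) {0..t}"
    if i: "i < N" and t: "t \<in> {0..T}" for i t
  proof (cases "i < n")
    case True
    have "((\<lambda>s. dx s $ i) has_integral (z i t - z i 0)) {0..t}"
      using Wx True t by (simp add: W12_deriv_def z_def)
    then show ?thesis
      by (rule has_integral_spike[OF neg, rotated]) (use dxi[OF _ _ True] t True in auto)
  next
    case False
    have "((\<lambda>s. dy s $ (i - n)) has_integral (z i t - z i 0)) {0..t}"
      using Wy False t i by (simp add: W12_deriv_def z_def)
    then show ?thesis
    proof (rule has_integral_spike[OF neg, rotated])
      fix s assume "s \<in> {0..t} - (S1 \<union> S2)"
      then have s: "s \<in> {0..T}" "s \<notin> S1" using t by auto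
      have "i - n < n" using i by auto
      then show "(\<Sum>p<N. of_real (A s $$ (i, p)) * z p s) - (if i < n then f s $ i else 0) = dy s $ (i - n)"
        using A_mult(1)[OF s(1), of "i - n" "\<lambda>p. z p s"] dyi[OF s, of "i - n"] False by simp
    qed
  qed
  have sol: "SLsol f z" unfolding SLsol_def
  proof (intro conjI allI impI ballI int)
    fix i assume i: "i < N"
    show "continuous_on {0..T} (z i)"
      by (rule continuous_on_of_has_integral[OF _ int[OF i]]) (use T in auto)
  qed
  have "vec N (\<lambda>i. z i t) = x t @\<^sub>v y t" if "t \<in> {0..T}" for t
    using car[OF that] by (intro eq_vecI) (auto simp: z_def)
  then have "BC z" unfolding BC_iff using bc T by simp
  then show ?thesis using that[OF sol] by (simp add: z_def)
qed

lemma SLsol_imp_SL_graph: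
  assumes f: "f \<in> L2 T n" and sol: "SLsol f z" and bc: "BC z"
  shows "((\<lambda>t. vec n (\<lambda>i. z (n + i) t)), f) \<in> SL_graph n T P Q R \<Lambda>0 \<Lambda>1"
proof -
  define y where "y = (\<lambda>t. vec n (\<lambda>i. z (n + i) t))"
  define x where "x = (\<lambda>t. vec n (\<lambda>i. z i t))"
  define az where "az = (\<lambda>i t. \<Sum>p<N. of_real (A t $$ (i, p)) * z p t)"
  define dy where "dy = (\<lambda>t. vec n (\<lambda>i. az (n + i) t))"
  define dx where "dx = (\<lambda>t. vec n (\<lambda>i. az i t - f t $ i))"
  have zc: "continuous_on {0..T} (z i)" if "i < N" for i using sol that by (simp add: SLsol_def)
  have azc: "continuous_on {0..T} (az i)" if "i < N" for i
    unfolding az_def using that A_cont zc by (intro continuous_intros) auto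
  have int: "((\<lambda>s. az i s - (if i < n then f s $ i else 0)) has_integral (z i t - z i 0)) {0..t}" if "i < N" "t \<in> {0..T}" for i t
    using sol that by (simp add: SLsol_def az_def)
  have fc: "f t \<in> carrier_vec n" if "t \<in> {0..T}" for t using f that by (auto simp: L2_def)
  have dyL: "dy \<in> L2 T n" by (rule continuous_L2) (auto simp: dy_def azc)
  have "(\<lambda>t. vec n (\<lambda>i. az i t)) \<in> L2 T n" by (rule continuous_L2) (auto simp: azc)
  then have dxL: "dx \<in> L2 T n" by (rule L2_cong_lin[OF _ f, where a = 1 and b = "- 1"]) (auto simp: dx_def)
  have Wy: "W12_deriv T n y dy" unfolding W12_deriv_def
  proof (intro conjI ballI allI impI dyL)
    fix i t assume it: "i < n" "t \<in> {0..T}"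
    have "((\<lambda>s. az (n + i) s) has_integral (z (n + i) t - z (n + i) 0)) {0..t}" using int[of "n + i" t] it by simp
    then show "((\<lambda>s. dy s $ i) has_integral (y t $ i - y 0 $ i)) {0..t}" using it by (simp add: dy_def y_def)
  qed (simp add: y_def)
  have Wx: "W12_deriv T n x dx" unfolding W12_deriv_def
  proof (intro conjI ballI allI impI dxL)
    fix i t assume it: "i < n" "t \<in> {0..T}"
    have "((\<lambda>s. az i s - f s $ i) has_integral (z i t - z i 0)) {0..t}" using int[of i t] it by simp
    then show "((\<lambda>s. dx s $ i) has_integral (x t $ i - x 0 $ i)) {0..t}" using it by (simp add: dx_def x_def)
  qed (simp add: x_def)
  have xe: "x t = cmat (P t) *\<^sub>v dy t + cmat (Q t) *\<^sub>v y t" if t: "t \<in> {0..T}" for t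
  proof (rule eq_vecI)
    fix i assume "i < dim_vec (cmat (P t) *\<^sub>v dy t + cmat (Q t) *\<^sub>v y t)"
    then have i: "i < n" using carriers[OF t] by (simp add: cmat_def)
    have d: "dy t \<in> carrier_vec n" "y t \<in> carrier_vec n" by (auto simp: dy_def y_def)
    have "\<forall>i<n. z i t = (\<Sum>q<n. of_real (P t $$ (i, q)) * dy t $ q) + (\<Sum>q<n. of_real (Q t $$ (i, q)) * z (n + q) t)"
      unfolding dyf_iff[OF t, of "\<lambda>p. z p t" "\<lambda>q. dy t $ q"] using A_mult(1)[OF t] by (simp add: dy_def az_def)
    moreover have "(cmat (P t) *\<^sub>v dy t + cmat (Q t) *\<^sub>v y t) $ i = (cmat (P t) *\<^sub>v dy t) $ i + (cmat (Q t) *\<^sub>v y t) $ i"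
      using i carriers[OF t] by (intro index_add_vec(1)) (auto simp: cmat_def)
    ultimately show "x t $ i = (cmat (P t) *\<^sub>v dy t + cmat (Q t) *\<^sub>v y t) $ i"
      using i cmat_mult_vec[OF carriers(1)[OF t] d(1) i] cmat_mult_vec[OF carriers(2)[OF t] d(2) i] by (simp add: x_def y_def)
  qed (use carriers[OF t] in \<open>auto simp: x_def cmat_def\<close>)
  have fe: "f t = - dx t + cmat (transpose_mat (Q t)) *\<^sub>v dy t + cmat (R t) *\<^sub>v y t" if t: "t \<in> {0..T}" for t
  proof (rule eq_vecI)
    have QT: "transpose_mat (Q t) \<in> carrier_mat n n" using carriers[OF t] by simp
    fix i assume "i < dim_vec (- dx t + cmat (transpose_mat (Q t)) *\<^sub>v dy t + cmat (R t) *\<^sub>v y t)"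
    then have i: "i < n" using carriers[OF t] by (simp add: cmat_def)
    have d: "dy t \<in> carrier_vec n" "y t \<in> carrier_vec n" "dx t \<in> carrier_vec n" by (auto simp: dy_def y_def dx_def)
    have "(- dx t + cmat (transpose_mat (Q t)) *\<^sub>v dy t + cmat (R t) *\<^sub>v y t) $ i = - dx t $ i + (cmat (transpose_mat (Q t)) *\<^sub>v dy t) $ i + (cmat (R t) *\<^sub>v y t) $ i"
      using i carriers[OF t] d by (simp add: cmat_def)
    also have "\<dots> = - dx t $ i + (\<Sum>q<n. of_real (Q t $$ (q, i)) * dy t $ q) + (\<Sum>q<n. of_real (R t $$ (i, q)) * z (n + q) t)"
      using cmat_mult_vec[OF QT d(1) i] cmat_mult_vec[OF carriers(3)[OF t] d(2) i] carriers[OF t] i by (simp add: y_def)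
    also have "\<dots> = - dx t $ i + az i t"
      unfolding az_def A_mult(2)[OF t i] using A_mult(1)[OF t] by (simp add: dy_def az_def)
    also have "\<dots> = f t $ i" using i by (simp add: dx_def)
    finally show "f t $ i = (- dx t + cmat (transpose_mat (Q t)) *\<^sub>v dy t + cmat (R t) *\<^sub>v y t) $ i" ..
  qed (use carriers[OF t] fc[OF t] in \<open>auto simp: cmat_def\<close>)
  have "vec N (\<lambda>i. z i t) = x t @\<^sub>v y t" for t
    by (intro eq_vecI) (auto simp: x_def y_def)
  then have bcs: "x 0 @\<^sub>v y 0 \<in> complexify \<Lambda>0 \<and> x T @\<^sub>v y T \<in> complexify \<Lambda>1" using bc unfolding BC_iff by simp
  have "AE t in lebesgue_on {0..T}. x t = cmat (P t) *\<^sub>v dy t + cmat (Q t) *\<^sub>v y t"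
    by (rule AE_I2) (use xe in auto)
  moreover have "AE t in lebesgue_on {0..T}. f t = - dx t + cmat (transpose_mat (Q t)) *\<^sub>v dy t + cmat (R t) *\<^sub>v y t"
    by (rule AE_I2) (use fe in auto)
  ultimately show ?thesis
    unfolding SL_graph_def using f Wy Wx bcs by (auto simp: y_def[symmetric])
qed

end

section \<open>The inverse operator\<close>

lemma continuous_AE_zero:
  fixes g :: "real \<Rightarrow> complex"
  assumes g: "continuous_on {0..T} g" and T: "T > 0" and ae: "AE t in lebesgue_on {0..T}. g t = 0" and t: "t \<in> {0..T}"
  shows "g t = 0"
proof -
  obtain S where S: "negligible S" "\<And>t. t \<in> {0..T} \<Longrightarrow> t \<notin> S \<Longrightarrow> g t = 0"
    using AE_lebesgue_on_negligible[OF ae] by blast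
  define U where "U = {t \<in> {0<..<T}. g t \<in> - {0}}"
  have "continuous_on {0<..<T} g" using g by (rule continuous_on_subset) auto
  then have "open ({0<..<T} \<inter> g -` (- {0}))" by (rule continuous_open_preimage) auto
  moreover have "{0<..<T} \<inter> g -` (- {0}) = U" by (auto simp: U_def)
  ultimately have "open U" by simp
  have "U \<subseteq> S"
  proof
    fix t assume "t \<in> U"
    then show "t \<in> S" using S(2)[of t] by (auto simp: U_def)
  qed
  then have "negligible U" using S(1) negligible_subset by blast
  then have "U = {}" using \<open>open U\<close> open_not_negligible by blast
  then have "g s = 0" if "s \<in> {0<..<T}" for s using that by (auto simp: U_def)
  moreover have cl: "closure {0<..<T} = {0..T}" using T by simp
  ultimately show ?thesis
    using continuous_constant_on_closure[of "{0<..<T}" g 0 t] g t by simp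
qed

lemma mat_inverse_sum:
  fixes X Y :: "real mat" and v :: "nat \<Rightarrow> complex"
  assumes X: "X \<in> carrier_mat n n" and Y: "Y \<in> carrier_mat n n" and XY: "X * Y = 1\<^sub>m n" and i: "i < n"
  shows "(\<Sum>p<n. of_real (X $$ (i, p)) * (\<Sum>q<n. of_real (Y $$ (p, q)) * v q)) = v i"
proof -
  have "(\<Sum>p<n. of_real (X $$ (i, p)) * (\<Sum>q<n. of_real (Y $$ (p, q)) * v q)) = (\<Sum>q<n. of_real (\<Sum>p<n. X $$ (i, p) * Y $$ (p, q)) * v q)"
    unfolding sum_distrib_left of_real_sum sum_distrib_right by (subst sum.swap) (simp add: mult.assoc)
  also have "\<dots> = (\<Sum>q<n. if q = i then v q else 0)"
  proof (rule sum.cong[OF refl])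
    fix q assume "q \<in> {..<n}"
    then have q: "q < n" by simp
    have e: "(\<Sum>p<n. X $$ (i, p) * Y $$ (p, q)) = (if i = q then 1 else 0)"
      unfolding index_mult_mat_sum[OF X Y i q, symmetric] XY using i q by simp
    show "of_real (\<Sum>p<n. X $$ (i, p) * Y $$ (p, q)) * v q = (if q = i then v q else 0)" unfolding e by simp
  qed
  finally show ?thesis using i by simp
qed

context sl_system
begin

definition e0 :: "nat \<Rightarrow> complex" where "e0 k = (if k = 0 then 1 else 0)"

lemma geometric_e0: "geometric_bound e0"
  unfolding geometric_bound_def by (intro exI[of _ 1] exI[of _ 0]) (auto simp: e0_def)

lemma sol_e0: "i < N \<Longrightarrow> sol e0 w i t = (\<Sum>l<N. of_real (\<gamma>0 t $$ (i, l)) * w l)"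
proof -
  have S: "vs.S e0 t l j = (if l = j then 1 else 0)" if "l < N" "j < N" for l j
  proof -
    have "vs.S e0 t l j = (\<Sum>k\<in>{0}. e0 k * of_real (vs.F k t l j))"
      unfolding vs.S_def by (rule suminf_finite) (auto simp: e0_def)
    then show ?thesis using that by (simp add: e0_def vs.F_0)
  qed
  have "(\<Sum>j<N. vs.S e0 t l j * w j) = w l" if "l < N" for l
    using that by (simp add: S if_distrib[of "\<lambda>x. x * _"] cong: if_cong)
  then show "sol e0 w i t = (\<Sum>l<N. of_real (\<gamma>0 t $$ (i, l)) * w l)"
    unfolding sol_def by (intro sum.cong) auto
qed

lemma \<Delta>_e0: "i < n \<Longrightarrow> j < n \<Longrightarrow> \<Delta> e0 i j = of_real (Pk 0 $$ (i, j))"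
proof -
  have "\<Delta> e0 i j = (\<Sum>k\<in>{0}. e0 k * of_real (Pk k $$ (i, j)))"
    unfolding \<Delta>_def by (rule suminf_finite) (auto simp: e0_def)
  then show "\<Delta> e0 i j = of_real (Pk 0 $$ (i, j))" by (simp add: e0_def)
qed

lemma sol_e0_deriv:
  assumes "i < N" "t \<in> {0..T}"
  shows "((\<lambda>t. sol e0 w i t) has_vector_derivative (\<Sum>p<N. of_real (A t $$ (i, p)) * sol e0 w p t)) (at t within {0..T})"
proof -
  have "(\<lambda>k. e0 (Suc k)) = (\<lambda>k. 0)" by (simp add: e0_def)
  moreover have "sol (\<lambda>k. 0) w p t = 0" for p by (simp add: sol_def vs.S_def)
  ultimately show ?thesis using sol_deriv[OF geometric_e0 assms, of w] by simp
qed

lemma M3v_cong: "(\<And>q. q < N \<Longrightarrow> z q = z' q) \<Longrightarrow> M3v z i = M3v z' i"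
  unfolding M3v_def by (intro sum.cong) auto

lemma SLsol_of_deriv:
  assumes "\<And>i t. i < N \<Longrightarrow> t \<in> {0..T} \<Longrightarrow> (z i has_vector_derivative
     (\<Sum>p<N. of_real (A t $$ (i, p)) * z p t) - (if i < n then f t $ i else 0)) (at t within {0..T})"
  shows "SLsol f z"
  unfolding SLsol_def
proof (intro conjI allI impI ballI)
  fix i assume i: "i < N"
  show "continuous_on {0..T} (z i)"
    unfolding continuous_on_eq_continuous_within
    using has_vector_derivative_continuous[OF assms[OF i]] by blast
  fix t assume t: "t \<in> {0..T}"
  show "((\<lambda>s. (\<Sum>p<N. of_real (A s $$ (i, p)) * z p s) - (if i < n then f s $ i else 0)) has_integral (z i t - z i 0)) {0..t}"
    by (rule has_integral_of_vector_derivative[OF assms[OF i] t])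
qed

lemma SLsol_sol_e0: "SLsol (\<lambda>t. 0\<^sub>v n) (sol e0 w)"
  by (rule SLsol_of_deriv) (use sol_e0_deriv[of _ _ w] in auto)

lemma Pk_carrier: "Pk k \<in> carrier_mat n n"
  by (simp add: Pk_def P_block_def)

text \<open>If \<open>y\<close> vanishes identically, then so does \<open>y'\<close>, and with it \<open>x = P y' + Q y\<close>.\<close>
lemma initial_zero_of_lower_zero:
  fixes z :: "nat \<Rightarrow> real \<Rightarrow> complex"
  assumes d: "\<And>i. i < n \<Longrightarrow> (z (n + i) has_vector_derivative (\<Sum>p<N. of_real (A 0 $$ (n + i, p)) * z p 0)) (at 0 within {0..T})"
    and z: "\<And>i t. i < n \<Longrightarrow> t \<in> {0..T} \<Longrightarrow> z (n + i) t = 0" and i: "i < N"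
  shows "z i 0 = 0"
proof -
  have T0: "0 \<in> {0..T}" using T by simp
  have "dyf (\<lambda>p. z p 0) 0 i = 0" if i: "i < n" for i
  proof -
    have "((\<lambda>t. 0) has_vector_derivative 0) (at 0 within {0..T})" by simp
    then have "(z (n + i) has_vector_derivative 0) (at 0 within {0..T})"
      unfolding has_vector_derivative_def by (rule has_derivative_transform[OF T0, rotated]) (use z i in auto)
    then have "(\<Sum>p<N. of_real (A 0 $$ (n + i, p)) * z p 0) = 0"
      using vector_derivative_unique_within_closed_interval[of 0 T 0 "z (n + i)"] d[OF i] T by auto
    then show ?thesis using A_mult(1)[OF T0 i, of "\<lambda>p. z p 0"] by simp
  qed
  then have "\<forall>i<n. z i 0 = (\<Sum>q<n. of_real (P 0 $$ (i, q)) * 0) + (\<Sum>q<n. of_real (Q 0 $$ (i, q)) * z (n + q) 0)"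
    using dyf_iff[OF T0, of "\<lambda>p. z p 0" "\<lambda>_. 0"] by simp
  then have "z i 0 = 0" if "i < n" using z T0 that by simp
  moreover have "z i 0 = 0" if "\<not> i < n" using z[of "i - n" 0] T0 that i by simp
  ultimately show ?thesis by blast
qed

lemma BC_sol_e0:
  assumes "\<And>i. i < n \<Longrightarrow> (\<Sum>j<n. of_real (Pk 0 $$ (i, j)) * c j) = 0"
  shows "BC (sol e0 (emb c))"
  unfolding BC_def
proof (intro conjI ballI allI impI)
  fix i assume i: "i \<in> {n..<N}"
  have "M3v (\<lambda>q. sol e0 (emb c) q 0) i = M3v (emb c) i"
    by (rule M3v_cong) (simp add: sol_0 e0_def)
  then show "M3v (\<lambda>q. sol e0 (emb c) q 0) i = 0" using M3v_emb[of i c] i by simp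
next
  fix i assume i: "i < n"
  show "M3v (\<lambda>q. sol e0 (emb c) q T) (k0 + i) = 0"
    unfolding M3v_sol_T[OF geometric_e0 i] using assms[OF i] i by (simp add: \<Delta>_e0)
qed

text \<open>A kernel vector of \<open>Pk 0\<close> is the initial datum of a solution of \<open>A y = 0\<close> satisfying both
  boundary conditions.\<close>

lemma det_Pk0: "det (Pk 0) \<noteq> 0"
proof
  assume "det (Pk 0) = 0"
  then obtain c where c: "c \<in> carrier_vec n" "c \<noteq> 0\<^sub>v n" "Pk 0 *\<^sub>v c = 0\<^sub>v n"
    using det_0_iff_vec_prod_zero_field[OF Pk_carrier] by auto
  define cc where "cc = (\<lambda>j. complex_of_real (c $ j))"
  define z where "z = sol e0 (emb cc)"
  have "(\<Sum>j<n. of_real (Pk 0 $$ (i, j)) * cc j) = 0" if i: "i < n" for i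
  proof -
    have "(\<Sum>j<n. of_real (Pk 0 $$ (i, j)) * cc j) = of_real ((Pk 0 *\<^sub>v c) $ i)"
      unfolding index_mult_mat_vec_sum[OF Pk_carrier c(1) i] by (simp add: cc_def)
    then show ?thesis using c(3) i by simp
  qed
  then have bc: "BC z" unfolding z_def by (rule BC_sol_e0)
  have "((\<lambda>t. vec n (\<lambda>i. z (n + i) t)), \<lambda>t. 0\<^sub>v n) \<in> SL_graph n T P Q R \<Lambda>0 \<Lambda>1"
    by (rule SLsol_imp_SL_graph[OF _ _ bc]) (auto simp: z_def SLsol_sol_e0 intro!: continuous_L2)
  then have ae: "AE t in lebesgue_on {0..T}. vec n (\<lambda>i. z (n + i) t) = 0\<^sub>v n"
    using nondeg unfolding SL_nondegenerate_def by blast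
  have zl: "z (n + i) t = 0" if i: "i < n" and t: "t \<in> {0..T}" for i t
  proof (rule continuous_AE_zero[OF _ T _ t])
    show "continuous_on {0..T} (z (n + i))" using SLsol_sol_e0 i by (simp add: SLsol_def z_def)
    show "AE t in lebesgue_on {0..T}. z (n + i) t = 0"
      using ae by eventually_elim (use i in \<open>auto dest!: arg_cong[of _ _ "\<lambda>v. v $ i"]\<close>)
  qed
  have "z i 0 = 0" if "i < N" for i
  proof (rule initial_zero_of_lower_zero[of z i])
    fix i assume "i < n"
    then show "(z (n + i) has_vector_derivative (\<Sum>p<N. of_real (A 0 $$ (n + i, p)) * z p 0)) (at 0 within {0..T})"
      unfolding z_def using T by (intro sol_e0_deriv) auto
  qed (use zl that in auto)
  then have "emb cc i = 0" if "i < N" for i using sol_0[OF that, of e0 "emb cc"] that by (simp add: z_def e0_def)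
  then have "M3v (emb cc) i = M3v (\<lambda>_. 0) i" for i by (intro M3v_cong) auto
  then have "cc i = 0" if "i < n" for i using M3v_emb[of i cc] that by (simp add: M3v_def)
  then have "c = 0\<^sub>v n" using c(1) by (intro eq_vecI) (auto simp: cc_def)
  then show False using c by simp
qed

lemma Pk0_kernel:
  assumes z: "\<And>i. i < n \<Longrightarrow> (\<Sum>j<n. of_real (Pk 0 $$ (i, j)) * c j) = (0::complex)" and i: "i < n"
  shows "c i = 0"
proof -
  note I = inv_mat_inverse[OF Pk_carrier det_Pk0]
  have "c i = (\<Sum>p<n. of_real (inv_mat (Pk 0) $$ (i, p)) * (\<Sum>q<n. of_real (Pk 0 $$ (p, q)) * c q))"
    by (rule mat_inverse_sum[OF I(1) Pk_carrier I(3) i, symmetric])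
  then show ?thesis using z by simp
qed

lemma M3v_diff: "M3v (\<lambda>q. z q - z' q) i = M3v z i - M3v z' i"
  by (simp add: M3v_def right_diff_distrib sum_subtractf)

text \<open>The difference of two solutions comes from free initial data in the kernel of \<open>Pk 0\<close>.\<close>

lemma SLsol_unique:
  assumes s: "SLsol f z" "SLsol f' z'" and bc: "BC z" "BC z'"
    and ae: "AE t in lebesgue_on {0..T}. \<forall>i<n. f t $ i = f' t $ i" and i: "i < N" and t: "t \<in> {0..T}"
  shows "z i t = z' i t"
proof -
  obtain S where S: "negligible S" "\<And>t. t \<in> {0..T} \<Longrightarrow> t \<notin> S \<Longrightarrow> \<forall>i<n. f t $ i = f' t $ i"
    using AE_lebesgue_on_negligible[OF ae] by blast
  define w where "w = (\<lambda>q. z q 0 - z' q 0)"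
  define c where "c = M3v w"
  have w: "w q = emb c q" if "q < N" for q
  proof -
    have "BC (\<lambda>q t. z q t - z' q t)" using bc unfolding BC_def M3v_diff by simp
    then show ?thesis using BC_initial[OF _ that, of "\<lambda>q t. z q t - z' q t"] by (simp add: w_def c_def)
  qed
  define d where "d = (\<lambda>i t. z i t - z' i t - sol e0 (emb c) i t)"
  have d0: "d i t = 0" if i: "i < N" and t: "t \<in> {0..T}" for i t
  proof (rule volterra_unique[of T N "\<lambda>s i p. of_real (A s $$ (i, p))" d])
    fix i t assume i: "i < N" and t: "t \<in> {0..T}"
    have "((\<lambda>s. ((\<Sum>p<N. of_real (A s $$ (i, p)) * z p s) - (if i < n then f s $ i else 0))
         - ((\<Sum>p<N. of_real (A s $$ (i, p)) * z' p s) - (if i < n then f' s $ i else 0))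
         - (\<Sum>p<N. of_real (A s $$ (i, p)) * sol e0 (emb c) p s)) has_integral
        ((z i t - z i 0) - (z' i t - z' i 0) - (sol e0 (emb c) i t - sol e0 (emb c) i 0))) {0..t}"
    proof (rule has_integral_diff[OF has_integral_diff])
      show "((\<lambda>s. (\<Sum>p<N. of_real (A s $$ (i, p)) * z p s) - (if i < n then f s $ i else 0)) has_integral (z i t - z i 0)) {0..t}"
        "((\<lambda>s. (\<Sum>p<N. of_real (A s $$ (i, p)) * z' p s) - (if i < n then f' s $ i else 0)) has_integral (z' i t - z' i 0)) {0..t}"
        using s i t unfolding SLsol_def by blast+
      show "((\<lambda>s. \<Sum>p<N. of_real (A s $$ (i, p)) * sol e0 (emb c) p s) has_integral (sol e0 (emb c) i t - sol e0 (emb c) i 0)) {0..t}"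
        by (rule has_integral_of_vector_derivative[OF sol_e0_deriv[OF i] t])
    qed
    moreover have "(z i t - z i 0) - (z' i t - z' i 0) - (sol e0 (emb c) i t - sol e0 (emb c) i 0) = d i t"
    proof -
      have "z i 0 - z' i 0 = emb c i" using w[OF i] by (simp add: w_def)
      moreover have "sol e0 (emb c) i 0 = emb c i" using sol_0[OF i] by (simp add: e0_def)
      then have e: "sol e0 (emb c) i 0 = z i 0 - z' i 0" using calculation by simp
      show ?thesis unfolding d_def e by simp
    qed
    ultimately have "((\<lambda>s. ((\<Sum>p<N. of_real (A s $$ (i, p)) * z p s) - (if i < n then f s $ i else 0))
         - ((\<Sum>p<N. of_real (A s $$ (i, p)) * z' p s) - (if i < n then f' s $ i else 0))
         - (\<Sum>p<N. of_real (A s $$ (i, p)) * sol e0 (emb c) p s)) has_integral d i t) {0..t}" by (simp only:)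
    then show "((\<lambda>s. \<Sum>j<N. of_real (A s $$ (i, j)) * d j s) has_integral d i t) {0..t}"
    proof (rule has_integral_spike[OF S(1), rotated])
      fix s assume "s \<in> {0..t} - S"
      then have "\<forall>i<n. f s $ i = f' s $ i" using S(2)[of s] t by auto
      then show "(\<Sum>j<N. of_real (A s $$ (i, j)) * d j s) = ((\<Sum>p<N. of_real (A s $$ (i, p)) * z p s) - (if i < n then f s $ i else 0))
         - ((\<Sum>p<N. of_real (A s $$ (i, p)) * z' p s) - (if i < n then f' s $ i else 0))
         - (\<Sum>p<N. of_real (A s $$ (i, p)) * sol e0 (emb c) p s)"
        by (auto simp: d_def right_diff_distrib sum_subtractf)
    qed
  qed (use T A_cont i t in \<open>auto intro!: continuous_intros\<close>)
  have zd: "z i t - z' i t = sol e0 (emb c) i t" if "i < N" "t \<in> {0..T}" for i t using d0[OF that] by (simp add: d_def)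
  have "(\<Sum>j<n. of_real (Pk 0 $$ (i, j)) * c j) = 0" if i: "i < n" for i
  proof -
    have "(\<Sum>j<n. of_real (Pk 0 $$ (i, j)) * c j) = (\<Sum>j<n. \<Delta> e0 i j * c j)" using i by (simp add: \<Delta>_e0)
    also have "\<dots> = M3v (\<lambda>q. sol e0 (emb c) q T) (k0 + i)" by (rule M3v_sol_T[OF geometric_e0 i, symmetric])
    also have "\<dots> = M3v (\<lambda>q. z q T - z' q T) (k0 + i)" by (rule M3v_cong) (use zd T in auto)
    also have "\<dots> = 0" unfolding M3v_diff using bc i by (simp add: BC_def)
    finally show ?thesis .
  qed
  then have "c j = 0" if "j < n" for j using Pk0_kernel that by blast
  then have "emb c q = 0" for q by (simp add: emb_def)
  then have "sol e0 (emb c) i t = 0" by (intro sol_zero) auto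
  then show ?thesis using zd[OF i t] by simp
qed

lemma \<gamma>inv_path: "mat_path T N N \<gamma>inv"
  unfolding \<gamma>inv_def
  by (intro mat_path_uminus mat_path_mult[where m = N] mat_path_const mat_path_transpose \<gamma>_path symp_J_carrier)

text \<open>Subtracting an antiderivative of the right hand side leaves an equation with continuous
  inhomogeneity, which variation of constants solves; the nonsingular matrix \<open>Pk 0\<close> provides the
  solution of the homogeneous equation that corrects the boundary form at \<open>T\<close>.\<close>

lemma SLsol_exists:
  assumes f: "f \<in> L2 T n"
  obtains z where "SLsol f z" "BC z"
proof -
  define G where "G = (\<lambda>i t. if i < n then - integral {0..t} (\<lambda>s. f s $ i) else (0::complex))"
  have Gint: "((\<lambda>s. if i < n then - f s $ i else 0) has_integral G i t) {0..t}" if t: "t \<in> {0..T}" for i t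
    using has_integral_neg[OF integrable_integral[OF L2_integrable_on[OF f _ t]], of i] by (auto simp: G_def)
  have G0: "G i 0 = 0" for i by (simp add: G_def)
  have Gc: "continuous_on {0..T} (G i)" for i
    by (rule continuous_on_of_has_integral[of _ "\<lambda>s. if i < n then - f s $ i else 0"]) (use Gint G0 T in auto)
  define ag where "ag = (\<lambda>m s. \<Sum>q<N. of_real (A s $$ (m, q)) * G q s)"
  have agc: "continuous_on {0..T} (ag m)" if "m < N" for m
    unfolding ag_def using that A_cont Gc by (intro continuous_intros) auto
  define v where "v = (\<lambda>l t. integral {0..t} (\<lambda>s. \<Sum>m<N. of_real (\<gamma>inv s $$ (l, m)) * ag m s))"
  have vd: "(v l has_vector_derivative (\<Sum>m<N. of_real (\<gamma>inv t $$ (l, m)) * ag m t)) (at t within {0..T})" if "l < N" "t \<in> {0..T}" for l t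
    unfolding v_def using that \<gamma>inv_path agc
    by (intro integral_has_vector_derivative continuous_intros) (auto simp: mat_path_def)
  have v0: "v l 0 = 0" for l by (simp add: v_def)
  define r where "r = (\<lambda>i. G i T + (\<Sum>l<N. of_real (\<gamma>0 T $$ (i, l)) * v l T))"
  define c where "c = (\<lambda>j. \<Sum>q<n. of_real (inv_mat (Pk 0) $$ (j, q)) * (- M3v r (k0 + q)))"
  define w where "w = (\<lambda>i t. \<Sum>l<N. of_real (\<gamma>0 t $$ (i, l)) * (emb c l + v l t))"
  define z where "z = (\<lambda>i t. G i t + w i t)"
  have wd: "(w i has_vector_derivative (\<Sum>p<N. of_real (A t $$ (i, p)) * w p t) + ag i t) (at t within {0..T})" if i: "i < N" and t: "t \<in> {0..T}" for i t
  proof -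
    have "(w i has_vector_derivative (\<Sum>l<N. of_real (\<gamma>0 t $$ (i, l)) * (0 + (\<Sum>m<N. of_real (\<gamma>inv t $$ (l, m)) * ag m t))
        + of_real (\<Sum>p<N. A t $$ (i, p) * \<gamma>0 t $$ (p, l)) * (emb c l + v l t))) (at t within {0..T})"
      unfolding w_def
      by (intro has_vector_derivative_sum has_vector_derivative_mult has_vector_derivative_of_real \<gamma>_deriv
          has_vector_derivative_add has_vector_derivative_const vd i t) auto
    also have "(\<Sum>l<N. of_real (\<gamma>0 t $$ (i, l)) * (0 + (\<Sum>m<N. of_real (\<gamma>inv t $$ (l, m)) * ag m t))
        + of_real (\<Sum>p<N. A t $$ (i, p) * \<gamma>0 t $$ (p, l)) * (emb c l + v l t))
      = (\<Sum>p<N. of_real (A t $$ (i, p)) * w p t) + ag i t"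
    proof -
      have "(\<Sum>l<N. of_real (\<gamma>0 t $$ (i, l)) * (\<Sum>m<N. of_real (\<gamma>inv t $$ (l, m)) * ag m t)) = ag i t"
        by (rule mat_inverse_sum[OF \<gamma>_carrier[OF t] \<gamma>inv_carrier[OF t] \<gamma>inv(1)[OF t] i])
      moreover have "(\<Sum>l<N. of_real (\<Sum>p<N. A t $$ (i, p) * \<gamma>0 t $$ (p, l)) * (emb c l + v l t)) = (\<Sum>p<N. of_real (A t $$ (i, p)) * w p t)"
        unfolding w_def of_real_sum sum_distrib_left sum_distrib_right of_real_mult by (subst sum.swap) (simp add: mult.assoc)
      ultimately show ?thesis by (simp only: sum.distrib add_0 add.commute)
    qed
    finally show ?thesis .
  qed
  have sol: "SLsol f z" unfolding SLsol_def
  proof (intro conjI allI impI ballI)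
    fix i assume i: "i < N"
    have "continuous_on {0..T} (w i)"
      unfolding continuous_on_eq_continuous_within using has_vector_derivative_continuous[OF wd[OF i]] by blast
    then show "continuous_on {0..T} (z i)" unfolding z_def using Gc by (intro continuous_intros)
    fix t assume t: "t \<in> {0..T}"
    have "((\<lambda>s. (if i < n then - f s $ i else 0) + ((\<Sum>p<N. of_real (A s $$ (i, p)) * w p s) + ag i s)) has_integral (G i t + (w i t - w i 0))) {0..t}"
      by (intro has_integral_add Gint t has_integral_of_vector_derivative[OF wd[OF i]])
    moreover have "G i t + (w i t - w i 0) = z i t - z i 0" by (simp add: z_def G0)
    moreover have "(\<lambda>s. (if i < n then - f s $ i else 0) + ((\<Sum>p<N. of_real (A s $$ (i, p)) * w p s) + ag i s))
       = (\<lambda>s. (\<Sum>p<N. of_real (A s $$ (i, p)) * z p s) - (if i < n then f s $ i else 0))"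
      by (auto simp: fun_eq_iff z_def ag_def distrib_left sum.distrib)
    ultimately show "((\<lambda>s. (\<Sum>p<N. of_real (A s $$ (i, p)) * z p s) - (if i < n then f s $ i else 0)) has_integral (z i t - z i 0)) {0..t}"
      by simp
  qed
  have z0: "z i 0 = emb c i" if "i < N" for i
  proof -
    have "w i 0 = (\<Sum>l<N. if l = i then emb c l else 0)"
      unfolding w_def \<gamma>_0 v0 using that by (intro sum.cong) auto
    then show ?thesis using that by (simp add: z_def G0)
  qed
  have "BC z" unfolding BC_def
  proof (intro conjI ballI allI impI)
    fix i assume i: "i \<in> {n..<N}"
    have "M3v (\<lambda>q. z q 0) i = M3v (emb c) i" by (rule M3v_cong) (use z0 in auto)
    then show "M3v (\<lambda>q. z q 0) i = 0" using M3v_emb[of i c] i by simp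
  next
    fix i assume i: "i < n"
    have "M3v (\<lambda>q. z q T) (k0 + i) = M3v (\<lambda>q. r q - (- sol e0 (emb c) q T)) (k0 + i)"
      by (rule M3v_cong) (simp add: z_def w_def r_def sol_e0 distrib_left sum.distrib)
    also have "\<dots> = M3v r (k0 + i) + M3v (\<lambda>q. sol e0 (emb c) q T) (k0 + i)"
      unfolding M3v_diff by (simp add: M3v_def sum_negf)
    also have "M3v (\<lambda>q. sol e0 (emb c) q T) (k0 + i) = (\<Sum>j<n. of_real (Pk 0 $$ (i, j)) * c j)"
      unfolding M3v_sol_T[OF geometric_e0 i] using i by (simp add: \<Delta>_e0)
    also have "\<dots> = - M3v r (k0 + i)"
      unfolding c_def using inv_mat_inverse[OF Pk_carrier det_Pk0] i
      by (intro mat_inverse_sum[where v = "\<lambda>q. - M3v r (k0 + q)", OF Pk_carrier]) auto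
    finally show "M3v (\<lambda>q. z q T) (k0 + i) = 0" by simp
  qed
  then show ?thesis using that sol by blast
qed

abbreviation "Kop \<equiv> SL_compact_op n T P Q R R1 \<Lambda>0 \<Lambda>1"

text \<open>The choice in the definition of the inverse operator is harmless, because the solution is
  unique at every point of the interval.\<close>

lemma Kop_eq:
  assumes f: "f \<in> L2 T n" and s: "SLsol g z" and bc: "BC z"
    and ae: "AE t in lebesgue_on {0..T}. \<forall>i<n. f t $ i = g t $ i" and t: "t \<in> {0..T}"
  shows "Kop f t \<in> carrier_vec n"
    and "i < n \<Longrightarrow> Kop f t $ i = (\<Sum>q<n. of_real (R1 t $$ (i, q)) * z (n + q) t)"
proof -
  obtain z0 where z0: "SLsol f z0" "BC z0" using SLsol_exists[OF f] .
  define y where "y = SL_inverse n T P Q R \<Lambda>0 \<Lambda>1 f"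
  have gr: "(y, f) \<in> SL_graph n T P Q R \<Lambda>0 \<Lambda>1"
  proof -
    have "\<exists>y. (y, f) \<in> SL_graph n T P Q R \<Lambda>0 \<Lambda>1" using SLsol_imp_SL_graph[OF f z0] by blast
    then show ?thesis unfolding y_def SL_inverse_def by (rule someI_ex)
  qed
  then have yc: "y t \<in> carrier_vec n" using t by (auto simp: SL_graph_def W12_deriv_def)
  obtain z1 where z1: "SLsol f z1" "BC z1" "\<And>t i. t \<in> {0..T} \<Longrightarrow> i < n \<Longrightarrow> y t $ i = z1 (n + i) t"
    using SL_graph_imp_SLsol[OF gr] by blast
  have yi: "y t $ i = z (n + i) t" if "i < n" for i
    using z1(3)[OF t that] SLsol_unique[OF z1(1) s z1(2) bc ae _ t, of "n + i"] that by simp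
  have K: "Kop f t = cmat (R1 t) *\<^sub>v y t" by (simp add: SL_compact_op_def y_def)
  show "Kop f t \<in> carrier_vec n" unfolding K using carriers(4)[OF t] yc by (intro mult_mat_vec_carrier[of _ n n]) (simp_all add: cmat_def)
  show "Kop f t $ i = (\<Sum>q<n. of_real (R1 t $$ (i, q)) * z (n + q) t)" if "i < n"
    unfolding K cmat_mult_vec[OF carriers(4)[OF t] yc that] by (intro sum.cong refl) (simp add: yi)
qed

end

section \<open>Jordan chains\<close>

lemma underdetermined_system:
  fixes x :: "nat \<Rightarrow> nat \<Rightarrow> complex"
  assumes "d < k"
  obtains y where "\<exists>j<k. y j \<noteq> 0" "\<And>s. s < d \<Longrightarrow> (\<Sum>j<k. y j * x j s) = 0"
proof -
  define M where "M = mat k k (\<lambda>(s, j). if s < d then x j s else 0)"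
  have M: "M \<in> carrier_mat k k" by (simp add: M_def)
  have "det M = 0"
    unfolding laplace_expansion_row[OF M assms] using assms by (intro sum.neutral) (auto simp: M_def)
  then obtain v where v: "v \<in> carrier_vec k" "v \<noteq> 0\<^sub>v k" "M *\<^sub>v v = 0\<^sub>v k"
    using det_0_iff_vec_prod_zero_field[OF M] by auto
  show ?thesis
  proof (rule that[of "\<lambda>j. v $ j"])
    show "\<exists>j<k. v $ j \<noteq> 0"
    proof (rule ccontr)
      assume "\<not> (\<exists>j<k. v $ j \<noteq> 0)"
      then have "v = 0\<^sub>v k" using v(1) by (intro eq_vecI) auto
      then show False using v(2) by simp
    qed
    fix s assume s: "s < d"
    then have "(M *\<^sub>v v) $ s = (\<Sum>j<k. x j s * v $ j)"
      using assms by (subst index_mult_mat_vec_sum[OF M v(1)]) (auto simp: M_def)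
    then show "(\<Sum>j<k. v $ j * x j s) = 0" using v(3) s assms by (simp add: mult.commute)
  qed
qed

text \<open>The coefficient of \<open>\<delta>\<^sup>q\<close> in \<open>(l / (1 - \<delta>))\<^sup>k\<close>. The parametrization \<open>\<lambda> = l / (1 - \<delta>)\<close> near
  \<open>l\<close> makes \<open>- 1 / \<lambda> + 1 / l = \<delta> / l\<close> linear in \<open>\<delta>\<close>, so that shifts of coefficients become
  applications of \<open>R\<^sub>1 A\<^sup>-\<^sup>1 + 1 / l\<close>.\<close>

primrec \<alpha> :: "complex \<Rightarrow> nat \<Rightarrow> nat \<Rightarrow> complex" where
  "\<alpha> l 0 q = (if q = 0 then 1 else 0)"
| "\<alpha> l (Suc k) q = l * (\<Sum>p\<le>q. \<alpha> l k p)"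

lemma Abs_fps_\<alpha>: "Abs_fps (\<alpha> l k) = Abs_fps (\<lambda>_. l) ^ k"
proof (induction k)
  case 0
  show ?case by (rule fps_ext) simp
next
  case (Suc k)
  show ?case unfolding power_Suc Suc[symmetric]
  proof (rule fps_ext)
    fix q
    have "fps_nth (Abs_fps (\<lambda>_. l) * Abs_fps (\<alpha> l k)) q = (\<Sum>i=0..q. l * \<alpha> l k (q - i))"
      by (simp add: fps_mult_nth)
    also have "\<dots> = (\<Sum>i=0..q. l * \<alpha> l k i)"
      by (rule sum.reindex_bij_witness[of _ "\<lambda>i. q - i" "\<lambda>i. q - i"]) auto
    finally show "fps_nth (Abs_fps (\<alpha> l (Suc k))) q = fps_nth (Abs_fps (\<lambda>_. l) * Abs_fps (\<alpha> l k)) q"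
      by (simp add: sum_distrib_left atLeast0AtMost)
  qed
qed

lemma geometric_\<alpha>: "geometric_bound (\<lambda>k. \<alpha> l k q)"
proof -
  have "norm (\<alpha> l k p) \<le> (norm l * real (q + 1)) ^ k" if "p \<le> q" for k p
    using that
  proof (induction k arbitrary: p)
    case (Suc k)
    have "norm (\<alpha> l (Suc k) p) \<le> norm l * (\<Sum>r\<le>p. (norm l * real (q + 1)) ^ k)"
      unfolding \<alpha>.simps norm_mult using Suc by (intro mult_left_mono sum_norm_le) auto
    also have "\<dots> = norm l * (real (p + 1) * (norm l * real (q + 1)) ^ k)" by simp
    also have "\<dots> \<le> norm l * (real (q + 1) * (norm l * real (q + 1)) ^ k)"
      using Suc.prems by (intro mult_left_mono mult_right_mono) auto
    finally show ?case by (simp add: mult_ac)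
  qed simp
  then have "\<forall>k. norm (\<alpha> l k q) \<le> 1 * (norm l * real (q + 1)) ^ k" by simp
  moreover have "norm l * real (q + 1) \<ge> 0" by simp
  ultimately show ?thesis unfolding geometric_bound_def by (metis zero_le_one)
qed

context sl_system
begin

text \<open>The \<open>j\<close>-th coefficient of the solution with parameter \<open>l / (1 - \<delta>)\<close>, applied to the inverse
  polynomial \<open>c\<close>.\<close>

definition Zc :: "complex \<Rightarrow> nat \<Rightarrow> (nat \<Rightarrow> nat \<Rightarrow> complex) \<Rightarrow> nat \<Rightarrow> nat \<Rightarrow> real \<Rightarrow> complex" where
  "Zc l K c j i t = (\<Sum>q<K. sol (\<lambda>k. \<alpha> l k q) (emb (\<lambda>p. c p (j + q))) i t)"

text \<open>The right hand side for which \<open>Zc\<close> solves the equation with parameter \<open>0\<close>.\<close>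

definition Hc :: "complex \<Rightarrow> nat \<Rightarrow> (nat \<Rightarrow> nat \<Rightarrow> complex) \<Rightarrow> nat \<Rightarrow> real \<Rightarrow> complex vec" where
  "Hc l K c j t = vec n (\<lambda>i. - l * (\<Sum>r<K. \<Sum>q<n. of_real (R1 t $$ (i, q)) * Zc l K c (j + r) (n + q) t))"

abbreviation supp_below :: "nat \<Rightarrow> (nat \<Rightarrow> nat \<Rightarrow> complex) \<Rightarrow> bool" where
  "supp_below K c \<equiv> \<forall>p<n. \<forall>j\<ge>K. c p j = 0"

lemma emb_zero: "(\<And>p. p < n \<Longrightarrow> c p = 0) \<Longrightarrow> emb c i = 0"
  by (simp add: emb_def)

lemma Zc_beyond: "supp_below K c \<Longrightarrow> j \<ge> K \<Longrightarrow> Zc l K' c j i t = 0"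
  unfolding Zc_def by (intro sum.neutral ballI sol_zero emb_zero) auto

lemma Zc_extend:
  assumes "supp_below K c" "K \<le> K'"
  shows "Zc l K' c j i t = Zc l K c j i t"
  unfolding Zc_def
proof (rule sum.mono_neutral_right)
  show "\<forall>q\<in>{..<K'} - {..<K}. sol (\<lambda>k. \<alpha> l k q) (emb (\<lambda>p. c p (j + q))) i t = 0"
    using assms by (intro ballI sol_zero emb_zero) auto
qed (use assms in auto)

lemma Hc_extend:
  assumes "supp_below K c" "K \<le> K'"
  shows "Hc l K' c j t = Hc l K c j t"
proof -
  have "(\<Sum>r<K'. \<Sum>q<n. of_real (R1 t $$ (i, q)) * Zc l K' c (j + r) (n + q) t) = (\<Sum>r<K. \<Sum>q<n. of_real (R1 t $$ (i, q)) * Zc l K c (j + r) (n + q) t)" for i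
    unfolding Zc_extend[OF assms]
    by (rule sum.mono_neutral_right) (use assms Zc_beyond[OF assms(1)] in auto)
  then show ?thesis by (simp add: Hc_def)
qed

text \<open>Multiplication by \<open>\<lambda> = l (1 + \<delta> + \<delta>\<^sup>2 + \<dots>)\<close> sums \<open>l\<close> times all later coefficients.\<close>

lemma Zc_deriv:
  assumes c: "supp_below K c" and i: "i < N" and t: "t \<in> {0..T}"
  shows "(Zc l K c j i has_vector_derivative (\<Sum>p<N. of_real (A t $$ (i, p)) * Zc l K c j p t)
     + l * (\<Sum>r<K. \<Sum>p<N. of_real (Bd t $$ (i, p)) * Zc l K c (j + r) p t)) (at t within {0..T})"
proof -
  define w where "w = (\<lambda>q. emb (\<lambda>p. c p q))"
  define a where "a = (\<lambda>q k. \<alpha> l k q)"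
  have ga: "geometric_bound (a q)" for q unfolding a_def by (rule geometric_\<alpha>)
  have Zw: "Zc l K c j i t = (\<Sum>q<K. sol (a q) (w (j + q)) i t)" for j i t by (simp add: Zc_def w_def a_def)
  have w0: "sol b (w q) p t = 0" if "q \<ge> K" for b q p
    using c that by (intro sol_zero) (auto simp: w_def intro!: emb_zero)
  have shift: "sol (\<lambda>k. a q (Suc k)) v p t = l * (\<Sum>r\<le>q. sol (a r) v p t)" for q v p
  proof -
    have "(\<lambda>k. a q (Suc k)) = (\<lambda>k. l * (\<Sum>r\<in>{..q}. a r k))" by (simp add: a_def)
    then show ?thesis using sol_sum_left[OF ga _ t, of "{..q}" l] by simp
  qed
  have inner: "(\<Sum>q<K. \<Sum>r\<le>q. sol (a r) (w (j + q)) p t) = (\<Sum>r<K. Zc l K c (j + r) p t)" for p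
  proof -
    have "(\<Sum>q<K. \<Sum>r\<le>q. sol (a r) (w (j + q)) p t) = (\<Sum>(q, r)\<in>(SIGMA q:{..<K}. {..q}). sol (a r) (w (j + q)) p t)"
      by (rule sum.Sigma) auto
    also have "\<dots> = (\<Sum>(s, r)\<in>(SIGMA s:{..<K}. {..<K - s}). sol (a r) (w (j + s + r)) p t)"
      by (rule sum.reindex_bij_witness[of _ "\<lambda>(s, r). (s + r, r)" "\<lambda>(q, r). (q - r, r)"]) auto
    also have "\<dots> = (\<Sum>s<K. \<Sum>r<K - s. sol (a r) (w (j + s + r)) p t)"
      by (rule sum.Sigma[symmetric]) auto
    also have "\<dots> = (\<Sum>s<K. \<Sum>r<K. sol (a r) (w (j + s + r)) p t)"
      by (intro sum.cong refl sum.mono_neutral_left) (auto intro!: w0)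
    finally show "(\<Sum>q<K. \<Sum>r\<le>q. sol (a r) (w (j + q)) p t) = (\<Sum>r<K. Zc l K c (j + r) p t)"
      by (simp add: Zw add.assoc)
  qed
  have "((\<lambda>t. \<Sum>q<K. sol (a q) (w (j + q)) i t) has_vector_derivative
     (\<Sum>q<K. (\<Sum>p<N. of_real (A t $$ (i, p)) * sol (a q) (w (j + q)) p t) + (\<Sum>p<N. of_real (Bd t $$ (i, p)) * sol (\<lambda>k. a q (Suc k)) (w (j + q)) p t))) (at t within {0..T})"
    by (intro has_vector_derivative_sum sol_deriv ga i t)
  also have "(\<Sum>q<K. (\<Sum>p<N. of_real (A t $$ (i, p)) * sol (a q) (w (j + q)) p t) + (\<Sum>p<N. of_real (Bd t $$ (i, p)) * sol (\<lambda>k. a q (Suc k)) (w (j + q)) p t))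
    = (\<Sum>p<N. of_real (A t $$ (i, p)) * Zc l K c j p t) + (\<Sum>p<N. of_real (Bd t $$ (i, p)) * (l * (\<Sum>q<K. \<Sum>r\<le>q. sol (a r) (w (j + q)) p t)))"
  proof -
    have "(\<Sum>q<K. \<Sum>p<N. of_real (A t $$ (i, p)) * sol (a q) (w (j + q)) p t) = (\<Sum>p<N. of_real (A t $$ (i, p)) * Zc l K c j p t)"
      unfolding Zw sum_distrib_left by (rule sum.swap)
    moreover have "(\<Sum>q<K. \<Sum>p<N. of_real (Bd t $$ (i, p)) * sol (\<lambda>k. a q (Suc k)) (w (j + q)) p t)
      = (\<Sum>p<N. of_real (Bd t $$ (i, p)) * (l * (\<Sum>q<K. \<Sum>r\<le>q. sol (a r) (w (j + q)) p t)))"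
      unfolding shift by (subst sum.swap) (simp only: sum_distrib_left[symmetric])
    ultimately show ?thesis unfolding sum.distrib by simp
  qed
  also have "(\<Sum>p<N. of_real (Bd t $$ (i, p)) * (l * (\<Sum>q<K. \<Sum>r\<le>q. sol (a r) (w (j + q)) p t)))
     = (\<Sum>p<N. of_real (Bd t $$ (i, p)) * (l * (\<Sum>r<K. Zc l K c (j + r) p t)))"
    unfolding inner ..
  also have "(\<Sum>p<N. of_real (Bd t $$ (i, p)) * (l * (\<Sum>r<K. Zc l K c (j + r) p t))) = l * (\<Sum>r<K. \<Sum>p<N. of_real (Bd t $$ (i, p)) * Zc l K c (j + r) p t)"
    unfolding sum_distrib_left by (subst sum.swap) (simp add: mult_ac)
  finally have "((\<lambda>t. \<Sum>q<K. sol (a q) (w (j + q)) i t) has_vector_derivative (\<Sum>p<N. of_real (A t $$ (i, p)) * Zc l K c j p t)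
     + l * (\<Sum>r<K. \<Sum>p<N. of_real (Bd t $$ (i, p)) * Zc l K c (j + r) p t)) (at t within {0..T})" .
  moreover have "Zc l K c j i = (\<lambda>t. \<Sum>q<K. sol (a q) (w (j + q)) i t)" by (simp add: Zw fun_eq_iff)
  ultimately show ?thesis by simp
qed

lemma SLsol_Zc:
  assumes c: "supp_below K c"
  shows "SLsol (Hc l K c j) (Zc l K c j)"
proof (rule SLsol_of_deriv)
  fix i t assume i: "i < N" and t: "t \<in> {0..T}"
  have "l * (\<Sum>r<K. \<Sum>p<N. of_real (Bd t $$ (i, p)) * Zc l K c (j + r) p t) = - (if i < n then Hc l K c j t $ i else 0)"
  proof (cases "i < n")
    case True
    then show ?thesis by (simp add: Hc_def Bd_mult(2)[OF t True])
  next
    case False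
    then have e: "n + (i - n) = i" "i - n < n" using i by auto
    have "(\<Sum>p<N. of_real (Bd t $$ (i, p)) * Zc l K c (j + r) p t) = 0" for r
      using Bd_mult(1)[OF t e(2), of "\<lambda>p. Zc l K c (j + r) p t"] e(1) by simp
    then show ?thesis using False by simp
  qed
  then show "(Zc l K c j i has_vector_derivative (\<Sum>p<N. of_real (A t $$ (i, p)) * Zc l K c j p t)
      - (if i < n then Hc l K c j t $ i else 0)) (at t within {0..T})"
    using Zc_deriv[OF c i t, of l j] by simp
qed

lemma Zc_cont: "supp_below K c \<Longrightarrow> i < N \<Longrightarrow> continuous_on {0..T} (Zc l K c j i)"
  using SLsol_Zc by (simp add: SLsol_def)

lemma R1_cont: "i < n \<Longrightarrow> q < n \<Longrightarrow> continuous_on {0..T} (\<lambda>t. R1 t $$ (i, q))"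
  using paths(4) by (auto simp: mat_path_def)

lemma Hc_L2: "supp_below K c \<Longrightarrow> Hc l K c j \<in> L2 T n"
proof (rule continuous_L2)
  fix i assume c: "supp_below K c" and i: "i < n"
  then have "continuous_on {0..T} (\<lambda>t. - l * (\<Sum>r<K. \<Sum>q<n. of_real (R1 t $$ (i, q)) * Zc l K c (j + r) (n + q) t))"
    using R1_cont Zc_cont by (intro continuous_intros) auto
  then show "continuous_on {0..T} (\<lambda>t. Hc l K c j t $ i)" using i by (simp add: Hc_def)
qed (simp add: Hc_def)

lemma Hc_Suc:
  assumes c: "supp_below K c" and K: "K > 0" and i: "i < n"
  shows "Hc l K c (Suc j) t $ i = Hc l K c j t $ i + l * (\<Sum>q<n. of_real (R1 t $$ (i, q)) * Zc l K c j (n + q) t)"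
proof -
  define f where "f = (\<lambda>r. \<Sum>q<n. of_real (R1 t $$ (i, q)) * Zc l K c (j + r) (n + q) t)"
  have "(\<Sum>r<K. f (Suc r)) + f 0 = (\<Sum>r<K. f r) + f K"
    using sum.lessThan_Suc_shift[of f K] by (simp add: add.commute)
  moreover have "f K = 0" unfolding f_def using Zc_beyond[OF c] by simp
  ultimately have e: "(\<Sum>r<K. f (Suc r)) = (\<Sum>r<K. f r) - f 0" by (simp add: eq_diff_eq)
  have "Hc l K c (Suc j) t $ i = - l * (\<Sum>r<K. f (Suc r))" using i by (simp add: Hc_def f_def)
  also have "\<dots> = - l * (\<Sum>r<K. f r) + l * f 0" unfolding e by (simp add: right_diff_distrib)
  also have "- l * (\<Sum>r<K. f r) = Hc l K c j t $ i" using i by (simp add: Hc_def f_def)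
  finally show ?thesis by (simp add: f_def)
qed

lemma Hc_beyond: "supp_below K c \<Longrightarrow> j \<ge> K \<Longrightarrow> i < n \<Longrightarrow> Hc l K c j t $ i = 0"
  using Zc_beyond by (simp add: Hc_def)

lemma Zc_0: "K > 0 \<Longrightarrow> i < N \<Longrightarrow> Zc l K c j i 0 = emb (\<lambda>p. c p j) i"
proof -
  assume K: "K > 0" and i: "i < N"
  have "Zc l K c j i 0 = (\<Sum>q<K. if q = 0 then emb (\<lambda>p. c p j) i else 0)"
    unfolding Zc_def by (intro sum.cong refl) (auto simp: sol_0[OF i])
  then show ?thesis using K by simp
qed

text \<open>The expansion in \<open>\<delta>\<close> of the transfer matrix at \<open>l / (1 - \<delta>)\<close>.\<close>

definition Ahat :: "complex \<Rightarrow> complex fps mat" where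
  "Ahat l = mat n n (\<lambda>(i, p). Abs_fps (\<lambda>q. \<Delta> (\<lambda>k. \<alpha> l k q) i p))"

lemma Zc_T:
  assumes c: "supp_below K c" and i: "i < n"
  shows "M3v (\<lambda>q. Zc l K c j q T) (k0 + i) = (\<Sum>p<n. fps_act (Ahat l $$ (i, p)) (c p) j)"
proof -
  have "M3v (\<lambda>q. Zc l K c j q T) (k0 + i) = (\<Sum>q<K. M3v (\<lambda>s. sol (\<lambda>k. \<alpha> l k q) (emb (\<lambda>p. c p (j + q))) s T) (k0 + i))"
    unfolding M3v_def Zc_def sum_distrib_left by (rule sum.swap)
  also have "\<dots> = (\<Sum>q<K. \<Sum>p<n. \<Delta> (\<lambda>k. \<alpha> l k q) i p * c p (j + q))"
    by (intro sum.cong refl M3v_sol_T geometric_\<alpha> i)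
  also have "\<dots> = (\<Sum>p<n. \<Sum>q<K. \<Delta> (\<lambda>k. \<alpha> l k q) i p * c p (j + q))" by (rule sum.swap)
  also have "\<dots> = (\<Sum>p<n. fps_act (Ahat l $$ (i, p)) (c p) j)"
  proof (rule sum.cong[OF refl])
    fix p assume p: "p \<in> {..<n}"
    then have "\<And>j. j \<ge> K \<Longrightarrow> c p j = 0" using c by auto
    then show "(\<Sum>q<K. \<Delta> (\<lambda>k. \<alpha> l k q) i p * c p (j + q)) = fps_act (Ahat l $$ (i, p)) (c p) j"
      using p i by (subst fps_act_eq[of K]) (auto simp: Ahat_def)
  qed
  finally show ?thesis .
qed

lemma BC_Zc:
  assumes c: "supp_below K c" and K: "K > 0" and ker: "c \<in> act_kernel n (Ahat l)"
  shows "BC (Zc l K c j)"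
  unfolding BC_def
proof (intro conjI ballI allI impI)
  fix i assume i: "i \<in> {n..<N}"
  have "M3v (\<lambda>q. Zc l K c j q 0) i = M3v (emb (\<lambda>p. c p j)) i"
    by (rule M3v_cong) (simp add: Zc_0[OF K])
  then show "M3v (\<lambda>q. Zc l K c j q 0) i = 0" using M3v_emb[of i] i by simp
next
  fix i assume i: "i < n"
  show "M3v (\<lambda>q. Zc l K c j q T) (k0 + i) = 0"
    unfolding Zc_T[OF c i] using ker i by (simp add: act_kernel_def)
qed

definition step :: "complex \<Rightarrow> (real \<Rightarrow> complex vec) \<Rightarrow> real \<Rightarrow> complex vec" where
  "step l g = (\<lambda>s. Kop g s - (- (1 / l)) \<cdot>\<^sub>v g s)"

lemma SLsol_scale: "SLsol f z \<Longrightarrow> (\<And>t i. t \<in> {0..T} \<Longrightarrow> i < n \<Longrightarrow> g t $ i = x * f t $ i) \<Longrightarrow> SLsol g (\<lambda>i t. x * z i t)"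
  unfolding SLsol_def
proof (intro conjI allI impI ballI)
  assume s: "(\<forall>i<N. continuous_on {0..T} (z i)) \<and> (\<forall>i<N. \<forall>t\<in>{0..T}.
     ((\<lambda>s. (\<Sum>p<N. of_real (A s $$ (i, p)) * z p s) - (if i < n then f s $ i else 0)) has_integral (z i t - z i 0)) {0..t})"
    and g: "\<And>t i. t \<in> {0..T} \<Longrightarrow> i < n \<Longrightarrow> g t $ i = x * f t $ i"
  fix i assume i: "i < N"
  show "continuous_on {0..T} (\<lambda>t. x * z i t)" using s i by (intro continuous_intros) auto
  fix t assume t: "t \<in> {0..T}"
  have "((\<lambda>s. (\<Sum>p<N. of_real (A s $$ (i, p)) * z p s) - (if i < n then f s $ i else 0)) has_integral (z i t - z i 0)) {0..t}"
    using s i t by blast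
  from has_integral_mult_right[OF this, of x]
  have "((\<lambda>s. x * ((\<Sum>p<N. of_real (A s $$ (i, p)) * z p s) - (if i < n then f s $ i else 0))) has_integral (x * z i t - x * z i 0)) {0..t}"
    by (simp only: right_diff_distrib)
  then show "((\<lambda>s. (\<Sum>p<N. of_real (A s $$ (i, p)) * (x * z p s)) - (if i < n then g s $ i else 0)) has_integral (x * z i t - x * z i 0)) {0..t}"
    by (rule has_integral_eq[rotated]) (use g t in \<open>auto simp: right_diff_distrib sum_distrib_left mult_ac\<close>)
qed

lemma M3v_scale: "M3v (\<lambda>q. x * z q) i = x * M3v z i"
  by (simp add: M3v_def sum_distrib_left mult_ac)

lemma BC_scale: "BC z \<Longrightarrow> BC (\<lambda>i t. x * z i t)"
  by (simp add: BC_def M3v_scale)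

lemma step_eq:
  assumes f: "f \<in> L2 T n" and s: "SLsol g z" and bc: "BC z"
    and ae: "AE t in lebesgue_on {0..T}. \<forall>i<n. f t $ i = g t $ i" and t: "t \<in> {0..T}"
  shows "step l f t \<in> carrier_vec n"
    and "i < n \<Longrightarrow> step l f t $ i = (\<Sum>q<n. of_real (R1 t $$ (i, q)) * z (n + q) t) + (1 / l) * f t $ i"
proof -
  have fc: "f t \<in> carrier_vec n" using f t by (auto simp: L2_def)
  note K = Kop_eq[OF f s bc ae t]
  show "step l f t \<in> carrier_vec n" unfolding step_def using K(1) fc by simp
  show "step l f t $ i = (\<Sum>q<n. of_real (R1 t $$ (i, q)) * z (n + q) t) + (1 / l) * f t $ i" if "i < n"
    unfolding step_def using K(1) K(2)[OF that] fc that by simp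
qed

lemma step_L2:
  assumes f: "f \<in> L2 T n"
  shows "step l f \<in> L2 T n"
proof -
  obtain z where z: "SLsol f z" "BC z" using SLsol_exists[OF f] .
  have "(\<lambda>t. vec n (\<lambda>i. \<Sum>q<n. of_real (R1 t $$ (i, q)) * z (n + q) t)) \<in> L2 T n"
  proof (rule continuous_L2)
    fix i assume i: "i < n"
    have "continuous_on {0..T} (\<lambda>t. \<Sum>q<n. of_real (R1 t $$ (i, q)) * z (n + q) t)"
      using R1_cont i z(1) by (intro continuous_intros) (auto simp: SLsol_def)
    then show "continuous_on {0..T} (\<lambda>t. vec n (\<lambda>i. \<Sum>q<n. of_real (R1 t $$ (i, q)) * z (n + q) t) $ i)" using i by simp
  qed simp
  then show ?thesis
    by (rule L2_cong_lin[OF _ f, where a = 1 and b = "1 / l"]) (use step_eq[OF f z] in auto)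
qed

lemma step_pow_L2: "f \<in> L2 T n \<Longrightarrow> (step l ^^ j) f \<in> L2 T n"
  by (induction j) (auto intro: step_L2)

text \<open>Consecutive right hand sides differ by \<open>l R\<^sub>1 y\<^sub>j\<close> with \<open>A y\<^sub>j = H\<^sub>j\<close>, which says that
  \<open>R\<^sub>1 A\<^sup>-\<^sup>1 + 1 / l\<close> maps \<open>H\<^sub>j\<close> to \<open>H\<^bsub>j+1\<^esub> / l\<close>.\<close>

lemma step_pow_Hc:
  assumes c: "supp_below K c" and K: "K > 0" and ker: "c \<in> act_kernel n (Ahat l)" and l: "l \<noteq> 0"
    and t: "t \<in> {0..T}" and i: "i < n"
  shows "(step l ^^ j) (Hc l K c 0) t $ i = (1 / l) ^ j * Hc l K c j t $ i"
  using t i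
proof (induction j arbitrary: t i)
  case (Suc j)
  define g where "g = (step l ^^ j) (Hc l K c 0)"
  have gL: "g \<in> L2 T n" unfolding g_def by (rule step_pow_L2[OF Hc_L2[OF c]])
  have gs: "SLsol g (\<lambda>i t. (1 / l) ^ j * Zc l K c j i t)"
    by (rule SLsol_scale[OF SLsol_Zc[OF c]]) (use Suc.IH in \<open>simp add: g_def\<close>)
  have "step l g t $ i = (\<Sum>q<n. of_real (R1 t $$ (i, q)) * ((1 / l) ^ j * Zc l K c j (n + q) t)) + (1 / l) * g t $ i"
    by (rule step_eq(2)[OF gL gs BC_scale[OF BC_Zc[OF c K ker]] _ Suc.prems]) simp
  also have "\<dots> = (1 / l) ^ Suc j * (Hc l K c j t $ i + l * (\<Sum>q<n. of_real (R1 t $$ (i, q)) * Zc l K c j (n + q) t))"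
  proof -
    have "g t $ i = (1 / l) ^ j * Hc l K c j t $ i" using Suc by (simp add: g_def)
    moreover have "(\<Sum>q<n. of_real (R1 t $$ (i, q)) * ((1 / l) ^ j * Zc l K c j (n + q) t)) = (1 / l) ^ j * (\<Sum>q<n. of_real (R1 t $$ (i, q)) * Zc l K c j (n + q) t)"
      unfolding sum_distrib_left by (intro sum.cong refl) (simp only: mult.left_commute)
    ultimately show ?thesis using l by (simp add: distrib_left)
  qed
  also have "\<dots> = (1 / l) ^ Suc j * Hc l K c (Suc j) t $ i" using Hc_Suc[OF c K Suc.prems(2)] by simp
  finally show ?case by (simp add: g_def)
qed simp

lemma Hc_gen_eigenspace:
  assumes c: "supp_below K c" and K: "K > 0" and ker: "c \<in> act_kernel n (Ahat l)" and l: "l \<noteq> 0"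
  shows "Hc l K c 0 \<in> L2_gen_eigenspace T n Kop (- (1 / l))"
  unfolding L2_gen_eigenspace_def mem_Collect_eq
proof (intro conjI Hc_L2[OF c] exI)
  have st: "(\<lambda>g s. Kop g s - (- (1 / l)) \<cdot>\<^sub>v g s) = step l" by (simp add: step_def fun_eq_iff)
  show "AE t in lebesgue_on {0..T}. ((\<lambda>g s. Kop g s - (- (1 / l)) \<cdot>\<^sub>v g s) ^^ K) (Hc l K c 0) t = 0\<^sub>v n"
    unfolding st
  proof (rule AE_I2)
    fix t assume "t \<in> space (lebesgue_on {0..T})"
    then have t: "t \<in> {0..T}" by simp
    have "(step l ^^ K) (Hc l K c 0) \<in> L2 T n" by (rule step_pow_L2[OF Hc_L2[OF c]])
    then have "(step l ^^ K) (Hc l K c 0) t \<in> carrier_vec n" using t by (auto simp: L2_def)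
    then show "(step l ^^ K) (Hc l K c 0) t = 0\<^sub>v n"
      using step_pow_Hc[OF c K ker l t] Hc_beyond[OF c] by (intro eq_vecI) auto
  qed
qed

lemma SLsol_0: "SLsol (\<lambda>t. 0\<^sub>v n) (\<lambda>i t. 0)"
  by (rule SLsol_of_deriv) auto

lemma BC_0: "BC (\<lambda>i t. 0)"
  by (simp add: BC_def M3v_def)

text \<open>If the first right hand side vanishes, so do all later ones of the chain, and uniqueness
  makes every \<open>Zc\<close>, hence its initial value, vanish.\<close>

lemma Hc_AE_0_imp:
  assumes c: "supp_below K c" and K: "K > 0" and ker: "c \<in> act_kernel n (Ahat l)"
    and ae: "AE t in lebesgue_on {0..T}. \<forall>i<n. Hc l K c 0 t $ i = 0" and p: "p < n"
  shows "c p j = 0"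
proof -
  have aej: "AE t in lebesgue_on {0..T}. \<forall>i<n. Hc l K c j t $ i = 0" for j
  proof (induction j)
    case (Suc j)
    have z: "Zc l K c j i t = 0" if "i < N" "t \<in> {0..T}" for i t
      using SLsol_unique[OF SLsol_Zc[OF c, where l = l and j = j] SLsol_0 BC_Zc[OF c K ker, where j = j] BC_0 _ that] Suc by simp
    have "AE t in lebesgue_on {0..T}. t \<in> {0..T}" by (rule AE_I2) simp
    with Suc show ?case
      by eventually_elim (simp add: Hc_Suc[OF c K] z)
  qed (rule ae)
  have z: "Zc l K c j i 0 = 0" if "i < N" for i
    using SLsol_unique[OF SLsol_Zc[OF c, where l = l and j = j] SLsol_0 BC_Zc[OF c K ker, where j = j] BC_0 _ that, of 0] aej[of j] T by simp
  then have "emb (\<lambda>p. c p j) i = 0" if "i < N" for i using Zc_0[OF K that, of l c j] that by simp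
  then have "M3v (emb (\<lambda>p. c p j)) p = M3v (\<lambda>_. 0) p" by (intro M3v_cong) auto
  then show ?thesis using M3v_emb[of p "\<lambda>p. c p j"] p by (simp add: M3v_def)
qed

text \<open>Conversely, solve \<open>A y\<^sub>j = g\<^sub>j\<close> along the chain \<open>g\<^sub>j = (R\<^sub>1 A\<^sup>-\<^sup>1 + 1 / l)\<^sup>j f\<close>. After
  scaling by \<open>l\<^sup>j\<close> the solutions satisfy the same differential equations as \<open>Zc\<close>, from the last
  nonzero one downwards. So they are \<open>Zc\<close> for the inverse polynomial formed by their own initial
  data, and their boundary conditions at \<open>T\<close> put it into the kernel.\<close>

lemma gen_eigenspace_imp_Hc:
  assumes f: "f \<in> L2_gen_eigenspace T n Kop (- (1 / l))" and l: "l \<noteq> 0"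
  obtains K c where "K > 0" "supp_below K c" "c \<in> act_kernel n (Ahat l)"
    "AE t in lebesgue_on {0..T}. \<forall>i<n. f t $ i = Hc l K c 0 t $ i"
proof -
  have st: "(\<lambda>g s. Kop g s - (- (1 / l)) \<cdot>\<^sub>v g s) = step l" by (simp add: step_def fun_eq_iff)
  obtain k where fL: "f \<in> L2 T n" and k: "AE t in lebesgue_on {0..T}. (step l ^^ k) f t = 0\<^sub>v n"
    using f unfolding L2_gen_eigenspace_def st by auto
  define g where "g = (\<lambda>j. (step l ^^ j) f)"
  have gL: "g j \<in> L2 T n" for j unfolding g_def by (rule step_pow_L2[OF fL])
  have "\<exists>z. SLsol (g j) z \<and> BC z" for j using SLsol_exists[OF gL] by blast
  then obtain z where z: "\<And>j. SLsol (g j) (z j)" "\<And>j. BC (z j)" by metis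
  define \<zeta> where "\<zeta> = (\<lambda>j i t. l ^ j * z j i t)"
  define h where "h = (\<lambda>j t. vec n (\<lambda>i. l ^ j * g j t $ i))"
  have hs: "SLsol (h j) (\<zeta> j)" for j unfolding \<zeta>_def by (rule SLsol_scale[OF z(1)]) (simp add: h_def)
  have hb: "BC (\<zeta> j)" for j unfolding \<zeta>_def by (rule BC_scale[OF z(2)])
  define r where "r = (\<lambda>j t i. \<Sum>q<n. of_real (R1 t $$ (i, q)) * \<zeta> j (n + q) t)"
  have hSuc: "h (Suc j) t $ i = h j t $ i + l * r j t i" if t: "t \<in> {0..T}" and i: "i < n" for j t i
  proof -
    have "g (Suc j) t $ i = (\<Sum>q<n. of_real (R1 t $$ (i, q)) * z j (n + q) t) + (1 / l) * g j t $ i"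
      using step_eq(2)[OF gL[of j] z(1)[of j] z(2)[of j] _ t i, where l = l] by (simp add: g_def)
    moreover have "r j t i = l ^ j * (\<Sum>q<n. of_real (R1 t $$ (i, q)) * z j (n + q) t)"
      unfolding r_def \<zeta>_def sum_distrib_left by (intro sum.cong refl) (simp only: mult.left_commute)
    ultimately show ?thesis using i l by (simp add: h_def distrib_left)
  qed
  have g0: "AE t in lebesgue_on {0..T}. \<forall>i<n. g j t $ i = 0" if "j \<ge> k" for j
    using that
  proof (induction j rule: dec_induct)
    case base
    show ?case using k by eventually_elim (simp add: g_def)
  next
    case (step j)
    have zz: "z j i t = 0" if "i < N" "t \<in> {0..T}" for i t
      using SLsol_unique[OF z(1)[of j] SLsol_0 z(2)[of j] BC_0 _ that] step.IH by simp
    have "AE t in lebesgue_on {0..T}. t \<in> {0..T}" by (rule AE_I2) simp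
    with step.IH show ?case
    proof eventually_elim
      case (elim t)
      have "g (Suc j) t $ i = (\<Sum>q<n. of_real (R1 t $$ (i, q)) * z j (n + q) t) + (1 / l) * g j t $ i" if "i < n" for i
        using step_eq(2)[OF gL[of j] z(1)[of j] z(2)[of j] _ elim(2) that, where l = l] by (simp add: g_def)
      then show ?case using elim zz by simp
    qed
  qed
  have z0: "z j i t = 0" if "j \<ge> k" "i < N" "t \<in> {0..T}" for j i t
    using SLsol_unique[OF z(1)[of j] SLsol_0 z(2)[of j] BC_0 _ that(2,3)] g0[OF that(1)] by simp
  \<comment> \<open>the initial data of the scaled solutions, as an inverse polynomial\<close>
  define K where "K = Suc k"
  define c where "c = (\<lambda>p j. M3v (\<lambda>q. \<zeta> j q 0) p)"
  have \<zeta>0: "\<zeta> j i t = 0" if "j \<ge> K" "i < N" "t \<in> {0..T}" for j i t using z0[of j i t] that by (simp add: \<zeta>_def K_def)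
  have csupp: "c p j = 0" if "j \<ge> K" for p j
    unfolding c_def M3v_def using \<zeta>0[OF that] T by (intro sum.neutral) auto
  have cK: "supp_below K c" using csupp by auto
  have K0: "K > 0" by (simp add: K_def)
  have tele: "h (j + s) t $ i = h j t $ i + l * (\<Sum>a<s. r (j + a) t i)" if "t \<in> {0..T}" "i < n" for j s t i
    by (induction s) (auto simp: hSuc[OF that] distrib_left)
  have hK: "AE t in lebesgue_on {0..T}. \<forall>i<n. h j t $ i = - l * (\<Sum>a<K. r (j + a) t i)" for j
  proof -
    have "AE t in lebesgue_on {0..T}. t \<in> {0..T}" by (rule AE_I2) simp
    moreover have "AE t in lebesgue_on {0..T}. \<forall>i<n. g (j + K) t $ i = 0" by (rule g0) (simp add: K_def)
    ultimately show ?thesis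
    proof eventually_elim
      case (elim t)
      note t = elim(1) and gg = elim(2)
      show ?case
      proof (intro allI impI)
        fix i assume i: "i < n"
        have "h (j + K) t $ i = 0" using gg i by (simp add: h_def)
        then show "h j t $ i = - l * (\<Sum>a<K. r (j + a) t i)" using tele[OF t i, of j K] by (simp add: eq_neg_iff_add_eq_0)
      qed
    qed
  qed
  have init: "\<zeta> j i 0 = Zc l K c j i 0" if "i < N" for j i
    using BC_initial[OF hb that, of j] Zc_0[OF K0 that] by (simp add: c_def)
  have eq: "\<zeta> j i t = Zc l K c j i t" if "i < N" "t \<in> {0..T}" for j i t
    using that
  proof (induction "K - j" arbitrary: j i t rule: less_induct)
    case less
    show ?case
    proof (cases "j \<ge> K")
      case True
      then show ?thesis using \<zeta>0[OF True less.prems] Zc_beyond[OF cK True] by simp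
    next
      case False
      obtain S where S: "negligible S" "\<And>t. t \<in> {0..T} \<Longrightarrow> t \<notin> S \<Longrightarrow> \<forall>i<n. h j t $ i = - l * (\<Sum>a<K. r (j + a) t i)"
        using AE_lebesgue_on_negligible[OF hK[of j]] by blast
      define d where "d = (\<lambda>i t. \<zeta> j i t - Zc l K c j i t)"
      have IH: "\<zeta> (j + Suc a) i t = Zc l K c (j + Suc a) i t" if "i < N" "t \<in> {0..T}" for a i t
        using less.hyps[of "j + Suc a" i t] that False by simp
      have diffH: "(if i < n then h j s $ i else 0) - (if i < n then Hc l K c j s $ i else 0) = - l * (\<Sum>p<N. of_real (Bd s $$ (i, p)) * d p s)"
        if i: "i < N" and s: "s \<in> {0..T}" "s \<notin> S" for i s
      proof (cases "i < n")
        case True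
        obtain K' where K': "K = Suc K'" using K0 gr0_implies_Suc by blast
        have "h j s $ i = - l * (\<Sum>a<K. r (j + a) s i)" using S(2)[OF s] True by blast
        moreover have "Hc l K c j s $ i = - l * (\<Sum>a<K. \<Sum>q<n. of_real (R1 s $$ (i, q)) * Zc l K c (j + a) (n + q) s)"
          using True by (simp add: Hc_def)
        moreover have "(\<Sum>a<K. r (j + a) s i) - (\<Sum>a<K. \<Sum>q<n. of_real (R1 s $$ (i, q)) * Zc l K c (j + a) (n + q) s)
           = (\<Sum>q<n. of_real (R1 s $$ (i, q)) * d (n + q) s)"
        proof -
          have "r (j + Suc a) s i = (\<Sum>q<n. of_real (R1 s $$ (i, q)) * Zc l K c (j + Suc a) (n + q) s)" for a
            unfolding r_def using IH[OF _ s(1)] by (intro sum.cong refl arg_cong2[of _ _ _ _ "(*)"]) auto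
          then have "(\<Sum>a<K. r (j + a) s i) - (\<Sum>a<K. \<Sum>q<n. of_real (R1 s $$ (i, q)) * Zc l K c (j + a) (n + q) s)
            = r j s i - (\<Sum>q<n. of_real (R1 s $$ (i, q)) * Zc l K c j (n + q) s)"
            unfolding K' sum.lessThan_Suc_shift by simp
          also have "\<dots> = (\<Sum>q<n. of_real (R1 s $$ (i, q)) * d (n + q) s)"
            by (simp add: r_def d_def right_diff_distrib sum_subtractf)
          finally show ?thesis .
        qed
        ultimately have "h j s $ i - Hc l K c j s $ i = - l * (\<Sum>q<n. of_real (R1 s $$ (i, q)) * d (n + q) s)"
          by (simp only: right_diff_distrib[symmetric])
        then show ?thesis using True Bd_mult(2)[OF s(1) True, of "\<lambda>p. d p s"] by simp
      next
        case False
        then have e: "n + (i - n) = i" "i - n < n" using i by auto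
        then show ?thesis using Bd_mult(1)[OF s(1) e(2), of "\<lambda>p. d p s"] False by simp
      qed
      have "d i t = 0"
      proof (rule volterra_unique[of T N "\<lambda>s i p. of_real (A s $$ (i, p)) + l * of_real (Bd s $$ (i, p))" d])
        fix i t assume i: "i < N" and t: "t \<in> {0..T}"
        have "((\<lambda>s. ((\<Sum>p<N. of_real (A s $$ (i, p)) * \<zeta> j p s) - (if i < n then h j s $ i else 0))
           - ((\<Sum>p<N. of_real (A s $$ (i, p)) * Zc l K c j p s) - (if i < n then Hc l K c j s $ i else 0))) has_integral
            ((\<zeta> j i t - \<zeta> j i 0) - (Zc l K c j i t - Zc l K c j i 0))) {0..t}"
        proof (rule has_integral_diff)
          show "((\<lambda>s. (\<Sum>p<N. of_real (A s $$ (i, p)) * \<zeta> j p s) - (if i < n then h j s $ i else 0)) has_integral (\<zeta> j i t - \<zeta> j i 0)) {0..t}"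
            using hs[of j] i t unfolding SLsol_def by blast
          show "((\<lambda>s. (\<Sum>p<N. of_real (A s $$ (i, p)) * Zc l K c j p s) - (if i < n then Hc l K c j s $ i else 0)) has_integral (Zc l K c j i t - Zc l K c j i 0)) {0..t}"
            using SLsol_Zc[OF cK, of l j] i t unfolding SLsol_def by blast
        qed
        moreover have "(\<zeta> j i t - \<zeta> j i 0) - (Zc l K c j i t - Zc l K c j i 0) = d i t"
          unfolding init[OF i] d_def by simp
        ultimately have "((\<lambda>s. ((\<Sum>p<N. of_real (A s $$ (i, p)) * \<zeta> j p s) - (if i < n then h j s $ i else 0))
           - ((\<Sum>p<N. of_real (A s $$ (i, p)) * Zc l K c j p s) - (if i < n then Hc l K c j s $ i else 0))) has_integral d i t) {0..t}"
          by (simp only:)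
        then show "((\<lambda>s. \<Sum>p<N. (of_real (A s $$ (i, p)) + l * of_real (Bd s $$ (i, p))) * d p s) has_integral d i t) {0..t}"
        proof (rule has_integral_spike[OF S(1), rotated])
          fix s assume "s \<in> {0..t} - S"
          then have s: "s \<in> {0..T}" "s \<notin> S" using t by auto
          have "((\<Sum>p<N. of_real (A s $$ (i, p)) * \<zeta> j p s) - (if i < n then h j s $ i else 0))
             - ((\<Sum>p<N. of_real (A s $$ (i, p)) * Zc l K c j p s) - (if i < n then Hc l K c j s $ i else 0))
             = ((\<Sum>p<N. of_real (A s $$ (i, p)) * \<zeta> j p s) - (\<Sum>p<N. of_real (A s $$ (i, p)) * Zc l K c j p s))
               - ((if i < n then h j s $ i else 0) - (if i < n then Hc l K c j s $ i else 0))" by (simp only: diff_diff_eq2 diff_diff_eq algebra_simps)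
          also have "\<dots> = (\<Sum>p<N. of_real (A s $$ (i, p)) * d p s) + l * (\<Sum>p<N. of_real (Bd s $$ (i, p)) * d p s)"
            unfolding diffH[OF i s] by (simp add: d_def right_diff_distrib sum_subtractf)
          also have "\<dots> = (\<Sum>p<N. (of_real (A s $$ (i, p)) + l * of_real (Bd s $$ (i, p))) * d p s)"
            by (simp add: sum_distrib_left distrib_right sum.distrib mult.assoc)
          finally show "(\<Sum>p<N. (of_real (A s $$ (i, p)) + l * of_real (Bd s $$ (i, p))) * d p s)
             = ((\<Sum>p<N. of_real (A s $$ (i, p)) * \<zeta> j p s) - (if i < n then h j s $ i else 0))
             - ((\<Sum>p<N. of_real (A s $$ (i, p)) * Zc l K c j p s) - (if i < n then Hc l K c j s $ i else 0))" ..
        qed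
      next
        show "\<And>i p. i < N \<Longrightarrow> p < N \<Longrightarrow> continuous_on {0..T} (\<lambda>s. of_real (A s $$ (i, p)) + l * of_real (Bd s $$ (i, p)))"
          using A_cont Bd_cont by (intro continuous_intros) auto
      qed (use T less.prems in auto)
      then show ?thesis by (simp add: d_def)
    qed
  qed
  have ker: "c \<in> act_kernel n (Ahat l)" unfolding act_kernel_def mem_Collect_eq
  proof (intro conjI allI impI)
    fix q assume "q < n"
    then show "fin_supp (c q)" using csupp by (auto simp: fin_supp_def)
  next
    fix i j assume i: "i < n"
    have "(\<Sum>p<n. fps_act (Ahat l $$ (i, p)) (c p) j) = M3v (\<lambda>q. \<zeta> j q T) (k0 + i)"
      unfolding Zc_T[OF cK i, symmetric] by (rule M3v_cong) (use eq T in auto)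
    then show "(\<Sum>q<n. fps_act (Ahat l $$ (i, q)) (c q) j) = 0" using hb[of j] i by (simp add: BC_def)
  qed
  have "AE t in lebesgue_on {0..T}. \<forall>i<n. f t $ i = Hc l K c 0 t $ i"
  proof -
    have "AE t in lebesgue_on {0..T}. t \<in> {0..T}" by (rule AE_I2) simp
    with hK[of 0] show ?thesis
    proof eventually_elim
      case (elim t)
      show ?case
      proof (intro allI impI)
        fix i assume i: "i < n"
        have "f t $ i = h 0 t $ i" using i by (simp add: h_def g_def)
        also have "\<dots> = - l * (\<Sum>a<K. r a t i)" using elim(1) i by simp
        also have "(\<Sum>a<K. r a t i) = (\<Sum>a<K. \<Sum>q<n. of_real (R1 t $$ (i, q)) * Zc l K c a (n + q) t)"
          unfolding r_def using eq[OF _ elim(2)] by (intro sum.cong refl arg_cong2[of _ _ _ _ "(*)"]) auto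
        finally show "f t $ i = Hc l K c 0 t $ i" using i by (simp add: Hc_def)
      qed
    qed
  qed
  then show ?thesis using that[OF K0 cK ker] by blast
qed

lemma Hc_linear:
  assumes i: "i < n"
  shows "Hc l K (\<lambda>p j. \<Sum>s<d. x s * b s p j) j t $ i = (\<Sum>s<d. x s * Hc l K (b s) j t $ i)"
proof -
  have "emb (\<lambda>p. \<Sum>s<d. x s * b s p q) = (\<lambda>i. \<Sum>s<d. x s * emb (\<lambda>p. b s p q) i)" for q
    unfolding emb_def sum_distrib_left fun_eq_iff by (subst sum.swap) (simp add: mult_ac)
  then have Z: "Zc l K (\<lambda>p j. \<Sum>s<d. x s * b s p j) j i t = (\<Sum>s<d. x s * Zc l K (b s) j i t)" for j i
    unfolding Zc_def by (simp only: sol_sum_right) (simp only: sum_distrib_left sum.swap[of _ "{..<d}" "{..<K}"])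
  define W where "W = (\<lambda>s r q. Zc l K (b s) (j + r) (n + q) t)"
  define X where "X = (\<lambda>s. \<Sum>r<K. \<Sum>q<n. of_real (R1 t $$ (i, q)) * W s r q)"
  have e: "(\<Sum>r<K. \<Sum>q<n. of_real (R1 t $$ (i, q)) * (\<Sum>s<d. x s * W s r q)) = (\<Sum>s<d. x s * X s)"
  proof -
    have "(\<Sum>r<K. \<Sum>q<n. of_real (R1 t $$ (i, q)) * (\<Sum>s<d. x s * W s r q)) = (\<Sum>r<K. \<Sum>q<n. \<Sum>s<d. x s * (of_real (R1 t $$ (i, q)) * W s r q))"
      unfolding sum_distrib_left by (simp only: mult.left_commute)
    also have "\<dots> = (\<Sum>r<K. \<Sum>s<d. \<Sum>q<n. x s * (of_real (R1 t $$ (i, q)) * W s r q))"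
      by (intro sum.cong refl sum.swap)
    also have "\<dots> = (\<Sum>s<d. \<Sum>r<K. \<Sum>q<n. x s * (of_real (R1 t $$ (i, q)) * W s r q))" by (rule sum.swap)
    finally show ?thesis unfolding X_def sum_distrib_left .
  qed
  have "Hc l K (\<lambda>p j. \<Sum>s<d. x s * b s p j) j t $ i
      = - l * (\<Sum>r<K. \<Sum>q<n. of_real (R1 t $$ (i, q)) * (\<Sum>s<d. x s * W s r q))"
    using i unfolding Hc_def Z W_def by simp
  also have "\<dots> = (\<Sum>s<d. x s * (- l * X s))"
    unfolding e sum_distrib_left[of "- l" "\<lambda>s. x s * X s"] by (intro sum.cong refl) (simp only: mult.left_commute)
  also have "\<dots> = (\<Sum>s<d. x s * Hc l K (b s) j t $ i)"
    using i by (simp add: Hc_def X_def W_def)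
  finally show ?thesis .
qed

text \<open>The map from kernel elements to the first right hand side of their chain is a linear
  isomorphism to the generalized eigenspace.\<close>

theorem L2_alg_mult_eq:
  assumes l: "l \<noteq> 0" and b: "act_kernel_basis n (Ahat l) d b"
  shows "L2_alg_mult T n Kop (- (1 / l)) = enat d"
proof -
  have bk: "b s \<in> act_kernel n (Ahat l)" if "s < d" for s using b that by (simp add: act_kernel_basis_def)
  have "\<exists>K. \<forall>s<d. \<forall>p<n. \<forall>j\<ge>K. b s p j = 0"
  proof -
    have "\<exists>K. \<forall>j\<ge>K. b s p j = 0" if "s < d" "p < n" for s p
      using bk[OF that(1)] that by (auto simp: act_kernel_def fin_supp_def)
    then obtain K where K: "\<And>s p j. s < d \<Longrightarrow> p < n \<Longrightarrow> j \<ge> K s p \<Longrightarrow> b s p j = 0" by metis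
    define KK where "KK = (\<Sum>s<d. \<Sum>p<n. K s p)"
    have "K s p \<le> KK" if "s < d" "p < n" for s p
    proof -
      have "K s p \<le> (\<Sum>p<n. K s p)" using that by (intro member_le_sum) auto
      also have "\<dots> \<le> KK" unfolding KK_def using that by (intro member_le_sum[of s _ "\<lambda>s. \<Sum>p<n. K s p"]) auto
      finally show ?thesis .
    qed
    show ?thesis
    proof (intro exI[of _ KK] allI impI)
      fix s p j assume "s < d" "p < n" "KK \<le> j"
      then show "b s p j = 0" using K order_trans[OF \<open>\<And>s p. s < d \<Longrightarrow> p < n \<Longrightarrow> K s p \<le> KK\<close>, of s p j] by blast
    qed
  qed
  then obtain Kb0 where Kb0: "\<And>s p j. s < d \<Longrightarrow> p < n \<Longrightarrow> j \<ge> Kb0 \<Longrightarrow> b s p j = 0" by blast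
  \<comment> \<open>a common positive bound for the supports, since \<open>Zc\<close> needs at least its term of index \<open>0\<close>\<close>
  define Kb where "Kb = Suc Kb0"
  have Kb: "supp_below Kb (b s)" if "s < d" for s using Kb0 that by (simp add: Kb_def)
  have Kb_pos: "Kb > 0" by (simp add: Kb_def)
  define \<Phi> where "\<Phi> = (\<lambda>s. Hc l Kb (b s) 0)"
  define E where "E = L2_gen_eigenspace T n Kop (- (1 / l))"
  have PhiE: "\<Phi> s \<in> E" if "s < d" for s
    unfolding \<Phi>_def E_def by (rule Hc_gen_eigenspace[OF Kb[OF that] Kb_pos bk[OF that] l])
  have Phi_indep: "\<forall>s<d. y s = 0" if ae: "AE t in lebesgue_on {0..T}. \<forall>i<n. (\<Sum>s<d. y s * \<Phi> s t $ i) = 0" for y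
  proof -
    define c where "c = (\<lambda>p j. \<Sum>s<d. y s * b s p j)"
    have c0: "supp_below Kb c" using Kb by (auto simp: c_def intro!: sum.neutral)
    have ck: "c \<in> act_kernel n (Ahat l)" unfolding act_kernel_def mem_Collect_eq
    proof (intro conjI allI impI)
      fix q assume "q < n"
      then show "fin_supp (c q)" using c0 by (auto simp: fin_supp_def)
    next
      fix p j assume p: "p < n"
      have fs: "fin_supp (b s q)" if "s < d" "q < n" for s q using bk[OF that(1)] that by (simp add: act_kernel_def)
      have "(\<Sum>q<n. fps_act (Ahat l $$ (p, q)) (c q) j) = (\<Sum>q<n. \<Sum>s<d. y s * fps_act (Ahat l $$ (p, q)) (b s q) j)"
      proof (rule sum.cong[OF refl])
        fix q assume q: "q \<in> {..<n}"
        have "fps_act (Ahat l $$ (p, q)) (c q) j = (\<Sum>s<d. fps_act (Ahat l $$ (p, q)) (\<lambda>j. y s * b s q j) j)"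
          unfolding c_def by (rule fps_act_sum_right) (use fs q in \<open>auto intro!: fin_supp_cmult\<close>)
        also have "\<dots> = (\<Sum>s<d. y s * fps_act (Ahat l $$ (p, q)) (b s q) j)"
          using fs q by (intro sum.cong refl fps_act_cmult_right) auto
        finally show "fps_act (Ahat l $$ (p, q)) (c q) j = (\<Sum>s<d. y s * fps_act (Ahat l $$ (p, q)) (b s q) j)" .
      qed
      also have "\<dots> = (\<Sum>s<d. y s * (\<Sum>q<n. fps_act (Ahat l $$ (p, q)) (b s q) j))"
        unfolding sum_distrib_left by (rule sum.swap)
      also have "\<dots> = 0" using bk p by (intro sum.neutral) (auto simp: act_kernel_def)
      finally show "(\<Sum>q<n. fps_act (Ahat l $$ (p, q)) (c q) j) = 0" .
    qed
    have "AE t in lebesgue_on {0..T}. \<forall>i<n. Hc l Kb c 0 t $ i = 0"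
      using ae by eventually_elim (simp add: c_def Hc_linear \<Phi>_def)
    then have "\<forall>q<n. \<forall>j. c q j = 0" using Hc_AE_0_imp[OF c0 Kb_pos ck] by blast
    then show ?thesis using b unfolding act_kernel_basis_def c_def by blast
  qed
  have Phi_span: "\<exists>x. AE t in lebesgue_on {0..T}. \<forall>i<n. f t $ i = (\<Sum>s<d. x s * \<Phi> s t $ i)" if f: "f \<in> E" for f
  proof -
    obtain K c where Kc: "K > 0" "supp_below K c" "c \<in> act_kernel n (Ahat l)"
      "AE t in lebesgue_on {0..T}. \<forall>i<n. f t $ i = Hc l K c 0 t $ i"
      using gen_eigenspace_imp_Hc[OF f[unfolded E_def] l] by blast
    obtain x where x: "\<forall>q<n. \<forall>j. c q j = (\<Sum>s<d. x s * b s q j)"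
      using b Kc(3) unfolding act_kernel_basis_def by blast
    define c' where "c' = (\<lambda>p j. \<Sum>s<d. x s * b s p j)"
    have cc: "c p j = c' p j" if "p < n" for p j using x that by (simp add: c'_def)
    have c': "supp_below Kb c'" using Kb by (auto simp: c'_def intro!: sum.neutral)
    have cKb: "supp_below Kb c" using c' cc by simp
    have ecc: "emb (\<lambda>p. c p q) i = emb (\<lambda>p. c' p q) i" for q i
      unfolding emb_def by (intro sum.cong refl) (simp add: cc)
    have ecc': "emb (\<lambda>p. c p q) = emb (\<lambda>p. c' p q)" for q using ecc by blast
    have "Hc l K c 0 t = Hc l Kb c' 0 t" for t
    proof -
      have "Hc l K c 0 t = Hc l (max K Kb) c 0 t" using Hc_extend[OF Kc(2), of "max K Kb" l 0 t] by simp
      also have "\<dots> = Hc l Kb c 0 t" using Hc_extend[OF cKb, of "max K Kb" l 0 t] by simp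
      also have "\<dots> = Hc l Kb c' 0 t" unfolding Hc_def Zc_def ecc' ..
      finally show ?thesis .
    qed
    then have "AE t in lebesgue_on {0..T}. \<forall>i<n. f t $ i = (\<Sum>s<d. x s * \<Phi> s t $ i)"
      using Kc(4) by (simp add: c'_def Hc_linear \<Phi>_def)
    then show ?thesis by blast
  qed
  have "L2_dim T n E = enat d"
    unfolding L2_dim_def
  proof (rule antisym)
    show "Sup {enat k |k. \<exists>fs. (\<forall>j<k. fs j \<in> E) \<and> L2_indep T n k fs} \<le> enat d"
    proof (rule Sup_least)
      fix e assume "e \<in> {enat k |k. \<exists>fs. (\<forall>j<k. fs j \<in> E) \<and> L2_indep T n k fs}"
      then obtain k gs where e: "e = enat k" and gs: "\<forall>j<k. gs j \<in> E" "L2_indep T n k gs" by auto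
      have "\<forall>j. \<exists>x. j < k \<longrightarrow> (AE t in lebesgue_on {0..T}. \<forall>i<n. gs j t $ i = (\<Sum>s<d. x s * \<Phi> s t $ i))"
        using Phi_span gs(1) by blast
      then obtain x where x: "\<And>j. j < k \<Longrightarrow> AE t in lebesgue_on {0..T}. \<forall>i<n. gs j t $ i = (\<Sum>s<d. x j s * \<Phi> s t $ i)"
        using choice[where Q = "\<lambda>j x. j < k \<longrightarrow> (AE t in lebesgue_on {0..T}. \<forall>i<n. gs j t $ i = (\<Sum>s<d. x s * \<Phi> s t $ i))"] by auto
      have "\<not> d < k"
      proof
        assume "d < k"
        have "\<exists>y. (\<exists>j<k. y j \<noteq> 0) \<and> (\<forall>s<d. (\<Sum>j<k. y j * x j s) = 0)"
          by (rule underdetermined_system[OF \<open>d < k\<close>, of x]) blast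
        then obtain y where y: "\<exists>j<k. y j \<noteq> 0" "\<And>s. s < d \<Longrightarrow> (\<Sum>j<k. y j * x j s) = 0" by blast
        have "AE t in lebesgue_on {0..T}. \<forall>j\<in>{..<k}. \<forall>i<n. gs j t $ i = (\<Sum>s<d. x j s * \<Phi> s t $ i)"
          using x by (intro AE_finite_allI) auto
        then have "AE t in lebesgue_on {0..T}. \<forall>i<n. (\<Sum>j<k. y j * gs j t $ i) = 0"
        proof eventually_elim
          case (elim t)
          show ?case
          proof (intro allI impI)
            fix i assume i: "i < n"
            have "(\<Sum>j<k. y j * gs j t $ i) = (\<Sum>j<k. \<Sum>s<d. y j * x j s * \<Phi> s t $ i)"
              using elim i by (intro sum.cong refl) (simp add: sum_distrib_left mult.assoc)
            also have "\<dots> = (\<Sum>s<d. (\<Sum>j<k. y j * x j s) * \<Phi> s t $ i)"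
              unfolding sum_distrib_right by (rule sum.swap)
            finally show "(\<Sum>j<k. y j * gs j t $ i) = 0" using y(2) by simp
          qed
        qed
        then have "\<forall>j<k. y j = 0" using spec[OF gs(2)[unfolded L2_indep_def], of y] by (rule rev_mp)
        then show False using y(1) by blast
      qed
      then show "e \<le> enat d" using e by simp
    qed
    show "enat d \<le> Sup {enat k |k. \<exists>fs. (\<forall>j<k. fs j \<in> E) \<and> L2_indep T n k fs}"
    proof (rule Sup_upper)
      have "L2_indep T n d \<Phi>" unfolding L2_indep_def by (intro allI impI Phi_indep)
      then show "enat d \<in> {enat k |k. \<exists>fs. (\<forall>j<k. fs j \<in> E) \<and> L2_indep T n k fs}" using PhiE by blast
    qed
  qed
  then show ?thesis by (simp add: L2_alg_mult_def E_def)
qed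

end

section \<open>The characteristic function\<close>

lemma holomorphic_on_UNIV_of_power_series:
  fixes g :: "complex \<Rightarrow> complex"
  assumes "\<And>x. (\<lambda>k. b k * x ^ k) sums g x"
  shows "g holomorphic_on UNIV"
proof -
  have "g holomorphic_on ball 0 (norm x + 1)" for x
    by (rule power_series_holomorphic[of _ _ b]) (simp add: assms)
  then have "g field_differentiable (at x)" for x
    using holomorphic_on_imp_differentiable_at[of g "ball 0 (norm x + 1)" x] by (auto simp: dist_norm)
  then show ?thesis by (simp add: holomorphic_on_def field_differentiable_at_within)
qed

lemma has_fps_expansion_det:
  fixes F :: "complex fps mat" and a :: "complex \<Rightarrow> nat \<Rightarrow> nat \<Rightarrow> complex"
  assumes F: "F \<in> carrier_mat n n"
    and a: "\<And>i j. i < n \<Longrightarrow> j < n \<Longrightarrow> (\<lambda>x. a x i j) has_fps_expansion F $$ (i, j)"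
  shows "(\<lambda>x. det (mat n n (\<lambda>(i, j). a x i j))) has_fps_expansion det F"
proof -
  have sgn: "(\<lambda>x. signof p :: complex) has_fps_expansion (signof p :: complex fps)" for p
    by (cases "evenperm p") (auto simp: sign_def intro!: fps_expansion_intros)
  have "(\<lambda>x. \<Sum>p | p permutes {0..<n}. signof p * (\<Prod>i = 0..<n. a x i (p i))) has_fps_expansion
     (\<Sum>p | p permutes {0..<n}. signof p * (\<Prod>i = 0..<n. F $$ (i, p i)))"
    by (intro has_fps_expansion_sum has_fps_expansion_mult has_fps_expansion_prod sgn a)
      (auto dest: permutes_in_image)
  also have "(\<lambda>x. \<Sum>p | p permutes {0..<n}. signof p * (\<Prod>i = 0..<n. a x i (p i))) = (\<lambda>x. det (mat n n (\<lambda>(i, j). a x i j)))"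
    by (subst det_def'[of _ n]) (auto intro!: ext sum.cong prod.cong simp: permutes_in_image)
  finally show ?thesis by (simp add: det_def'[OF F])
qed

lemma norm_det_le:
  fixes A :: "complex mat"
  assumes A: "A \<in> carrier_mat n n" and b: "\<And>i j. i < n \<Longrightarrow> j < n \<Longrightarrow> norm (A $$ (i, j)) \<le> b"
  shows "norm (det A) \<le> fact n * b ^ n"
proof -
  have sgn: "norm (signof p :: complex) = 1" for p by (simp add: sign_def)
  have "norm (det A) \<le> (\<Sum>p | p permutes {0..<n}. norm (signof p * (\<Prod>i = 0..<n. A $$ (i, p i))))"
    unfolding det_def'[OF A] by (rule norm_sum)
  also have "\<dots> \<le> (\<Sum>p | p permutes {0..<n}. b ^ n)"
  proof (rule sum_mono)
    fix p assume "p \<in> {p. p permutes {0..<n}}"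
    then have p: "p i < n" if "i < n" for i using that by (auto dest: permutes_in_image)
    have "(\<Prod>i = 0..<n. norm (A $$ (i, p i))) \<le> (\<Prod>i = 0..<n. b)"
      using b p by (intro prod_mono) auto
    then show "norm (signof p * (\<Prod>i = 0..<n. A $$ (i, p i))) \<le> b ^ n"
      unfolding norm_mult sgn prod_norm[symmetric] by simp
  qed
  also have "\<dots> = fact n * b ^ n" using card_permutations[of "{0..<n}" n] by simp
  finally show ?thesis .
qed

context sl_system
begin

definition zs :: "complex \<Rightarrow> (nat \<Rightarrow> complex) \<Rightarrow> nat \<Rightarrow> real \<Rightarrow> complex" where
  "zs l c = sol (\<lambda>k. l ^ k) (emb c)"

lemma zs_deriv:
  assumes i: "i < N" and t: "t \<in> {0..T}"
  shows "(zs l c i has_vector_derivative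
     (\<Sum>p<N. (of_real (A t $$ (i, p)) + l * of_real (Bd t $$ (i, p))) * zs l c p t)) (at t within {0..T})"
proof -
  have sh: "sol (\<lambda>k. l ^ Suc k) (emb c) p t = l * zs l c p t" for p
    using sol_sum_left[of "{0::nat}" "\<lambda>_ k. l ^ k" t l "emb c" p] geometric_bound_power t by (simp add: zs_def)
  have "(\<Sum>p<N. of_real (A t $$ (i, p)) * zs l c p t) + (\<Sum>p<N. of_real (Bd t $$ (i, p)) * (l * zs l c p t))
     = (\<Sum>p<N. (of_real (A t $$ (i, p)) + l * of_real (Bd t $$ (i, p))) * zs l c p t)"
    unfolding sum.distrib[symmetric] by (intro sum.cong refl) (simp add: algebra_simps)
  then show ?thesis using sol_deriv[OF geometric_bound_power i t, of l "emb c"]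
    unfolding sh by (simp add: zs_def[symmetric])
qed

lemma zs_0: "i < N \<Longrightarrow> zs l c i 0 = emb c i"
  by (simp add: zs_def sol_0)

lemma Bd_index:
  assumes t: "t \<in> {0..T}" and ij: "i < N" "j < N" and nz: "Bd t $$ (i, j) \<noteq> 0"
  shows "i < n \<and> n \<le> j"
proof -
  have ent: "(\<Sum>p<N. of_real (Bd t $$ (i, p)) * (if p = j then 1 else 0)) = complex_of_real (Bd t $$ (i, j))"
    using ij by (simp add: if_distrib[of "\<lambda>x. _ * x"] cong: if_cong)
  have "i < n"
  proof (rule ccontr)
    assume "\<not> i < n"
    then have "n + (i - n) = i" "i - n < n" using ij by auto
    then show False using Bd_mult(1)[OF t \<open>i - n < n\<close>, of "\<lambda>p. if p = j then 1 else 0 :: complex"] ent nz by simp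
  qed
  moreover have "n \<le> j"
  proof (rule ccontr)
    assume "\<not> n \<le> j"
    then have "(\<Sum>q<n. of_real (R1 t $$ (i, q)) * (if n + q = j then 1 else 0)) = (0::complex)"
      by (intro sum.neutral) auto
    then show False using Bd_mult(2)[OF t \<open>i < n\<close>, of "\<lambda>p. if p = j then 1 else 0 :: complex"] ent nz by simp
  qed
  ultimately show ?thesis ..
qed

text \<open>With the weight \<open>\<mu> = 1 + sqrt \<bar>l\<bar>\<close> on the components of \<open>y\<close>, the entry \<open>l R\<^sub>1\<close> is divided by
  \<open>\<mu>\<close>, while the block expressing \<open>y'\<close> by \<open>x\<close> is multiplied by \<open>\<mu>\<close>. Since \<open>\<bar>l\<bar> \<le> \<mu>\<^sup>2\<close>, all entries
  are \<open>O(\<mu>)\<close>. An unweighted estimate would only give order one, which is not enough to determine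
  the function by its zeros.\<close>

lemma zs_growth:
  obtains C where "C \<ge> 0" "\<And>l c i. i < N \<Longrightarrow>
    norm (zs l c i T) \<le> exp (C * (1 + sqrt (norm l))) * sqrt (\<Sum>p<N. (norm (emb c p))\<^sup>2)"
proof -
  obtain CA where CA: "CA \<ge> 0" "\<And>t i j. t \<in> {0..T} \<Longrightarrow> i < N \<Longrightarrow> j < N \<Longrightarrow> \<bar>A t $$ (i, j)\<bar> \<le> CA"
    using mat_path_bounded[OF A_path] by blast
  obtain CB where CB: "CB \<ge> 0" "\<And>t i j. t \<in> {0..T} \<Longrightarrow> i < N \<Longrightarrow> j < N \<Longrightarrow> \<bar>Bd t $$ (i, j)\<bar> \<le> CB"
    using mat_path_bounded[OF Bd_path] by blast
  define C where "C = real N * (CA + CB) * T + 1"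
  have "norm (zs l c i T) \<le> exp (C * (1 + sqrt (norm l))) * sqrt (\<Sum>p<N. (norm (emb c p))\<^sup>2)" if i: "i < N" for l c i
  proof -
    define \<mu> where "\<mu> = 1 + sqrt (norm l)"
    have mu1: "\<mu> \<ge> 1" by (simp add: \<mu>_def)
    have mu2: "norm l \<le> \<mu> * \<mu>"
    proof -
      have "norm l = (sqrt (norm l))\<^sup>2" by simp
      also have "\<dots> \<le> \<mu>\<^sup>2" unfolding \<mu>_def by (intro power_mono) auto
      finally show ?thesis by (simp add: power2_eq_square)
    qed
    define s where "s = (\<lambda>i. if i < n then 1 else \<mu>)"
    have s: "1 \<le> s i" "s i \<le> \<mu>" "s i > 0" for i using mu1 by (auto simp: s_def)
    define M where "M = (\<lambda>t i j. complex_of_real (s i / s j) * (of_real (A t $$ (i, j)) + l * of_real (Bd t $$ (i, j))))"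
    define u where "u = (\<lambda>i t. complex_of_real (s i) * zs l c i t)"
    have du: "(u i has_vector_derivative (\<Sum>j<N. M t i j * u j t)) (at t within {0..T})" if "i < N" "t \<in> {0..T}" for i t
    proof -
      have eq: "M t i j * u j t = of_real (s i) * ((of_real (A t $$ (i, j)) + l * of_real (Bd t $$ (i, j))) * zs l c j t)" for j
        using s(3)[of j] by (simp add: M_def u_def)
      show ?thesis
        unfolding eq sum_distrib_left[symmetric] unfolding u_def
        by (rule has_vector_derivative_mult_right[OF zs_deriv[OF that, of l c]])
    qed
    have Mb: "norm (M t i j) \<le> \<mu> * (CA + CB)" if "i < N" "j < N" "t \<in> {0..T}" for i j t
    proof -
      have "s i / s j \<le> \<mu> / 1" using s(1)[of j] s(2)[of i] mu1 by (intro frac_le) auto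
      then have "s i / s j * \<bar>A t $$ (i, j)\<bar> \<le> \<mu> * CA"
        using CA that mu1 s[of i] s[of j] by (intro mult_mono) auto
      moreover have "s i / s j * (norm l * \<bar>Bd t $$ (i, j)\<bar>) \<le> \<mu> * CB"
      proof (cases "Bd t $$ (i, j) = 0")
        case True
        then show ?thesis using CB(1) mu1 by simp
      next
        case False
        then have "s i = 1" "s j = \<mu>" using Bd_index[OF that(3,1,2)] by (auto simp: s_def)
        moreover have "norm l / \<mu> \<le> \<mu>" using mu1 mu2 by (simp add: divide_le_eq)
        then have "norm l / \<mu> * \<bar>Bd t $$ (i, j)\<bar> \<le> \<mu> * CB" using CB that mu1 by (intro mult_mono) auto
        ultimately show ?thesis by simp
      qed
      moreover have "norm (M t i j) \<le> s i / s j * (\<bar>A t $$ (i, j)\<bar> + norm l * \<bar>Bd t $$ (i, j)\<bar>)"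
      proof -
        have "norm (of_real (A t $$ (i, j)) + l * of_real (Bd t $$ (i, j))) \<le> \<bar>A t $$ (i, j)\<bar> + norm l * \<bar>Bd t $$ (i, j)\<bar>"
          by (rule order_trans[OF norm_triangle_ineq]) (simp add: norm_mult)
        then show ?thesis unfolding M_def norm_mult norm_of_real
          using s(3)[of i] s(3)[of j] by (intro mult_mono) auto
      qed
      ultimately show ?thesis by (simp add: distrib_left)
    qed
    define W where "W = (\<Sum>p<N. (norm (emb c p))\<^sup>2)"
    have W0: "W \<ge> 0" by (simp add: W_def sum_nonneg)
    have init: "(\<Sum>p<N. (norm (u p 0))\<^sup>2) \<le> \<mu>\<^sup>2 * W"
      unfolding W_def sum_distrib_left
    proof (rule sum_mono)
      fix p assume "p \<in> {..<N}"
      then have "(norm (u p 0))\<^sup>2 = (s p)\<^sup>2 * (norm (emb c p))\<^sup>2"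
        by (simp add: u_def zs_0 norm_mult power_mult_distrib)
      also have "\<dots> \<le> \<mu>\<^sup>2 * (norm (emb c p))\<^sup>2" using s[of p] by (intro mult_right_mono power_mono) auto
      finally show "(norm (u p 0))\<^sup>2 \<le> \<mu>\<^sup>2 * (norm (emb c p))\<^sup>2" .
    qed
    have "(norm (zs l c i T))\<^sup>2 \<le> (norm (u i T))\<^sup>2"
      using s(1)[of i] mult_right_mono[of 1 "s i" "norm (zs l c i T)"] by (intro power_mono) (auto simp: u_def norm_mult)
    also have "\<dots> \<le> (\<Sum>p<N. (norm (u p T))\<^sup>2)"
      using i by (intro member_le_sum[of i _ "\<lambda>p. (norm (u p T))\<^sup>2"]) auto
    also have "\<dots> \<le> exp (2 * real N * (\<mu> * (CA + CB)) * T) * (\<Sum>p<N. (norm (u p 0))\<^sup>2)"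
      by (rule gronwall_linear_system[OF du Mb]) (use T mu1 CA CB in auto)
    also have "\<dots> \<le> exp (2 * real N * (\<mu> * (CA + CB)) * T) * (\<mu>\<^sup>2 * W)"
      by (intro mult_left_mono init) auto
    also have "\<dots> \<le> exp (2 * real N * (\<mu> * (CA + CB)) * T) * ((exp \<mu>)\<^sup>2 * W)"
    proof -
      have "\<mu>\<^sup>2 \<le> (exp \<mu>)\<^sup>2" using exp_ge_add_one_self[of \<mu>] mu1 by (intro power_mono) linarith+
      then show ?thesis using W0 by (intro mult_left_mono mult_right_mono) auto
    qed
    also have "\<dots> = (exp (C * \<mu>))\<^sup>2 * W"
      by (simp add: C_def power2_eq_square exp_add[symmetric] mult.assoc[symmetric]) (simp add: algebra_simps)
    also have "\<dots> = (exp (C * \<mu>) * sqrt W)\<^sup>2" using W0 by (simp add: power_mult_distrib)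
    finally have "norm (zs l c i T) \<le> exp (C * \<mu>) * sqrt W"
      by (rule power2_le_imp_le) (simp add: W0)
    then show ?thesis by (simp add: \<mu>_def W_def)
  qed
  moreover have "C \<ge> 0" using CA CB T by (simp add: C_def)
  ultimately show ?thesis using that by blast
qed

definition charf :: "complex \<Rightarrow> complex" where
  "charf l = det (mat n n (\<lambda>(i, j). \<Delta> (\<lambda>k. l ^ k) i j))"

lemma \<Delta>_power_sums:
  assumes "i < n" "j < n"
  shows "(\<lambda>k. of_real (Pk k $$ (i, j)) * l ^ k) sums \<Delta> (\<lambda>k. l ^ k) i j"
  using \<Delta>_sums[OF geometric_bound_power assms, of l] by (simp add: mult.commute)

lemma charf_holomorphic: "charf holomorphic_on UNIV"
proof -
  have h: "(\<lambda>l. \<Delta> (\<lambda>k. l ^ k) i j) holomorphic_on UNIV" if "i < n" "j < n" for i j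
    by (rule holomorphic_on_UNIV_of_power_series) (rule \<Delta>_power_sums[OF that])
  have "(\<lambda>l. \<Sum>p | p permutes {0..<n}. signof p * (\<Prod>i = 0..<n. \<Delta> (\<lambda>k. l ^ k) i (p i))) holomorphic_on UNIV"
    by (intro holomorphic_intros h) (auto dest: permutes_in_image)
  also have "(\<lambda>l. \<Sum>p | p permutes {0..<n}. signof p * (\<Prod>i = 0..<n. \<Delta> (\<lambda>k. l ^ k) i (p i))) = charf"
    unfolding charf_def
    by (subst det_def'[of _ n]) (auto intro!: ext sum.cong prod.cong simp: permutes_in_image)
  finally show ?thesis .
qed

lemma charf_growth:
  obtains C where "\<And>l. norm (charf l) \<le> exp (C * (1 + sqrt (norm l)))" "C \<ge> 0"
proof -
  obtain C where C: "C \<ge> 0" "\<And>l c i. i < N \<Longrightarrow>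
    norm (zs l c i T) \<le> exp (C * (1 + sqrt (norm l))) * sqrt (\<Sum>p<N. (norm (emb c p))\<^sup>2)"
    using zs_growth by blast
  define e where "e = (\<lambda>(j::nat) (p::nat). if p = j then 1 else 0 :: complex)"
  define B where "B = (\<lambda>i j. \<Sum>q<N. \<bar>M3 $$ (k0 + i, q)\<bar> * sqrt (\<Sum>p<N. (norm (emb (e j) p))\<^sup>2))"
  define D where "D = 1 + (\<Sum>i<n. \<Sum>j<n. B i j)"
  have B0: "B i j \<ge> 0" for i j unfolding B_def by (intro sum_nonneg mult_nonneg_nonneg real_sqrt_ge_zero) auto
  have D1: "D \<ge> 1" unfolding D_def using B0 by (simp add: sum_nonneg)
  have BD: "B i j \<le> D" if "i < n" "j < n" for i j
  proof -
    have "B i j \<le> (\<Sum>j<n. B i j)" using that B0 by (intro member_le_sum) auto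
    also have "\<dots> \<le> (\<Sum>i<n. \<Sum>j<n. B i j)" using that B0 by (intro member_le_sum[of i _ "\<lambda>i. \<Sum>j<n. B i j"] sum_nonneg) auto
    finally show ?thesis by (simp add: D_def)
  qed
  have ent: "norm (\<Delta> (\<lambda>k. l ^ k) i j) \<le> exp (C * (1 + sqrt (norm l))) * D" if "i < n" "j < n" for l i j
  proof -
    have "\<Delta> (\<lambda>k. l ^ k) i j = M3v (\<lambda>q. zs l (e j) q T) (k0 + i)"
      unfolding zs_def M3v_sol_T[OF geometric_bound_power that(1)] using that
      by (simp add: e_def if_distrib[of "\<lambda>x. _ * x"] cong: if_cong)
    also have "norm \<dots> \<le> (\<Sum>q<N. \<bar>M3 $$ (k0 + i, q)\<bar> * (exp (C * (1 + sqrt (norm l))) * sqrt (\<Sum>p<N. (norm (emb (e j) p))\<^sup>2)))"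
      unfolding M3v_def by (intro sum_norm_le) (auto simp: norm_mult intro!: mult_left_mono C)
    also have "\<dots> = exp (C * (1 + sqrt (norm l))) * B i j"
      unfolding B_def sum_distrib_left by (intro sum.cong refl) (simp only: mult.left_commute)
    also have "\<dots> \<le> exp (C * (1 + sqrt (norm l))) * D" using BD[OF that] by simp
    finally show ?thesis .
  qed
  define K where "K = fact n * D ^ n"
  have K1: "K \<ge> 1" unfolding K_def using mult_mono[of 1 "fact n" 1 "D ^ n"] one_le_power[OF D1] fact_ge_1[of n, where 'a = real] by simp
  have "norm (charf l) \<le> exp ((real n * C + ln K) * (1 + sqrt (norm l)))" for l
  proof -
    have "norm (charf l) \<le> fact n * (exp (C * (1 + sqrt (norm l))) * D) ^ n"
      unfolding charf_def by (rule norm_det_le[OF mat_carrier]) (simp add: ent)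
    also have "\<dots> = K * exp (real n * C * (1 + sqrt (norm l)))"
      by (simp add: K_def power_mult_distrib exp_of_nat_mult[symmetric] mult_ac)
    also have "\<dots> \<le> exp (ln K * (1 + sqrt (norm l))) * exp (real n * C * (1 + sqrt (norm l)))"
    proof -
      have "K = exp (ln K * 1)" using K1 by simp
      also have "\<dots> \<le> exp (ln K * (1 + sqrt (norm l)))" using K1 by (intro iffD2[OF exp_le_cancel_iff] mult_left_mono) auto
      finally show ?thesis by (intro mult_right_mono) auto
    qed
    finally show ?thesis by (simp add: exp_add[symmetric] distrib_right add.commute)
  qed
  moreover have "real n * C + ln K \<ge> 0" using C K1 by simp
  ultimately show ?thesis using that by blast
qed

end

section \<open>Zeros of the characteristic function and eigenvalues\<close>

text \<open>The partial sums are polynomials in \<open>l / (1 - \<delta>)\<close> with a known expansion; they converge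
  uniformly near \<open>0\<close>, and so do their Taylor coefficients.\<close>

lemma entire_series_compose_geometric:
  fixes g :: "complex \<Rightarrow> complex"
  assumes g: "\<And>x. (\<lambda>k. b k * x ^ k) sums g x"
  shows "(\<lambda>\<delta>. g (l / (1 - \<delta>))) has_fps_expansion Abs_fps (\<lambda>q. \<Sum>k. b k * \<alpha> l k q)"
proof -
  define B where "B = ball (0::complex) (1 / 2)"
  define h where "h = (\<lambda>\<delta>::complex. l / (1 - \<delta>))"
  define u where "u = (\<lambda>K \<delta>. \<Sum>k<K. b k * h \<delta> ^ k)"
  have B: "1 - \<delta> \<noteq> 0" "norm (h \<delta>) \<le> 2 * norm l" if "\<delta> \<in> B" for \<delta>
  proof -
    have "norm (1 - \<delta>) \<ge> 1 / 2" using norm_triangle_ineq2[of 1 \<delta>] that by (simp add: B_def)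
    then show "1 - \<delta> \<noteq> 0" by auto
    have "norm l / norm (1 - \<delta>) \<le> norm l / (1 / 2)"
      using \<open>norm (1 - \<delta>) \<ge> 1 / 2\<close> by (intro divide_left_mono) auto
    then show "norm (h \<delta>) \<le> 2 * norm l" by (simp add: h_def norm_divide)
  qed
  have oB: "open B" "0 \<in> B" by (auto simp: B_def)
  have hh: "h holomorphic_on B" unfolding h_def using B(1) by (intro holomorphic_intros) auto
  have unif: "uniform_limit B u (\<lambda>\<delta>. g (h \<delta>)) sequentially"
  proof -
    have "uniform_limit B (\<lambda>K \<delta>. \<Sum>k<K. b k * h \<delta> ^ k) (\<lambda>\<delta>. \<Sum>k. b k * h \<delta> ^ k) sequentially"
    proof (rule Weierstrass_m_test)
      show "norm (b k * h \<delta> ^ k) \<le> norm (b k * of_real (2 * norm l) ^ k)" if "\<delta> \<in> B" for k \<delta>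
      proof -
        have "norm (b k) * norm (h \<delta>) ^ k \<le> norm (b k) * (2 * norm l) ^ k"
          using B(2)[OF that] by (intro mult_left_mono power_mono) auto
        then show ?thesis by (simp add: norm_mult norm_power)
      qed
      have "summable (\<lambda>k. b k * of_real (2 * norm l + 1) ^ k)" using g sums_summable by blast
      moreover have "norm (complex_of_real (2 * norm l)) < norm (complex_of_real (2 * norm l + 1))"
        unfolding norm_of_real by simp
      ultimately show "summable (\<lambda>k. norm (b k * of_real (2 * norm l) ^ k))" by (rule powser_insidea)
    qed
    moreover have "(\<Sum>k. b k * h \<delta> ^ k) = g (h \<delta>)" for \<delta> using g sums_unique by metis
    ultimately show ?thesis by (simp add: u_def)
  qed
  have hu: "u K holomorphic_on B" for K unfolding u_def by (intro holomorphic_intros hh)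
  have "(\<lambda>\<delta>. g (h \<delta>)) holomorphic_on B"
    using holomorphic_on_compose_gen[OF hh holomorphic_on_UNIV_of_power_series[OF g]] by (simp add: o_def)
  then have fe: "(\<lambda>\<delta>. g (h \<delta>)) has_fps_expansion fps_expansion (\<lambda>\<delta>. g (h \<delta>)) 0"
    using analytic_at_imp_has_fps_expansion_0 analytic_at oB by blast
  have hexp: "h has_fps_expansion Abs_fps (\<lambda>_. l)"
  proof (rule has_fps_expansionI)
    have "(\<lambda>n. l * \<delta> ^ n) sums h \<delta>" if "\<delta> \<in> B" for \<delta>
      using sums_mult[OF geometric_sums[of \<delta>], of l] that by (simp add: B_def h_def)
    then show "\<forall>\<^sub>F \<delta> in nhds 0. (\<lambda>n. fps_nth (Abs_fps (\<lambda>_. l)) n * \<delta> ^ n) sums h \<delta>"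
      using oB by (auto simp: eventually_nhds)
  qed
  have uexp: "u K has_fps_expansion (\<Sum>k<K. fps_const (b k) * Abs_fps (\<lambda>_. l) ^ k)" for K
    unfolding u_def by (intro fps_expansion_intros hexp)
  have "fps_expansion (\<lambda>\<delta>. g (h \<delta>)) 0 = Abs_fps (\<lambda>q. \<Sum>k. b k * \<alpha> l k q)"
  proof (rule fps_ext)
    fix q
    have "(\<lambda>K. (deriv ^^ q) (u K) 0) \<longlonglongrightarrow> (deriv ^^ q) (\<lambda>\<delta>. g (h \<delta>)) 0"
      by (rule higher_deriv_complex_uniform_limit[OF unif _ _ oB]) (auto simp: hu)
    then have "(\<lambda>K. (deriv ^^ q) (u K) 0 / fact q) \<longlonglongrightarrow> (deriv ^^ q) (\<lambda>\<delta>. g (h \<delta>)) 0 / fact q"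
      by (intro tendsto_intros) auto
    moreover have "(deriv ^^ q) (u K) 0 / fact q = (\<Sum>k<K. b k * \<alpha> l k q)" for K
      unfolding fps_nth_fps_expansion[OF uexp, symmetric] Abs_fps_\<alpha>[symmetric] by (simp add: fps_sum_nth)
    ultimately have "(\<lambda>k. b k * \<alpha> l k q) sums fps_nth (fps_expansion (\<lambda>\<delta>. g (h \<delta>)) 0) q"
      unfolding fps_nth_fps_expansion[OF fe] sums_def by simp
    then show "fps_nth (fps_expansion (\<lambda>\<delta>. g (h \<delta>)) 0) q = fps_nth (Abs_fps (\<lambda>q. \<Sum>k. b k * \<alpha> l k q)) q"
      using sums_unique by simp
  qed
  then show ?thesis using fe by (simp add: h_def)
qed

lemma cmat_mult: "A \<in> carrier_mat r m \<Longrightarrow> B \<in> carrier_mat m c \<Longrightarrow> cmat (A * B) = cmat A * cmat B"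
  unfolding cmat_def by (rule of_real_hom.mat_hom_mult)

lemma det_cmat: "det (cmat A) = of_real (det A)"
  unfolding cmat_def by (rule of_real_hom.hom_det)

lemma cmat_carrier: "A \<in> carrier_mat r c \<Longrightarrow> cmat A \<in> carrier_mat r c"
  by (simp add: cmat_def)

lemma trace_prod_mats_cmat:
  assumes G: "\<And>k. G k \<in> carrier_mat n n"
  shows "trace_mat (prod_mats n (map (\<lambda>k. cmat (G k)) js)) = of_real (trace_mat (prod_mats n (map G js)))"
proof -
  have c: "prod_mats n (map G js) \<in> carrier_mat n n" for js
    by (induction js) (auto simp: prod_mats_def intro: mult_carrier_mat G)
  have "prod_mats n (map (\<lambda>k. cmat (G k)) js) = cmat (prod_mats n (map G js))"
  proof (induction js)
    case Nil
    show ?case by (simp add: prod_mats_def cmat_def of_real_hom.mat_hom_one)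
  next
    case (Cons j js)
    then show ?case using cmat_mult[OF G c, of j js] by (simp add: prod_mats_def)
  qed
  then show ?thesis using c[of js] by (simp add: trace_mat_def cmat_def)
qed

context sl_system
begin

lemma Ahat_carrier: "Ahat l \<in> carrier_mat n n"
  by (simp add: Ahat_def)

lemma charf_compose: "(\<lambda>\<delta>. charf (l / (1 - \<delta>))) has_fps_expansion det (Ahat l)"
  unfolding charf_def
proof (rule has_fps_expansion_det[OF Ahat_carrier])
  fix i j assume ij: "i < n" "j < n"
  have "\<Delta> (\<lambda>k. \<alpha> l k q) i j = (\<Sum>k. of_real (Pk k $$ (i, j)) * \<alpha> l k q)" for q
    by (simp add: \<Delta>_def mult.commute)
  then show "(\<lambda>\<delta>. \<Delta> (\<lambda>k. (l / (1 - \<delta>)) ^ k) i j) has_fps_expansion Ahat l $$ (i, j)"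
    using entire_series_compose_geometric[OF \<Delta>_power_sums[OF ij], of l] ij by (simp add: Ahat_def)
qed

lemma charf_0: "charf 0 = of_real (det (Pk 0))" "charf 0 \<noteq> 0"
proof -
  have e: "(\<lambda>k. 0 ^ k) = e0" by (auto simp: e0_def)
  have "mat n n (\<lambda>(i, j). \<Delta> (\<lambda>k. 0 ^ k) i j) = cmat (Pk 0)"
    unfolding e using Pk_carrier[of 0] by (intro eq_matI) (auto simp: \<Delta>_e0 cmat_def)
  then show "charf 0 = of_real (det (Pk 0))" by (simp add: charf_def det_cmat)
  then show "charf 0 \<noteq> 0" using det_Pk0 by simp
qed

lemma charf_eventually_nonzero: "\<forall>\<^sub>F w in at l. charf w \<noteq> 0"
  using non_zero_neighbour_alt[OF charf_holomorphic open_UNIV connected_UNIV UNIV_I UNIV_I charf_0(2), of l]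
  by (simp add: eventually_conj_iff)

text \<open>The substitution \<open>\<delta> \<mapsto> l / (1 - \<delta>)\<close> has nonzero derivative \<open>l\<close> at \<open>0\<close> and preserves the order
  of the zero.\<close>

lemma zorder_charf:
  assumes l: "l \<noteq> 0"
  shows "det (Ahat l) \<noteq> 0" "int (subdegree (det (Ahat l))) = zorder charf l"
proof -
  define h where "h = (\<lambda>\<delta>::complex. l / (1 - \<delta>))"
  have h0: "h 0 = l" by (simp add: h_def)
  have hne: "h \<delta> \<noteq> l" if "\<delta> \<noteq> 0" for \<delta> using that l by (cases "\<delta> = 1") (auto simp: h_def field_simps)
  have "filterlim h (at l) (at 0)"
    unfolding filterlim_at
  proof
    show "\<forall>\<^sub>F x in at 0. h x \<in> UNIV \<and> h x \<noteq> l" using hne by (auto simp: eventually_at intro!: exI[of _ 1])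
    have "(h \<longlongrightarrow> l / (1 - 0)) (at 0)" unfolding h_def by (intro tendsto_intros) auto
    then show "(h \<longlongrightarrow> l) (at 0)" by simp
  qed
  then have ev: "\<forall>\<^sub>F \<delta> in at 0. charf (h \<delta>) \<noteq> 0"
    using eventually_compose_filterlim[OF charf_eventually_nonzero] by blast
  show nz: "det (Ahat l) \<noteq> 0"
  proof
    assume "det (Ahat l) = 0"
    then have "\<forall>\<^sub>F \<delta> in nhds 0. charf (h \<delta>) = 0"
      using charf_compose[of l] by (simp add: has_fps_expansion_0_iff h_def)
    then have "\<forall>\<^sub>F \<delta> in at 0. charf (h \<delta>) = 0" by (simp add: eventually_nhds_conv_at)
    with ev have "\<forall>\<^sub>F \<delta> in at (0::complex). False" by eventually_elim simp
    then show False by simp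
  qed
  \<comment> \<open>the expansion of \<open>l / (1 - \<delta>) - l\<close>, of order one since \<open>l \<noteq> 0\<close>\<close>
  define G where "G = Abs_fps (\<lambda>q. if q = 0 then 0 else l)"
  have G: "(\<lambda>x. h (0 + x) - h 0) has_fps_expansion G"
  proof (rule has_fps_expansionI)
    have "(\<lambda>q. fps_nth G q * \<delta> ^ q) sums (h (0 + \<delta>) - h 0)" if "norm \<delta> < 1" for \<delta>
    proof -
      have "(\<lambda>q. l * \<delta> ^ q) sums h \<delta>" using sums_mult[OF geometric_sums[OF that], of l] by (simp add: h_def)
      moreover have "(\<lambda>q. if q = 0 then l else 0) sums l" using sums_single[of 0 "\<lambda>_. l"] by simp
      ultimately have "(\<lambda>q. l * \<delta> ^ q - (if q = 0 then l else 0)) sums (h \<delta> - l)" by (rule sums_diff)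
      moreover have "l * \<delta> ^ q - (if q = 0 then l else 0) = fps_nth G q * \<delta> ^ q" for q by (simp add: G_def)
      ultimately show ?thesis by (simp add: h0)
    qed
    moreover have "\<forall>\<^sub>F \<delta> in nhds (0::complex). norm \<delta> < 1"
      using eventually_nhds_ball[of 1 "0::complex"] by simp
    ultimately show "\<forall>\<^sub>F \<delta> in nhds 0. (\<lambda>q. fps_nth G q * \<delta> ^ q) sums (h (0 + \<delta>) - h 0)"
      by (auto elim: eventually_mono)
  qed
  have G0: "G \<noteq> 0" "subdegree G = 1"
  proof -
    show "subdegree G = 1" using l by (intro subdegreeI) (auto simp: G_def)
    then show "G \<noteq> 0" by auto
  qed
  have an: "charf analytic_on {h 0}" using charf_holomorphic analytic_on_holomorphic by blast
  have "zorder (charf \<circ> h) 0 = zorder charf (h 0) * subdegree G"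
    by (rule zorder_compose[OF _ _ G G0(1)])
      (use an charf_eventually_nonzero in \<open>auto intro: isolated_singularity_at_analytic not_essential_analytic\<close>)
  moreover have "zorder (charf \<circ> h) 0 = int (subdegree (det (Ahat l)))"
    using has_fps_expansion_zorder_0[OF charf_compose nz] by (simp add: o_def h_def)
  ultimately show "int (subdegree (det (Ahat l))) = zorder charf l" using G0(2) h0 by simp
qed

lemma SL_mult_eq_zorder:
  assumes l: "l \<noteq> 0"
  obtains d where "SL_mult n T P Q R R1 \<Lambda>0 \<Lambda>1 l = enat d" "int d = zorder charf l"
proof -
  obtain b where "act_kernel_basis n (Ahat l) (subdegree (det (Ahat l))) b"
    using act_kernel_dimension[OF Ahat_carrier zorder_charf(1)[OF l] refl] by blast
  from L2_alg_mult_eq[OF l this] show ?thesis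
    using that zorder_charf(2)[OF l] by (simp add: SL_mult_def)
qed

text \<open>Eigenfunctions are continuously differentiable solutions of the homogeneous problem, which
  has only the zero solution.\<close>

lemma zero_not_eigenvalue: "\<not> SL_eigenvalue n T P Q R R1 \<Lambda>0 \<Lambda>1 0"
proof
  assume "SL_eigenvalue n T P Q R R1 \<Lambda>0 \<Lambda>1 0"
  then obtain y dy x dx where dy: "vec_path_deriv T n y dy" and dx: "vec_path_deriv T n x dx"
    and xe: "\<forall>t\<in>{0..T}. x t = cmat (P t) *\<^sub>v dy t + cmat (Q t) *\<^sub>v y t"
    and de: "\<forall>t\<in>{0..T}. - dx t + cmat (transpose_mat (Q t)) *\<^sub>v dy t + (cmat (R t) + 0 \<cdot>\<^sub>m cmat (R1 t)) *\<^sub>v y t = 0\<^sub>v n"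
    and bc: "x 0 @\<^sub>v y 0 \<in> complexify \<Lambda>0" "x T @\<^sub>v y T \<in> complexify \<Lambda>1"
    and nz: "\<exists>t\<in>{0..T}. y t \<noteq> 0\<^sub>v n"
    unfolding SL_eigenvalue_def by blast
  have car: "x t \<in> carrier_vec n" "y t \<in> carrier_vec n" "dx t \<in> carrier_vec n" "dy t \<in> carrier_vec n" if "t \<in> {0..T}" for t
    using dy dx that by (auto simp: vec_path_deriv_def)
  define z where "z = (\<lambda>i t. if i < n then x t $ i else y t $ (i - n))"
  have zl: "z (n + q) t = y t $ q" and zu: "q < n \<Longrightarrow> z q t = x t $ q" for q t by (auto simp: z_def)
  have dyz: "dy t $ i = dyf (\<lambda>p. z p t) t i" if t: "t \<in> {0..T}" and i: "i < n" for t i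
  proof -
    have "x t $ i = (\<Sum>q<n. of_real (P t $$ (i, q)) * dy t $ q) + (\<Sum>q<n. of_real (Q t $$ (i, q)) * y t $ q)" if i: "i < n" for i
    proof -
      have "x t $ i = (cmat (P t) *\<^sub>v dy t) $ i + (cmat (Q t) *\<^sub>v y t) $ i"
        using xe t i carriers[OF t] by (subst bspec[OF xe t], subst index_add_vec(1)) (auto simp: cmat_def)
      then show ?thesis using cmat_mult_vec[OF carriers(1)[OF t] car(4)[OF t] i] cmat_mult_vec[OF carriers(2)[OF t] car(2)[OF t] i] by simp
    qed
    then show ?thesis using dyf_iff[OF t, of "\<lambda>p. z p t" "\<lambda>q. dy t $ q"] zl zu i by simp
  qed
  have dxz: "dx t $ i = (\<Sum>p<N. of_real (A t $$ (i, p)) * z p t)" if t: "t \<in> {0..T}" and i: "i < n" for t i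
  proof -
    have QT: "transpose_mat (Q t) \<in> carrier_mat n n" using carriers[OF t] by simp
    have "cmat (R t) + 0 \<cdot>\<^sub>m cmat (R1 t) = cmat (R t)" using carriers[OF t] by (intro eq_matI) (auto simp: cmat_def)
    then have "(- dx t + cmat (transpose_mat (Q t)) *\<^sub>v dy t + cmat (R t) *\<^sub>v y t) $ i = 0" using bspec[OF de t] i by simp
    then have "- dx t $ i + (cmat (transpose_mat (Q t)) *\<^sub>v dy t) $ i + (cmat (R t) *\<^sub>v y t) $ i = 0"
      using i carriers[OF t] car[OF t] by (simp add: cmat_def algebra_simps)
    then have "- dx t $ i + (\<Sum>q<n. of_real (Q t $$ (q, i)) * dy t $ q) + (\<Sum>q<n. of_real (R t $$ (i, q)) * y t $ q) = 0"
      using cmat_mult_vec[OF QT car(4)[OF t] i] cmat_mult_vec[OF carriers(3)[OF t] car(2)[OF t] i] carriers[OF t] i by simp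
    then have "dx t $ i = (\<Sum>q<n. of_real (Q t $$ (q, i)) * dy t $ q) + (\<Sum>q<n. of_real (R t $$ (i, q)) * y t $ q)"
      by (simp add: algebra_simps)
    also have "(\<Sum>q<n. of_real (Q t $$ (q, i)) * dy t $ q) = (\<Sum>q<n. of_real (Q t $$ (q, i)) * dyf (\<lambda>p. z p t) t q)"
      using dyz[OF t] by (intro sum.cong refl) simp
    finally show ?thesis unfolding A_mult(2)[OF t i] zl .
  qed
  have "SLsol (\<lambda>_. 0\<^sub>v n) z"
  proof (rule SLsol_of_deriv)
    fix i t assume i: "i < N" and t: "t \<in> {0..T}"
    show "(z i has_vector_derivative (\<Sum>p<N. of_real (A t $$ (i, p)) * z p t) - (if i < n then 0\<^sub>v n $ i else 0)) (at t within {0..T})"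
    proof (cases "i < n")
      case True
      then have zi: "z i = (\<lambda>s. x s $ i)" by (auto simp: z_def)
      have "((\<lambda>s. x s $ i) has_vector_derivative dx t $ i) (at t within {0..T})"
        using dx t True unfolding vec_path_deriv_def by blast
      then show ?thesis unfolding zi dxz[OF t True] using True by simp
    next
      case False
      then have e: "n + (i - n) = i" "i - n < n" using i by auto
      from False have zi: "z i = (\<lambda>s. y s $ (i - n))" by (auto simp: z_def)
      have "((\<lambda>s. y s $ (i - n)) has_vector_derivative dy t $ (i - n)) (at t within {0..T})"
        using dy t e(2) unfolding vec_path_deriv_def by blast
      moreover have "(\<Sum>p<N. of_real (A t $$ (i, p)) * z p t) = dy t $ (i - n)"
        using A_mult(1)[OF t e(2), of "\<lambda>p. z p t"] dyz[OF t e(2)] unfolding e(1) by simp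
      ultimately show ?thesis unfolding zi using False by simp
    qed
  qed
  moreover have "vec N (\<lambda>i. z i t) = x t @\<^sub>v y t" if "t \<in> {0..T}" for t
    using car[OF that] by (intro eq_vecI) (auto simp: z_def)
  then have "BC z" unfolding BC_iff using bc T by simp
  ultimately have "z i t = 0" if "i < N" "t \<in> {0..T}" for i t
    using SLsol_unique[of "\<lambda>_. 0\<^sub>v n" z "\<lambda>_. 0\<^sub>v n" "\<lambda>_ _. 0" i t] SLsol_0 BC_0 that by simp
  then have "y t = 0\<^sub>v n" if "t \<in> {0..T}" for t
    using car(2)[OF that] that by (intro eq_vecI) (auto simp: zl[symmetric])
  then show False using nz by blast
qed

text \<open>A kernel vector of the transfer matrix is the initial datum of a nonzero solution \<open>z\<close> of the
  boundary value problem. Its component \<open>y\<close> cannot vanish identically, since \<open>x\<close> would vanish as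
  well.\<close>

lemma charf_zero_eigenvalue:
  assumes l: "charf l = 0"
  shows "SL_eigenvalue n T P Q R R1 \<Lambda>0 \<Lambda>1 l"
proof -
  define \<Delta>m where "\<Delta>m = mat n n (\<lambda>(i, j). \<Delta> (\<lambda>k. l ^ k) i j)"
  have Dm: "\<Delta>m \<in> carrier_mat n n" by (simp add: \<Delta>m_def)
  obtain v where v: "v \<in> carrier_vec n" "v \<noteq> 0\<^sub>v n" "\<Delta>m *\<^sub>v v = 0\<^sub>v n"
    using det_0_iff_vec_prod_zero_field[OF Dm] l by (auto simp: charf_def \<Delta>m_def)
  define c where "c = (\<lambda>j. v $ j)"
  define z where "z = zs l c"
  define dz where "dz = (\<lambda>i t. (\<Sum>p<N. of_real (A t $$ (i, p)) * z p t) + l * (\<Sum>p<N. of_real (Bd t $$ (i, p)) * z p t))"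
  have dz: "(z i has_vector_derivative dz i t) (at t within {0..T})" if "i < N" "t \<in> {0..T}" for i t
    using zs_deriv[OF that, of l c] by (simp add: z_def dz_def distrib_right sum.distrib sum_distrib_left mult.assoc)
  have dzl: "dz (n + i) t = dyf (\<lambda>p. z p t) t i" if "i < n" "t \<in> {0..T}" for i t
    using that by (simp add: dz_def A_mult(1) Bd_mult(1))
  have dzu: "dz i t = (\<Sum>p<n. of_real (Q t $$ (p, i)) * dz (n + p) t) + (\<Sum>q<n. of_real (R t $$ (i, q)) * z (n + q) t)
     + l * (\<Sum>q<n. of_real (R1 t $$ (i, q)) * z (n + q) t)" if "i < n" "t \<in> {0..T}" for i t
  proof -
    have "dz i t = (\<Sum>p<N. of_real (A t $$ (i, p)) * z p t) + l * (\<Sum>p<N. of_real (Bd t $$ (i, p)) * z p t)"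
      by (simp only: dz_def)
    then show ?thesis unfolding A_mult(2)[OF that(2,1)] Bd_mult(2)[OF that(2,1)] using dzl that by simp
  qed
  have bc: "BC z" unfolding BC_def
  proof (intro conjI ballI allI impI)
    fix i assume i: "i \<in> {n..<N}"
    have "M3v (\<lambda>q. z q 0) i = M3v (emb c) i" by (rule M3v_cong) (simp add: z_def zs_0)
    then show "M3v (\<lambda>q. z q 0) i = 0" using M3v_emb[of i c] i by simp
  next
    fix i assume i: "i < n"
    have "M3v (\<lambda>q. z q T) (k0 + i) = (\<Delta>m *\<^sub>v v) $ i"
      unfolding z_def zs_def M3v_sol_T[OF geometric_bound_power i] index_mult_mat_vec_sum[OF Dm v(1) i]
      using i by (intro sum.cong refl) (simp add: \<Delta>m_def c_def)
    then show "M3v (\<lambda>q. z q T) (k0 + i) = 0" using v(3) i by simp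
  qed
  define y where "y = (\<lambda>t. vec n (\<lambda>i. z (n + i) t))"
  define x where "x = (\<lambda>t. vec n (\<lambda>i. z i t))"
  define dy where "dy = (\<lambda>t. vec n (\<lambda>i. dz (n + i) t))"
  define dx where "dx = (\<lambda>t. vec n (\<lambda>i. dz i t))"
  have d: "dy t \<in> carrier_vec n" "y t \<in> carrier_vec n" "dx t \<in> carrier_vec n" for t by (auto simp: dy_def y_def dx_def)
  have "vec_path_deriv T n y dy" "vec_path_deriv T n x dx"
    using dz by (auto simp: vec_path_deriv_def y_def dy_def x_def dx_def)
  moreover have "x t = cmat (P t) *\<^sub>v dy t + cmat (Q t) *\<^sub>v y t" if t: "t \<in> {0..T}" for t
  proof (rule eq_vecI)
    fix i assume "i < dim_vec (cmat (P t) *\<^sub>v dy t + cmat (Q t) *\<^sub>v y t)"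
    then have i: "i < n" using carriers[OF t] by (simp add: cmat_def)
    have "\<forall>i<n. z i t = (\<Sum>q<n. of_real (P t $$ (i, q)) * dy t $ q) + (\<Sum>q<n. of_real (Q t $$ (i, q)) * z (n + q) t)"
      unfolding dyf_iff[OF t, of "\<lambda>p. z p t" "\<lambda>q. dy t $ q"] using dzl t by (simp add: dy_def)
    moreover have "(cmat (P t) *\<^sub>v dy t + cmat (Q t) *\<^sub>v y t) $ i = (cmat (P t) *\<^sub>v dy t) $ i + (cmat (Q t) *\<^sub>v y t) $ i"
      using i carriers[OF t] by (intro index_add_vec(1)) (auto simp: cmat_def)
    ultimately show "x t $ i = (cmat (P t) *\<^sub>v dy t + cmat (Q t) *\<^sub>v y t) $ i"
      using i cmat_mult_vec[OF carriers(1)[OF t] d(1) i] cmat_mult_vec[OF carriers(2)[OF t] d(2) i] by (simp add: x_def y_def)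
  qed (use carriers[OF t] in \<open>auto simp: x_def cmat_def\<close>)
  moreover have "- dx t + cmat (transpose_mat (Q t)) *\<^sub>v dy t + (cmat (R t) + l \<cdot>\<^sub>m cmat (R1 t)) *\<^sub>v y t = 0\<^sub>v n" if t: "t \<in> {0..T}" for t
  proof (rule eq_vecI)
    have QT: "transpose_mat (Q t) \<in> carrier_mat n n" using carriers[OF t] by simp
    have RR: "cmat (R t) + l \<cdot>\<^sub>m cmat (R1 t) \<in> carrier_mat n n" using carriers[OF t] by (simp add: cmat_def)
    fix i assume "i < dim_vec (0\<^sub>v n :: complex vec)"
    then have i: "i < n" by simp
    have r: "((cmat (R t) + l \<cdot>\<^sub>m cmat (R1 t)) *\<^sub>v y t) $ i = (\<Sum>q<n. of_real (R t $$ (i, q)) * z (n + q) t) + l * (\<Sum>q<n. of_real (R1 t $$ (i, q)) * z (n + q) t)"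
      unfolding index_mult_mat_vec_sum[OF RR d(2) i] sum_distrib_left sum.distrib[symmetric]
      using carriers[OF t] i by (intro sum.cong refl) (simp add: cmat_def y_def algebra_simps)
    have "(- dx t + cmat (transpose_mat (Q t)) *\<^sub>v dy t + (cmat (R t) + l \<cdot>\<^sub>m cmat (R1 t)) *\<^sub>v y t) $ i
       = - dx t $ i + (cmat (transpose_mat (Q t)) *\<^sub>v dy t) $ i + ((cmat (R t) + l \<cdot>\<^sub>m cmat (R1 t)) *\<^sub>v y t) $ i"
      using i carriers[OF t] d[of t] by (simp add: cmat_def del: index_mult_mat_vec)
    also have "\<dots> = 0"
      unfolding r using cmat_mult_vec[OF QT d(1) i] carriers[OF t] i dzu[OF i t] by (simp add: dx_def dy_def)
    finally show "(- dx t + cmat (transpose_mat (Q t)) *\<^sub>v dy t + (cmat (R t) + l \<cdot>\<^sub>m cmat (R1 t)) *\<^sub>v y t) $ i = 0\<^sub>v n $ i"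
      using i by simp
  qed (use carriers[OF t] in \<open>auto simp: cmat_def\<close>)
  moreover have "vec N (\<lambda>i. z i t) = x t @\<^sub>v y t" for t
    by (intro eq_vecI) (auto simp: x_def y_def)
  then have "x 0 @\<^sub>v y 0 \<in> complexify \<Lambda>0 \<and> x T @\<^sub>v y T \<in> complexify \<Lambda>1" using bc unfolding BC_iff by simp
  moreover have "\<exists>t\<in>{0..T}. y t \<noteq> 0\<^sub>v n"
  proof (rule ccontr)
    assume "\<not> (\<exists>t\<in>{0..T}. y t \<noteq> 0\<^sub>v n)"
    then have "y t $ i = 0" if "i < n" "t \<in> {0..T}" for i t using that by simp
    then have zl: "z (n + i) t = 0" if "i < n" "t \<in> {0..T}" for i t using that by (simp add: y_def)
    have "z i 0 = 0" if "i < N" for i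
    proof (rule initial_zero_of_lower_zero[of z i])
      fix i assume i: "i < n"
      have "0 \<in> {0..T}" using T by simp
      then show "(z (n + i) has_vector_derivative (\<Sum>p<N. of_real (A 0 $$ (n + i, p)) * z p 0)) (at 0 within {0..T})"
        using dz[of "n + i" 0] dzl[OF i] A_mult(1)[OF _ i] i by simp
    qed (use zl that in auto)
    then have "emb c i = 0" if "i < N" for i using zs_0[OF that, of l c] that by (simp add: z_def)
    then have "M3v (emb c) i = M3v (\<lambda>_. 0) i" for i by (intro M3v_cong) auto
    then have "c i = 0" if "i < n" for i using M3v_emb[of i c] that by (simp add: M3v_def)
    then have "v = 0\<^sub>v n" using v(1) by (intro eq_vecI) (auto simp: c_def)
    then show False using v(2) by simp
  qed
  ultimately show ?thesis unfolding SL_eigenvalue_def by blast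
qed

text \<open>The multiplicity is \<open>0\<close> at points where the characteristic function does not vanish, so only
  its zeros contribute indices.\<close>

lemma SL_spectrum_eq: "SL_spectrum n T P Q R R1 \<Lambda>0 \<Lambda>1 = zero_multiset_index charf"
proof -
  have "(SL_eigenvalue n T P Q R R1 \<Lambda>0 \<Lambda>1 l \<and> enat i < SL_mult n T P Q R R1 \<Lambda>0 \<Lambda>1 l)
     \<longleftrightarrow> (charf l = 0 \<and> int i < zorder charf l)" for l i
  proof (cases "l = 0")
    case True
    then show ?thesis using zero_not_eigenvalue charf_0(2) by simp
  next
    case False
    obtain d where d: "SL_mult n T P Q R R1 \<Lambda>0 \<Lambda>1 l = enat d" "int d = zorder charf l"
      using SL_mult_eq_zorder[OF False] by blast
    have "zorder charf l = 0" if "charf l \<noteq> 0"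
      using zorder_eq_0I[of charf l] that charf_holomorphic analytic_on_holomorphic by blast
    then show ?thesis using d charf_zero_eigenvalue[of l] by force
  qed
  then show ?thesis unfolding SL_spectrum_def zero_multiset_index_def by simp
qed

lemma G_mat_eq: "G_mat n T R1 \<gamma>0 k0 M3 k = Pk k * inv_mat (Pk 0)"
proof -
  have "\<gamma>0 T * F_mat n T R1 \<gamma>0 0 = \<gamma>0 T"
    using \<gamma>_carrier[of T] T by (simp add: F_mat_def)
  then show ?thesis by (simp add: G_mat_def Pk_def)
qed

text \<open>Normalizing by \<open>\<Delta>(0)\<^sup>-\<^sup>1\<close> turns the coefficients of the transfer matrix into the matrices \<open>G\<^sub>k\<close>, with \<open>G\<^sub>0 = I\<close>, and multiplies its determinant by a constant.\<close>

theorem trace_formula: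
  assumes m: "m > 0"
  defines "G \<equiv> \<lambda>k. G_mat n T R1 \<gamma>0 k0 M3 k"
  shows "((\<lambda>(l, i). 1 / l ^ m) has_sum
           complex_of_real (real m * (\<Sum>k = 1..m. (-1) ^ k / real k *
                (\<Sum>js\<in>compositions m k. trace_mat (prod_mats n (map G js))))))
           (SL_spectrum n T P Q R R1 \<Lambda>0 \<Lambda>1)"
proof -
  note i0 = inv_mat_inverse[OF Pk_carrier[of 0] det_Pk0]
  have G: "G k \<in> carrier_mat n n" for k
    unfolding G_def G_mat_eq by (rule mult_carrier_mat[OF Pk_carrier i0(1)])
  have G0: "G 0 = 1\<^sub>m n" unfolding G_def G_mat_eq by (rule i0(2))
  define a where "a = (\<lambda>l i j. \<Sum>p<n. \<Delta> (\<lambda>k. l ^ k) i p * of_real (inv_mat (Pk 0) $$ (p, j)))"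
  have a_sums: "(\<lambda>k. of_real (G k $$ (i, j)) * l ^ k) sums a l i j" if ij: "i < n" "j < n" for l i j
  proof -
    have "(\<lambda>k. \<Sum>p<n. (of_real (Pk k $$ (i, p)) * l ^ k) * of_real (inv_mat (Pk 0) $$ (p, j))) sums a l i j"
      unfolding a_def by (intro sums_sum sums_mult2 \<Delta>_power_sums ij) auto
    moreover have "(\<Sum>p<n. (of_real (Pk k $$ (i, p)) * l ^ k) * of_real (inv_mat (Pk 0) $$ (p, j))) = of_real (G k $$ (i, j)) * l ^ k" for k
      unfolding G_def G_mat_eq index_mult_mat_sum[OF Pk_carrier i0(1) ij] by (simp add: sum_distrib_left mult_ac)
    ultimately show ?thesis by simp
  qed
  define \<kappa> where "\<kappa> = complex_of_real (det (inv_mat (Pk 0)))"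
  define f where "f = (\<lambda>l. det (mat n n (\<lambda>(i, j). a l i j)))"
  have f: "f l = \<kappa> * charf l" for l
  proof -
    have D: "mat n n (\<lambda>(i, j). \<Delta> (\<lambda>k. l ^ k) i j) \<in> carrier_mat n n" by simp
    have "mat n n (\<lambda>(i, j). a l i j) = mat n n (\<lambda>(i, j). \<Delta> (\<lambda>k. l ^ k) i j) * cmat (inv_mat (Pk 0))"
    proof (rule eq_matI)
      fix i j assume "i < dim_row (mat n n (\<lambda>(i, j). \<Delta> (\<lambda>k. l ^ k) i j) * cmat (inv_mat (Pk 0)))"
        "j < dim_col (mat n n (\<lambda>(i, j). \<Delta> (\<lambda>k. l ^ k) i j) * cmat (inv_mat (Pk 0)))"
      then have ij: "i < n" "j < n" using i0(1) by (auto simp: cmat_def)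
      show "mat n n (\<lambda>(i, j). a l i j) $$ (i, j) = (mat n n (\<lambda>(i, j). \<Delta> (\<lambda>k. l ^ k) i j) * cmat (inv_mat (Pk 0))) $$ (i, j)"
        unfolding index_mult_mat_sum[OF D cmat_carrier[OF i0(1)] ij]
        using ij i0(1) by (simp add: a_def cmat_def)
    qed (use i0(1) in \<open>auto simp: cmat_def\<close>)
    then show ?thesis unfolding f_def
      using det_mult[OF D cmat_carrier[OF i0(1)]] by (simp add: charf_def \<kappa>_def det_cmat)
  qed
  have "det (Pk 0) * det (inv_mat (Pk 0)) = 1"
    using det_mult[OF Pk_carrier[of 0] i0(1)] i0(2) by simp
  then have k1: "charf 0 * \<kappa> = 1" unfolding charf_0(1) \<kappa>_def by (metis of_real_1 of_real_mult)
  then have k0: "\<kappa> \<noteq> 0" by auto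
  have f0: "f 0 = 1" using k1 by (simp add: f mult.commute)
  have fh: "f holomorphic_on UNIV" unfolding f by (intro holomorphic_intros charf_holomorphic)
  define Nm where "Nm = mat n n (\<lambda>(i, j). Abs_fps (\<lambda>k. if k = 0 then 0 else cmat (G k) $$ (i, j)))"
  have fe: "f has_fps_expansion det (1\<^sub>m n + Nm)"
    unfolding f_def
  proof (rule has_fps_expansion_det)
    fix i j assume ij: "i < n" "j < n"
    have "(1\<^sub>m n + Nm) $$ (i, j) = Abs_fps (\<lambda>k. of_real (G k $$ (i, j)))"
      using ij G0 carrier_matD[OF G] by (auto simp: Nm_def cmat_def fps_eq_iff)
    then show "(\<lambda>l. a l i j) has_fps_expansion (1\<^sub>m n + Nm) $$ (i, j)"
      using a_sums[OF ij] by (intro has_fps_expansionI) simp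
  qed (simp add: Nm_def)
  obtain C where C: "\<And>l. norm (charf l) \<le> exp (C * (1 + sqrt (norm l)))" "C \<ge> 0"
    using charf_growth by blast
  have growth: "norm (f l) \<le> exp ((ln (1 + norm \<kappa>) + C) * (1 + sqrt (norm l)))" for l
  proof -
    have "norm \<kappa> \<le> exp (ln (1 + norm \<kappa>) * 1)" by (subst mult_1_right, subst exp_ln) (auto simp: add_pos_nonneg)
    also have "\<dots> \<le> exp (ln (1 + norm \<kappa>) * (1 + sqrt (norm l)))" by (intro iffD2[OF exp_le_cancel_iff] mult_left_mono) auto
    finally have "norm (f l) \<le> exp (ln (1 + norm \<kappa>) * (1 + sqrt (norm l))) * exp (C * (1 + sqrt (norm l)))"
      unfolding f norm_mult using C(1) by (intro mult_mono) auto
    then show ?thesis by (simp add: exp_add[symmetric] distrib_right)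
  qed
  have "zero_multiset_index f = zero_multiset_index charf"
    unfolding zero_multiset_index_def f using k0 by (simp add: zorder_cmult)
  then have "((\<lambda>(l, i). 1 / l ^ m) has_sum - fps_nth (fps_logderiv (det (1\<^sub>m n + Nm))) (m - 1)) (SL_spectrum n T P Q R R1 \<Lambda>0 \<Lambda>1)"
    using has_sum_zeros_of_order_half[OF fh fe f0 growth m] SL_spectrum_eq by simp
  also have "- fps_nth (fps_logderiv (det (1\<^sub>m n + Nm))) (m - 1) =
     of_nat m * (\<Sum>k=1..m. (-1) ^ k / of_nat k * (\<Sum>js\<in>compositions m k. trace_mat (prod_mats n (map (\<lambda>k. cmat (G k)) js))))"
    unfolding Nm_def by (subst fps_logderiv_det_compositions[OF cmat_carrier[OF G] m]) simp
  also have "\<dots> = complex_of_real (real m * (\<Sum>k = 1..m. (-1) ^ k / real k *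
                (\<Sum>js\<in>compositions m k. trace_mat (prod_mats n (map G js)))))"
    by (simp add: trace_prod_mats_cmat[OF G])
  finally show ?thesis .
qed

end

theorem theorem1p3:
  fixes n k0 m :: nat and T :: real
    and P Q R R1 \<gamma>0 :: "real \<Rightarrow> real mat"
    and \<Lambda>0 \<Lambda>1 :: "real vec set"
    and ds fs :: "real vec list"
    and G :: "nat \<Rightarrow> real mat"
  assumes "n > 0" and "T > 0" and "m > 0"
    and "continuous_mat_path n T P" and "continuous_mat_path n T Q"
    and "continuous_mat_path n T R" and "continuous_mat_path n T R1"
    and "\<And>t. t \<in> {0..T} \<Longrightarrow> transpose_mat (P t) = P t"
    and "\<And>t. t \<in> {0..T} \<Longrightarrow> transpose_mat (R t) = R t"
    and "\<And>t. t \<in> {0..T} \<Longrightarrow> transpose_mat (R1 t) = R1 t"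
    and "\<And>t. t \<in> {0..T} \<Longrightarrow> invertible_mat (P t)"
    and "lagrangian n \<Lambda>0" and "lagrangian n \<Lambda>1"
    and "SL_nondegenerate n T P Q R \<Lambda>0 \<Lambda>1"
    and "fundamental_solution n T P Q R \<gamma>0"
    and "k0 = subspace_dim (2 * n) (\<Lambda>0 \<inter> \<Lambda>1)"
    and "orthonormal_basis (2 * n) (take k0 ds) (\<Lambda>0 \<inter> \<Lambda>1)"
    and "orthonormal_basis (2 * n) ds \<Lambda>0"
    and "orthonormal_basis (2 * n) fs (orth_complement_in (\<Lambda>0 \<inter> \<Lambda>1) \<Lambda>1)"
    and "\<And>k. G k = G_mat n T R1 \<gamma>0 k0 (M3_mat n k0 ds fs) k"
  shows "((\<lambda>(l, i). 1 / l ^ m) has_sum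
           complex_of_real
             (real m * (\<Sum>k = 1..m. (-1) ^ k / real k *
                (\<Sum>js\<in>compositions m k. trace_mat (prod_mats n (map G js))))))
           (SL_spectrum n T P Q R R1 \<Lambda>0 \<Lambda>1)"
proof -
  interpret sl_system n k0 \<Lambda>0 \<Lambda>1 ds fs T P Q R R1 \<gamma>0
    by unfold_locales (use assms in auto)
  have "G = (\<lambda>k. G_mat n T R1 \<gamma>0 k0 (M3_mat n k0 ds fs) k)" using assms(20) by blast
  then show ?thesis using trace_formula[OF assms(3)] by simp
qed

end
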